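(* Let $H\in(\frac12,1)$, $0<\alpha\le2$ and $0<\beta<d$ with $d-2\alpha H<\beta$. Let $\mathcal{L}$ be the generator of a symmetric Lévy process in $\mathbb{R}^d$ with transition densities $p_t$ and characteristic exponent $\Psi(\xi)\asymp|\xi|^\alpha$, let $\mu$ be a tempered measure on $\mathbb{R}^d$ with $\mu(d\xi)\asymp|\xi|^{-\beta}d\xi$ and Fourier transform $f$, and let $B$ be the fractional-colored Gaussian noise with Hurst index $H$ in time and spatial covariance $f$. Let $$u(t,x)=\int_0^t\int_{\mathbb{R}^d}p_{t-s}(x-y)\,B(ds\,dy),\qquad t\ge0,\ x\in\mathbb{R}^d,$$ be the solution of $\partial_tu=\mathcal{L}u+\dot B$, $u(0,x)=0$. Put $H_1=H-\frac{d-\beta}{2\alpha}$, $H_2=\alpha H_1$, $Q=\frac1{H_1}+\frac d{H_2}$, and suppose that $H_2<1$. Let $I=[a,b]\times[-M,M]^d$ with $0<a<b<\infty$ and $M>0$. Then there is a constant $\kappa_7\in(0,\infty)$ such that for any $(t,x)\in I$, $$\liminf_{\varepsilon\to0^+}\ \sup_{(s,y):\ \tilde\rho(s,y)\le\varepsilon}\frac{|u(t+s,x+y)-u(t,x)|}{\varepsilon(\log\log1/\varepsilon)^{-1/Q}}=\kappa_7\quad\text{a.s.},$$ where $\tilde\rho(s,y)=|s|^{H_1}+|y|^{H_2}$.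
   Context: $A\asymp B$ means $c^{-1}B\le A\le cB$ for some constant $c\ge1$ independent of the variables. The condition $\mu(d\xi)\asymp|\xi|^{-\beta}d\xi$ means that $\mu$ has a density comparable to $|\xi|^{-\beta}$. The Lévy process $X$ satisfies $X_0=0$ and $\mathbb{E}(e^{i\langle\xi,X_t\rangle})=e^{-t\Psi(\xi)}$. Symmetric means $\Psi(\xi)=\Psi(-\xi)$ (so $\Psi\ge0$ is real). $X_t$ is assumed to have the density $p_t(x)=(2\pi)^{-d}\int_{\mathbb{R}^d}e^{-i\langle x,\xi\rangle}e^{-t\Psi(\xi)}d\xi$ for $t>0$. Fourier transform: $\mathcal{F}\varphi(\xi)=\int_{\mathbb{R}^d}e^{-i\langle\xi,x\rangle}\varphi(x)dx$. The function $f$ is the Fourier transform of $\mu$ in the sense that $\int f\varphi\,dx=\int\mathcal{F}\varphi\,d\mu$ for Schwartz $\varphi$. The noise $B$ is the centered Gaussian isonormal process with $$\mathbb{E}[B(\varphi)B(\psi)]=H(2H-1)\int\int|u-v|^{2H-2}\int_{\mathbb{R}^d}\int_{\mathbb{R}^d}\varphi(u,z)f(z-z')\psi(v,z')\,dz\,dz'\,du\,dv,$$ extended by isometry to the completion of the test functions. The spatial double integral is understood through the Parseval identity $\int\int\varphi(x)f(x-y)\psi(y)dxdy=c_d\int\mathcal{F}\varphi(\xi)\overline{\mathcal{F}\psi(\xi)}\mu(d\xi)$, with $c_d>0$ depending only on $d$. Under the stated assumptions the integrand defining $u(t,x)$ has finite norm. A continuous version of $u$ is used. *)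

theory Defs
  imports "HOL-Probability.Probability"
begin

subsection \<open>Smooth functions, Schwartz functions, Fourier transform\<close>

fun iter_deriv :: "'a::real_normed_vector list \<Rightarrow> ('a \<Rightarrow> 'b::real_normed_vector) \<Rightarrow> 'a \<Rightarrow> 'b" where
  "iter_deriv [] \<phi> = \<phi>"
| "iter_deriv (v # vs) \<phi> = (\<lambda>x. frechet_derivative (iter_deriv vs \<phi>) (at x) v)"

text \<open>On a Euclidean space this is the class of infinitely differentiable functions.\<close>

definition smooth :: "('a::real_normed_vector \<Rightarrow> 'b::real_normed_vector) \<Rightarrow> bool" where
  "smooth \<phi> \<longleftrightarrow> (\<forall>vs x. iter_deriv vs \<phi> differentiable (at x))"

definition schwartz :: "('a::real_normed_vector \<Rightarrow> 'b::real_normed_vector) \<Rightarrow> bool" where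
  "schwartz \<phi> \<longleftrightarrow> smooth \<phi> \<and>
     (\<forall>(k::nat) vs. bounded (range (\<lambda>x. norm x ^ k *\<^sub>R iter_deriv vs \<phi> x)))"

definition fourier :: "('a::euclidean_space \<Rightarrow> complex) \<Rightarrow> 'a \<Rightarrow> complex" where
  "fourier \<phi> \<xi> = (LINT x|lborel. cis (- (\<xi> \<bullet> x)) * \<phi> x)"

definition is_fourier_transform_of_measure ::
    "('a::euclidean_space \<Rightarrow> real) \<Rightarrow> 'a measure \<Rightarrow> bool" where
  "is_fourier_transform_of_measure f \<mu> \<longleftrightarrow>
     (\<forall>\<phi> :: 'a \<Rightarrow> complex. schwartz \<phi> \<longrightarrow>
        integrable lborel (\<lambda>x. complex_of_real (f x) * \<phi> x) \<and>
        integrable \<mu> (fourier \<phi>) \<and>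
        (LINT x|lborel. complex_of_real (f x) * \<phi> x) = (LINT \<xi>|\<mu>. fourier \<phi> \<xi>))"

subsection \<open>Comparability and the spectral measure\<close>

definition comparable :: "('a \<Rightarrow> real) \<Rightarrow> ('a \<Rightarrow> real) \<Rightarrow> bool" where
  "comparable A B \<longleftrightarrow> (\<exists>c\<ge>1. \<forall>x. inverse c * B x \<le> A x \<and> A x \<le> c * B x)"

definition tempered_measure :: "'a::euclidean_space measure \<Rightarrow> bool" where
  "tempered_measure \<mu> \<longleftrightarrow> sets \<mu> = sets borel \<and>
     (\<exists>k::nat. (\<integral>\<^sup>+ \<xi>. ennreal (1 / (1 + (norm \<xi>)\<^sup>2) ^ k) \<partial>\<mu>) < \<infinity>)"

text \<open>Since \<open>0 powr (- \<beta>) = 0\<close>, the pointwise comparison forces \<open>g 0 = 0\<close>; this is no restriction,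
  as \<open>g\<close> may be changed on a null set.\<close>

definition has_density_comparable :: "'a::euclidean_space measure \<Rightarrow> ('a \<Rightarrow> real) \<Rightarrow> bool" where
  "has_density_comparable \<mu> h \<longleftrightarrow>
     (\<exists>g \<in> borel_measurable borel. comparable g h \<and> \<mu> = density lborel (\<lambda>\<xi>. ennreal (g \<xi>)))"

subsection \<open>Levy processes\<close>

definition levy_process :: "'v measure \<Rightarrow> (real \<Rightarrow> 'v \<Rightarrow> 'a::euclidean_space) \<Rightarrow> bool" where
  "levy_process N X \<longleftrightarrow>
     prob_space N \<and>
     (\<forall>t\<ge>0. X t \<in> borel_measurable N) \<and>
     (AE \<omega> in N. X 0 \<omega> = 0) \<and>
     (\<forall>(n::nat) \<tau>. 0 \<le> \<tau> 0 \<and> mono_on {..n} \<tau> \<longrightarrow>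
        prob_space.indep_vars N (\<lambda>_. borel) (\<lambda>i \<omega>. X (\<tau> (Suc i)) \<omega> - X (\<tau> i) \<omega>) {..<n}) \<and>
     (\<forall>s\<ge>0. \<forall>t\<ge>0. distr N borel (\<lambda>\<omega>. X (s + t) \<omega> - X s \<omega>) = distr N borel (X t)) \<and>
     (AE \<omega> in N. (\<forall>t\<ge>0. continuous (at_right t) (\<lambda>s. X s \<omega>)) \<and>
        (\<forall>t>0. \<exists>l. ((\<lambda>s. X s \<omega>) \<longlongrightarrow> l) (at_left t)))"

text \<open>Exponents are real-valued here because only symmetric processes are considered.\<close>

definition char_exponent ::
    "'v measure \<Rightarrow> (real \<Rightarrow> 'v \<Rightarrow> 'a::euclidean_space) \<Rightarrow> ('a \<Rightarrow> real) \<Rightarrow> bool" where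
  "char_exponent N X \<Psi> \<longleftrightarrow>
     (\<forall>t\<ge>0. \<forall>\<xi>. (LINT \<omega>|N. cis (\<xi> \<bullet> X t \<omega>)) = complex_of_real (exp (- t * \<Psi> \<xi>)))"

text \<open>For an even exponent the complex integral is real, so \<open>Re\<close> only changes the type.\<close>

definition transition_density :: "('a::euclidean_space \<Rightarrow> real) \<Rightarrow> real \<Rightarrow> 'a \<Rightarrow> real" where
  "transition_density \<Psi> t x =
     Re (LINT \<xi>|lborel. cis (- (x \<bullet> \<xi>)) * complex_of_real (exp (- t * \<Psi> \<xi>))) / (2 * pi) ^ DIM('a)"

subsection \<open>Fractional-colored Gaussian noise\<close>

definition test_fun :: "(real \<times> 'a::euclidean_space \<Rightarrow> real) \<Rightarrow> bool" where
  "test_fun \<phi> \<longleftrightarrow> smooth \<phi> \<and>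
     (\<exists>K. compact K \<and> K \<subseteq> {0<..} \<times> UNIV \<and> (\<forall>z. z \<notin> K \<longrightarrow> \<phi> z = 0))"

definition noise_covariance ::
    "real \<Rightarrow> ('a::euclidean_space \<Rightarrow> real) \<Rightarrow> (real \<times> 'a \<Rightarrow> real) \<Rightarrow> (real \<times> 'a \<Rightarrow> real) \<Rightarrow> real" where
  "noise_covariance H f \<phi> \<psi> = H * (2 * H - 1) *
     (LINT v|lborel. LINT u|lborel. \<bar>u - v\<bar> powr (2 * H - 2) *
        (LINT z'|lborel. LINT z|lborel. \<phi> (u, z) * f (z - z') * \<psi> (v, z')))"

definition centered_gaussian :: "'w measure \<Rightarrow> ('w \<Rightarrow> real) \<Rightarrow> bool" where
  "centered_gaussian P Y \<longleftrightarrow> Y \<in> borel_measurable P \<and>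
     ((AE \<omega> in P. Y \<omega> = 0) \<or> (\<exists>\<sigma>>0. distributed P lborel Y (\<lambda>y. ennreal (normal_density 0 \<sigma> y))))"

definition fractional_colored_noise ::
    "'w measure \<Rightarrow> real \<Rightarrow> ('a::euclidean_space \<Rightarrow> real) \<Rightarrow> ((real \<times> 'a \<Rightarrow> real) \<Rightarrow> 'w \<Rightarrow> real) \<Rightarrow> bool" where
  "fractional_colored_noise P H f B \<longleftrightarrow>
     prob_space P \<and>
     (\<forall>S c. finite S \<and> (\<forall>\<phi>\<in>S. test_fun \<phi>) \<longrightarrow>
        centered_gaussian P (\<lambda>\<omega>. \<Sum>\<phi>\<in>S. c \<phi> * B \<phi> \<omega>)) \<and>
     (\<forall>\<phi> \<psi>. test_fun \<phi> \<and> test_fun \<psi> \<longrightarrow>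
        (LINT \<omega>|P. B \<phi> \<omega> * B \<psi> \<omega>) = noise_covariance H f \<phi> \<psi>)"

text \<open>The norm of the completion on functions \<open>g\<close> for which the spatial double integral against
  \<open>f\<close> need not converge: that integral is replaced by its Parseval form. With the above
  normalisations of \<^const>\<open>fourier\<close> and of \<open>f\<close> the constant in the Parseval identity is 1
  (and below only convergence to 0 of the norm is used).\<close>

definition energy_integrand ::
    "real \<Rightarrow> (real \<times> 'a::euclidean_space \<Rightarrow> real) \<Rightarrow> real \<times> real \<times> 'a \<Rightarrow> complex" where
  "energy_integrand H g = (\<lambda>(u, v, \<xi>). complex_of_real (\<bar>u - v\<bar> powr (2 * H - 2)) *
     (fourier (\<lambda>y. complex_of_real (g (u, y))) \<xi> *
      cnj (fourier (\<lambda>y. complex_of_real (g (v, y))) \<xi>)))"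

definition finite_energy ::
    "real \<Rightarrow> 'a::euclidean_space measure \<Rightarrow> (real \<times> 'a \<Rightarrow> real) \<Rightarrow> bool" where
  "finite_energy H \<mu> g \<longleftrightarrow> g \<in> borel_measurable borel \<and>
     (AE u in lborel. integrable lborel (\<lambda>y. g (u, y))) \<and>
     integrable (lborel \<Otimes>\<^sub>M (lborel \<Otimes>\<^sub>M \<mu>)) (energy_integrand H g)"

definition energy :: "real \<Rightarrow> 'a::euclidean_space measure \<Rightarrow> (real \<times> 'a \<Rightarrow> real) \<Rightarrow> real" where
  "energy H \<mu> g =
     H * (2 * H - 1) * Re (LINT w|(lborel \<Otimes>\<^sub>M (lborel \<Otimes>\<^sub>M \<mu>)). energy_integrand H g w)"

text \<open>\<open>Y\<close> is a version of \<open>B(g)\<close>, where \<open>B\<close> has been extended by isometry.\<close>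

definition is_noise_integral ::
    "'w measure \<Rightarrow> real \<Rightarrow> 'a::euclidean_space measure \<Rightarrow> ((real \<times> 'a \<Rightarrow> real) \<Rightarrow> 'w \<Rightarrow> real) \<Rightarrow>
     (real \<times> 'a \<Rightarrow> real) \<Rightarrow> ('w \<Rightarrow> real) \<Rightarrow> bool" where
  "is_noise_integral P H \<mu> B g Y \<longleftrightarrow>
     Y \<in> borel_measurable P \<and> finite_energy H \<mu> g \<and>
     (\<exists>\<phi> :: nat \<Rightarrow> real \<times> 'a \<Rightarrow> real.
        (\<forall>n. test_fun (\<phi> n) \<and> finite_energy H \<mu> (\<lambda>z. \<phi> n z - g z)) \<and>
        (\<lambda>n. energy H \<mu> (\<lambda>z. \<phi> n z - g z)) \<longlonglongrightarrow> 0 \<and>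
        (\<lambda>n. \<integral>\<^sup>+ \<omega>. ennreal ((B (\<phi> n) \<omega> - Y \<omega>)\<^sup>2) \<partial>P) \<longlonglongrightarrow> 0)"

subsection \<open>The solution\<close>

definition heat_integrand ::
    "('a::euclidean_space \<Rightarrow> real) \<Rightarrow> real \<Rightarrow> 'a \<Rightarrow> real \<times> 'a \<Rightarrow> real" where
  "heat_integrand \<Psi> t x =
     (\<lambda>(s, y). if 0 < s \<and> s < t then transition_density \<Psi> (t - s) (x - y) else 0)"

definition continuous_mild_solution ::
    "'w measure \<Rightarrow> real \<Rightarrow> 'a::euclidean_space measure \<Rightarrow> ((real \<times> 'a \<Rightarrow> real) \<Rightarrow> 'w \<Rightarrow> real) \<Rightarrow>
     ('a \<Rightarrow> real) \<Rightarrow> (real \<Rightarrow> 'a \<Rightarrow> 'w \<Rightarrow> real) \<Rightarrow> bool" where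
  "continuous_mild_solution P H \<mu> B \<Psi> u \<longleftrightarrow>
     (\<forall>t\<ge>0. \<forall>x. is_noise_integral P H \<mu> B (heat_integrand \<Psi> t x) (u t x)) \<and>
     (AE \<omega> in P. continuous_on ({0..} \<times> UNIV) (\<lambda>(t, x). u t x \<omega>))"

definition rho :: "real \<Rightarrow> real \<Rightarrow> real \<Rightarrow> 'a::euclidean_space \<Rightarrow> real" where
  "rho H\<^sub>1 H\<^sub>2 s y = \<bar>s\<bar> powr H\<^sub>1 + norm y powr H\<^sub>2"

end

(* Writing |r|^(2H-2) as a mixture of Gaussians turns the energy of an integrand into an L2 norm with
weight |tau|^(1-2H) dtau mu(dxi); the solution is then a Gaussian family with features
(exp(-i(tau t + xi.x)) - exp(-i xi.x - t Psi)) / (Psi - i tau). Its increments at (t, x) are those of a field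
with stationary increments, up to a part that is Lipschitz in mean square and hence negligible, as H1, H2 < 1.
For the stationary part the lower limit over dyadic points is almost surely constant, because it does not
depend on bounded frequencies. It is finite by small ball estimates (Sidak's inequality and chaining) for the
independent contributions of disjoint annuli of frequencies at the scales 2^(-n^2), and positive
by Borel-Cantelli, since orthogonality of characters bounds the small ball probability over a lattice. *)
theory Submission
 imports Defs
begin

text \<open>The space carrying \<open>B\<close> may be too small to hold independent pieces of
  \<open>u\<close>. Laws are therefore compared instead of variables: \<open>gaussian_family\<close>
  prescribes characteristic functions, auxiliary fields live on spaces of independent standard
  Gaussians, and events in countably many coordinates are transferred by equality of laws. Hence the
  countable set \<open>D\<close> of dyadic points, with continuity of \<open>u\<close> entering only
  at the end. \<open>Q\<close> is an entropy exponent: a \<open>\<rho>\<close>-ball of radius r has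
  about (r/q)^Q points at mutual distance q, and a field with increments of order
  \<open>\<rho>\<close> stays below r/x on it with probability about exp (- C x^Q). At r = 2^(-n^2)
  this is 1/n for x of order (ln n)^(1/Q), and ln ln (1/r) is of order ln n. The harmonic series
  diverges, while frequencies outside the n-th annulus are smaller than r by a factor exponential in
  n; this is what forces quadratic exponents. One constant serves all (t, x) because the stationary
  part of the increment there has the features at the origin up to a factor of modulus one.\<close>

abbreviation "bm == borel_measurable borel"

lemmas lint_cong = Bochner_Integration.integral_cong and lint_bound = Bochner_Integration.integrable_bound and lint_sum = Bochner_Integration.integral_sum and integrable_lint_sum = Bochner_Integration.integrable_sum

section \<open>Gaussian families\<close>

lemma measurable_cis[measurable]: "f:borel_measurable M ==> (%x. cis (f x)):borel_measurable M"
 using measurable_compose[OF _ borel_measurable_continuous_onI[OF continuous_on_cis[OF continuous_on_id]]] by blast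

text \<open>Scaling a finite measure of nonzero mass to a probability makes the pushforward a
  \<open>real_distribution\<close>, the setting of \<open>Levy_uniqueness\<close>.\<close>

lemma normalized_law:
 fixes X :: "'a => real"
 assumes "finite_measure M" and m: "measure M (space M) = m" "m ~= 0" and X[measurable]: "X:borel_measurable M"
 defines "D == distr (density M (%_. ennreal (1/m))) borel X"
 shows "real_distribution D" "char D t = (LINT w|M. cis (t*X w))/m"
 "B:sets borel ==> measure D B = measure M (X -` B Int space M)/m"
proof -
 interpret finite_measure M by fact
 have m0: "m > 0" using m by (metis less_eq_real_def measure_nonneg)
 have P: "prob_space (density M (%_. ennreal (1/m)))" by standard (use m m0 in "simp add: emeasure_density_const emeasure_eq_measure ennreal_mult[symmetric]")
 interpret P: prob_space "density M (%_. ennreal (1/m))" by fact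
 show "real_distribution D" unfolding D_def real_distribution_axioms_def by auto
 show "char D t = (LINT w|M. cis (t*X w))/m" using m0 by (simp add: D_def char_def integral_distr integral_density cis_conv_exp
 scaleR_conv_of_real)
 assume [measurable]: "B:sets borel"
 show "measure D B = measure M (X -` B Int space M)/m" using m0 by (simp add: D_def measure_distr) (simp add: measure_def emeasure_density_const enn2real_mult)
qed

text \<open>The characteristic function at 0 is the total mass, so both masses agree; mass 0 is
  trivial and any other mass is normalised away.\<close>

lemma finite_law_unique:
 fixes X :: "'a => real" and X' :: "'b => real"
 assumes M: "finite_measure M" "finite_measure M'" and X[measurable]: "X:borel_measurable M" "X':borel_measurable M'"
 and eq: "!!t. (LINT w|M. cis (t*X w)) = (LINT w|M'. cis (t*X' w))" and B: "B:sets borel"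
 shows "measure M (X -` B Int space M) = measure M' (X' -` B Int space M')"
proof -
 interpret M: finite_measure M by fact
 interpret M': finite_measure M' by fact
 have m: "measure M (space M) = measure M' (space M')" using eq[of 0] by simp
 show ?thesis
 proof (cases "measure M (space M) = 0")
 case True
 thus ?thesis using m by (metis M'.bounded_measure M.bounded_measure measure_nonneg antisym)
 next
 case False
 note n = normalized_law[OF M(1) refl False X(1)] normalized_law[OF M(2) m[symmetric] False X(2)]
 show ?thesis using n(3,6)[OF B] False by (simp add: n fun_eq_iff eq Levy_uniqueness[OF n(1,4)])
 qed
qed

text \<open>The weight is moved into the measure, so that weighted integrals of indicators become
  laws. The bound 2 is the maximum of the weights 1 + cos and 1 + sin.\<close>

lemma bounded_density:
 fixes Y h :: "'x => real"
 assumes N: "finite_measure N" and [measurable]: "Y:borel_measurable N" "h:borel_measurable N" "B:sets borel" and h: "!!w. 0<=h w" "!!w. h w<=2"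
 shows "finite_measure (density N (%w. ennreal (h w)))"
 "measure (density N (%w. ennreal (h w))) (Y -` B Int space N) = (LINT w|N. h w*indicator B (Y w))"
proof -
 let ?A = "density N (%w. ennreal (h w))"
 interpret finite_measure N by fact
 have i: "integrable N (%w. h w*indicator B (Y w))" "integrable N h" by (rule integrable_const_bound[where B=2]; use h in \<open>auto simp: indicator_def\<close>)+
 show "finite_measure ?A" by standard (use i(2) h in "simp add: emeasure_density nn_integral_eq_integral cong: nn_integral_cong_simp")
 have "emeasure ?A (Y -` B Int space N) = nn_integral N (%w. ennreal (h w*indicator B (Y w)))"
 by (subst emeasure_density) (auto intro!: nn_integral_cong simp: indicator_def)
 also have "... = ennreal (LINT w|N. h w*indicator B (Y w))" by (rule nn_integral_eq_integral[OF i(1)]) (use h in auto)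
 finally show "measure ?A (Y -` B Int space N) = (LINT w|N. h w*indicator B (Y w))" by (simp add: measure_def h)
qed

lemma weighted_law_unique:
 fixes X :: "'a => real" and X' :: "'b => real"
 assumes M: "finite_measure M" "finite_measure M'" and X[measurable]: "X:borel_measurable M" "X':borel_measurable M'"
 and gm[measurable]: "g:borel_measurable M" "g':borel_measurable M'" and g: "!!w. 0<=g w" "!!w. g w<=2" "!!w. 0<=g' w" "!!w. g' w <= (2::real)"
 and eq: "!!t. (LINT w|M. complex_of_real (g w) * cis (t*X w)) = (LINT w|M'. complex_of_real (g' w) * cis (t*X' w))" and B: "B:sets borel"
 shows "(LINT w|M. g w*indicator B (X w)) = (LINT w|M'. g' w*indicator B (X' w))"
proof -
 note b = bounded_density[OF M(1) X(1) gm(1) B g(1,2)] bounded_density[OF M(2) X(2) gm(2) B g(3,4)]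
 have "measure (density M (%w. ennreal (g w))) (X -` B Int space (density M (%w. ennreal (g w))))
 = measure (density M' (%w. ennreal (g' w))) (X' -` B Int space (density M' (%w. ennreal (g' w))))"
 by (rule finite_law_unique[OF b(1,3) _ _ _ B])
 (use eq g in "auto simp: integral_density scaleR_conv_of_real")
 thus ?thesis using b by simp
qed

text \<open>Both weighted integrals are combinations of \<open>I\<close> at 0, 1 and -1. Hence an
  identity of characteristic functions that holds for all coefficient vectors passes to the weighted
  laws.\<close>

lemma trig_expand:
 fixes p h x :: "'a => real"
 assumes "finite_measure M" and [measurable]: "p:borel_measurable M" "h:borel_measurable M" "x:borel_measurable M" and b: "!!w. 0<=p w" "!!w. p w<=1"
 defines "I == %s. (LINT w|M. complex_of_real (p w) * cis (s * h w+x w))"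
 shows "(LINT w|M. complex_of_real (p w*(1 + cos (h w))) * cis (x w)) = I 0+(I 1+I (-1))/2"
 "(LINT w|M. complex_of_real (p w*(1+sin (h w))) * cis (x w)) = I 0+(I 1-I (-1))/(2*\<i>)"
proof -
 interpret finite_measure M by fact
 define F where "F s w = of_real (p w) * cis (s * h w+x w)" for s w
 have i: "integrable M (F s)" for s unfolding F_def by (rule integrable_const_bound[where B=1]) (use b in "auto simp: norm_mult")
 have c: "F 0 w = p w * cis (x w)" "F 1 w = p w*(cis (h w) * cis (x w))" "F (-1) w = p w*(cis (- h w) * cis (x w))" for w by (simp_all add: cis_mult F_def)
 have *: "of_real (cos y) = (cis y + cis (- y))/2" "of_real (sin y) = (cis y - cis (- y))/(2*\<i>)" for y by (simp_all add: complex_eq_iff)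
 have I: "I s = (LINT w|M. F s w)" for s by (simp add: I_def F_def)
 have "of_real (p w*(1 + cos (h w))) * cis (x w) = F 0 w+(F 1 w+F (-1) w)/2"
 "of_real (p w*(1+sin (h w))) * cis (x w) = F 0 w+(F 1 w-F (-1) w)/(2*\<i>)" for w by (simp_all only: * c of_real_mult of_real_add) (simp_all add: field_simps)
 thus "(LINT w|M. of_real (p w*(1 + cos (h w))) * cis (x w)) = I 0+(I 1+I (-1))/2"
 "(LINT w|M. of_real (p w*(1+sin (h w))) * cis (x w)) = I 0+(I 1-I (-1))/(2*\<i>)" by (simp_all add: I i)
qed

text \<open>The factors \<open>cis (a l * X l)\<close> are replaced by indicators one coordinate at a time; the weights
 \<open>1 + cos\<close> and \<open>1 + sin\<close> of the remaining exponential are nonnegative, so that the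
 one-dimensional uniqueness theorem applies.\<close>

lemma family_law_step:
 fixes X :: "'i => 'a => real" and X' :: "'i => 'b => real"
 assumes M: "finite_measure M" "finite_measure M'" and L: "finite L" and X: "!!i. i:L ==> X i:borel_measurable M" "!!i. i:L ==> X' i:borel_measurable M'"
 and eq: "!!a. (LINT w|M. cis (SUM l:L. a l*X l w)) = (LINT w|M'. cis (SUM l:L. a l*X' l w))" and B: "!!j. j:L ==> B j:sets borel" and J: "finite J" "J \<subseteq> L"
 shows "(LINT w|M. complex_of_real (PROD j:J. indicator (B j) (X j w)) * cis (SUM l:L. a l*X l w))
 = (LINT w|M'. complex_of_real (PROD j:J. indicator (B j) (X' j w)) * cis (SUM l:L. a l*X' l w))"
 using J
proof (induction J arbitrary: a rule: finite_induct)
 case empty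
 thus ?case by (simp add: eq)
next
 case (insert k J)
 interpret M: finite_measure M by fact
 interpret M': finite_measure M' by fact
 have k: "k:L" and JL: "J \<subseteq> L" using insert by auto
 note [measurable] = X B k
 define p where "p w = (PROD j:J. indicator (B j) (X j w) :: real)" for w
 define p' where "p' w = (PROD j:J. indicator (B j) (X' j w) :: real)" for w
 define \<theta> where "\<theta> w = (SUM l:L. a l*X l w)" for w
 define \<theta>' where "\<theta>' w = (SUM l:L. a l*X' l w)" for w
 have [measurable]: "\<theta>:borel_measurable M" "\<theta>':borel_measurable M'" unfolding \<theta>_def \<theta>'_def by auto
 have [measurable]: "p:borel_measurable M" "p':borel_measurable M'" unfolding p_def p'_def by (intro borel_measurable_prod; use JL X in \<open>measurable; blast\<close>)+
 have p: "0<=p w" "p w<=1" "0<=p' v" "p' v<=1" for w v by (auto simp: p_def p'_def intro!: prod_nonneg prod_le_1)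
 \<comment> \<open>Scaling \<open>a\<close> by \<open>s\<close> and adding \<open>t\<close> to its
   \<open>k\<close>-th entry is again a coefficient vector, which is why \<open>a\<close> is
   arbitrary in the induction.\<close>
 have sum: "(SUM l:L. (s * a l+(if l = k then t else 0))*Z l) = s * (SUM l:L. a l*Z l)+t*Z k" for s t and Z :: "'i => real"
 using L k by (simp add: distrib_right sum.distrib sum_distrib_left mult.assoc if_distrib[of "%x. x*_"] cong: if_cong)
 have h: "(LINT w|M. of_real (p w) * cis (s * \<theta> w+t*X k w)) = (LINT w|M'. of_real (p' w) * cis (s * \<theta>' w+t*X' k w))" for s t
 using insert.IH[OF JL, of "%l. s * a l+(if l = k then t else 0)"] unfolding sum p_def p'_def \<theta>_def \<theta>'_def .
 note t = trig_expand[OF M(1), of p \<theta> "%w. t*X k w" for t] trig_expand[OF M(2), of p' \<theta>' "%w. t*X' k w" for t]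
 have r: "(LINT w|M. g w*indicator (B k) (X k w)) = (LINT w|M'. g' w*indicator (B k) (X' k w))" if "g:borel_measurable M" "g':borel_measurable M'"
 and "!!w. 0<=g w" "!!w. g w<=2" "!!w. 0<=g' w" "!!w. g' w <= (2::real)"
 and "!!t. (LINT w|M. of_real (g w) * cis (t*X k w)) = (LINT w|M'. of_real (g' w) * cis (t*X' k w))" for g g'
 by (rule weighted_law_unique[OF M X(1)[OF k] X(2)[OF k] that B[OF k]])
 have pm: "0<=1 + cos v" "0<=1+sin v" for v :: real using cos_ge_minus_one[of v] sin_ge_minus_one[of v] by linarith+
 have le2: "u*(1 + cos v)<=2" "u*(1+sin v)<=2" "0<=u*(1 + cos v)" "0<=u*(1+sin v)" if "0<=u" "u<=1" for u v :: real
 using that mult_mono[of u 1 "1 + cos v" 2] mult_mono[of u 1 "1+sin v" 2] mult_nonneg_nonneg[OF _ pm(1), of u] mult_nonneg_nonneg[OF _ pm(2), of u] pm[of v] cos_le_one[of v] sin_le_one[of v]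
 by auto
 have r0: "(LINT w|M. p w*indicator (B k) (X k w)) = (LINT w|M'. p' w*indicator (B k) (X' k w))"
 by (rule r) (use h[of 0] p order.trans[OF p(2), of 2] order.trans[OF p(4), of 2] in auto)
 have rc: "(LINT w|M. p w*(1 + cos (\<theta> w))*indicator (B k) (X k w)) = (LINT w|M'. p' w*(1 + cos (\<theta>' w))*indicator (B k) (X' k w))"
 by (rule r) (use p le2 in \<open>auto simp: t h[of 1, simplified] h[of "-1", simplified] h[of 0, simplified] simp del: of_real_mult of_real_add\<close>)
 have rs: "(LINT w|M. p w*(1+sin (\<theta> w))*indicator (B k) (X k w)) = (LINT w|M'. p' w*(1+sin (\<theta>' w))*indicator (B k) (X' k w))"
 by (rule r) (use p le2 in \<open>auto simp: t h[of 1, simplified] h[of "-1", simplified] h[of 0, simplified] simp del: of_real_mult of_real_add\<close>)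
 \<comment> \<open>The weights exceed cos and sin by 1, so the unweighted integral is subtracted
   from each to recover real and imaginary part.\<close>
 have fin: "(LINT w|N. of_real (q w*indicator (B k) (Y w)) * cis (F w)) =
 of_real ((LINT w|N. q w*(1 + cos (F w))*indicator (B k) (Y w))-(LINT w|N. q w*indicator (B k) (Y w)))
 + \<i> * of_real ((LINT w|N. q w*(1+sin (F w))*indicator (B k) (Y w))-(LINT w|N. q w*indicator (B k) (Y w)))"
 if N: "finite_measure N" and [measurable]: "q:borel_measurable N" "Y:borel_measurable N" "F:borel_measurable N"
 and q: "!!w. 0<=q w" "!!w. q w<=1" for N :: "'z measure" and q Y F :: "'z => real"
 proof -
 interpret N: finite_measure N by fact
 have q2: "q w<=2" for w using q(2)[of w] by simp
 have [simp]: "integrable N (%w. q w*indicator (B k) (Y w))"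
 "integrable N (%w. q w*(1+sin (F w))*indicator (B k) (Y w))" "integrable N (%w. q w*(1 + cos (F w))*indicator (B k) (Y w))"
 by (rule N.integrable_const_bound[where B=2]; use q le2[OF q] in \<open>auto simp: indicator_def q2 pm\<close>)+
 define G where "G w = of_real (q w*indicator (B k) (Y w)) * cis (F w)" for w
 have i: "integrable N G" unfolding G_def by (rule N.integrable_const_bound[where B=1]; use q in \<open>auto simp: indicator_def norm_mult\<close>)
 have "Re (LINT w|N. G w) = (LINT w|N. q w*(1 + cos (F w))*indicator (B k) (Y w)-q w*indicator (B k) (Y w))"
 unfolding integral_Re[OF i, symmetric] by (intro lint_cong refl) (simp add: G_def algebra_simps)
 moreover have "Im (LINT w|N. G w) = (LINT w|N. q w*(1+sin (F w))*indicator (B k) (Y w)-q w*indicator (B k) (Y w))"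
 unfolding integral_Im[OF i, symmetric] by (intro lint_cong refl) (simp add: G_def algebra_simps)
 ultimately show ?thesis unfolding G_def[symmetric] by (simp add: complex_eq_iff)
 qed
 show ?case using fin[OF M(1), of p "X k" \<theta>] fin[OF M(2), of p' "X' k" \<theta>'] p r0 rc rs insert(1,2)
 by (simp add: p_def p'_def \<theta>_def \<theta>'_def mult.commute)
qed

text \<open>With all coefficients 0 the exponential in \<open>family_law_step\<close> is 1, which
  leaves the measures of finite-dimensional cylinders; these determine a finite measure on the
  product.\<close>

lemma family_law_unique:
 fixes X :: "'i => 'a => real" and X' :: "'i => 'b => real"
 assumes M: "finite_measure M" "finite_measure M'" and X: "!!i. i:I ==> X i:borel_measurable M" "!!i. i:I ==> X' i:borel_measurable M'"
 and eq: "!!L a. finite L ==> L \<subseteq> I ==> (LINT w|M. cis (SUM l:L. a l*X l w)) = (LINT w|M'. cis (SUM l:L. a l*X' l w))"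
 shows "distr M (PiM I (%_. borel)) (%w. \<lambda>i\<in>I. X i w) = distr M' (PiM I (%_. borel)) (%w. \<lambda>i\<in>I. X' i w)"
 (is "?D = ?D'")
proof (rule measure_eqI_PiM_infinite)
 let ?B = "%Y. %w. \<lambda>i\<in>I. Y i w"
 let ?A = "%_. borel :: real measure"
 interpret M: finite_measure M by fact
 interpret M': finite_measure M' by fact
 have m[measurable]: "(%w. \<lambda>i\<in>I. X i w):measurable M (PiM I (%_. borel))" "(%w. \<lambda>i\<in>I. X' i w):measurable M' (PiM I (%_. borel))" using X by auto
 show "finite_measure ?D" by (rule M.finite_measure_distr) measurable
 fix A :: "'i => real set" and J assume J: "finite J" "J \<subseteq> I" and A: "!!i. i:J ==> A i:sets borel"
 have e: "emeasure (distr N (PiM I ?A) (?B Y)) (prod_emb I ?A J (Pi\<^sub>E J A))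
 = ennreal (Re (LINT w|N. of_real (PROD j:J. indicator (A j) (Y j w)) * cis (SUM l:J. 0*Y l w)))"
 if N: "finite_measure N" and Y: "!!i. i:I ==> Y i:borel_measurable N" for N :: "'z measure" and Y :: "'i => 'z => real"
 proof -
 interpret N: finite_measure N by fact
 have [measurable]: "(?B Y):measurable N (PiM I ?A)" "prod_emb I ?A J (Pi\<^sub>E J A):sets (PiM I ?A)" using Y J A by auto
 have "(?B Y) -` prod_emb I ?A J (Pi\<^sub>E J A) Int space N = {w:space N. ALL j:J. Y j w:A j}" using J by (auto simp: prod_emb_def PiE_iff subset_eq)
 hence s: "{w:space N. ALL j:J. Y j w:A j}:sets N" using measurable_sets[OF \<open>(?B Y) : _\<close> \<open>prod_emb I ?A J (Pi\<^sub>E J A) : _\<close>] by simp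
 have "(LINT w|N. of_real (PROD j:J. indicator (A j) (Y j w)) * cis (SUM l:J. 0*Y l w)) = (LINT w|N. of_real (indicator {w:space N. ALL j:J. Y j w:A j} w))"
 by (intro lint_cong refl) (use J(1) in "auto simp: indicator_def prod_zero_iff")
 also have "... = of_real (measure N {w:space N. ALL j:J. Y j w:A j})" using s by simp
 finally show ?thesis using \<open>_ = {w:space N. ALL j:J. Y j w : A j}\<close> by (simp add: emeasure_distr N.emeasure_eq_measure)
 qed
 show "emeasure ?D (prod_emb I ?A J (Pi\<^sub>E J A)) = emeasure ?D' (prod_emb I ?A J (Pi\<^sub>E J A))" using e[of M X] e[of M' X'] M
 family_law_step[OF M J(1), of X X' A J "%_. 0"] X J A eq by (simp add: subset_eq)
qed auto

text \<open>Prescribing the characteristic functions of finite linear combinations admits degenerate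
  covariances without a case distinction. \<open>K\<close> enters through its quadratic form, so a
  kernel and its symmetrisation describe the same family.\<close>

definition gaussian_family :: "'w measure => 'i set => ('i => 'w => real) => ('i => 'i => real) => bool" where
 "gaussian_family P I X K \<longleftrightarrow> prob_space P & (ALL i:I. X i:borel_measurable P) &
 (ALL J a. finite J & J \<subseteq> I --> (LINT w|P. cis (SUM j:J. a j*X j w))
 = complex_of_real (exp (- (SUM i:J. SUM j:J. a i*a j*K i j)/2)))"

lemma gaussian_familyD:
 assumes "gaussian_family P I X K"
 shows "prob_space P" "i:I ==> X i:borel_measurable P"
 "finite J ==> J \<subseteq> I ==> (LINT w|P. cis (SUM j:J. a j*X j w)) = complex_of_real (exp (- (SUM i:J. SUM j:J. a i*a j*K i j)/2))"
 using assms by (auto simp: gaussian_family_def)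

lemma gaussian_family_subset: "gaussian_family P I X K ==> J \<subseteq> I ==> gaussian_family P J X K" by (auto simp: gaussian_family_def)

lemma gaussian_family_cong:
 "(!!i j. i:I ==> j:I ==> K i j = K' i j) ==> gaussian_family P I X K \<longleftrightarrow> gaussian_family P I X K'" by (auto simp: gaussian_family_def subset_eq)

lemma gaussian_family_law:
 assumes "gaussian_family P I X K" "gaussian_family P' I X' K" and A[measurable]: "A:sets (PiM I (%_. borel))"
 shows "\<P>(w in P. (\<lambda>i\<in>I. X i w):A) = \<P>(w in P'. (\<lambda>i\<in>I. X' i w):A)"
proof -
 have f: "finite_measure P" "finite_measure P'" using gaussian_familyD(1)[OF assms(1)] gaussian_familyD(1)[OF assms(2)] by (simp_all add: prob_space.finite_measure)
 note X[measurable] = gaussian_familyD(2)[OF assms(1)] gaussian_familyD(2)[OF assms(2)]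
 have "measure (distr P (PiM I (%_. borel)) (%w. \<lambda>i\<in>I. X i w)) A = measure (distr P' (PiM I (%_. borel)) (%w. \<lambda>i\<in>I. X' i w)) A"
 by (subst family_law_unique[OF f X]) (auto simp: gaussian_familyD(3)[OF assms(1)] gaussian_familyD(3)[OF assms(2)])
 thus ?thesis by (simp add: measure_distr Int_def conj_commute)
qed

text \<open>The finite sets \<open>J p\<close> are embedded into their union, over which a
  combination of combinations is a single combination; the quadratic form is regrouped
  accordingly.\<close>

lemma gaussian_family_linear:
 assumes g: "gaussian_family P I X K" and f: "!!p. p:I' ==> finite (J p)" "!!p. p:I' ==> J p \<subseteq> I"
 shows "gaussian_family P I' (%p w. SUM j:J p. c p j*X j w) (%p q. SUM i:J p. SUM j:J q. c p i * c q j*K i j)"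
proof -
 let ?A = "%p q. SUM i:J p. SUM j:J q. c p i * c q j*K i j"
 have "(LINT w|P. cis (SUM p:F. a p*(SUM j:J p. c p j*X j w)))
 = of_real (exp (- (SUM p:F. SUM q:F. a p*a q*?A p q)/2))"
 if F: "finite F" "F \<subseteq> I'" for F a
 proof -
 define U where "U = (UN p:F. J p)"
 define d where "d p j = (if j:J p then c p j else 0)" for p j
 have U: "finite U" "U \<subseteq> I" using F f by (auto simp: U_def)
 have s: "(SUM j:J p. c p j*Z j) = (SUM j:U. d p j*Z j)" if "p:F" for p Z by (rule sum.mono_neutral_cong_left[OF U(1)]) (use that in "auto simp: U_def d_def")
 have "(SUM p:F. a p*(SUM j:J p. c p j*X j w)) = (SUM j:U. (SUM p:F. a p*d p j)*X j w)" for w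
 by (simp add: s sum_distrib_left sum_distrib_right mult.assoc) (rule sum.swap)
 moreover have "(SUM p:F. SUM q:F. a p*a q*?A p q)
 = (SUM i:U. SUM j:U. (SUM p:F. a p*d p i)*(SUM p:F. a p*d p j)*K i j)"
 proof -
 have "(SUM p:F. SUM q:F. a p*a q*?A p q)
 = (SUM p:F. SUM q:F. a p*a q*(SUM i:U. d p i*(SUM j:U. d q j*K i j)))"
 proof (rule sum.cong[OF refl], rule sum.cong[OF refl], rule arg_cong[where f="(*) _"])
 fix p q assume pq: "p:F" "q:F"
 have "?A p q = (SUM i:J p. c p i*(SUM j:J q. c q j*K i j))" by (simp add: sum_distrib_left mult.assoc)
 thus "?A p q = (SUM i:U. d p i*(SUM j:U. d q j*K i j))" by (simp only: s[OF pq(1)] s[OF pq(2)])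
 qed
 also have "... = (SUM p:F. SUM i:U. SUM q:F. SUM j:U. a p*d p i*(a q*d q j)*K i j)" by (auto simp: sum_distrib_left mult.assoc mult.left_commute intro!: sum.cong refl sum.swap)
 also have "... = (SUM i:U. SUM p:F. SUM j:U. SUM q:F. a p*d p i*(a q*d q j)*K i j)" by (subst sum.swap) (intro sum.swap)
 also have "... = (SUM i:U. SUM j:U. SUM p:F. SUM q:F. a p*d p i*(a q*d q j)*K i j)" by (intro sum.cong refl sum.swap)
 finally show ?thesis by (simp only: sum_product sum_distrib_right[symmetric])
 qed
 ultimately show ?thesis by (simp only: gaussian_familyD(3)[OF g U])
 qed
 moreover have "(%w. SUM j:J p. c p j*X j w):borel_measurable P" if "p:I'" for p using gaussian_familyD(2)[OF g] f(2)[OF that] by (intro borel_measurable_sum) auto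
 ultimately show ?thesis using gaussian_familyD(1)[OF g] by (auto simp: gaussian_family_def)
qed

text \<open>On the product space the summands are independent, so characteristic functions multiply
  and covariances add. This is how disjoint ranges of frequencies are superposed.\<close>

lemma gaussian_family_sum:
 assumes g: "gaussian_family P I X K" "gaussian_family P' I X' K'"
 shows "gaussian_family (P \<Otimes>\<^sub>M P') I (%i w. X i (fst w)+X' i (snd w)) (%i j. K i j+K' i j)"
proof -
 interpret MP: prob_space P by (rule gaussian_familyD[OF g(1)])
 interpret MP': prob_space P' by (rule gaussian_familyD[OF g(2)])
 interpret pair_prob_space P P' ..
 note [measurable] = gaussian_familyD(2)[OF g(1)] gaussian_familyD(2)[OF g(2)]
 have "(LINT w|(P \<Otimes>\<^sub>M P'). cis (SUM j:J. a j*(X j (fst w)+X' j (snd w)))) = of_real (exp (- (SUM i:J. SUM j:J. a i*a j*(K i j+K' i j))/2))"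
 if J: "finite J" "J \<subseteq> I" for J a
 proof -
 have m: "(%w. SUM j:J. a j*X j w):borel_measurable P" "(%w. SUM j:J. a j*X' j w):borel_measurable P'" by (intro borel_measurable_sum ; use J in auto)+
 note [measurable] = m measurable_compose[OF measurable_fst m(1)] measurable_compose[OF measurable_snd m(2)]
 have "(LINT w|(P \<Otimes>\<^sub>M P'). cis (SUM j:J. a j*(X j (fst w)+X' j (snd w))))
 = (LINT u|P. LINT v|P'. cis (SUM j:J. a j*X j u) * cis (SUM j:J. a j*X' j v))" by (simp add: cis_mult distrib_left sum.distrib norm_mult integral_fst'[symmetric] integrable_const_bound[where B=1])
 also have "... = (LINT u|P. cis (SUM j:J. a j*X j u))*(LINT v|P'. cis (SUM j:J. a j*X' j v))" by simp
 finally show ?thesis using J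
 by (simp add: gaussian_familyD(3)[OF g(1)] gaussian_familyD(3)[OF g(2)] distrib_left sum.distrib exp_add[symmetric] add_divide_distrib flip: of_real_mult)
 qed
 thus ?thesis by (auto simp: gaussian_family_def prob_space_axioms)
qed

lemma gaussian_family_PiM:
 assumes N: "finite N" and g: "!!n. n:N ==> gaussian_family (P n) I (X n) (K n)" and ps: "!!n. prob_space (P n)"
 shows "gaussian_family (PiM N P) I (%i w. SUM n:N. X n i (w n)) (%i j. SUM n:N. K n i j)"
proof -
 interpret product_prob_space P N by (rule product_prob_spaceI[OF ps])
 have m[measurable]: "X n i:borel_measurable (P n)" if "n:N" "i:I" for n i using gaussian_familyD(2)[OF g] that by simp
 have "(LINT w|PiM N P. cis (SUM j:J. a j*(SUM n:N. X n j (w n)))) = of_real (exp (- (SUM i:J. SUM j:J. a i*a j*(SUM n:N. K n i j))/2))"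
 if J: "finite J" "J \<subseteq> I" for J a
 proof -
 have c: "cis (SUM n:N. f n) = (PROD n:N. cis (f n))" for f :: "_ => real" using N by (induction rule: finite_induct) (auto simp: cis_mult[symmetric])
 have "(SUM j:J. a j*(SUM n:N. X n j (w n))) = (SUM n:N. SUM j:J. a j*X n j (w n))" for w by (simp add: sum_distrib_left) (rule sum.swap)
 hence "(LINT w|PiM N P. cis (SUM j:J. a j*(SUM n:N. X n j (w n)))) = (LINT w|PiM N P. (PROD n:N. cis (SUM j:J. a j*X n j (w n))))" by (simp add: c)
 also have "... = (PROD n:N. (LINT w|P n. cis (SUM j:J. a j*X n j w)))"
 proof (rule product_integral_prod[OF N])
 fix n assume n: "n:N"
 have [measurable]: "(%w. SUM j:J. a j*X n j w):borel_measurable (P n)" by (intro borel_measurable_sum ; use J n in auto)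
 show "integrable (P n) (%w. cis (SUM j:J. a j*X n j w))" by (rule M.integrable_const_bound[where B=1]) auto
 qed
 also have "... = (PROD n:N. of_real (exp (- (SUM i:J. SUM j:J. a i*a j*K n i j)/2)))" by (intro prod.cong refl gaussian_familyD(3)[OF g] J)
 also have "... = of_real (exp (- (SUM n:N. SUM i:J. SUM j:J. a i*a j*K n i j)/2))" using N by (simp add: exp_sum sum_divide_distrib sum_negf[symmetric])
 finally show ?thesis by (simp add: sum_distrib_left) (subst sum.swap, intro sum.swap)
 qed
 moreover have "(%w. SUM n:N. X n i (w n)):borel_measurable (PiM N P)" if "i:I" for i using that by simp
 ultimately show ?thesis by (auto simp: gaussian_family_def P.prob_space_axioms)
qed

section \<open>Existence of Gaussian families\<close>

abbreviation N01 :: "real measure" where "N01 == density lborel (%x. ennreal (std_normal_density x))"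

lemma prob_space_N01: "prob_space N01" using prob_space_normal_density[of 1 0] by simp

lemma cis_N01: "(LINT x|N01. cis (t*x)) = complex_of_real (exp (- t\<^sup>2/2))"
 using fun_cong[OF char_std_normal_distribution, of t] by (simp add: char_def cis_conv_exp)

lemma cis_PiM_N01:
 "(LINT w|PiM UNIV (%_::nat. N01). cis (SUM k<n. c k*w k)) = complex_of_real (exp (- (SUM k<n. (c k)^2)/2))"
proof -
 interpret product_prob_space "%_::nat. N01" UNIV by (rule product_prob_spaceI[OF prob_space_N01])
 have c: "cis (SUM k<n. f k) = (PROD k<n. cis (f k))" for f :: "nat => real" by (induction n) (auto simp: cis_mult[symmetric])
 have "(LINT w|PiM UNIV (%_::nat. N01). cis (SUM k<n. c k*w k))
 = (LINT w|PiM UNIV (%_::nat. N01). (%v. cis (SUM k<n. c k * v k)) (restrict w {..<n}))"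
 by simp
 also have "... = (LINT v|PiM {..<n} (%_::nat. N01). cis (SUM k<n. c k * v k))"
 by (subst distr_PiM_restrict_finite[OF finite_lessThan subset_UNIV, of n, symmetric], rule integral_distr[symmetric, OF measurable_restrict_subset]) auto
 also have "... = (PROD k<n. (LINT x|N01. cis (c k*x)))" unfolding c
 proof (rule product_integral_prod)
 fix k
 show "integrable N01 (%x. cis (c k*x))" by (rule M.integrable_const_bound[where B=1]) auto
 qed simp
 finally show ?thesis by (simp add: cis_N01 exp_sum sum_divide_distrib sum_negf[symmetric])
qed

text \<open>Gaussian elimination without pivoting: \<open>S n\<close> is the Schur complement after
  \<open>n\<close> steps and stays positive semidefinite. A zero pivot has a zero row by
  semidefiniteness, and division by 0 giving 0 makes that step harmless. Triangularity means that
  entry \<open>i\<close> of the resulting field uses only coordinates up to \<open>i\<close>, which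
  \<open>sidak_step\<close> exploits.\<close>

lemma cholesky:
 fixes K :: "nat => nat => real"
 assumes sym: "!!i j. K i j = K j i" and psd: "!!n a. 0<=(SUM i<n. SUM j<n. a i*a j*K i j)"
 obtains L where "!!i k. i < k ==> L i k = 0" "!!i j n. i < n ==> j < n ==> K i j = (SUM k<n. L i k*L j k)"
proof -
 define S where "S = rec_nat K (%n A i j. A i j-A i n*A j n/A n n)"
 have S0: "S 0 = K" and SS: "S (Suc n) i j = S n i j-S n i n*S n j n/S n n n" for n i j by (simp_all add: S_def)
 have sy: "S n i j = S n j i" for n i j by (induction n) (use sym in "auto simp: S0 SS mult.commute")
 have ps: "0<=(SUM i<m. SUM j<m. a i*a j*S n i j)" for n m a
 proof (induction n arbitrary: m a)
 case 0 thus ?case using psd by (simp add: S0)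
 next
 case (Suc n)
 define M where "M = max m (Suc n)"
 define b where "b i = (if i < m then a i else 0)" for i
 define s where "s = (SUM i<M. b i*S n i n)"
 \<comment> \<open>For a nonzero pivot, subtracting \<open>c\<close> in direction \<open>n\<close>
   minimises the form of \<open>S n\<close>, and the minimum is the form of
   \<open>S (Suc n)\<close>.\<close>
 define c where "c = s / S n n n"
 have M: "n < M" "m <= M" by (auto simp: M_def)
 have bs: "(SUM i<m. a i*f i) = (SUM i<M. b i*f i)" for f by (rule sum.mono_neutral_cong_left) (use M in "auto simp: b_def")
 define d where "d i = b i-(if i = n then c else 0)" for i
 have ds: "(SUM i<M. d i*f i) = (SUM i<M. b i*f i) - c*f n" for f using M(1) by (simp add: d_def left_diff_distrib sum_subtractf if_distrib[of "%x. x*_"] cong:)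
 have s': "(SUM j<M. b j*S n n j) = s" unfolding s_def by (intro sum.cong refl) (metis sy)
 have "0<=(SUM i<M. SUM j<M. d i*d j*S n i j)" by (rule Suc)
 also have "... = (SUM i<M. d i*(SUM j<M. d j*S n i j))" by (simp add: sum_distrib_left mult.assoc)
 also have "... = (SUM i<M. b i*(SUM j<M. b j*S n i j)) - c * s - c*(s - c*S n n n)" by (simp add: ds s' right_diff_distrib sum_subtractf) (simp add: s_def sum_distrib_left mult_ac)
 also have "... = (SUM i<M. b i*(SUM j<M. b j*S n i j))-s * s / S n n n" by (simp add: c_def)
 also have "... = (SUM i<M. b i*(SUM j<M. b j*S (Suc n) i j))" by (simp add: SS right_diff_distrib sum_subtractf s_def sum_distrib_left sum_divide_distrib mult_ac)
 also have "... = (SUM i<m. SUM j<m. a i*a j*S (Suc n) i j)"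
 proof -
 have "(SUM i<m. SUM j<m. a i*a j*S (Suc n) i j) = (SUM i<m. a i*(SUM j<m. a j*S (Suc n) i j))" by (simp only: sum_distrib_left mult.assoc)
 thus ?thesis by (simp only: bs)
 qed
 finally show ?case .
 qed
 have diag: "0<=S n k k" for n k using ps[of "%i. if i = k then 1 else 0" n "Suc k"] by simp
 have null: "S n k j = 0" if "S n k k = 0" "k ~= j" for n k j
 proof (rule ccontr)
 assume ne: "S n k j ~= 0"
 \<comment> \<open>For this \<open>t\<close> the form at \<open>t\<close> times the
   \<open>k\<close>-th plus the \<open>j\<close>-th unit vector equals -1.\<close>
 define t where "t = - (S n j j+1)/(2*S n k j)"
 define d where "d i = (if i = k then t else 0)+(if i = j then 1 else 0)" for i
 have ds: "(SUM i<Suc (max k j). d i*f i) = t*f k+f j" for f :: "nat => real" by (simp add: d_def distrib_right if_distrib[of "%x. x*_"] cong: if_cong)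
 have "(SUM i<Suc (max k j). SUM l<Suc (max k j). d i*d l*S n i l) = (SUM i<Suc (max k j). d i*(SUM l<Suc (max k j). d l*S n i l))"
 by (simp only: sum_distrib_left mult.assoc)
 also have "... = -1" using that sy[of n k j] ne unfolding ds by (simp add: t_def field_simps)
 finally show False using ps[of d n "Suc (max k j)"] by simp
 qed
 have zero: "S n i j = 0" if "i < n \<or> j < n" for n i j using that
 proof (induction n arbitrary: i j)
 case (Suc n)
 have z: "S n n j-S n n n*S n j n/S n n n = 0" for j using null[of n n j] by (auto intro!: sy)
 have z': "S (Suc n) n j = 0" for j unfolding SS by (rule z)
 consider "i < n \<or> j < n" | "i = n" | "j = n" using Suc.prems by linarith
 thus ?case
 proof cases
 case 1
 hence "S n i j = 0" "S n i n*S n j n = 0" using Suc.IH by auto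
 thus ?thesis by (simp add: SS)
 next
 case 2 thus ?thesis using z' by simp
 next
 case 3 thus ?thesis using z' sy[of "Suc n" i n] by simp
 qed
 qed simp
 define L where "L i k = S k i k / sqrt (S k k k)" for i k
 have LL: "L i k*L j k = S k i k*S k j k/S k k k" for i j k using diag[of k k] by (simp add: L_def)
 have "K i j-(SUM k<n. L i k*L j k) = S n i j" for i j n by (induction n) (auto simp: S0 SS LL)
 hence "K i j = (SUM k<n. L i k*L j k)" if "i < n" "j < n" for i j n using zero[of i n j] that by (metis eq_iff_diff_eq_0)
 moreover have "L i k = 0" if "i < k" for i k using zero[of i k k] that by (simp add: L_def)
 ultimately show ?thesis by (intro that[of L])
qed

lemma gaussian_family_cholesky:
 assumes "!!i k. i < k ==> L i k = 0" "!!i j n. i < n ==> j < n ==> K i j = (SUM k<n. L i k*L j k)"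
 shows "gaussian_family (PiM UNIV (%_::nat. N01)) UNIV (%i w. SUM k<=i. L i k*w k) K"
proof -
 let ?A = "%j w. SUM k<=j. L j k*w k"
 have "(LINT w|PiM UNIV (%_::nat. N01). cis (SUM j:J. a j*?A j w)) = of_real (exp (- (SUM i:J. SUM j:J. a i*a j*K i j)/2))" if J: "finite J" for J a
 proof -
 obtain n where n: "J \<subseteq> {..<n}" using J by (metis finite_nat_iff_bounded)
 have "(SUM j:J. a j*?A j w) = (SUM j:J. SUM k<n. a j*L j k*w k)" for w
 proof (intro sum.cong refl)
 fix j assume "j:J"
 thus "a j*?A j w = (SUM k<n. a j*L j k*w k)" unfolding sum_distrib_left mult.assoc[symmetric] by (intro sum.mono_neutral_left) (use n assms(1)[of j] in auto)
 qed
 hence e: "(SUM j:J. a j*?A j w) = (SUM k<n. (SUM j:J. a j*L j k)*w k)" for w by (simp add: sum_distrib_right) (rule sum.swap)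
 have "(SUM i:J. SUM j:J. a i*a j*K i j) = (SUM i:J. SUM j:J. SUM k<n. a i*L i k*(a j*L j k))"
 using n by (intro sum.cong refl) (auto simp: assms(2)[of _ n] subset_eq sum_distrib_left mult_ac intro!: sum.cong)
 also have "... = (SUM k<n. (SUM j:J. a j*L j k)^2)" by (simp only: sum.swap[of _ "{..<n}" J] power2_eq_square sum_product)
 finally show ?thesis by (simp add: e cis_PiM_N01)
 qed
 moreover have "prob_space (PiM UNIV (%_::nat. N01))" by (rule prob_space_PiM[OF prob_space_N01])
 moreover have "(%w. SUM k<=i. L i k*w k):borel_measurable (PiM UNIV (%_::nat. N01))" for i by simp
 ultimately show ?thesis by (simp add: gaussian_family_def)
qed

text \<open>An enumeration of \<open>I\<close> turns the kernel into an infinite matrix, which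
  \<open>cholesky\<close> factorises; independent standard Gaussians then carry the field.\<close>

lemma gaussian_family_exists:
 fixes K :: "'i => 'i => real"
 assumes I: "countable I" "I ~= {}" and sym: "!!i j. K i j = K j i"
 and psd: "!!n a (f::nat => 'i). range f \<subseteq> I ==> 0<=(SUM i<n. SUM j<n. a i*a j*K (f i) (f j))"
 obtains X where "gaussian_family (PiM UNIV (%_::nat. N01)) I X K"
proof -
 define f where "f = from_nat_into I"
 have f: "range f \<subseteq> I" using I by (auto simp: f_def)
 obtain L where L: "!!i k. i < k ==> L i k = 0" "!!i j n. i < n ==> j < n ==> K (f i) (f j) = (SUM k<n. L i k*L j k)"
 by (rule cholesky[of "%i j. K (f i) (f j)"]) (use sym psd[OF f] in auto)
 note g = gaussian_family_cholesky[of L, OF L]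
 have "gaussian_family (PiM UNIV (%_::nat. N01)) I (%i w. SUM j:{to_nat_on I i}. 1*(SUM k<=j. L j k*w k))
 (%p q. SUM i:{to_nat_on I p}. SUM j:{to_nat_on I q}. 1*1*K (f i) (f j))"
 by (rule gaussian_family_linear[OF g]) auto
 hence "gaussian_family (PiM UNIV (%_::nat. N01)) I (%i w. SUM k<=to_nat_on I i. L (to_nat_on I i) k*w k) K"
 by (subst gaussian_family_cong[where K'="%p q. K (f (to_nat_on I p)) (f (to_nat_on I q))"]) (simp_all add: f_def I)
 thus ?thesis by rule
qed

section \<open>The Sidak inequality\<close>

lemma emeasure_affine:
 assumes [measurable]: "A:sets borel" and "0<(c::real)"
 shows "emeasure lborel {z. (z-t) / c:A} = ennreal c*emeasure lborel A"
proof -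
 have "emeasure lborel {z. (z-t) / c:A} = nn_integral lborel (%z. indicator {z. (z-t) / c:A} z)" by simp
 also have "... = nn_integral lborel (%z. indicator A ((z-t) / c))" by (intro nn_integral_cong) (auto simp: indicator_def)
 finally show ?thesis using assms(2) by (simp add: nn_integral_real_affine[where c=c and t=t])
qed

text \<open>Stands in for a maximum: \<open>brunn_minkowski_real\<close> cuts a set at one of its
  own points, and the set need not have a largest one. Without a maximum, a sequence in the set that
  approaches its supremum in the extended reals is cofinal.\<close>

lemma cofinal_sequence:
 fixes A :: "real set" assumes "A ~= {}"
 obtains a :: "nat => real" where "incseq a" "range a \<subseteq> A" "!!x. x:A ==> EX n. x <= a n"
proof (cases "EX m:A. ALL x:A. x <= m")
 case True
 then obtain m where "m:A" "ALL x:A. x <= m" by auto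
 thus ?thesis using that[of "%_. m"] by simp
next
 case False
 obtain f where f: "incseq f" "range f \<subseteq> ereal ` A" "Sup (ereal ` A) = (SUP i. f i)" using Sup_countable_SUP[of "ereal ` A"] assms by auto
 define a where "a n = real_of_ereal (f n)" for n
 have fa: "f n = ereal (a n) & a n:A" for n
 proof -
 have "f n:ereal ` A" using f(2) by auto
 thus ?thesis by (auto simp: a_def)
 qed
 show ?thesis
 proof (rule that[of a])
 show "incseq a" using f(1) by (simp add: incseq_def fa)
 show "range a \<subseteq> A" using fa by auto
 fix x assume "x:A"
 then obtain y where "y:A" "x < y" using False by auto
 hence "ereal x < (SUP i. f i)" unfolding f(3)[symmetric] by (meson SUP_upper imageI less_ereal.simps(1) less_le_trans Sup_upper)
 then obtain n where "ereal x < f n" by (auto simp: less_SUP_iff)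
 thus "EX n. x <= a n" by (auto simp: fa intro: less_imp_le)
 qed
qed

text \<open>If \<open>A\<close> ends at \<open>a\<close> and \<open>B\<close> begins at
  \<open>b\<close>, then l A + (1 - l) b and l a + (1 - l) B lie in \<open>C\<close> on opposite
  sides of their common point l a + (1 - l) b, so their lengths add. General sets are exhausted by
  such truncations.\<close>

lemma brunn_minkowski_real:
 assumes [measurable]: "A:sets borel" "B:sets borel" "C:sets borel" and ne: "A ~= {}" "B ~= {}"
 and l: "0<l" "l < (1::real)" and AB: "!!x y. x:A ==> y:B ==> l*x+(1-l)*y:C"
 shows "ennreal l*emeasure lborel A+ennreal (1-l)*emeasure lborel B <= emeasure lborel C"
proof -
 have *: "ennreal l*emeasure lborel (A Int {..a})+ennreal (1-l)*emeasure lborel (B Int {b..}) <= emeasure lborel C" if ab: "a:A" "b:B" for a b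
 proof -
 define m where "m = l*a+(1-l)*b"
 define S T where "S = {z. (z-(1-l)*b)/l:A Int {..a}}" and "T = {z. (z-l*a)/(1-l):B Int {b..}}"
 have [measurable]: "S:sets borel" "T:sets borel" unfolding S_def T_def by auto
 have S: "S \<subseteq> C Int {..m}"
 proof
 fix z assume z: "z:S"
 thus "z:C Int {..m}" using AB[of "(z-(1-l)*b)/l" b] ab l by (auto simp: S_def m_def field_simps)
 qed
 have T: "T - {m} \<subseteq> C Int {m<..}"
 proof
 fix z assume z: "z:T - {m}"
 hence "z:C" using AB[of a "(z-l*a)/(1-l)"] ab l by (auto simp: T_def)
 moreover have "m <= z" using z l by (auto simp: T_def m_def field_simps)
 ultimately show "z:C Int {m<..}" using z by auto
 qed
 have "emeasure lborel S+emeasure lborel T = emeasure lborel S+emeasure lborel (T - {m})" by (subst emeasure_Diff_null_set) auto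
 also have "... <= emeasure lborel (C Int {..m})+emeasure lborel (C Int {m<..})" by (intro add_mono emeasure_mono S T) auto
 also have "... = emeasure lborel C" by (subst plus_emeasure) (auto intro!: arg_cong[where f="emeasure lborel"])
 finally show ?thesis using l emeasure_affine[of "A Int {..a}" l "(1-l)*b"] emeasure_affine[of "B Int {b..}" "1-l" "l*a"] unfolding S_def T_def by simp
 qed
 obtain a where a: "incseq a" "range a \<subseteq> A" "!!x. x:A ==> EX n. x <= a n" using cofinal_sequence[OF ne(1)] by auto
 obtain b where b: "incseq b" "range b \<subseteq> uminus ` B" "!!x. x:uminus ` B ==> EX n. x <= b n" using cofinal_sequence[of "uminus ` B"] ne(2) by auto
 have "A = (\<Union>n. A Int {..a n})" "B = (\<Union>n. B Int {- b n..})" using a(3) b(3) by (auto simp: minus_le_iff)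
 moreover have "(%n. emeasure lborel (A Int {..a n})) \<longlonglongrightarrow> emeasure lborel (\<Union>n. A Int {..a n})"
 "(%n. emeasure lborel (B Int {- b n..})) \<longlonglongrightarrow> emeasure lborel (\<Union>n. B Int {- b n..})"
 using a(1) b(1) by (intro Lim_emeasure_incseq; force simp: incseq_def)+
 ultimately have "(%n. ennreal l*emeasure lborel (A Int {..a n})+ennreal (1-l)*emeasure lborel (B Int {- b n..}))
 \<longlonglongrightarrow> ennreal l*emeasure lborel A+ennreal (1-l)*emeasure lborel B"
 by (intro tendsto_add ennreal_tendsto_cmult) auto
 moreover have "- b n:B" for n
 proof -
 have "b n:uminus ` B" using b(2) by auto
 thus ?thesis by auto
 qed
 ultimately show ?thesis using * a(2) by (intro LIMSEQ_le_const2[of _ _ "emeasure lborel C"]) (auto simp: subset_eq)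
qed

lemma layer_cake:
 fixes F :: "real => real"
 assumes [measurable]: "F:bm" and F: "!!x. 0<=F x" and a: "0<a"
 shows "nn_integral lborel (%x. ennreal (F x)) = ennreal a*nn_integral lborel (%t. indicator {0<..} t*emeasure lborel {x. a*t < F x})"
proof -
 let ?B = "%x. {t. 0<t & a*t < F x}"
 let ?A = "\<integral>\<^sup>+x. \<integral>\<^sup>+t. indicator (?B x) t \<partial>lborel \<partial>lborel"
 have "ennreal (F x) = ennreal a*nn_integral lborel (%t. indicator (?B x) t)" for x
 proof -
 have "?B x = {0<..<F x/a}" using a by (auto simp: field_simps)
 thus ?thesis using a F[of x] by (simp add: ennreal_mult[symmetric])
 qed
 hence "nn_integral lborel (%x. ennreal (F x)) = ennreal a*?A" by (simp add: nn_integral_cmult)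
 also have "?A = nn_integral lborel (%t. \<integral>\<^sup>+x. indicator (?B x) t \<partial>lborel)" by (rule lborel_pair.Fubini') measurable
 also have "... = nn_integral lborel (%t. indicator {0<..} t*emeasure lborel {x. a*t < F x})"
 by (intro nn_integral_cong, subst nn_integral_indicator[symmetric], measurable, subst nn_integral_cmult[symmetric])
 (auto simp: indicator_def)
 finally show ?thesis .
qed

text \<open>The level sets at heights \<open>a * t\<close> and \<open>b * t\<close>, with
  \<open>a\<close> and \<open>b\<close> the suprema, are nonempty for the same t below 1, so
  \<open>brunn_minkowski_real\<close> applies level by level. Integration over t yields an
  arithmetic mean, and Young's inequality the geometric one.\<close>

lemma prekopa_leindler:
 fixes F G H :: "real => real"
 assumes [measurable]: "F:bm" "G:bm" "H:bm" and nn: "!!x. 0<=F x" "!!x. 0<=G x" "!!x. 0<=H x" and ub: "!!x. F x<=1" "!!x. G x<=1"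
 and int: "integrable lborel F" "integrable lborel G" "integrable lborel H" and l: "0<l" "l<1" and FGH: "!!x y. F x powr l*G y powr (1-l) <= H (l*x+(1-l)*y)"
 shows "integral\<^sup>L lborel F powr l*integral\<^sup>L lborel G powr (1-l) <= integral\<^sup>L lborel H"
proof (cases "integral\<^sup>L lborel F = 0 \<or> integral\<^sup>L lborel G = 0")
 case True thus ?thesis using nn by auto
next
 case False
 define a b where "a = Sup (range F)" and "b = Sup (range G)"
 have bdd: "bdd_above (range F)" "bdd_above (range G)" using ub by (auto intro!: bdd_aboveI[of _ 1])
 have Fa: "F x <= a" "G x <= b" for x using bdd by (auto simp: a_def b_def intro: cSup_upper)
 have ab: "0<a" "0<b"
 proof -
 have "F ~= (%_. 0)" "G ~= (%_. 0)" using False by auto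
 hence "EX x. F x ~= 0" "EX x. G x ~= 0" by auto
 thus "0<a" "0<b" using Fa nn by (metis antisym_conv2 less_le_trans)+
 qed
 define c where "c = a powr l*b powr (1-l)"
 have c: "0<c" using ab by (simp add: c_def)
 define I J K where "I = integral\<^sup>L lborel F" and "J = integral\<^sup>L lborel G" and "K = integral\<^sup>L lborel H"
 have IJK: "0<=I" "0<=J" "0<=K" using nn by (auto simp: I_def J_def K_def)
 define m where "m X r t = (indicator {0<..} t*emeasure lborel {x. r*t < X x} :: ennreal)" for X :: "real => real" and r t
 have [measurable]: "m F a:bm" "m G b:bm" "m H c:bm"
 proof -
 have "m X r:bm" if [measurable]: "X:bm" for X r
 proof -
 have "emeasure lborel {x. r*t < X x} = nn_integral lborel (%x. (if r*t < X x then 1 else 0))" for t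
 by (subst nn_integral_indicator[symmetric]) (auto intro!: nn_integral_cong simp del: nn_integral_indicator)
 moreover have [measurable]: "(%t. \<integral>\<^sup>+x. (if r*t < X x then 1 else 0) \<partial>lborel):bm" by simp
 ultimately have e: "m X r = (%t. indicator {0<..} t*nn_integral lborel (%x. (if r*t < X x then 1 else 0)))" by (simp add: m_def fun_eq_iff)
 show ?thesis unfolding e by simp
 qed
 thus "m F a:bm" "m G b:bm" "m H c:bm" by auto
 qed
 have i: "ennreal (I/a) = nn_integral lborel (%t. m F a t)" "ennreal (J/b) = nn_integral lborel (%t. m G b t)" "ennreal (K / c) = nn_integral lborel (%t. m H c t)"
 proof -
 have "ennreal (integral\<^sup>L lborel X/r) = nn_integral lborel (%t. m X r t)" if "integrable lborel X" "0<r" "!!x. 0<=X x" and [measurable]: "X:bm" for X r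
 proof -
 have "ennreal (1/r)*ennreal (integral\<^sup>L lborel X) = ennreal (1/r)*ennreal r*nn_integral lborel (%t. m X r t)" using that unfolding m_def by (simp add: layer_cake mult.assoc nn_integral_eq_integral[symmetric])
 thus ?thesis using that(2) by (simp add: ennreal_mult''[symmetric] mult.commute flip: ennreal_mult')
 qed
 thus "ennreal (I/a) = nn_integral lborel (%t. m F a t)" "ennreal (J/b) = nn_integral lborel (%t. m G b t)" "ennreal (K / c) = nn_integral lborel (%t. m H c t)"
 using int ab c nn by (auto simp: I_def J_def K_def)
 qed
 have mm: "ennreal l*m F a t+ennreal (1-l)*m G b t <= m H c t" for t
 proof (cases "0<t & t<1")
 case True
 have ne: "{x. a*t < F x} ~= {}" "{x. b*t < G x} ~= {}"
 using less_cSup_iff[OF _ bdd(1), of "a*t"] less_cSup_iff[OF _ bdd(2), of "b*t"] True ab by (auto simp: a_def[symmetric] b_def[symmetric])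
 have "ennreal l*emeasure lborel {x. a*t < F x}+ennreal (1-l)*emeasure lborel {x. b*t < G x} <= emeasure lborel {x. c*t < H x}"
 proof (rule brunn_minkowski_real[OF _ _ _ ne l])
 fix x y assume "x:{x. a*t < F x}" "y:{x. b*t < G x}"
 hence xy: "a*t < F x" "b*t < G y" by auto
 have "0<a*t" "0<b*t" using True ab by auto
 hence lt: "(a*t) powr l*(b*t) powr (1-l) < F x powr l*G y powr (1-l)" using xy l by (intro mult_strict_mono powr_less_mono2) auto
 have "c*t = (a*t) powr l*(b*t) powr (1-l)" using True by (simp add: powr_add[symmetric] powr_mult c_def)
 also have "... < F x powr l*G y powr (1-l)" by (rule lt)
 also have "... <= H (l*x+(1-l)*y)" by (rule FGH)
 finally show "l*x+(1-l)*y:{x. c*t < H x}" by simp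
 qed measurable
 thus ?thesis using True by (simp add: m_def)
 next
 case False
 then consider "t<=0" | "1<=t" by auto
 hence "m F a t = 0 & m G b t = 0"
 proof cases
 case 2
 hence "a <= a*t" "b <= b*t" using ab by auto
 hence "{x. a*t < F x} = {}" "{x. b*t < G x} = {}" using Fa by (auto simp: not_less intro: order.trans)
 thus ?thesis by (simp add: m_def)
 qed (auto simp: m_def indicator_def)
 thus ?thesis by simp
 qed
 have "ennreal (l*(I/a)+(1-l)*(J/b)) = ennreal l*ennreal (I/a)+ennreal (1-l)*ennreal (J/b)"
 using l IJK ab by (subst (1 2) ennreal_mult'[symmetric]) (simp_all add: ennreal_plus[symmetric] del: ennreal_plus)
 also have "... = nn_integral lborel (%t. ennreal l*m F a t+ennreal (1-l)*m G b t)" unfolding i by (subst nn_integral_add) (auto simp: nn_integral_cmult)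
 also have "... <= ennreal (K / c)" unfolding i by (intro nn_integral_mono mm)
 finally have le: "l*(I/a)+(1-l)*(J/b) <= K / c" using IJK c by simp
 have "I powr l*J powr (1-l) / c <= K / c" using Youngs_inequality_0[of l "1-l" "I/a" "J/b"] l ab IJK False le by (simp add: I_def J_def powr_divide c_def)
 thus ?thesis using c by (simp add: divide_le_cancel I_def J_def K_def)
qed

text \<open>The Gaussian density is itself log-concave, because the square of a convex combination
  is at most the combination of the squares; it is absorbed into the three functions.\<close>

lemma prekopa_leindler_N01:
 fixes f g h :: "real => real"
 assumes [measurable]: "f:bm" "g:bm" "h:bm" and b: "!!x. f x:{0..1}" "!!x. g x:{0..1}" "!!x. h x:{0..1}"
 and l: "0<l" "l<1" and fgh: "!!x y. f x powr l*g y powr (1-l) <= h (l*x+(1-l)*y)"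
 shows "(LINT x|N01. f x) powr l*(LINT x|N01. g x) powr (1-l) <= (LINT x|N01. h x)"
proof -
 let ?A = "%x y. l*x+(1-l)*y"
 let ?p = std_normal_density
 have p1: "?p x<=1" for x using pi_gt3 mult_mono[of "1 / sqrt (2*pi)" 1 "exp (- x\<^sup>2/2)" 1] by (simp add: std_normal_density_def)
 have p: "?p x powr l*?p y powr (1-l) <= ?p (?A x y)" for x y
 proof -
 have "(?A x y)^2 = l*x^2+(1-l)*y^2-l*(1-l)*(x-y)^2" by (simp add: power2_eq_square algebra_simps)
 hence q: "(?A x y)^2 <= l*x^2+(1-l)*y^2" using l by simp
 define r where "r = 1 / sqrt (2*pi)"
 have r: "?p z = r*exp (- z\<^sup>2/2)" "0<r" for z by (simp_all add: r_def std_normal_density_def)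
 have "?p x powr l*?p y powr (1-l) = (r powr l*r powr (1-l))*(exp (- x\<^sup>2/2*l)*exp (- y\<^sup>2/2*(1-l)))" by (simp only: r(1) powr_mult exp_powr_real mult_ac)
 also have "... = r*exp (- (l*x^2+(1-l)*y^2)/2)" using r(2) by (simp add: powr_add[symmetric] exp_add[symmetric])
 finally show ?thesis using q r(2) by (simp add: r(1))
 qed
 have i: "integrable lborel (%x. ?p x*k x)" if [measurable]: "k:bm" and k: "!!x. k x:{0..1}" for k by (rule lint_bound[of _ ?p]) (use k in "auto intro!: mult_left_le")
 have e: "(LINT x|N01. k x) = (LINT x|lborel. ?p x*k x)" if [measurable]: "k:bm" for k :: "real => real" by (subst integral_density) auto
 have "integral\<^sup>L lborel (%x. ?p x*f x) powr l*integral\<^sup>L lborel (%x. ?p x*g x) powr (1-l) <= integral\<^sup>L lborel (%x. ?p x*h x)"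
 proof (rule prekopa_leindler[OF _ _ _ _ _ _ _ _ i i i l])
 fix x y
 have "(?p x*f x) powr l*(?p y*g y) powr (1-l) = (?p x powr l*?p y powr (1-l))*(f x powr l*g y powr (1-l))" by (simp add: powr_mult)
 also have "... <= ?p (?A x y)*h (?A x y)" by (intro mult_mono p fgh) auto
 finally show "(?p x*f x) powr l*(?p y*g y) powr (1-l) <= ?p (?A x y)*h (?A x y)" .
 qed (use b p1 in "auto simp: normal_density_nonneg intro!: mult_le_one")
 thus ?thesis by (simp add: e)
qed

lemma N01_symmetric: "(LINT x|N01. f (- x)) = (LINT x|N01. f x)" if [measurable]: "f:bm" for f :: "real => real"
proof -
 have "(LINT x|N01. f (- x)) = (LINT x|lborel. std_normal_density x*f (- x))" by (subst integral_density) auto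
 also have "... = (LINT x|lborel. std_normal_density x*f x)" by (subst lborel_integral_real_affine[where c="-1" and t=0]) (auto simp: std_normal_density_def)
 finally show ?thesis by (simp add: integral_density)
qed

section \<open>Even log-concave functions of Gaussian sequences\<close>

definition log_concave_even :: "((nat => real) => real) => bool" where
 "log_concave_even F \<longleftrightarrow> F:borel_measurable (PiM UNIV (%_. borel)) & (ALL u. F u:{0..1}) & (ALL u. F (%i. - u i) = F u) &
 (ALL l u v. 0<l --> l<1 --> F u powr l*F v powr (1-l) <= F (%i. l*u i+(1-l) * v i))"

text \<open>Integrating out one coordinate with the others as parameters is Prekopa-Leindler;
  evenness survives by the symmetry of the Gaussian.\<close>

lemma log_concave_even_integral:
 assumes F: "log_concave_even F"
 shows "log_concave_even (%u. LINT x|N01. F (u(j := x)))"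
proof -
 interpret N: prob_space N01 by (rule prob_space_N01)
 have Fm[measurable]: "F:borel_measurable (PiM UNIV (%_. borel))" and b: "!!u. F u:{0..1}"
 and e: "!!u. F (%i. - u i) = F u" and c: "!!l u v. 0<l ==> l<1 ==> F u powr l*F v powr (1-l) <= F (%i. l*u i+(1-l) * v i)" using F by (auto simp: log_concave_even_def)
 have m2: "(%(u, x). F (u(j := x))):borel_measurable (PiM UNIV (%_. borel) \<Otimes>\<^sub>M borel)"
 using measurable_compose[OF measurable_add_dim[of j UNIV "%_. borel"] , of F borel] by (simp add: case_prod_beta)
 have m1[measurable]: "(%x. F (u(j := x))):bm" for u using measurable_compose[OF measurable_Pair1'[of u "PiM UNIV (%_. borel)" borel] m2] by (simp add: space_PiM)
 have i: "integrable N01 (%x. F (u(j := x)))" for u by (rule N.integrable_const_bound[where B=1]) (use b in auto)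
 have m: "(%u. LINT x|N01. F (u(j := x))):borel_measurable (PiM UNIV (%_. borel))" using m2 by simp
 moreover have "(LINT x|N01. F (u(j := x))):{0..1}" for u using b N.integral_le_const[OF i[of u], where c=1] by simp
 moreover have "(LINT x|N01. F ((%i. - u i)(j := x))) = (LINT x|N01. F (u(j := x)))" for u
 proof -
 have "F ((%i. - u i)(j := x)) = F (u(j := - x))" for x using e[of "u(j := - x)"] by (simp add: fun_upd_def if_distrib cong: if_cong)
 thus ?thesis using N01_symmetric[of "%x. F (u(j := x))"] by simp
 qed
 moreover have "(LINT x|N01. F (u(j := x))) powr l*(LINT x|N01. F (v(j := x))) powr (1-l) <= (LINT x|N01. F ((%i. l*u i+(1-l) * v i)(j := x)))" if "0<l" "l<1" for l u v
 proof (rule prekopa_leindler_N01[OF m1 m1 m1 b b b that])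
 fix x y
 have "(%i. l*u i+(1-l) * v i)(j := l*x+(1-l)*y) = (%i. l*(u(j := x)) i+(1-l)*(v(j := y)) i)" by auto
 thus "F (u(j := x)) powr l*F (v(j := y)) powr (1-l) <= F ((%i. l*u i+(1-l) * v i)(j := l*x+(1-l)*y))" using c[OF that, of "u(j := x)" "v(j := y)"] by simp
 qed
 ultimately show ?thesis unfolding log_concave_even_def by blast
qed

lemma measurable_extend:
 "(%w i. if i:J then w i else u i):measurable (PiM J (%_. N01)) (PiM UNIV (%_. borel))"
proof (rule measurable_PiM_single')
 fix i show "(%w. if i:J then w i else u i):measurable (PiM J (%_. N01)) borel" by (cases "i:J") simp_all
qed (simp add: space_PiM)

lemma log_concave_even_PiM:
 assumes "finite J" "log_concave_even F"
 shows "log_concave_even (%u. LINT w|PiM J (%_. N01). F (%i. if i:J then w i else u i))" using assms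
proof (induction J arbitrary: F rule: finite_induct)
 case empty
 interpret product_prob_space "%_::nat. N01" "{}" by (rule product_prob_spaceI[OF prob_space_N01])
 show ?case using empty P.prob_space by simp
next
 case (insert j J)
 interpret product_prob_space "%_::nat. N01" "insert j J" by (rule product_prob_spaceI[OF prob_space_N01])
 have Fm[measurable]: "F:borel_measurable (PiM UNIV (%_. borel))" and b: "!!u. F u:{0..1}" using insert.prems by (auto simp: log_concave_even_def)
 have "(LINT w|PiM (insert j J) (%_. N01). F (%i. if i:insert j J then w i else u i))
 = (LINT w|PiM J (%_. N01). (LINT x|N01. F ((%i. if i:J then w i else u i)(j := x))))" for u
 proof -
 have "(%w i. if i:insert j J then w i else u i):measurable (PiM (insert j J) (%_. N01)) (PiM UNIV (%_. borel))" by (rule measurable_extend)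
 hence "integrable (PiM (insert j J) (%_. N01)) (%w. F (%i. if i:insert j J then w i else u i))" by (intro P.integrable_const_bound[where B=1]) (use b in auto)
 hence "(LINT w|PiM (insert j J) (%_. N01). F (%i. if i:insert j J then w i else u i))
 = (LINT w|PiM J (%_. N01). (LINT x|N01. F (%i. if i:insert j J then (w(j := x)) i else u i)))"
 by (rule product_integral_insert[OF insert(1,2)])
 also have "... = (LINT w|PiM J (%_. N01). (LINT x|N01. F ((%i. if i:J then w i else u i)(j := x))))" by (intro lint_cong arg_cong[where f=F]) auto
 finally show ?thesis .
 qed
 thus ?case using insert.IH[OF log_concave_even_integral[OF insert.prems, of j]] by (simp only:)
qed

text \<open>Chebyshev's association inequality: the indicator of the interval and \<open>g\<close>
  both decrease in the modulus. With the indicator centred at its mean and \<open>g\<close> at its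
  value on the edge of the interval, the product is nonnegative everywhere.\<close>

lemma even_unimodal_association:
 fixes g :: "real => real"
 assumes [measurable]: "g:bm" and g: "!!s. g s:{0..1}" "!!s t. abs s <= abs t ==> g t <= g s"
 shows "measure N01 {s. abs (c * s) <= b}*(LINT s|N01. g s) <= (LINT s|N01. indicator {s. abs (c * s) <= b} s * g s)"
proof -
 interpret N: prob_space N01 by (rule prob_space_N01)
 define A where "A = {s. abs (c * s) <= b}"
 have [measurable]: "A:sets borel" unfolding A_def by simp
 define p where "p = measure N01 A"
 \<comment> \<open>The value of \<open>g\<close> on the edge of the interval. For
   \<open>c = 0\<close> the interval is empty or the whole line, and 0 is a mere default.\<close>
 define q where "q = (if c = 0 then 0 else g (b / c))"
 have p: "0<=p" "p<=1" by (auto simp: p_def)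
 have i[simp]: "integrable N01 (%s. indicator A s * g s)" "integrable N01 g" "integrable N01 (indicat_real A)"
 by (rule N.integrable_const_bound[where B=1]; use g(1) in \<open>auto simp: indicator_def\<close>)+
 have nn: "0<=(indicator A s-p)*(g s-q)" for s
 proof (cases "c = 0")
 case True
 hence "A = UNIV \<or> A = {}" by (auto simp: A_def)
 moreover have "measure N01 UNIV = 1" using N.prob_space by simp
 ultimately show ?thesis by (auto simp: p_def)
 next
 case False
 show ?thesis
 proof (cases "s:A")
 case True
 hence "q <= g s" using False g(2) by (simp add: A_def field_simps q_def)
 thus ?thesis using True p by simp
 next
 case s: False
 have "p*(g s-q)<=0"
 proof (cases "0<=b")
 case True
 hence "g s <= q" using s False g(2) by (simp add: A_def abs_mult field_simps q_def)
 thus ?thesis using p by (simp add: mult_nonneg_nonpos)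
 next
 case nb: False
 have "A = {}" using nb by (auto simp: A_def)
 thus ?thesis by (simp add: p_def)
 qed
 thus ?thesis using s by simp
 qed
 qed
 have "0<=(LINT s|N01. (indicator A s-p)*(g s-q))" by (intro Bochner_Integration.integral_nonneg nn)
 also have "... = (LINT s|N01. indicator A s * g s-p*g s-q*indicator A s+p*q)" by (intro lint_cong refl) (simp add: algebra_simps)
 also have "... = (LINT s|N01. indicator A s * g s)-p*(LINT s|N01. g s)" using N.prob_space by (simp add: p_def)
 finally show ?thesis by (simp add: A_def p_def)
qed

text \<open>Coordinate 0 is separated from the coordinates 1 to n - 1. In the extended sequence the
  value \<open>s\<close> is genuine at 0 and a dummy from \<open>n\<close> on, where \<Phi> does not
  look.\<close>

lemma integral_PiM_N01_split:
 assumes n: "0<n" and [measurable]: "\<Phi>:borel_measurable (PiM UNIV (%_. borel))"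
 and b: "!!u. abs (\<Phi> u)<=1" and d: "!!u v. (!!i. i < n ==> u i = v i) ==> \<Phi> u = (\<Phi> v :: real)"
 shows "(LINT w|PiM UNIV (%_::nat. N01). \<Phi> w)
 = (LINT s|N01. (LINT w|PiM {1..<n} (%_. N01). \<Phi> (%i. if i:{1..<n} then w i else s)))"
proof -
 let ?A = "PiM {1..<n} (%_. N01) \<Otimes>\<^sub>M N01"
 interpret product_prob_space "%_::nat. N01" UNIV by (rule product_prob_spaceI[OF prob_space_N01])
 interpret J: product_prob_space "%_::nat. N01" "{1..<n}" by (rule product_prob_spaceI[OF prob_space_N01])
 interpret In: product_prob_space "%_::nat. N01" "insert 0 {1..<n}" by (rule product_prob_spaceI[OF prob_space_N01])
 interpret PP: pair_prob_space "PiM {1..<n} (%_. N01)" N01 ..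
 have ins: "insert 0 {1..<n} = {..<n}" using n by auto
 define E where "E w i = (if i < n then w i else 0)" for w :: "nat => real" and i
 have Em: "E:measurable (PiM {..<n} (%_. N01)) (PiM UNIV (%_. borel))" using measurable_extend[of "{..<n}" "%_. 0"] unfolding E_def by simp
 have m1: "(%w. \<Phi> (E w)):borel_measurable (PiM {..<n} (%_. N01))" by (rule measurable_compose[OF Em]) measurable
 have "(LINT w|PiM UNIV (%_::nat. N01). \<Phi> w) = (LINT w|PiM UNIV (%_::nat. N01). \<Phi> (E (restrict w {..<n})))" by (intro lint_cong refl d) (simp add: E_def)
 also have "... = (LINT w|PiM {..<n} (%_::nat. N01). \<Phi> (E w))"
 by (subst distr_PiM_restrict_finite[OF finite_lessThan subset_UNIV, of n, symmetric], rule integral_distr[symmetric, OF measurable_restrict_subset m1]) simp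
 also have "... = (LINT w|PiM {1..<n} (%_. N01). (LINT s|N01. \<Phi> (E (w(0 := s)))))"
 proof -
 have "integrable (PiM (insert 0 {1..<n}) (%_. N01)) (%w. \<Phi> (E w))" by (rule In.P.integrable_const_bound[where B=1]) (use b m1 ins in auto)
 from product_integral_insert[OF _ _ this] show ?thesis by (simp add: ins[symmetric])
 qed
 also have "... = (LINT s|N01. (LINT w|PiM {1..<n} (%_. N01). \<Phi> (E (w(0 := s)))))"
 proof (rule PP.Fubini_integral[symmetric])
 have "(%(w, s). w(0 := s)):measurable ?A (PiM (insert 0 {1..<n}) (%_. N01))" by simp
 from measurable_compose[OF this[unfolded ins] m1] have "(%(w, s). \<Phi> (E (w(0 := s)))):borel_measurable ?A" by (simp add: case_prod_beta)
 thus "integrable ?A (%(w, s). \<Phi> (E (w(0 := s))))" by (intro PP.integrable_const_bound[where B=1]) (use b in auto)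
 qed
 finally show ?thesis by (auto simp: E_def intro!: lint_cong d)
qed

text \<open>In the triangular representation \<open>X 0\<close> depends on coordinate 0 alone. Given
  that coordinate, the probability of the other constraints is a Gaussian average of an even
  log-concave indicator, hence even and log-concave in it, hence decreasing in its modulus;
  \<open>even_unimodal_association\<close> concludes.\<close>

lemma sidak_step:
 fixes L :: "nat => nat => real" and b :: "nat => real"
 assumes n: "0<n"
 defines "X == %k (w::nat => real). SUM j<=k. L k j*w j" and "P == PiM UNIV (%_::nat. N01)"
 shows "\<P>(w in P. abs (X 0 w) <= b 0)*\<P>(w in P. ALL k:{1..<n}. abs (X k w) <= b k)
 <= \<P>(w in P. ALL k<n. abs (X k w) <= b k)"
proof -
 let ?B = "PiM UNIV (%_. borel)"
 let ?A = "{s. abs (L 0 0 * s) <= b 0}"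
 interpret J: product_prob_space "%_::nat. N01" "{1..<n}" by (rule product_prob_spaceI[OF prob_space_N01])
 have Xm[measurable]: "X k:borel_measurable ?B" for k unfolding X_def by simp
 define F where "F u = (if ALL k:{1..<n}. abs (X k u) <= b k then 1 else 0 :: real)" for u
 define A where "A u = (if abs (X 0 u) <= b 0 then 1 else 0 :: real)" for u
 have [measurable]: "F:borel_measurable ?B" "A:borel_measurable ?B" unfolding F_def A_def by auto
 have d: "X k u = X k v" if "!!i. i < n ==> u i = v i" "k < n" for u v k unfolding X_def using that by simp
 have Fl: "log_concave_even F"
 proof -
 have "F u powr l*F v powr (1-l) <= F (%i. l*u i+(1-l) * v i)" if l: "0<l" "l<1" for l u v
 proof (cases "F u = 1 & F v = 1")
 case True
 have "abs (X k (%i. l*u i+(1-l) * v i)) <= b k" if k: "k:{1..<n}" for k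
 proof -
 have uv: "abs (X k u) <= b k" "abs (X k v) <= b k" using True k by (auto simp: F_def split: if_splits)
 have "X k (%i. l*u i+(1-l) * v i) = l*X k u+(1-l)*X k v" by (simp add: X_def sum_distrib_left sum.distrib[symmetric] algebra_simps)
 also have "abs ... <= l*b k+(1-l)*b k" using l uv by (simp add: abs_mult order.trans[OF abs_triangle_ineq] add_mono)
 finally show ?thesis by (simp add: algebra_simps)
 qed
 thus ?thesis by (simp add: True) (simp add: F_def)
 next
 case False
 hence "F u = 0 \<or> F v = 0" by (auto simp: F_def split: if_splits)
 moreover have "0<=F w" for w by (simp add: F_def)
 ultimately show ?thesis by auto
 qed
 moreover have "X k (%i. - u i) = - X k u" for k u by (simp add: X_def sum_negf)
 hence "F (%i. - u i) = F u" for u by (simp add: F_def)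
 ultimately show ?thesis by (auto simp: log_concave_even_def F_def)
 qed
 define G where "G u = (LINT w|PiM {1..<n} (%_. N01). F (%i. if i:{1..<n} then w i else u i))" for u
 have Gl: "log_concave_even G" unfolding G_def by (rule log_concave_even_PiM[OF _ Fl]) simp
 define g where "g s = G (%_. s)" for s
 have "G:borel_measurable ?B" using Gl by (simp add: log_concave_even_def)
 hence gm: "g:bm" unfolding g_def by (rule measurable_compose[rotated]) (rule measurable_PiM_single', auto)
 have g01: "g s:{0..1}" for s using Gl by (simp add: log_concave_even_def g_def)
 have ge: "g (- s) = g s" for s using Gl by (simp add: log_concave_even_def g_def)
 have gu: "g t <= g s" if "abs s <= abs t" for s t
 proof (cases "abs s = abs t")
 case True thus ?thesis using ge by (auto simp: abs_eq_iff)
 next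
 case False
 \<comment> \<open>The weight that represents \<open>s\<close> as a convex combination of
   \<open>t\<close> and \<open>- t\<close>.\<close>
 define l where "l = (1+s / t)/2"
 have "abs (s / t)<1" "t ~= 0" using False that by auto
 hence "-1 < s / t" "s / t<1" by linarith+
 hence l: "0<l" "l<1" by (simp_all add: l_def)
 have st: "l*t+(1-l)*(- t) = s" using \<open>t ~= 0\<close> by (simp add: l_def field_simps)
 have "ALL l u v. 0<l --> l<1 --> G u powr l*G v powr (1-l) <= G (%i. l*u i+(1-l) * v i)" using Gl unfolding log_concave_even_def by simp
 from this[rule_format, OF l, of "%_. t" "%_. - t"]
 have "g t powr l*g (- t) powr (1-l) <= g s" unfolding g_def st .
 moreover have "g t powr l*g t powr (1-l) = g t" using g01[of t] by (cases "g t = 0") (auto simp: powr_add[symmetric])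
 ultimately show ?thesis by (simp add: ge)
 qed
 have iU: "(LINT w|P. \<Phi> w) = (LINT s|N01. (LINT w|PiM {1..<n} (%_. N01). \<Phi> (%i. if i:{1..<n} then w i else s)))"
 if "\<Phi>:borel_measurable ?B" "!!u. abs (\<Phi> u)<=1" "!!u v. (!!i. i < n ==> u i = v i) ==> \<Phi> u = \<Phi> v" for \<Phi> :: "(nat => real) => real"
 unfolding P_def by (rule integral_PiM_N01_split[OF n that(1,2)]) (rule that(3), simp)
 have me: "\<P>(w in P. Q w) = (LINT w|P. (if Q w then 1 else 0))" if [measurable]: "Measurable.pred P Q" for Q
 proof -
 have "(LINT w|P. (if Q w then 1 else 0)) = (LINT w|P. indicator {w:space P. Q w} w)" by (intro lint_cong) auto
 also have "... = \<P>(w in P. Q w)" by simp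
 finally show ?thesis ..
 qed
 have sP: "sets P = sets ?B" unfolding P_def by (intro sets_PiM_cong refl) simp
 have XP[measurable]: "X k:borel_measurable P" for k by (simp add: measurable_cong_sets[OF sP refl])
 have A0: "A (%i. if i:{1..<n} then w i else s) = indicator ?A s" for w s by (simp add: A_def X_def)
 have 1: "\<P>(w in P. abs (X 0 w) <= b 0) = measure N01 ?A"
 proof -
 have dA: "A u = A v" if "!!i. i < n ==> u i = v i" for u v using d[OF that n] by (simp add: A_def)
 have "(LINT w|P. A w) = (LINT s|N01. indicator ?A s)" by (subst iU, simp, simp add: A_def, rule dA, simp) (simp only: A0, use J.P.prob_space in simp)
 thus ?thesis using me[of "%w. abs (X 0 w) <= b 0"] by (simp add: A_def)
 qed
 have dF: "F u = F v" if "!!i. i < n ==> u i = v i" for u v unfolding F_def using d[OF that] by auto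
 have 2: "\<P>(w in P. ALL k:{1..<n}. abs (X k w) <= b k) = (LINT s|N01. g s)"
 proof -
 have "(LINT w|P. F w) = (LINT s|N01. g s)" unfolding g_def G_def by (rule iU, simp, simp add: F_def, rule dF, simp)
 thus ?thesis by (subst me) (auto simp: F_def)
 qed
 have 3: "\<P>(w in P. ALL k<n. abs (X k w) <= b k) = (LINT s|N01. indicator ?A s * g s)"
 proof -
 have dA: "A u*F u = A v * F v" if "!!i. i < n ==> u i = v i" for u v using dF[OF that] d[OF that n] by (simp add: A_def)
 have "(LINT w|P. A w*F w) = (LINT s|N01. indicator ?A s * g s)"
 unfolding g_def G_def by (subst iU, simp, simp add: A_def F_def, rule dA, simp) (simp only: A0 Bochner_Integration.integral_mult_right_zero)
 moreover have "(if ALL k<n. abs (X k w) <= b k then 1 else 0) = A w*F w" for w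
 proof -
 have "(ALL k<n. abs (X k w) <= b k) \<longleftrightarrow> abs (X 0 w) <= b 0 & (ALL k:{1..<n}. abs (X k w) <= b k)"
 using n by (metis One_nat_def atLeastLessThan_iff le_simps(3) not_gr_zero)
 thus ?thesis by (simp add: A_def F_def)
 qed
 ultimately show ?thesis by (subst me) auto
 qed
 show ?thesis unfolding 1 2 3 by (rule even_unimodal_association[OF gm g01 gu])
qed

text \<open>A characteristic function has modulus at most 1, so its exponent cannot be
  positive.\<close>

lemma gaussian_family_psd:
 assumes "gaussian_family P I X K" "finite J" "J \<subseteq> I"
 shows "0<=(SUM i:J. SUM j:J. a i*a j*K i j)"
proof -
 interpret prob_space P by (rule gaussian_familyD[OF assms(1)])
 have [measurable]: "(%w. SUM j:J. a j*X j w):borel_measurable P" using gaussian_familyD(2)[OF assms(1)] assms(3) by (intro borel_measurable_sum) auto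
 have i: "integrable P (%w. cis (SUM j:J. a j*X j w))" by (rule integrable_const_bound[where B=1]) auto
 have "norm (LINT w|P. cis (SUM j:J. a j*X j w)) <= (LINT w|P. norm (cis (SUM j:J. a j*X j w)))" by (rule integral_norm_bound)
 thus ?thesis using gaussian_familyD(3)[OF assms] prob_space by simp
qed

lemma gaussian_family_reindex:
 assumes "gaussian_family P I X K" "f ` J \<subseteq> I"
 shows "gaussian_family P J (%j. X (f j)) (%i j. K (f i) (f j))" using gaussian_family_linear[OF assms(1), of J "%p. {f p}" "%_ _. 1"] assms(2) by auto

lemma gaussian_family_symm:
 assumes "gaussian_family P I X K"
 shows "gaussian_family P I X (%i j. (K i j+K j i)/2)"
proof -
 let ?B = "%J a. SUM i:J. SUM j:J. a i*a j*((K i j+K j i)/2)"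
 let ?A = "%J a. SUM i:J. SUM j:J. a i*a j*K i j"
 have "?B J a = ?A J a" for J a
 proof -
 have "?B J a = (?A J a+(SUM i:J. SUM j:J. a i*a j*K j i))/2" by (simp add: sum_divide_distrib sum.distrib[symmetric] distrib_left)
 also have "(SUM i:J. SUM j:J. a i*a j*K j i) = ?A J a" by (subst sum.swap) (simp add: mult.commute[of "a _" "a _"])
 finally show ?thesis by simp
 qed
 thus ?thesis using assms by (simp add: gaussian_family_def)
qed

text \<open>Induction splits off one constraint at a time. The law is reproduced by a Cholesky field
  in which the constraint split off comes first, so that \<open>sidak_step\<close> applies.\<close>

theorem sidak:
 fixes X :: "'i => 'w => real"
 assumes g: "gaussian_family P I X K" and I: "finite I"
 shows "(PROD i:I. \<P>(w in P. abs (X i w) <= b i)) <= \<P>(w in P. ALL i:I. abs (X i w) <= b i)" using I g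
proof (induction I rule: finite_induct)
 case empty
 interpret prob_space P by (rule gaussian_familyD[OF empty])
 show ?case using prob_space by simp
next
 case (insert i0 I)
 obtain h where h: "bij_betw h {0..<card I} I" using ex_bij_betw_nat_finite[OF insert(1)] by auto
 \<comment> \<open>\<open>i0\<close> takes position 0, the one driven by a single Gaussian
   coordinate.\<close>
 define f where "f k = (case k of 0 => i0 | Suc m => h m)" for k
 define n where "n = Suc (card I)"
 have e: "{1..<n} = Suc ` {0..<card I}" by (simp add: n_def)
 have fI: "f ` {1..<n} = I" unfolding e image_image using h by (simp add: f_def bij_betw_def)
 have fn: "f ` {..<n} = insert i0 I"
 proof -
 have "{..<n} = insert 0 {1..<n}" by (auto simp: n_def)
 thus ?thesis using fI by (simp add: f_def)
 qed
 \<comment> \<open>Symmetrised and padded with zeros, since \<open>cholesky\<close> factorises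
   symmetric matrices indexed by all natural numbers.\<close>
 define K' where "K' k l = (if k < n & l < n then (K (f k) (f l)+K (f l) (f k))/2 else 0)" for k l
 have g': "gaussian_family P {..<n} (%k. X (f k)) K'" using gaussian_family_symm[OF gaussian_family_reindex[OF insert.prems, of f "{..<n}"]] fn
 by (subst gaussian_family_cong[where K'="%k l. (K (f k) (f l)+K (f l) (f k))/2"]) (auto simp: K'_def)
 have psd: "0<=(SUM i<m. SUM j<m. a i*a j*K' i j)" for m a
 proof -
 have "(SUM i<m. SUM j<m. a i*a j*K' i j) = (SUM i:{..<m} Int {..<n}. SUM j:{..<m} Int {..<n}. a i*a j*K' i j)"
 by (intro sum.mono_neutral_cong_right) (auto simp: K'_def)
 thus ?thesis using gaussian_family_psd[OF g', of "{..<m} Int {..<n}" a] by auto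
 qed
 obtain L where L: "!!i k. i < k ==> L i k = 0" "!!i j n. i < n ==> j < n ==> K' i j = (SUM k<n. L i k*L j k)" by (rule cholesky[of K']) (use psd in "auto simp: K'_def")
 let ?P = "PiM UNIV (%_::nat. N01)" let ?X = "%k w. SUM j<=k. L k j*w j"
 have gc: "gaussian_family ?P {..<n} ?X K'" by (rule gaussian_family_subset[OF gaussian_family_cholesky[of L K', OF L]]) auto
 have eq: "\<P>(w in P. ALL k:S. abs (X (f k) w) <= b (f k)) = measure ?P {w:space ?P. ALL k:S. abs (?X k w) <= b (f k)}" if S: "S \<subseteq> {..<n}" for S
 proof -
 have fS: "finite S" using S finite_subset by auto
 have "{v:space (PiM {..<n} (%_. borel)). ALL k:S. abs (v k) <= b (f k)}:sets (PiM {..<n} (%_. borel :: real measure))"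
 using S fS by (intro sets.sets_Collect_finite_All) auto
 from gaussian_family_law[OF g' gc this] show ?thesis using S by (simp add: space_PiM subset_eq cong:)
 qed
 have "\<P>(w in P. abs (X i0 w) <= b i0)*(PROD i:I. \<P>(w in P. abs (X i w) <= b i))
 <= \<P>(w in P. abs (X i0 w) <= b i0)*\<P>(w in P. ALL i:I. abs (X i w) <= b i)"
 by (intro mult_left_mono insert.IH gaussian_family_subset[OF insert.prems]) auto
 also have "... = measure ?P {w:space ?P. abs (?X 0 w) <= b (f 0)}*measure ?P {w:space ?P. ALL k:{1..<n}. abs (?X k w) <= b (f k)}"
 proof -
 have "\<P>(w in P. abs (X i0 w) <= b i0) = measure ?P {w:space ?P. abs (?X 0 w) <= b (f 0)}" using eq[of "{0}"] by (simp add: f_def n_def)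
 moreover have "\<P>(w in P. ALL i:I. abs (X i w) <= b i) = measure ?P {w:space ?P. ALL k:{1..<n}. abs (?X k w) <= b (f k)}"
 using eq[of "{1..<n}"] by (simp add: fI[symmetric] subset_eq)
 ultimately show ?thesis by (simp only:)
 qed
 also have "... <= measure ?P {w:space ?P. ALL k<n. abs (?X k w) <= b (f k)}" by (rule sidak_step) (simp add: n_def)
 also have "... = \<P>(w in P. ALL i:insert i0 I. abs (X i w) <= b i)" using eq[of "{..<n}"] unfolding fn[symmetric] by simp (simp add: Ball_def)
 finally show ?case using insert(1,2) by simp
qed

section \<open>Dyadic grids adapted to the anisotropic distance\<close>

text \<open>Rounding towards 0 rather than down: moduli never grow, so truncation does not leave a
  ball around 0, and a coarse truncation absorbs a finer one.\<close>

definition tr :: "nat => real => real" where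
 "tr m x = sgn x * of_int (floor (abs x*2^m))/2^m"

lemma sgn_floor: "of_int (floor (sgn x)) = sgn (x::real)" by (auto simp: sgn_if)

lemma abs_tr: "abs (tr m x) = of_int (floor (abs x*2^m))/2^m" by (auto simp: tr_def abs_mult)

lemma tr_le: "abs (tr m x) <= abs x" by (simp add: abs_tr divide_le_eq)

lemma tr_0[simp]: "tr m 0 = 0" by (simp add: tr_def)

lemma tr_diff: "\<bar>x-tr m x\<bar> <= 1/2^m"
proof -
 have "x-tr m x = sgn x*(\<bar>x\<bar> - of_int \<lfloor>\<bar>x\<bar>*2^m\<rfloor>/2^m)" by (simp add: tr_def right_diff_distrib sgn_mult_abs)
 moreover have "\<bar>\<bar>x\<bar> - of_int \<lfloor>\<bar>x\<bar>*2^m\<rfloor>/2^m\<bar> <= 1/2^m"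
 proof -
 have "\<bar>x\<bar> - of_int \<lfloor>\<bar>x\<bar>*2^m\<rfloor>/2^m = (\<bar>x\<bar>*2^m - of_int \<lfloor>\<bar>x\<bar>*2^m\<rfloor>)/2^m" by (simp add: diff_divide_distrib)
 moreover have "\<bar>\<bar>x\<bar>*2^m - of_int \<lfloor>\<bar>x\<bar>*2^m\<rfloor>\<bar><=1" by linarith
 ultimately show ?thesis by (simp add: divide_right_mono)
 qed
 ultimately show ?thesis by (simp add: abs_mult)
qed

lemma tr_eq_0: "abs x < 1/2^m ==> tr m x = 0"
proof -
 assume "abs x < 1/2^m"
 hence "0<=abs x*2^m" "abs x*2^m<1" by (simp_all add: field_simps)
 hence "floor (abs x*2^m) = 0" by linarith
 thus ?thesis by (simp add: tr_def)
qed

text \<open>The meshes differ by the integer factor 2^(m - k), so nested floors collapse to the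
  coarser one; the sign is lost only where the coarser floor is 0 anyway.\<close>

lemma tr_tr: assumes "k <= m" shows "tr k (tr m x) = tr k x"
proof -
 define z where "z = floor (abs x*2^k)"
 define c where "c = (2::int)^(m-k)"
 have c: "(2::real)^m = 2^k * of_int c" "0<c" using assms by (simp_all add: c_def power_add[symmetric])
 have z: "of_int z <= abs x*2^k" "abs x*2^k < of_int z+1" by (simp_all add: z_def)
 have "z * c <= floor (abs x*2^m)" using z(1) c by (simp add: le_floor_iff)
 hence "of_int (z * c) <= (of_int (floor (abs x*2^m)) :: real)" by linarith
 hence 1: "of_int z <= of_int (floor (abs x*2^m))/(of_int c :: real)" using c(2) by (simp add: pos_le_divide_eq)
 have "of_int (floor (abs x*2^m))/(of_int c :: real) <= abs x*2^k" using c by (simp add: pos_divide_le_eq mult.assoc)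
 hence "\<lfloor>of_int (floor (abs x*2^m))/(of_int c :: real)\<rfloor> = z" using 1 z by linarith
 moreover have "abs (tr m x)*2^k = of_int (floor (abs x*2^m)) / of_int c" using c by (simp add: abs_tr)
 ultimately have f: "floor (abs (tr m x)*2^k) = z" by simp
 show ?thesis
 proof (cases "z = 0")
 case True thus ?thesis unfolding tr_def[of k] f by (simp add: z_def)
 next
 case False
 have "tr m x ~= 0" using f False by auto
 moreover have "0<=floor (abs x*2^m)" by simp
 moreover have "floor (abs x*2^m) ~= 0" using \<open>tr m x ~= 0\<close> by (auto simp: tr_def)
 ultimately have "0<floor (abs x*2^m)" by linarith
 hence pos: "0<of_int (floor (abs x*2^m))/(2::real)^m" by simp
 have "sgn (tr m x) = sgn x" unfolding tr_def times_divide_eq_right[symmetric] sgn_mult sgn_pos[OF pos] by simp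
 thus ?thesis unfolding tr_def[of k] f by (simp add: z_def)
 qed
qed

lemma tr_fixed_mono: assumes "tr m x = x" "m <= n" shows "tr n x = x"
proof -
 have "abs x*2^m = of_int (floor (abs x*2^m))" using abs_tr[of m x] assms(1) by (simp add: field_simps)
 hence "abs x*2^n = of_int (floor (abs x*2^m)*2^(n-m))" using assms(2) by simp (metis power_add le_add_diff_inverse)
 hence e: "of_int (floor (abs x*2^n)) = abs x*2^n" by (metis floor_of_int)
 show ?thesis unfolding tr_def e by (simp add: sgn_mult_abs)
qed

definition trv :: "nat => 'a::euclidean_space => 'a" where
 "trv m y = (SUM b:Basis. tr m (y \<bullet> b) *\<^sub>R b)"

lemma trv_inner[simp]: "b:Basis ==> trv m y \<bullet> b = tr m (y \<bullet> b)" by (simp add: trv_def)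

lemma trv_le: "norm (trv m y) <= norm y" by (rule norm_le_componentwise) (simp add: tr_le)

lemma trv_diff: "norm (y-trv m y) <= real DIM('a)/2^m" for y :: "'a::euclidean_space"
proof -
 have "norm (y-trv m y) <= (SUM b:Basis. abs ((y-trv m y) \<bullet> b))" by (rule norm_le_l1)
 also have "... <= (SUM b:(Basis :: 'a set). 1/2^m)" by (intro sum_mono) (simp add: inner_diff_left tr_diff)
 finally show ?thesis by simp
qed

lemma trv_trv: "k <= m ==> trv k (trv m y) = trv k y" by (rule euclidean_eqI) (simp add: tr_tr)

lemma trv_fixed_mono: "trv m y = y ==> m <= n ==> trv n y = y" by (rule euclidean_eqI) (metis trv_inner tr_fixed_mono)

lemma trv_eq_0: "norm y < 1/2^m ==> trv m y = 0" by (rule euclidean_eqI) (simp add: tr_eq_0 le_less_trans[OF Basis_le_norm])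

lemma trv_0[simp]: "trv m 0 = 0" by (simp add: trv_def)

definition dist_rho :: "real => real => real*'a::euclidean_space => real" where
 "dist_rho H1 H2 p = rho H1 H2 (fst p) (snd p)"

text \<open>The meshes are about 2^(-n/H1) in time and 2^(-n/H2) in space, so that a cell has
  \<open>\<rho>\<close>-size about 2^(-n) in every direction.\<close>

definition trunc :: "real => real => nat => real*'a::euclidean_space => real*'a" where
 "trunc H1 H2 n p = (tr (nat (floor (n/H1))) (fst p), trv (nat (floor (n/H2))) (snd p))"

definition dyadics :: "(real*'a::euclidean_space) set" where
 "dyadics = {p. EX m. tr m (fst p) = fst p & trv m (snd p) = snd p}"

definition expQ :: "'a::euclidean_space itself => real => real => real" where
 "expQ _ H1 H2 = 1/H1+real DIM('a)/H2"

lemma nat_floor_bounds: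
 assumes "0<h" shows "real (nat (floor (real n/h))) <= n/h" "n/h <= real (nat (floor (real n/h)))+1" using assms by auto

lemma mesh_le:
 assumes "0<h" shows "1/2^nat (floor (real n/h)) <= 2*2 powr (- real n/h)" "2 powr (- real n/h) <= 1/2^nat (floor (real n/h))"
proof -
 let ?A = "- real (nat (floor (real n/h)))"
 have *: "1/2^nat (floor (real n/h)) = 2 powr ?A" by (simp add: powr_minus powr_realpow divide_inverse)
 have "2 powr ?A<=2 powr (1-real n/h)" using nat_floor_bounds(2)[OF assms, of n] by simp
 also have "... = 2*2 powr (- real n/h)" by (subst diff_conv_add_uminus, subst powr_add) simp
 finally show "1/2^nat (floor (real n/h)) <= 2*2 powr (- real n/h)" unfolding * .
 show "2 powr (- real n/h) <= 1/2^nat (floor (real n/h))" unfolding * using nat_floor_bounds(1)[OF assms, of n] by simp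
qed

text \<open>\<open>D\<close> is closed under truncation so that chains never leave it. It may be
  smaller than \<open>dyadics\<close>, because around a given time the solution only exists for
  bounded negative time increments.\<close>

locale grid =
 fixes H1 H2 :: real and D :: "(real*'a::euclidean_space) set"
 assumes H1: "0<H1" "H1<1" and H2: "0<H2" "H2<1" and D_dyadic: "D \<subseteq> dyadics" and D_0: "0:D" and D_trunc: "!!n p. p:D ==> trunc H1 H2 n p:D"
begin

abbreviation "\<rho> == (dist_rho H1 H2 :: real*'a => real)"

abbreviation "T == (trunc H1 H2 :: nat => real*'a => real*'a)"

definition "Q = expQ TYPE('a) H1 H2"

lemma Q_pos: "0<Q" using H1 H2 by (simp add: Q_def expQ_def add_pos_nonneg)

lemma floor_mono: "k <= n ==> nat (floor (real k/H1)) <= nat (floor (real n/H1))" "k <= n ==> nat (floor (real k/H2)) <= nat (floor (real n/H2))"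
 using H1 H2 by (auto intro!: nat_mono Archimedean_Field.floor_mono divide_right_mono)

lemma T_T: "k <= n ==> T k (T n p) = T k p" by (simp add: trunc_def tr_tr trv_trv floor_mono)

lemma T_0[simp]: "T n 0 = 0" by (simp add: trunc_def zero_prod_def)

lemma \<rho>_nonneg: "0<=\<rho> p" by (simp add: dist_rho_def rho_def)

lemma \<rho>_0[simp]: "\<rho> 0 = 0" by (simp add: dist_rho_def rho_def)

lemma T_\<rho>_le: "\<rho> (T n p) <= \<rho> p" unfolding dist_rho_def rho_def trunc_def
 by (auto intro!: add_mono powr_mono2 tr_le trv_le less_imp_le[OF H1(1)] less_imp_le[OF H2(1)])

lemma \<rho>_components:
 assumes "\<rho> p < r" "0<r" shows "abs (fst p) < r powr (1/H1)" "norm (snd p) < r powr (1/H2)"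
proof -
 have "abs (fst p) powr H1 < r" "norm (snd p) powr H2 < r"
 using assms powr_ge_zero[of "norm (snd p)" H2] powr_ge_zero[of "abs (fst p)" H1] unfolding dist_rho_def rho_def by linarith+
 hence "(abs (fst p) powr H1) powr (1/H1) < r powr (1/H1)" "(norm (snd p) powr H2) powr (1/H2) < r powr (1/H2)" using H1 H2 by (auto intro!: powr_less_mono2)
 thus "abs (fst p) < r powr (1/H1)" "norm (snd p) < r powr (1/H2)" using H1 H2 by (simp_all add: powr_powr)
qed

lemma powr_neg_pow: "(1/2^n) powr (1/h) = 2 powr (- real n/h)" by (simp add: powr_realpow[symmetric] powr_minus_divide[symmetric] powr_powr)

text \<open>Chains for the ball of radius 1/2^n can therefore start at the origin on level
  \<open>n\<close>.\<close>

lemma T_ball: assumes "\<rho> p < 1/2^n" shows "T n p = 0"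
proof -
 have "abs (fst p)<2 powr (- real n/H1)" "norm (snd p)<2 powr (- real n/H2)" using \<rho>_components[OF assms] by (simp_all add: powr_neg_pow)
 thus ?thesis using mesh_le(2)[OF H1(1), of n] mesh_le(2)[OF H2(1), of n] by (simp add: trunc_def zero_prod_def tr_eq_0 trv_eq_0)
qed

text \<open>As \<open>H1\<close> and \<open>H2\<close> are below 1, level n keeps at least n binary
  digits, so every dyadic point is eventually resolved exactly.\<close>

lemma T_eventually_id:
 assumes "p:D" obtains N where "!!n. N <= n ==> T n p = p"
proof -
 obtain m where m: "tr m (fst p) = fst p" "trv m (snd p) = snd p" using assms D_dyadic by (auto simp: dyadics_def)
 have "T n p = p" if "m <= n" for n
 proof -
 have "real m <= real n/h" if "0<h" "h<1" for h using that \<open>m <= n\<close> by (simp add: pos_le_divide_eq) (metis mult_left_le less_eq_real_def of_nat_0_le_iff of_nat_le_iff order_trans)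
 hence "m <= nat (floor (real n/H1))" "m <= nat (floor (real n/H2))" using H1 H2 by (auto simp: le_nat_iff le_floor_iff)
 thus ?thesis using tr_fixed_mono[OF m(1)] trv_fixed_mono[OF m(2)] by (simp add: trunc_def)
 qed
 thus ?thesis using that by auto
qed

definition "cT = 2 powr H1+(2*real DIM('a)) powr H2"

lemma cT_pos: "0<cT" by (simp add: cT_def add_pos_nonneg)

lemma mesh_powr: "0<h ==> (2 powr (- real n/h)) powr h = 1/2^n" by (simp add: powr_powr) (simp add: powr_minus powr_realpow divide_inverse)

lemma T_step: "\<rho> (p-T n p) <= cT/2^n"
proof -
 let ?B = "fst p-tr (nat (floor (real n/H1))) (fst p)"
 let ?A = "snd p-trv (nat (floor (real n/H2))) (snd p)"
 have "abs ?B powr H1 <= (2*2 powr (- real n/H1)) powr H1" using H1 by (intro powr_mono2 order.trans[OF tr_diff mesh_le(1)]) auto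
 also have "... = 2 powr H1/2^n" using H1 by (simp add: powr_mult mesh_powr[simplified])
 finally have 1: "abs ?B powr H1<=2 powr H1/2^n" .
 have "norm ?A <= real DIM('a)*(1/2^nat (floor (real n/H2)))" using trv_diff[of "snd p" "nat (floor (real n/H2))"] by simp
 also have "... <= real DIM('a)*(2*2 powr (- real n/H2))" by (rule mult_left_mono[OF mesh_le(1)[OF H2(1)]]) simp
 finally have "norm ?A powr H2 <= ((2*real DIM('a))*2 powr (- real n/H2)) powr H2" using H2 by (intro powr_mono2) auto
 also have "... = (2*real DIM('a)) powr H2/2^n" using H2 by (simp add: powr_mult mesh_powr[simplified])
 finally show ?thesis using 1 by (simp add: dist_rho_def rho_def trunc_def cT_def add_divide_distrib)
qed

definition "ball_pts K = {p:D. \<rho> p < 1/2^K}"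

abbreviation "incr_le X K b w == ALL p:ball_pts K. abs (X p w-X 0 w)<=b"

text \<open>A truncated point is coded by one integer per coordinate, of modulus at most 2 to the
  power (n - K)/H1 or (n - K)/H2. Each count 2 r + 1 is at most 3 r, and the exponents add up to
  \<open>Q\<close>.\<close>

lemma T_card:
 assumes "K <= n"
 shows "finite (T n ` ball_pts K)" "real (card (T n ` ball_pts K)) <= 3^(1+DIM('a))*2 powr (Q*(real n-real K))"
proof -
 let ?C = "T n ` ball_pts K"
 let ?B = "%r2. {- floor (r2)..floor (r2)}"
 let ?A = "real n-real K"
 define m1 m2 where "m1 = nat (floor (real n/H1))" and "m2 = nat (floor (real n/H2))"
 define r1 r2 where "r1 = 2 powr (?A/H1)" and "r2 = 2 powr (?A/H2)"
 define G where "G = (%(k::int, f::'a => int). (of_int k/2^m1 :: real, SUM b:Basis. (of_int (f b)/2^m2) *\<^sub>R b))"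
 define S where "S = {- floor (r1)..floor (r1)} \<times> ((Basis :: 'a set) \<rightarrow>\<^sub>E (?B r2))"
 have r1: "1<=r1" "1<=r2" using assms H1 H2 by (auto simp: r1_def r2_def intro!: ge_one_powr_ge_zero)
 have fl: "\<lfloor>abs x*2^nat (floor (real n/h))\<rfloor> <= floor (2 powr (?A/h))" if "0<h" "abs x<=2 powr (- real K/h)" for x h
 proof (rule Archimedean_Field.floor_mono)
 have "abs x*2^nat (floor (real n/h))<=2 powr (- real K/h)*2 powr (real n/h)" using that by (intro mult_mono) (auto simp: powr_realpow[symmetric])
 also have "... = 2 powr (?A/h)" by (simp add: powr_add[symmetric] diff_divide_distrib)
 finally show "abs x*2^nat (floor (real n/h))<=2 powr (?A/h)" .
 qed
 have sg: "abs (floor (sgn x)*j) <= abs j" for x :: real and j :: int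
 proof -
 have "floor (-1::real) = -1" by linarith
 thus "abs (floor (sgn x)*j) <= abs j" by (auto simp: sgn_if)
 qed
 have sub: "T n ` ball_pts K \<subseteq> G ` S"
 proof
 fix q assume "q:T n ` ball_pts K"
 then obtain p where p: "q = T n p" "\<rho> p < 1/2^K" by (auto simp: ball_pts_def)
 define k where "k = floor (sgn (fst p))*floor (abs (fst p)*2^m1)"
 define f where "f = restrict (%b. \<lfloor>sgn (snd p \<bullet> b)\<rfloor>*\<lfloor>abs (snd p \<bullet> b)*2^m2\<rfloor>) (Basis :: 'a set)"
 have c: "abs (fst p)<=2 powr (- real K/H1)" "norm (snd p)<=2 powr (- real K/H2)" using \<rho>_components[OF p(2)] by (simp_all add: powr_neg_pow)
 have "abs k <= floor (r1)" using sg[of "fst p" "floor (abs (fst p)*2^m1)"] fl[OF H1(1) c(1)] by (auto simp: k_def m1_def r1_def)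
 moreover
 have fb: "abs (f b) <= floor (r2)" if "b:Basis" for b
 proof -
 have "abs (snd p \<bullet> b)<=2 powr (- real K/H2)" using c(2) Basis_le_norm[OF that, of "snd p"] by simp
 from fl[OF H2(1) this] show ?thesis using sg[of "snd p \<bullet> b" "\<lfloor>abs (snd p \<bullet> b)*2^m2\<rfloor>"] that by (simp add: f_def m2_def r2_def)
 qed
 have "f b:(?B r2)" if "b:Basis" for b using fb[OF that] by auto
 hence "f:Basis \<rightarrow>\<^sub>E (?B r2)" by (simp add: f_def)
 ultimately have "(k, f):S" by (auto simp: S_def)
 moreover have "G (k, f) = q"
 proof -
 have "of_int k/2^m1 = tr m1 (fst p)" by (simp add: k_def tr_def sgn_floor)
 moreover have "(SUM b:Basis. (of_int (f b)/2^m2) *\<^sub>R b) = trv m2 (snd p)" unfolding trv_def by (intro sum.cong refl) (simp add: f_def tr_def sgn_floor)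
 ultimately show ?thesis by (simp add: G_def p trunc_def m1_def m2_def)
 qed
 ultimately show "q:G ` S" by auto
 qed
 have fS: "finite S" by (auto simp: S_def intro!: finite_PiE)
 show "finite ?C" by (rule finite_subset[OF sub]) (use fS in auto)
 have b: "real (nat (2*floor (r)+1)) <= 3*r" if "1<=r" for r :: real using that by linarith
 have "card ?C <= card (G ` S)" by (rule card_mono[OF _ sub]) (use fS in auto)
 also have "... <= card S" by (rule card_image_le[OF fS])
 also have "card S = nat (2*floor (r1)+1)*nat (2*floor (r2)+1)^DIM('a)" by (simp add: S_def card_cartesian_product card_PiE finite_Basis prod_constant)
 finally have "real (card ?C) <= real (nat (2*floor (r1)+1))*real (nat (2*floor (r2)+1))^DIM('a)" by (metis of_nat_le_iff of_nat_mult of_nat_power)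
 also have "... <= (3*r1)*(3*r2)^DIM('a)" using r1 by (intro mult_mono power_mono b) auto
 also have "... = 3^(1+DIM('a))*(r1*r2^DIM('a))" by simp
 also have "r1*r2^DIM('a) = 2 powr (Q*?A)"
 proof -
 show ?thesis unfolding r1_def by (simp add: r2_def powr_realpow[symmetric] powr_powr powr_add[symmetric] Q_def expQ_def algebra_simps diff_divide_distrib)
 qed
 finally show "real (card ?C) <= 3^(1+DIM('a))*2 powr (Q*?A)" .
qed

lemma ball_pts_countable: "countable D" "countable (ball_pts K)"
proof -
 let ?D = "%m. %(k::int, j::int). of_int k * of_int j/2^m"
 let ?C = "%m. %f. SUM b:Basis. (of_int (f b)/2^m) *\<^sub>R b"
 let ?B = "%y m. %b. \<lfloor>sgn (y \<bullet> b)\<rfloor>*\<lfloor>abs (y \<bullet> b)*2^m\<rfloor>"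
 let ?A = "\<Union>m. range (tr m) \<times> trv m ` (UNIV :: 'a set)"
 have "countable (trv m ` (UNIV :: 'a set))" for m
 proof -
 have "trv m ` (UNIV :: 'a set) \<subseteq> (?C m) ` (Basis \<rightarrow>\<^sub>E UNIV)"
 proof safe
 fix y :: 'a
 show "trv m y:(?C m) ` (Basis \<rightarrow>\<^sub>E UNIV)" unfolding trv_def by (auto simp: tr_def sgn_floor intro!: sum.cong refl image_eqI[where x="restrict (?B y m) Basis"])
 qed
 thus ?thesis by (rule countable_subset) (auto intro!: countable_PiE)
 qed
 moreover have "countable (range (tr m))" for m
 proof -
 have "range (tr m) \<subseteq> (?D m) ` UNIV"
 proof safe
 fix x :: real
 show "tr m x:(?D m) ` UNIV" unfolding tr_def by (intro image_eqI[of _ _ "(floor (sgn x), floor (abs x*2^m))"]) (auto simp: sgn_floor)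
 qed
 thus ?thesis by (rule countable_subset) auto
 qed
 ultimately have "countable ?A" by simp
 moreover have "D \<subseteq> ?A"
 proof
 fix p assume "p:D"
 then obtain m where "tr m (fst p) = fst p" "trv m (snd p) = snd p" using D_dyadic by (auto simp: dyadics_def)
 hence "fst p:range (tr m)" "snd p:trv m ` UNIV" by (metis rangeI)+
 thus "p:?A" by (auto simp: mem_Times_iff)
 qed
 ultimately show "countable D" by (rule countable_subset[rotated])
 thus "countable (ball_pts K)" by (rule countable_subset[rotated]) (auto simp: ball_pts_def)
qed

end

section \<open>Small balls and large deviations by chaining\<close>

definition tail_const :: "nat => real" where "tail_const m = fact (2*m)/(2^m*fact m)"

lemma tail_const_pos: "0<tail_const m" by (simp add: tail_const_def)

text \<open>Markov's inequality for the moment of order 2 m, whose value is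
  \<open>tail_const m\<close>. Polynomial tails are enough for chaining once m is large against the
  number of points.\<close>

lemma N01_tail:
 assumes "0<r" shows "measure N01 {x. r < abs x} <= tail_const m/r^(2*m)"
proof -
 interpret N: prob_space N01 by (rule prob_space_N01)
 have i: "integrable N01 (%x. x^(2*m))" by (rule integrable_std_normal_distribution_moment)
 have "measure N01 {x. r < abs x}*r^(2*m) = (LINT x|N01. indicator {x. r < abs x} x*r^(2*m))" by simp
 also have "... <= (LINT x|N01. x^(2*m))"
 proof (rule integral_mono[OF _ i])
 show "integrable N01 (%x. indicator {x. r < abs x} x*r^(2*m))" by (rule N.integrable_const_bound[where B="r^(2*m)"]) (use in \<open>auto simp: indicator_def\<close>)
 fix x :: real
 have "r^(2*m) <= abs x^(2*m)" if "r < abs x" using that assms by (intro power_mono) auto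
 thus "indicator {x. r < abs x} x*r^(2*m) <= x^(2*m)" by (auto simp: indicator_def power_even_abs)
 qed
 also have "... = tail_const m" by (simp add: tail_const_def std_normal_distribution_even_moments)
 finally show ?thesis using assms by (simp add: pos_le_divide_eq)
qed

text \<open>One bound for all radii with a freely chosen exponent: near 0 the probability is at
  least linear in r, far out its defect from 1 is at most a multiple of r^(-s). Chaining takes a
  small exponent on coarse levels and a large one on fine levels.\<close>

lemma N01_small_ball:
 assumes s: "0<s"
 shows "EX C>0. ALL r>0. exp (- C*r powr-s) <= measure N01 {x. abs x <= r}"
proof -
 interpret N: prob_space N01 by (rule prob_space_N01)
 define k where "k = 2 * std_normal_density 1"
 have k0: "0<k" by (simp add: k_def normal_density_pos)
 have low: "k*r <= measure N01 {x. abs x <= r}" if "0<r" "r<=1" for r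
 proof -
 have "ennreal (k*r) = nn_integral lborel (%x. ennreal (std_normal_density 1)*indicator {-r..r} x)"
 using that by (simp add: nn_integral_cmult k_def ennreal_mult[symmetric])
 also have "... <= nn_integral lborel (%x. ennreal (std_normal_density x)*indicator {x. abs x <= r} x)"
 proof (intro nn_integral_mono)
 fix x
 have "std_normal_density 1<=std_normal_density x" if "abs x <= r"
 proof -
 have "x^2<=1" using that \<open>r <= 1\<close> by (simp add: abs_square_le_1)
 thus ?thesis by (simp add: std_normal_density_def divide_right_mono)
 qed
 thus "ennreal (std_normal_density 1)*indicator {-r..r} x <= ennreal (std_normal_density x)*indicator {x. abs x <= r} x" by (auto simp: indicator_def)
 qed
 also have "... = ennreal (measure N01 {x. abs x <= r})" by (simp add: emeasure_density N.emeasure_eq_measure[symmetric])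
 finally show ?thesis by simp
 qed
 have k1: "k<=1" using low[of 1] N.prob_le_1[of "{x. abs x<=1}"] by linarith
 define m where "m = nat \<lceil>s\<rceil>"
 have ms: "s <= 2*real m" by (simp add: m_def) linarith
 define M where "M = tail_const m"
 have M: "0<M" by (simp add: M_def tail_const_pos)
 \<comment> \<open>The first two terms serve r up to 1, the term \<open>2*M\<close> serves larger r
   with defect at most 1/2, and the last one serves larger r where only the probability of [-1, 1]
   is used.\<close>
 define C where "C = ln (1/k)+1 / s+2*M+2*M*ln (1/k)"
 have lk: "0<=ln (1/k)" using k0 k1 by simp
 have C: "0<C" using lk s M by (simp add: C_def add_nonneg_pos add_pos_nonneg)
 have "exp (- C*r powr-s) <= measure N01 {x. abs x <= r}" if r: "0<r" for r
 proof (cases "r<=1")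
 case True
 have p1: "1<=r powr-s" using True r s by (simp add: powr_minus one_le_inverse_iff powr_le1)
 have "ln (1/r) * s = ln (r powr-s)" by (simp add: ln_div)
 also have "... <= r powr-s" using ln_le_minus_one[of "r powr-s"] r by simp
 finally have "ln (1/r) <= r powr-s / s" using s by (simp add: pos_le_divide_eq)
 moreover have "ln (1/k) <= ln (1/k)*r powr-s" using p1 lk by (simp add: mult_le_cancel_left1)
 moreover have "0<=(2*M+2*M*ln (1/k))*r powr-s" using M lk by simp
 ultimately have "ln (1/k)+ln (1/r) <= C*r powr-s" by (simp add: C_def distrib_right)
 hence "- C*r powr-s <= ln (k*r)" using k0 r by (simp add: ln_mult ln_div)
 hence "exp (- C*r powr-s) <= k*r" using k0 r by (metis exp_le_cancel_iff exp_ln mult_pos_pos)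
 thus ?thesis using low[OF r True] by simp
 next
 case False
 have sub: "1-measure N01 {x. r < abs x} = measure N01 {x. abs x <= r}"
 using N.prob_compl[of "{x. r < abs x}"] by (simp add: Compl_eq_Diff_UNIV[symmetric] Collect_neg_eq[symmetric] not_less)
 have "measure N01 {x. r < abs x} <= M/r^(2*m)" unfolding M_def by (rule N01_tail[OF r])
 also have "... <= M*r powr-s" using False ms r M by (simp add: powr_realpow[symmetric] powr_minus divide_inverse)
 finally have t: "1-M*r powr-s <= measure N01 {x. abs x <= r}" using sub by simp
 define x where "x = M*r powr-s"
 have x0: "0<=x" using M by (simp add: x_def)
 show ?thesis
 proof (cases "x <= 1/2")
 case True
 have "- 2*x <= - x-2*x^2" using True x0 mult_left_mono[of x "1/2" "2*x"] by (simp add: power2_eq_square)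
 also have "... <= ln (1-x)" by (rule ln_one_minus_pos_lower_bound[OF x0 True])
 finally have "exp (- 2*x) <= exp (ln (1-x))" by simp
 hence "exp (- 2*x) <= 1-x" using True by simp
 moreover have "- C*r powr-s <= - 2*x"
 proof -
 have "2*M*r powr-s <= C*r powr-s" using lk s M by (simp add: C_def mult_right_mono)
 thus ?thesis by (simp add: x_def)
 qed
 hence "exp (- C*r powr-s) <= exp (- 2*x)" by simp
 ultimately show ?thesis using t unfolding x_def by linarith
 next
 case False
 have "2*M*ln (1/k)*r powr-s <= C*r powr-s" using lk s M by (simp add: C_def mult_right_mono)
 moreover have "ln (1/k) <= 2*x*ln (1/k)" using False lk by (simp add: mult_le_cancel_right1)
 ultimately have "- C*r powr-s <= ln k" using k0 by (simp add: x_def ln_div mult_ac)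
 hence "exp (- C*r powr-s) <= k" using k0 by (metis exp_le_cancel_iff exp_ln)
 also have "k <= measure N01 {x. abs x<=1}" using low[of 1] by simp
 also have "... <= measure N01 {x. abs x <= r}" using \<open>~ r <= 1\<close> by (intro N.finite_measure_mono) auto
 finally show ?thesis .
 qed
 qed
 thus ?thesis using C by auto
qed

definition ball_const :: "real => real" where
 "ball_const s = (SOME C. C > 0 & (ALL r>0. exp (- C*r powr-s) <= measure N01 {x. abs x <= r}))"

lemma ball_const:
 assumes "0<s" shows "0<ball_const s" "0<r ==> exp (- ball_const s * r powr-s) <= measure N01 {x. abs x <= r}"
 using someI_ex[OF N01_small_ball[OF assms, unfolded Bex_def]] unfolding ball_const_def by auto

lemma gaussian_marginal:
 assumes g: "gaussian_family P I X K" and i: "i:I" and B: "B:sets borel"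
 shows "measure P (X i -` B Int space P) = measure N01 {x. sqrt (K i i)*x:B}"
proof -
 interpret N: prob_space N01 by (rule prob_space_N01)
 interpret prob_space P by (rule gaussian_familyD[OF g])
 have k: "0<=K i i" using gaussian_family_psd[OF g, of "{i}" "%_. 1"] i by simp
 have "measure P (X i -` B Int space P) = measure N01 ((%x. sqrt (K i i)*x) -` B Int space N01)"
 proof (rule finite_law_unique[OF finite_measure_axioms N.finite_measure_axioms gaussian_familyD(2)[OF g i] _ _ B])
 fix t show "(LINT w|P. cis (t*X i w)) = (LINT x|N01. cis (t*(sqrt (K i i)*x)))"
 using gaussian_familyD(3)[OF g, of "{i}" "%_. t"] i cis_N01[of "t * sqrt (K i i)"] k by (simp add: mult.assoc) (simp add: power2_eq_square)
 qed measurable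
 thus ?thesis by (simp add: vimage_def)
qed

lemma gaussian_tail:
 assumes g: "gaussian_family P I X K" and i: "i:I" and v: "K i i <= r^2" "0<r" and b: "0<b"
 shows "\<P>(w in P. b < abs (X i w)) <= tail_const m*(r/b)^(2*m)"
proof -
 let ?A = "{x. sqrt (K i i)*x:{x. b < abs x}}"
 interpret N: prob_space N01 by (rule prob_space_N01)
 have k: "0<=K i i" using gaussian_family_psd[OF g, of "{i}" "%_. 1"] i by simp
 have s: "sqrt (K i i) <= r" using v by (simp add: real_le_lsqrt)
 have "\<P>(w in P. b < abs (X i w)) = measure N01 ?A" using gaussian_marginal[OF g i, of "{x. b < abs x}"] by (simp add: Int_def conj_commute)
 also have "... <= measure N01 {x. b/r < abs x}"
 proof (rule N.finite_measure_mono)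
 show "?A \<subseteq> {x. b/r < abs x}"
 proof
 fix x assume "x:?A"
 hence "b < sqrt (K i i)*abs x" using k by (simp add: abs_mult)
 also have "... <= r*abs x" by (intro mult_right_mono s) auto
 finally show "x:{x. b/r < abs x}" using v by (simp add: pos_divide_less_eq mult.commute)
 qed
 qed simp
 also have "... <= tail_const m/(b/r)^(2*m)" using v b by (intro N01_tail) auto
 finally show ?thesis by (simp add: power_divide)
qed

lemma gaussian_small_ball:
 assumes g: "gaussian_family P I X K" and i: "i:I" and v: "K i i <= r^2" "0<r" and b: "0<b" "0<s"
 shows "exp (- ball_const s * (b/r) powr-s) <= \<P>(w in P. abs (X i w) <= b)"
proof -
 let ?A = "{x. sqrt (K i i)*x:{x. abs x <= b}}"
 interpret N: prob_space N01 by (rule prob_space_N01)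
 have k: "0<=K i i" using gaussian_family_psd[OF g, of "{i}" "%_. 1"] i by simp
 have s: "sqrt (K i i) <= r" using v by (simp add: real_le_lsqrt)
 have "exp (- ball_const s * (b/r) powr-s) <= measure N01 {x. abs x <= b/r}" using b v by (intro ball_const) auto
 also have "... <= measure N01 ?A"
 proof (rule N.finite_measure_mono)
 show "{x. abs x <= b/r} \<subseteq> ?A"
 proof
 fix x assume "x:{x. abs x <= b/r}"
 hence "r*abs x <= b" using v by (simp add: pos_le_divide_eq mult.commute)
 moreover have "sqrt (K i i)*abs x <= r*abs x" by (intro mult_right_mono s) auto
 ultimately show "x:?A" using k by (simp add: abs_mult)
 qed
 qed simp
 finally show ?thesis using gaussian_marginal[OF g i, of "{x. abs x <= b}"] by (simp add: Int_def conj_commute)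
qed

definition incr_var :: "('i => 'i => real) => 'i => 'i => real" where
 "incr_var K p q = K p p-K p q-K q p+K q q"

lemma gaussian_family_diff:
 fixes X :: "'i => 'w => real"
 assumes g: "gaussian_family P I X K"
 shows "gaussian_family P (I \<times> I) (%z w. X (fst z) w-X (snd z) w)
 (%z z'. K (fst z) (fst z')-K (fst z) (snd z')-K (snd z) (fst z')+K (snd z) (snd z'))"
proof -
 let ?c = "%z j. (if j = fst z then 1 else 0)-(if j = snd z then 1 else 0 :: real)"
 have s: "(SUM j:{fst z, snd z}. ?c z j*f j) = f (fst z)-f (snd z)" for z :: "'i \<times> 'i" and f :: "'i => real" by (cases "fst z = snd z") auto
 have "(SUM i:{fst z, snd z}. SUM j:{fst z', snd z'}. ?c z i*?c z' j*K i j)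
 = K (fst z) (fst z')-K (fst z) (snd z')-K (snd z) (fst z')+K (snd z) (snd z')" for z z'
 proof -
 have "(SUM i:{fst z, snd z}. SUM j:{fst z', snd z'}. ?c z i*?c z' j*K i j)
 = (SUM i:{fst z, snd z}. ?c z i*(SUM j:{fst z', snd z'}. ?c z' j*K i j))"
 by (simp only: sum_distrib_left mult.assoc)
 thus ?thesis by (simp only: s)
 qed
 thus ?thesis using gaussian_family_linear[OF g, of "I \<times> I" "%z. {fst z, snd z}" ?c] by (simp only: s) auto
qed

text \<open>Continuity from above along finite subsets, since \<open>sidak\<close> and the union
  bound speak of finitely many points.\<close>

lemma (in prob_space) countable_event_bound:
 assumes S: "countable S" and Q[measurable]: "!!p. p:S ==> Measurable.pred M (Q p)"
 and c: "!!F. finite F ==> F \<subseteq> S ==> c <= measure M {w:space M. ALL p:F. Q p w}"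
 shows "c <= measure M {w:space M. ALL p:S. Q p w}"
proof (cases "S = {}")
 case True thus ?thesis using c[of "{}"] by simp
next
 case False
 define F where "F n = from_nat_into S ` {..<n}" for n
 have F: "finite (F n)" "F n \<subseteq> S" for n using from_nat_into[OF False] by (auto simp: F_def)
 have US: "(\<Union>n. F n) = S"
 proof
 show "S \<subseteq> (\<Union>n. F n)"
 proof
 fix p assume "p:S"
 hence "p = from_nat_into S (to_nat_on S p)" using S by simp
 thus "p:(\<Union>n. F n)" unfolding F_def by auto
 qed
 qed (use F in auto)
 define E where "E n = {w:space M. ALL p:F n. Q p w}" for n
 have Em: "E n:events" for n unfolding E_def
 proof (rule sets.sets_Collect_finite_All[OF _ F(1)])
 fix p assume "p:F n"
 thus "{w:space M. Q p w}:events" using predE[OF Q] F(2) by blast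
 qed
 have "(%n. measure M (E n)) \<longlonglongrightarrow> measure M (\<Inter>n. E n)" by (rule finite_Lim_measure_decseq) (use Em in "auto simp: decseq_def E_def F_def")
 moreover have "(\<Inter>n. E n) = {w:space M. ALL p:S. Q p w}" unfolding US[symmetric] E_def by auto
 moreover have "c <= measure M (E n)" for n unfolding E_def by (rule c[OF F])
 ultimately show ?thesis by (metis LIMSEQ_le_const)
qed

text \<open>By truncated subtraction the exponent is the distance of \<open>n\<close> from
  \<open>n0\<close>, so there is one geometric series on either side.\<close>

lemma two_sided_geometric:
 assumes "0<x" "x < (1::real)"
 shows "(SUM n=K..<N. x^((n-n0)+(n0-n))) <= 2/(1-x)"
proof -
 have g: "(SUM k<M. x^k) <= 1/(1-x)" for M using assms sum_le_suminf[of "%k. x^k" "{..<M}"] suminf_geometric[of x] by simp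
 have "(SUM n=K..<N. x^((n-n0)+(n0-n))) <= (SUM n<n0+N. x^((n-n0)+(n0-n)))" using assms by (intro sum_mono2) auto
 also have "... = (SUM n<n0. x^(n0-n))+(SUM n<N. x^n)" by (induction N) simp_all
 also have "(SUM n<n0. x^(n0-n)) = (SUM n<n0. x^Suc n)" by (subst sum.nat_diff_reindex[symmetric]) auto
 also have "... <= (SUM n<n0. x^n)" using assms by (intro sum_mono) simp
 finally show ?thesis using g[of n0] g[of N] by simp
qed

context grid
begin

definition "cc = (3::real)^(1+DIM('a))"

text \<open>A finite \<open>F\<close> is resolved exactly at some level \<open>N\<close>, and at
  level \<open>K\<close> all its points truncate to 0; the increment telescopes in between. The
  bound is stated for arbitrary real functions in order to be used path by path.\<close>

lemma chain_telescope:
 assumes F: "finite F" "F \<subseteq> ball_pts K"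
 obtains N where "K <= N" "!!(x::real*'a => real) \<beta> p. (!!n r. n:{K..<N} ==> r:T (Suc n) ` ball_pts K ==> abs (x r-x (T n r)) <= \<beta> n)
 ==> p:F ==> abs (x p-x 0) <= (SUM n=K..<N. \<beta> n)"
proof -
 have "ALL p:F. EX N. ALL n>=N. T n p = p" using F(2) by (metis (no_types, lifting) T_eventually_id ball_pts_def mem_Collect_eq subset_iff)
 then obtain M where M: "!!p n. p:F ==> M p <= n ==> T n p = p" by metis
 define N where "N = Max (insert K (M ` F))"
 have N: "K <= N" "!!p. p:F ==> M p <= N" using F(1) by (auto simp: N_def)
 show ?thesis
 proof (rule that[OF N(1)])
 fix x :: "real*'a => real" and \<beta> p
 assume b: "!!n r. n:{K..<N} ==> r:T (Suc n) ` ball_pts K ==> abs (x r-x (T n r)) <= \<beta> n" and p: "p:F"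
 have pb: "p:ball_pts K" using p F by auto
 have "x p-x 0 = x (T N p)-x (T K p)" using M[OF p N(2)[OF p]] T_ball[of p K] pb by (simp add: ball_pts_def)
 also have "... = (SUM n=K..<N. x (T (Suc n) p)-x (T n p))" by (rule sum_Suc_diff'[OF N(1), symmetric])
 also have "abs ... <= (SUM n=K..<N. abs (x (T (Suc n) p)-x (T n p)))" by simp
 also have "... <= (SUM n=K..<N. \<beta> n)"
 proof (rule sum_mono)
 fix n assume "n:{K..<N}"
 from b[OF this, of "T (Suc n) p"] show "abs (x (T (Suc n) p)-x (T n p)) <= \<beta> n" using pb by (simp add: T_T)
 qed
 finally show "abs (x p-x 0) <= (SUM n=K..<N. \<beta> n)" .
 qed
qed

lemma ball_T: "p:ball_pts K ==> T n p:ball_pts K" by (simp add: ball_pts_def D_trunc le_less_trans[OF T_\<rho>_le])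

lemma card_level: "K <= n ==> real (card (T (Suc n) ` ball_pts K)) <= cc*2 powr (Q*(real n+1-real K))" using T_card(2)[of K "Suc n"] by (simp add: cc_def add.commute)

lemma chain_family:
 assumes g: "gaussian_family P D X Kf"
 shows "gaussian_family P (Sigma {K..<N} (%n. T (Suc n) ` ball_pts K)) (%z w. X (snd z) w-X (T (fst z) (snd z)) w)
 (%z z'. Kf (snd z) (snd z')-Kf (snd z) (T (fst z') (snd z'))-Kf (T (fst z) (snd z)) (snd z')+Kf (T (fst z) (snd z)) (T (fst z') (snd z')))"
proof -
 have "(%z. (snd z, T (fst z) (snd z))) ` Sigma {K..<N} (%n. T (Suc n) ` ball_pts K) \<subseteq> D \<times> D" by (auto simp: ball_pts_def intro!: D_trunc)
 from gaussian_family_reindex[OF gaussian_family_diff[OF g] this] show ?thesis by simp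
qed

lemma level_finite: "finite (Sigma {K..<N} (%n. T (Suc n) ` ball_pts K))" by (auto intro!: finite_SigmaI T_card(1))

lemma increments_measurable:
 assumes g: "gaussian_family P D X Kf" and "p:D"
 shows "Measurable.pred P (%w. abs (X p w-X 0 w) <= B)"
proof -
 have [measurable]: "X p:borel_measurable P" "X 0:borel_measurable P" using gaussian_familyD(2)[OF g] assms(2) D_0 by auto
 show ?thesis by simp
qed

text \<open>\<open>sidak\<close> is applied to all links of all chains at once, so the probability
  is at least a product of one-dimensional small ball probabilities; \<open>L\<close> bounds the sum
  of the exponents.\<close>

lemma chain_small_ball:
 assumes g: "gaussian_family P D X Kf" and pos: "!!n. 0<\<sigma> n" "!!n. 0<\<beta> n" "!!n. 0<s n"
 and var: "!!n r. K <= n ==> r:T (Suc n) ` ball_pts K ==> incr_var Kf r (T n r) <= (\<sigma> n)^2" and sB: "!!N. (SUM n=K..<N. \<beta> n) <= B"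
 and sL: "!!N. (SUM n=K..<N. cc*2 powr (Q*(real n+1-real K))*(ball_const (s n)*(\<beta> n/\<sigma> n) powr-s n)) <= L"
 shows "exp (- L) <= \<P>(w in P. incr_le X K B w)"
proof -
 let ?B = "%J Y. {w:space P. ALL z:J. abs (Y z w) <= \<beta> (fst z)}"
 let ?A = "%F. {w:space P. ALL p:F. abs (X p w-X 0 w) <= B}"
 interpret prob_space P by (rule gaussian_familyD[OF g])
 show ?thesis
 proof (rule countable_event_bound[OF ball_pts_countable(2)])
 fix p assume "p:ball_pts K"
 thus "Measurable.pred P (%w. abs (X p w-X 0 w) <= B)" by (intro increments_measurable[OF g]) (simp add: ball_pts_def)
 next
 fix F assume F: "finite F" "F \<subseteq> ball_pts K"
 obtain N where N: "K <= N" "!!(x::real*'a => real) \<beta> p. (!!n r. n:{K..<N} ==> r:T (Suc n) ` ball_pts K ==> abs (x r-x (T n r)) <= \<beta> n)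
 ==> p:F ==> abs (x p-x 0) <= (SUM n=K..<N. \<beta> n)" using chain_telescope[OF F] by metis
 define J where "J = Sigma {K..<N} (%n. T (Suc n) ` ball_pts K)"
 define Y where "Y z w = X (snd z) w-X (T (fst z) (snd z)) w" for z w
 define c where "c n = ball_const (s n)*(\<beta> n/\<sigma> n) powr-s n" for n
 have fJ: "finite J" unfolding J_def by (rule level_finite)
 note cf = chain_family[OF g, of K N, folded J_def Y_def]
 have c0: "0<=c n" for n using ball_const(1)[OF pos(3), of n] by (simp add: c_def)
 have "(SUM z:J. c (fst z)) = (SUM n=K..<N. real (card (T (Suc n) ` ball_pts K)) * c n)"
 using sum.Sigma[of "{K..<N}" "%n. T (Suc n) ` ball_pts K" "%n r. c n"] T_card(1) unfolding J_def by (simp add: case_prod_beta)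
 also have "... <= (SUM n=K..<N. cc*2 powr (Q*(real n+1-real K)) * c n)" by (intro sum_mono mult_right_mono card_level c0) auto
 also have "... <= L" using sL by (simp add: c_def)
 finally have "exp (- L) <= exp (SUM z:J. - c (fst z))" by (simp add: sum_negf)
 also have "... = (PROD z:J. exp (- c (fst z)))" by (rule exp_sum[OF fJ])
 also have "... <= (PROD z:J. \<P>(w in P. abs (Y z w) <= \<beta> (fst z)))"
 proof (rule prod_mono, safe)
 fix n r assume z: "(n, r):J"
 have "exp (- ball_const (s n)*(\<beta> n/\<sigma> n) powr-s n) <= \<P>(w in P. abs (Y (n, r) w) <= \<beta> n)"
 by (rule gaussian_small_ball[OF cf z _ pos(1,2,3)]) (use var[of n r] z in "auto simp: J_def incr_var_def")
 thus "exp (- c (fst (n, r))) <= \<P>(w in P. abs (Y (n, r) w) <= \<beta> (fst (n, r)))" by (simp add: c_def)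
 qed simp
 also have "... <= measure P (?B J Y)" by (rule sidak[OF cf fJ])
 also have "... <= measure P (?A F)"
 proof (rule finite_measure_mono)
 show "(?B J Y) \<subseteq> (?A F)"
 proof safe
 fix w p assume w: "ALL z:J. abs (Y z w) <= \<beta> (fst z)" and p: "p:F"
 have "abs (X p w-X 0 w) <= (SUM n=K..<N. \<beta> n)"
 proof (rule N(2)[of "%p. X p w"])
 fix n r assume "n:{K..<N}" "r:T (Suc n) ` ball_pts K"
 hence "(n, r):J" by (simp add: J_def)
 with w show "abs (X r w-X (T n r) w) <= \<beta> n" by (auto simp: Y_def)
 qed (rule p)
 thus "abs (X p w-X 0 w) <= B" using sB[of N] by simp
 qed
 show "(?A F):events" using F by (intro sets.sets_Collect_finite_All predE increments_measurable[OF g]) (auto simp: ball_pts_def)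
 qed
 finally show "exp (- L) <= measure P (?A F)" .
 qed
qed

text \<open>The same links as in \<open>chain_small_ball\<close>, with a union bound in place of the
  product.\<close>

lemma chain_large_deviation:
 assumes g: "gaussian_family P D X Kf" and pos: "!!n. 0<\<sigma> n" "!!n. 0<\<beta> n"
 and var: "!!n r. K <= n ==> r:T (Suc n) ` ball_pts K ==> incr_var Kf r (T n r) <= (\<sigma> n)^2" and sB: "!!N. (SUM n=K..<N. \<beta> n) <= B"
 and sL: "!!N. (SUM n=K..<N. cc*2 powr (Q*(real n+1-real K))*(tail_const m*(\<sigma> n/\<beta> n)^(2*m))) <= L"
 shows "1-L <= \<P>(w in P. incr_le X K B w)"
proof -
 let ?A = "%z Y. {w:space P. \<beta> (fst z) < abs (Y z w)}"
 interpret prob_space P by (rule gaussian_familyD[OF g])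
 show ?thesis
 proof (rule countable_event_bound[OF ball_pts_countable(2)])
 fix p assume "p:ball_pts K"
 thus "Measurable.pred P (%w. abs (X p w-X 0 w) <= B)" by (intro increments_measurable[OF g]) (simp add: ball_pts_def)
 next
 fix F assume F: "finite F" "F \<subseteq> ball_pts K"
 obtain N where N: "K <= N" "!!(x::real*'a => real) \<beta> p. (!!n r. n:{K..<N} ==> r:T (Suc n) ` ball_pts K ==> abs (x r-x (T n r)) <= \<beta> n)
 ==> p:F ==> abs (x p-x 0) <= (SUM n=K..<N. \<beta> n)" using chain_telescope[OF F] by metis
 define J where "J = Sigma {K..<N} (%n. T (Suc n) ` ball_pts K)"
 define Y where "Y z w = X (snd z) w-X (T (fst z) (snd z)) w" for z w
 define c where "c n = tail_const m*(\<sigma> n/\<beta> n)^(2*m)" for n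
 define G where "G = {w:space P. ALL p:F. abs (X p w-X 0 w) <= B}"
 have fJ: "finite J" unfolding J_def by (rule level_finite)
 note cf = chain_family[OF g, of K N, folded J_def Y_def]
 note [measurable] = gaussian_familyD(2)[OF cf]
 have c0: "0<=c n" for n using tail_const_pos[of m] by (simp add: c_def)
 have Gm: "G:events" unfolding G_def using F by (intro sets.sets_Collect_finite_All predE increments_measurable[OF g]) (auto simp: ball_pts_def)
 have "space P-G \<subseteq> (UN z:J. (?A z Y))"
 proof
 fix w assume w: "w:space P-G"
 show "w:(UN z:J. (?A z Y))"
 proof (rule ccontr)
 assume n: "w ~: (UN z:J. (?A z Y))"
 have "abs (X p w-X 0 w) <= (SUM n=K..<N. \<beta> n)" if p: "p:F" for p
 proof (rule N(2)[of "%p. X p w"])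
 fix n' r assume "n':{K..<N}" "r:T (Suc n') ` ball_pts K"
 hence "(n', r):J" by (simp add: J_def)
 with n w show "abs (X r w-X (T n' r) w) <= \<beta> n'" by (force simp: Y_def)
 qed (rule p)
 thus False using w order.trans[OF _ sB[of N]] by (simp add: G_def)
 qed
 qed
 hence "measure P (space P-G) <= measure P (UN z:J. (?A z Y))" by (intro finite_measure_mono sets.finite_UN fJ) measurable
 also have "... <= (SUM z:J. measure P (?A z Y))" by (intro finite_measure_subadditive_finite fJ image_subsetI) measurable
 also have "... <= (SUM z:J. c (fst z))"
 proof (rule sum_mono, safe)
 fix n r assume z: "(n, r):J"
 have "\<P>(w in P. \<beta> n < abs (Y (n, r) w)) <= tail_const m*(\<sigma> n/\<beta> n)^(2*m)"
 by (rule gaussian_tail[OF cf z _ pos(1,2)]) (use var[of n r] z in "auto simp: J_def incr_var_def")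
 thus "\<P>(w in P. \<beta> (fst (n, r)) < abs (Y (n, r) w)) <= c (fst (n, r))" by (simp add: c_def)
 qed
 also have "... = (SUM n=K..<N. real (card (T (Suc n) ` ball_pts K)) * c n)"
 using sum.Sigma[of "{K..<N}" "%n. T (Suc n) ` ball_pts K" "%n r. c n"] T_card(1) unfolding J_def by (simp add: case_prod_beta)
 also have "... <= (SUM n=K..<N. cc*2 powr (Q*(real n+1-real K)) * c n)" by (intro sum_mono mult_right_mono card_level c0) auto
 also have "... <= L" using sL by (simp add: c_def)
 finally show "1-L <= \<P>(w in P. ALL p:F. abs (X p w-X 0 w) <= B)" using prob_compl[OF Gm] by (simp add: G_def)
 qed
qed

text \<open>The budget is largest at level \<open>n0\<close>, which is K + j, and falls off
  geometrically on both sides. On coarser levels it is far below the standard deviation, but there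
  are few points; on finer levels it is far above, which pays for the growing number of points. The
  total exponent is then of the order of the number 2^(Q j) of points at level
  \<open>n0\<close>.\<close>

theorem small_ball:
 assumes A: "0<A"
 obtains B C where "0<B" "0<C"
 "!!(P::'w measure) X Kf K j. gaussian_family P D X Kf ==> (!!p q. p:D ==> q:D ==> incr_var Kf p q <= (A*\<rho> (p-q))^2) ==>
 exp (- C*2 powr (Q*real j)) <= \<P>(w in P. incr_le X K (B/2^(K+j)) w)"
proof -
 let ?B = "%n K. Q*(real n+1-real K)"
 let ?A = "%n n0. (n-n0)+(n0-n)"
 define y where "y = (2::real) powr (- 1/2)"
 define x where "x = (2::real) powr (- Q/2)"
 have y: "0<y" "y<1" and x: "0<x" "x<1" using Q_pos by (auto simp: y_def x_def powr_less_one)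
 define B where "B = A * cT*(2/(1-y))"
 define bc where "bc = max (ball_const (Q/3)) (ball_const (4*Q))"
 have bc: "0<bc" using ball_const(1)[of "4*Q"] Q_pos by (simp add: bc_def)
 define C where "C = cc*bc*2 powr Q*(2/(1-x))"
 have cc: "0<cc" by (simp add: cc_def)
 have "0<B" "0<C" using A cT_pos y x bc cc by (auto simp: B_def C_def)
 moreover have "exp (- C*2 powr (Q*real j)) <= \<P>(w in P. incr_le X K (B/2^(K+j)) w)"
 if g: "gaussian_family P D X Kf" and v: "!!p q. p:D ==> q:D ==> incr_var Kf p q <= (A*\<rho> (p-q))^2" for P :: "'w measure" and X Kf K j
 proof -
 define n0 where "n0 = K+j"
 define \<sigma> where "\<sigma> n = A * cT/2^n" for n :: nat
 define \<beta> where "\<beta> n = A * cT/2^n0*y^(?A n n0)" for n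
 \<comment> \<open>At v levels below \<open>n0\<close> the exponent Q/3 costs a factor 2^(Q v/2)
   against 2^(-Q v) for the number of points. At u levels above, 4 Q gains 2^(-2 Q u) against 2^(Q
   u).\<close>
 define s where "s n = (if n < n0 then Q/3 else 4*Q)" for n
 have Q: "0<Q" by (rule Q_pos)
 have "exp (- (C*2 powr (Q*real j))) <= \<P>(w in P. incr_le X K (B/2^(K+j)) w)"
 proof (rule chain_small_ball[OF g, where \<sigma>=\<sigma> and \<beta>=\<beta> and s=s])
 show "0<\<sigma> n" "0<\<beta> n" "0<s n" for n using A cT_pos y Q by (auto simp: \<sigma>_def \<beta>_def s_def)
 fix n r assume "K <= n" "r:T (Suc n) ` ball_pts K"
 hence r: "r:D" using D_trunc by (auto simp: ball_pts_def)
 have "(A*\<rho> (r-T n r))^2 <= (\<sigma> n)^2" using mult_left_mono[OF T_step[of r n], of A] A \<rho>_nonneg by (simp add: \<sigma>_def power_mono)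
 thus "incr_var Kf r (T n r) <= (\<sigma> n)^2" using v[OF r D_trunc[OF r, of n]] by simp
 next
 fix N
 have "(SUM n=K..<N. \<beta> n) = A * cT/2^n0*(SUM n=K..<N. y^(?A n n0))" by (simp add: \<beta>_def sum_distrib_left)
 also have "... <= A * cT/2^n0*(2/(1-y))" using A cT_pos by (intro mult_left_mono two_sided_geometric y) auto
 finally show "(SUM n=K..<N. \<beta> n) <= B/2^(K+j)" by (simp add: B_def n0_def mult.commute)
 next
 fix N
 have t: "cc*2 powr (?B n K)*(ball_const (s n)*(\<beta> n/\<sigma> n) powr-s n)
 <= cc*bc*2 powr Q*2 powr (Q*real j)*x^(?A n n0)" for n
 proof -
 define u v where "u = real (n-n0)" and "v = real (n0-n)"
 have n: "real n = real K+real j+u-v" by (auto simp: u_def v_def n0_def)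
 have "\<beta> n/\<sigma> n = 2^n/2^n0*y^(?A n n0)" using A cT_pos by (simp add: \<beta>_def \<sigma>_def)
 also have "... = 2 powr (u-v)*2 powr (- (u+v)/2)" using y n by (simp add: powr_realpow[symmetric] u_def v_def y_def powr_powr diff_divide_distrib add_divide_distrib powr_diff[symmetric] n0_def)
 finally have r: "(\<beta> n/\<sigma> n) powr-s n = 2 powr (- s n*(u-3 * v)/2)" by (simp add: powr_add[symmetric] field_simps powr_powr mult_ac)
 have bs: "ball_const (s n) <= bc" by (simp add: s_def bc_def)
 have e: "2 powr (?B n K)*(\<beta> n/\<sigma> n) powr-s n<=2 powr Q*2 powr (Q*real j)*x^(?A n n0)"
 proof -
 have "Q*(real n+1-real K)+(- s n*(u-3 * v)/2) <= Q+Q*real j+(- Q/2)*(u+v)"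
 proof (cases "n < n0")
 case True
 thus ?thesis using True by (simp add: u_def s_def n algebra_simps)
 next
 case False
 hence "v = 0" "0<=u" by (simp_all add: u_def v_def)
 thus ?thesis using False Q by (simp add: s_def n algebra_simps)
 qed
 moreover have "x^(?A n n0) = 2 powr ((- Q/2)*(u+v))" by (simp add: powr_realpow[symmetric] x_def powr_powr u_def v_def)
 ultimately show ?thesis unfolding r by (simp only: powr_add[symmetric]) simp
 qed
 have "ball_const (s n)*(2 powr (?B n K)*(\<beta> n/\<sigma> n) powr-s n)
 <= bc*(2 powr Q*2 powr (Q*real j)*x^(?A n n0))"
 by (rule mult_mono[OF bs e]) (use bc in auto)
 from mult_left_mono[OF this, of cc] show ?thesis using cc by (simp add: mult_ac)
 qed
 have "(SUM n=K..<N. cc*2 powr (?B n K)*(ball_const (s n)*(\<beta> n/\<sigma> n) powr-s n))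
 <= cc*bc*2 powr Q*2 powr (Q*real j)*(SUM n=K..<N. x^(?A n n0))" by (simp add: sum_distrib_left sum_mono[OF t])
 also have "... <= cc*bc*2 powr Q*2 powr (Q*real j)*(2/(1-x))" using cc bc by (intro mult_left_mono two_sided_geometric x) auto
 finally show "(SUM n=K..<N. cc*2 powr (?B n K)*(ball_const (s n)*(\<beta> n/\<sigma> n) powr-s n)) <= C*2 powr (Q*real j)" by (simp add: C_def mult_ac)
 qed
 thus ?thesis by simp
 qed
 ultimately show ?thesis by rule
qed

text \<open>The order m is chosen with Q < h m: at k levels above \<open>K\<close> the union bound
  has of order 2^(Q k) links, each failing with probability of order at most 2^(-h m k).\<close>

theorem large_deviation:
 assumes h: "0<h" and m: "Q < h*real m"
 obtains C where "0<C"
 "!!(P::'w measure) X Kf K A b. gaussian_family P D X Kf ==> 0<A ==> 0<b ==>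
 (!!p q. p:ball_pts K ==> q:ball_pts K ==> incr_var Kf p q <= (A*\<rho> (p-q) powr h)^2) ==>
 1-C*(A*2 powr (- h*real K)/b)^(2*m) <= \<P>(w in P. incr_le X K b w)"
proof -
 let ?B = "%n K. Q*(real n+1-real K)"
 let ?A = "%A n. A*(cT/2^n) powr h"
 define y where "y = (2::real) powr (- h/2)"
 define x where "x = (2::real) powr (Q-h*real m)"
 have y: "0<y" "y<1" and x: "0<x" "x<1" using h m by (auto simp: y_def x_def powr_less_one)
 define c where "c = cT powr h/(1-y)"
 have c: "0<c" using cT_pos y by (simp add: c_def)
 define C where "C = cc*2 powr Q*tail_const m * c^(2*m)/(1-x)"
 have cc: "0<cc" by (simp add: cc_def)
 have geo: "(SUM n=K..<N. z^(n-K)) <= 1/(1-z)" if "0<z" "z<1" for z :: real and K N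
 proof -
 have "(SUM n=K..<N. z^(n-K)) = (SUM k<N-K. z^k)" by (rule sum.reindex_bij_witness[of _ "%k. k+K" "%n. n-K"]) auto
 also have "... <= 1/(1-z)" using that sum_le_suminf[of "%k. z^k" "{..<N-K}"] suminf_geometric[of z] by simp
 finally show ?thesis .
 qed
 have "0<C" using tail_const_pos cc c x by (simp add: C_def)
 moreover have "1-C*(A*2 powr (- h*real K)/b)^(2*m) <= \<P>(w in P. incr_le X K b w)"
 if g: "gaussian_family P D X Kf" and A: "0<A" and b: "0<b" and v: "!!p q. p:ball_pts K ==> q:ball_pts K ==> incr_var Kf p q <= (A*\<rho> (p-q) powr h)^2"
 for P :: "'w measure" and X Kf K A b
 proof (rule chain_large_deviation[OF g, where \<sigma>="%n. A*(cT/2^n) powr h" and \<beta>="%n. b*(1-y)*y^(n-K)"])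
 show "0<A*(cT/2^n) powr h" "0<b*(1-y)*y^(n-K)" for n using A b y cT_pos by auto
 fix n r assume n: "K <= n" "r:T (Suc n) ` ball_pts K"
 hence r: "r:ball_pts K" "T n r:ball_pts K" by (auto intro!: ball_T)
 have "(A*\<rho> (r-T n r) powr h)^2 <= (?A A n)^2" using A h T_step[of r n] \<rho>_nonneg by (simp add: mult_left_mono powr_mono2)
 thus "incr_var Kf r (T n r) <= (?A A n)^2" using v[OF r] by simp
 next
 fix N
 have "(SUM n=K..<N. b*(1-y)*y^(n-K)) = b*(1-y)*(SUM n=K..<N. y^(n-K))" by (simp add: sum_distrib_left)
 also have "... <= b*(1-y)*(1/(1-y))" using b y by (intro mult_left_mono geo) auto
 finally show "(SUM n=K..<N. b*(1-y)*y^(n-K)) <= b" using y by simp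
 define R where "R = A*2 powr (- h*real K)/b"
 have t: "cc*2 powr (?B n K)*(tail_const m*(?A A n/(b*(1-y)*y^(n-K)))^(2*m))
 = cc*2 powr Q*tail_const m*(c * R)^(2*m)*x^(n-K)" if n: "K <= n" for n
 proof -
 define k where "k = n-K"
 have nk: "n = K+k" using n by (simp add: k_def)
 have "(cT/2^n) powr h = cT powr h*2 powr (- h*real K)*(y^k*y^k)"
 proof -
 have "(cT/2^n) powr h = cT powr h/(2 powr (h*real n))" by (simp add: powr_divide powr_realpow[symmetric] powr_powr mult.commute)
 also have "... = cT powr h*2 powr (- h*real K + - h*real k)" by (simp add: nk powr_minus[symmetric] divide_inverse algebra_simps)
 finally show ?thesis by (simp add: powr_realpow[symmetric] y_def powr_powr powr_add[symmetric])
 qed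
 hence "?A A n/(b*(1-y)*y^(n-K)) = c * R*y^k" using y b by (simp add: c_def R_def k_def field_simps)
 moreover have "2 powr (?B n K)*(y^k)^(2*m) = 2 powr Q*x^k" by (simp add: powr_realpow[symmetric] y_def x_def powr_powr powr_add[symmetric] nk algebra_simps)
 ultimately show ?thesis by (simp add: power_mult_distrib k_def)
 qed
 have "(SUM n=K..<N. cc*2 powr (?B n K)*(tail_const m*(?A A n/(b*(1-y)*y^(n-K)))^(2*m)))
 = cc*2 powr Q*tail_const m*(c * R)^(2*m)*(SUM n=K..<N. x^(n-K))" by (auto simp: sum_distrib_left intro!: sum.cong refl t)
 also have "... <= cc*2 powr Q*tail_const m*(c * R)^(2*m)*(1/(1-x))" using cc tail_const_pos[of m] by (intro mult_left_mono geo x) auto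
 finally show "(SUM n=K..<N. cc*2 powr (?B n K)*(tail_const m*(?A A n/(b*(1-y)*y^(n-K)))^(2*m)))
 <= C*(A*2 powr (- h*real K)/b)^(2*m)" unfolding R_def[symmetric] by (simp add: C_def power_mult_distrib)
 qed
 ultimately show ?thesis by rule
qed

end

section \<open>Spectral estimates\<close>

lemma dyadic_bracket:
 assumes "1<=(u::real)" obtains k :: nat where "2^k <= u" "u < 2^Suc k"
proof -
 define k where "k = nat (floor (log 2 u))"
 have "real k <= log 2 u" "log 2 u < real (Suc k)" using assms floor_correct[of "log 2 u"] by (auto simp: k_def add.commute)
 hence "2 powr real k <= u" "u<2 powr real (Suc k)" using assms by (simp_all only: le_log_iff log_less_iff)
 thus ?thesis using that by (simp only: powr_realpow)
qed

lemma powr_bracket: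
 fixes u :: real
 assumes "2^k <= u" "u < 2^Suc k" shows "u powr g<=2 powr abs g*(2^k) powr g"
proof (cases "0<=g")
 case True
 have u: "0<u" using assms(1) by (rule less_le_trans[rotated]) simp
 have "u powr g <= (2*2^k) powr g" using assms True by (intro powr_mono2) auto
 thus ?thesis using True by (simp add: powr_mult)
next
 case False
 have "u powr g <= (2^k) powr g" using assms False by (intro powr_mono2') auto
 also have "... <= 2 powr abs g*(2^k) powr g" by (simp add: ge_one_powr_ge_zero)
 finally show ?thesis .
qed

text \<open>A substitute for polar coordinates: wherever it is nonzero the integrand is below a
  constant attached to some ball containing the point, and constants times volumes are
  summed.\<close>

lemma nn_integral_shells:
 fixes c r :: "nat => real" and f :: "'a::euclidean_space => real"
 assumes c: "!!k. 0<=c k" and r: "!!k. 0<=r k" and le: "!!x. f x ~= 0 ==> EX k. norm x <= r k & f x <= c k"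
 and s: "summable (%k. c k*(unit_ball_vol (real DIM('a))*r k^DIM('a)))"
 shows "nn_integral lborel (%x. ennreal (f x)) <= ennreal (\<Sum>k. c k*(unit_ball_vol (real DIM('a))*r k^DIM('a)))"
proof -
 let ?A = "%x. \<Sum>k. ennreal (c k)*indicator (cball (0::'a) (r k)) x"
 have [measurable]: "cball (0::'a) (r k):sets borel" for k by simp
 have "nn_integral lborel (%x. ennreal (f x)) <= nn_integral lborel (%x. (?A x))"
 proof (intro nn_integral_mono)
 fix x :: 'a
 show "ennreal (f x) <= ?A x"
 proof (cases "f x = 0")
 case False
 then obtain k where k: "norm x <= r k" "f x <= c k" using le by auto
 define h where "h k = ennreal (c k)*indicator (cball (0::'a) (r k)) x" for k
 have "ennreal (f x) <= h k" using k by (simp add: ennreal_leI h_def)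
 also have "... <= (\<Sum>k. h k)" using sum_le_suminf[OF summableI, of "{k}" h] by simp
 finally show ?thesis by (simp add: h_def)
 qed simp
 qed
 also have "... = (\<Sum>k. ennreal (c k)*emeasure lborel (cball (0::'a) (r k)))" by (subst nn_integral_suminf, measurable, simp add: nn_integral_cmult_indicator)
 also have "... = (\<Sum>k. ennreal (c k*(unit_ball_vol (real DIM('a))*r k^DIM('a))))" using c r by (intro suminf_cong) (simp add: emeasure_cball ennreal_mult)
 finally show ?thesis using c r by (simp add: suminf_ennreal_eq[OF _ summable_sums[OF s]])
qed

lemma nn_integral_powr_inner:
 assumes g: "d < real DIM('a)"
 obtains C where "0<C" "!!X. 0<X ==> (\<integral>\<^sup>+(x::'a::euclidean_space). ennreal (if norm x <= X then norm x powr-d else 0) \<partial>lborel) <= ennreal (C*X powr (real DIM('a)-d))"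
proof -
 let ?B = "real DIM('a)-d"
 let ?A = "%x X. if norm x <= X then norm x powr-d else 0"
 define v where "v = unit_ball_vol (real DIM('a))"
 define q where "q = (2::real) powr (- ?B)"
 have q: "0<q" "q<1" using g by (auto simp: q_def powr_less_one)
 have v: "0<v" by (simp add: v_def)
 have "(\<integral>\<^sup>+(x::'a). ennreal (?A x X) \<partial>lborel) <= ennreal (2 powr abs d * v / (1-q)*X powr ?B)" if X: "0<X" for X
 proof -
 define c where "c k = X powr-d*(2 powr abs d*(2^k) powr d)" for k :: nat
 define r where "r k = X/2^k" for k :: nat
 have e: "c k*(v * r k^DIM('a)) = 2 powr abs d * v * X powr ?B*q^k" for k
 proof -
 have "r k^DIM('a) = X powr real DIM('a)*2 powr (- real k*real DIM('a))"
 proof -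
 have r': "r k = X*2 powr (- real k)" by (simp add: r_def powr_minus powr_realpow divide_inverse)
 hence "r k^DIM('a) = (X*2 powr (- real k)) powr real DIM('a)" using X by (simp add: powr_realpow)
 thus ?thesis by (simp add: powr_mult powr_powr)
 qed
 moreover have "(2^k) powr d = 2 powr (real k*d)" by (simp add: powr_realpow[symmetric] powr_powr)
 moreover have "q^k = 2 powr (real k*d)*2 powr (- real k*real DIM('a))" by (simp add: powr_realpow[symmetric] q_def powr_powr powr_add[symmetric] algebra_simps)
 moreover have "X powr ?B = X powr real DIM('a)*X powr-d" by (simp add: powr_add[symmetric])
 ultimately show ?thesis by (simp add: c_def)
 qed
 have "(\<integral>\<^sup>+(x::'a). ennreal (?A x X) \<partial>lborel) <= ennreal (\<Sum>k. c k*(v * r k^DIM('a)))" unfolding v_def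
 proof (rule nn_integral_shells)
 fix x :: 'a assume "(?A x X) ~= 0"
 hence x: "norm x <= X" "0<norm x" by (auto split: if_splits)
 then obtain k where k: "2^k <= X/norm x" "X/norm x < 2^Suc k" using dyadic_bracket[of "X/norm x"] by auto
 have "norm x powr-d = X powr-d*(X/norm x) powr d" using X by (simp add: powr_divide powr_minus field_simps)
 also have "... <= c k" unfolding c_def by (intro mult_left_mono powr_bracket k) auto
 finally show "EX k. norm x <= r k & (?A x X) <= c k" using x k(1) by (intro exI[of _ k]) (simp add: r_def field_simps)
 next
 show "summable (%k. c k*(unit_ball_vol (real DIM('a))*r k^DIM('a)))" unfolding v_def[symmetric] e using q by simp
 qed (use X in "auto simp: c_def r_def")
 also have "(\<Sum>k. c k*(v * r k^DIM('a))) = 2 powr abs d * v * X powr ?B*(1/(1-q))" unfolding e using q by (subst suminf_mult) (auto simp: suminf_geometric)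
 finally show ?thesis by simp
 qed
 thus ?thesis using that[of "2 powr abs d * v / (1-q)"] v q by auto
qed

lemma nn_integral_powr_outer:
 assumes g: "real DIM('a) < d"
 obtains C where "0<C" "!!X. 0<X ==> (\<integral>\<^sup>+(x::'a::euclidean_space). ennreal (if X < norm x then norm x powr-d else 0) \<partial>lborel) <= ennreal (C*X powr (real DIM('a)-d))"
proof -
 let ?B = "real DIM('a)-d"
 let ?A = "%X x. if X < norm x then norm x powr-d else 0"
 define v where "v = unit_ball_vol (real DIM('a))"
 define q where "q = (2::real) powr ?B"
 have q: "0<q" "q<1" using g by (auto simp: q_def powr_less_one)
 have v: "0<v" by (simp add: v_def)
 have "(\<integral>\<^sup>+(x::'a). ennreal (?A X x) \<partial>lborel) <= ennreal (2 powr abs d*2^DIM('a) * v / (1-q)*X powr ?B)" if X: "0<X" for X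
 proof -
 define c where "c k = X powr-d*(2 powr abs (- d)*(2^k) powr-d)" for k :: nat
 define r where "r k = 2*(X*2^k)" for k :: nat
 have e: "c k*(v * r k^DIM('a)) = 2 powr abs d*2^DIM('a) * v * X powr ?B*q^k" for k using X by (simp add: r_def power_mult_distrib powr_realpow[symmetric] powr_powr q_def powr_add[symmetric] algebra_simps c_def)
 have "(\<integral>\<^sup>+(x::'a). ennreal (?A X x) \<partial>lborel) <= ennreal (\<Sum>k. c k*(v * r k^DIM('a)))" unfolding v_def
 proof (rule nn_integral_shells)
 fix x :: 'a assume "(?A X x) ~= 0"
 hence x: "X < norm x" "0<norm x" by (auto split: if_splits)
 then obtain k where k: "2^k <= norm x/X" "norm x/X < 2^Suc k" using X dyadic_bracket[of "norm x/X"] by auto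
 have "norm x powr-d = X powr-d*(norm x/X) powr-d" using X by (simp add: powr_divide field_simps)
 also have "... <= c k" unfolding c_def by (intro mult_left_mono powr_bracket k) auto
 finally show "EX k. norm x <= r k & (?A X x) <= c k" using x X k(2) by (intro exI[of _ k]) (simp add: r_def field_simps)
 next
 show "summable (%k. c k*(unit_ball_vol (real DIM('a))*r k^DIM('a)))" unfolding v_def[symmetric] e using q by simp
 qed (use X in "auto simp: c_def r_def")
 also have "(\<Sum>k. c k*(v * r k^DIM('a))) = 2 powr abs d*2^DIM('a) * v * X powr ?B*(1/(1-q))" unfolding e using q by (subst suminf_mult) (auto simp: suminf_geometric)
 finally show ?thesis by simp
 qed
 thus ?thesis using that[of "2 powr abs d*2^DIM('a) * v / (1-q)"] v q by auto
qed

lemma nn_integral_split_bound: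
 fixes f :: "'a::euclidean_space => real"
 assumes le: "!!x. norm x <= X ==> f x <= a*norm x powr-p" "!!x. X < norm x ==> f x <= b*norm x powr-q" and ab: "0<=a" "0<=b" and X: "0<X"
 and A: "(\<integral>\<^sup>+(x::'a). ennreal (if norm x <= X then norm x powr-p else 0) \<partial>lborel) <= ennreal A"
 and B: "(\<integral>\<^sup>+(x::'a). ennreal (if X < norm x then norm x powr-q else 0) \<partial>lborel) <= ennreal B" and AB: "0<=A" "0<=B"
 shows "nn_integral lborel (%x. ennreal (f x)) <= ennreal (a*A+b*B)"
proof -
 have "nn_integral lborel (%x. ennreal (f x)) <= (\<integral>\<^sup>+(x::'a). ennreal a*ennreal (if norm x <= X then norm x powr-p else 0)
 + ennreal b*ennreal (if X < norm x then norm x powr-q else 0) \<partial>lborel)"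
 by (intro nn_integral_mono) (use le ab in "auto simp: ennreal_mult[symmetric] intro!: ennreal_leI")
 also have "... = ennreal a*(\<integral>\<^sup>+(x::'a). ennreal (if norm x <= X then norm x powr-p else 0) \<partial>lborel)
 + ennreal b*(\<integral>\<^sup>+(x::'a). ennreal (if X < norm x then norm x powr-q else 0) \<partial>lborel)"
 by (subst nn_integral_add) (auto simp: nn_integral_cmult)
 also have "... <= ennreal a*ennreal A+ennreal b*ennreal B" by (intro add_mono mult_left_mono A B) auto
 finally show ?thesis using ab AB by (simp add: ennreal_mult[symmetric] ennreal_plus[symmetric] del: ennreal_plus)
qed

lemma divide_le_summand:
 fixes a x y :: real
 assumes "0<=a" "0<=x" "0<=y"
 shows "0<y ==> a/(x+y) <= a/y" "0<x ==> a/(x+y) <= a/x" using assms by (simp_all add: frac_le)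

lemma regroup: "x*y*z = w ==> x' * v = w ==> c*x*y*(a*z) + c*x'*(b * v) = c*(a+b)*(w::real)"
proof -
 assume "x*y*z = w" "x' * v = w"
 moreover have "c*x*y*(a*z) + c*x'*(b * v) = c*a*(x*y*z) + c*b*(x' * v)" by simp
 ultimately show ?thesis by (simp add: distrib_left distrib_right)
qed

text \<open>The modulus is 2 |sin (x/2)|. The first bound serves low frequencies, the second high
  ones.\<close>

lemma norm_cis_diff: "(cmod (cis x-1))^2 <= x^2" "(cmod (cis x-1))^2<=4"
proof -
 let ?A = "cmod (cis x-1)"
 have "?A^2 = (cos x-1)^2+(sin x)^2" by (simp add: cmod_power2)
 also have "... = 4*(sin (x/2))^2" using cos_double_sin[of "x/2"] by (simp add: power2_eq_square algebra_simps)
 finally have e: "?A^2 = 4*(sin (x/2))^2" .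
 have "(sin (x/2))^2 <= (x/2)^2" using abs_sin_x_le_abs_x[of "x/2"] by (metis abs_le_square_iff)
 thus "?A^2 <= x^2" unfolding e by (simp add: power_divide)
 show "?A^2<=4" unfolding e by (simp add: abs_square_le_1)
qed

text \<open>\<open>S\<close> is the spectral density of the field with stationary increments. All
  estimates rest on its two-sided comparison with an explicit density, so \<Psi> and \<mu> reappear
  only with the solution itself.\<close>

locale spectral =
 fixes H \<alpha> \<beta> cS :: real and S :: "real*'a::euclidean_space => real"
 assumes H: "1/2 < H" "H<1" and \<alpha>: "0<\<alpha>" and \<beta>: "0<\<beta>" "\<beta> < real DIM('a)" "real DIM('a)-2*\<alpha>*H < \<beta>"
 and H2_less: "\<alpha>*(H-(real DIM('a)-\<beta>)/(2*\<alpha>))<1" and Sm[measurable]: "S:bm" and cS: "0<cS"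
 and S_upper: "!!r k. S (r, k) <= cS*(abs r powr (1-2*H)*norm k powr-\<beta>/(norm k powr (2*\<alpha>)+r^2))"
 and S_lower: "!!r k. abs r powr (1-2*H)*norm k powr-\<beta>/(norm k powr (2*\<alpha>)+r^2) <= cS*S (r, k)"
begin

definition "H1 = H-(real DIM('a)-\<beta>)/(2*\<alpha>)"

definition "H2 = \<alpha>*H1"

lemma H1: "0<H1" "H1<1"
proof -
 have "0<(real DIM('a)-\<beta>)/(2*\<alpha>)" "(real DIM('a)-\<beta>)/(2*\<alpha>) < H" using \<alpha> \<beta> by (simp_all add: pos_divide_less_eq mult_ac)
 thus "0<H1" "H1<1" using H by (simp_all add: H1_def)
qed

lemma H2: "0<H2" "H2<1" using H1 \<alpha> H2_less by (simp_all add: H2_def H1_def)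

lemma H2_eq: "2*H2 = 2*\<alpha>*H-real DIM('a)+\<beta>" using \<alpha> by (simp add: H2_def H1_def field_simps)

lemma S_nonneg: "0<=S w"
proof -
 have "0<=abs (fst w) powr (1-2*H)*norm (snd w) powr-\<beta>/(norm (snd w) powr (2*\<alpha>)+(fst w)^2)" by simp
 also have "... <= cS*S w" using S_lower[of "fst w" "snd w"] by simp
 finally show ?thesis using cS by (simp add: zero_le_mult_iff)
qed

abbreviation "S0 == %r (k::'a). abs r powr (1-2*H)*norm k powr-\<beta>/(norm k powr (2*\<alpha>)+r^2)"

text \<open>The integral is split where the two terms of the denominator balance, at |k| =
  |r|^(1/\<alpha>). The result is the spectral density of a fractional Brownian motion of index
  \<open>H1\<close>, up to a constant.\<close>

lemma space_marginal:
 obtains C where "0<C" "!!r. nn_integral lborel (%k. ennreal (S (r, k))) <= ennreal (C*abs r powr-(1+2*H1))"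
proof -
 let ?C = "%r. \<integral>\<^sup>+k. ennreal (S (r, k)) \<partial>lborel"
 let ?B = "%A X. A*X powr (real DIM('a)-\<beta>)"
 let ?A = "\<beta>+2*\<alpha>"
 have g: "\<beta> < real DIM('a)" "real DIM('a) < \<beta>+2*\<alpha>"
 proof -
 have "2*\<alpha>*H < 2*\<alpha>" using \<alpha> H by simp
 thus "real DIM('a) < \<beta>+2*\<alpha>" using \<beta> by simp
 qed (rule \<beta>)
 obtain A where A: "0<A" "!!X. 0<X ==> (\<integral>\<^sup>+(x::'a). ennreal (if norm x <= X then norm x powr-\<beta> else 0) \<partial>lborel) <= ennreal (?B A X)"
 using nn_integral_powr_inner[OF g(1)] by auto
 obtain B where B: "0<B" "!!X. 0<X ==> (\<integral>\<^sup>+(x::'a). ennreal (if X < norm x then norm x powr-?A else 0) \<partial>lborel) <= ennreal (B*X powr (real DIM('a)-?A))"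
 using nn_integral_powr_outer[OF g(2)] by auto
 have "?C r <= ennreal (cS*(A+B)*abs r powr-(1+2*H1))" for r
 proof (cases "r = 0")
 case True
 have "S (0, k) = 0" for k using S_upper[of 0 k] S_nonneg[of "(0, k)"] by simp
 thus ?thesis using True by simp
 next
 case False
 define t where "t = abs r"
 have t: "0<t" using False by (simp add: t_def)
 define X where "X = t powr (1/\<alpha>)"
 have X: "0<X" using t by (simp add: X_def)
 have Xp: "X powr c = t powr (c/\<alpha>)" for c by (simp add: X_def powr_powr)
 have "?C r <= ennreal (cS*t powr (1-2*H)*t powr -2*(?B A X)
 + cS*t powr (1-2*H)*(B*X powr (real DIM('a)-?A)))"
 proof (rule nn_integral_split_bound[OF _ _ _ _ X A(2)[OF X] B(2)[OF X]])
 fix k :: 'a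
 have e: "t powr -2 = 1/t^2" using t by (simp add: powr_minus divide_inverse)
 have "S (r, k) <= cS*S0 r k" by (rule S_upper)
 also have "S0 r k <= t powr (1-2*H)*norm k powr-\<beta>/t^2" unfolding t_def power2_abs by (rule divide_le_summand(1)) (use False in auto)
 finally show "S (r, k) <= cS*t powr (1-2*H)*t powr -2*norm k powr-\<beta>" using cS by (simp add: e)
 next
 fix k :: 'a assume x: "X < norm k"
 hence x0: "0<norm k" using X by auto
 have "S (r, k) <= cS*S0 r k" by (rule S_upper)
 also have "S0 r k <= t powr (1-2*H)*norm k powr-\<beta>/norm k powr (2*\<alpha>)" unfolding t_def by (rule divide_le_summand(2)) (use x0 in auto)
 also have "... = t powr (1-2*H)*norm k powr-?A"
 proof -
 have "norm k powr-?A = norm k powr-\<beta>/norm k powr (2*\<alpha>)" by (simp add: powr_diff[symmetric])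
 thus ?thesis by simp
 qed
 finally show "S (r, k) <= cS*t powr (1-2*H)*norm k powr-?A" using cS by simp
 qed (use cS A(1) B(1) in auto)
 also have "cS*t powr (1-2*H)*t powr -2*?B A X + cS*t powr (1-2*H)*(B*X powr (real DIM('a)-?A))
 = cS*(A+B)*t powr-(1+2*H1)"
 proof -
 have "t powr (1-2*H)*t powr -2*X powr (real DIM('a)-\<beta>) = t powr-(1+2*H1)"
 unfolding Xp powr_add[symmetric] using \<alpha> by (intro arg_cong[where f="%x. t powr x"]) (simp add: H1_def field_simps)
 moreover have "t powr (1-2*H)*X powr (real DIM('a)-?A) = t powr-(1+2*H1)"
 unfolding Xp powr_add[symmetric] using \<alpha> by (intro arg_cong[where f="%x. t powr x"]) (simp add: H1_def field_simps)
 ultimately show ?thesis by (rule regroup)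
 qed
 finally show ?thesis by (simp add: t_def)
 qed
 thus ?thesis using that[of "cS*(A+B)"] cS A(1) B(1) by simp
qed

text \<open>Split at |r| = |k|^\<alpha>. By \<open>H2_eq\<close> the exponent is the dimension plus
  2 H2, as for an isotropic fractional field of index \<open>H2\<close>.\<close>

lemma time_marginal:
 obtains C where "0<C" "!!k. nn_integral lborel (%r. ennreal (S (r, k))) <= ennreal (C*norm k powr-(\<beta>+2*\<alpha>*H))"
proof -
 let ?D = "%k. \<integral>\<^sup>+r. ennreal (S (r, k)) \<partial>lborel"
 let ?C = "\<beta>+2*\<alpha>*H"
 let ?B = "real DIM(real)-(2*H+1)"
 let ?A = "real DIM(real)-(2*H-1)"
 have g: "2*H-1 < real DIM(real)" "real DIM(real) < 2*H+1" using H by auto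
 obtain A where A: "0<A" "!!X. 0<X ==> (\<integral>\<^sup>+(x::real). ennreal (if norm x <= X then norm x powr-(2*H-1) else 0) \<partial>lborel) <= ennreal (A*X powr ?A)"
 using nn_integral_powr_inner[OF g(1)] by auto
 obtain B where B: "0<B" "!!X. 0<X ==> (\<integral>\<^sup>+(x::real). ennreal (if X < norm x then norm x powr-(2*H+1) else 0) \<partial>lborel) <= ennreal (B*X powr ?B)"
 using nn_integral_powr_outer[OF g(2)] by auto
 have "?D k <= ennreal (cS*(A+B)*norm k powr-?C)" for k
 proof (cases "k = 0")
 case True
 have "S (r, 0) = 0" for r using S_upper[of r 0] S_nonneg[of "(r, 0)"] by simp
 thus ?thesis using True by simp
 next
 case False
 define t where "t = norm k"
 have t: "0<t" using False by (simp add: t_def)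
 define X where "X = t powr \<alpha>"
 have X: "0<X" using t by (simp add: X_def)
 have Xp: "X powr c = t powr (\<alpha> * c)" for c by (simp add: X_def powr_powr)
 have "?D k <= ennreal (cS*t powr-\<beta>*t powr-(2*\<alpha>)*(A*X powr ?A)
 + cS*t powr-\<beta>*(B*X powr ?B))"
 proof (rule nn_integral_split_bound[OF _ _ _ _ X A(2)[OF X] B(2)[OF X]])
 fix r :: real
 have "S (r, k) <= cS*S0 r k" by (rule S_upper)
 also have "S0 r k <= abs r powr (1-2*H)*t powr-\<beta>/t powr (2*\<alpha>)" unfolding t_def by (rule divide_le_summand(2)) (use False in auto)
 finally show "S (r, k) <= cS*t powr-\<beta>*t powr-(2*\<alpha>)*norm r powr-(2*H-1)" using cS by (simp add: mult_ac powr_minus divide_inverse)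
 next
 fix r :: real assume x: "X < norm r"
 hence x0: "0<abs r" using X by simp
 have "S (r, k) <= cS*S0 r k" by (rule S_upper)
 also have "S0 r k <= abs r powr (1-2*H)*t powr-\<beta>/r^2" unfolding t_def by (rule divide_le_summand(1)) (use x0 in auto)
 also have "... = t powr-\<beta>*abs r powr-(2*H+1)"
 proof -
 have "abs r powr (1-2*H)/r^2 = abs r powr (1-2*H)*abs r powr -2" by (simp add: powr_minus divide_inverse)
 also have "... = abs r powr-(2*H+1)" unfolding powr_add[symmetric] by (rule arg_cong[where f="%x. abs r powr x"]) simp
 finally have e: "abs r powr (1-2*H)/r^2 = abs r powr-(2*H+1)" .
 have "abs r powr (1-2*H)*t powr-\<beta>/r^2 = t powr-\<beta>*(abs r powr (1-2*H)/r^2)" by simp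
 thus ?thesis unfolding e .
 qed
 finally show "S (r, k) <= cS*t powr-\<beta>*norm r powr-(2*H+1)" using cS by simp
 qed (use cS A(1) B(1) in auto)
 also have "cS*t powr-\<beta>*t powr-(2*\<alpha>)*(A*X powr ?A) + cS*t powr-\<beta>*(B*X powr ?B)
 = cS*(A+B)*t powr-?C"
 proof -
 have "t powr-\<beta>*t powr-(2*\<alpha>)*X powr ?A = t powr-?C" unfolding Xp powr_add[symmetric] by (intro arg_cong[where f="%x. t powr x"]) (simp add: algebra_simps)
 moreover have "t powr-\<beta>*X powr ?B = t powr-?C" unfolding Xp powr_add[symmetric] by (intro arg_cong[where f="%x. t powr x"]) simp
 ultimately show ?thesis by (rule regroup)
 qed
 finally show ?thesis by (simp add: t_def)
 qed
 thus ?thesis using that[of "cS*(A+B)"] cS A(1) B(1) by simp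
qed

lemma nn_integral_time:
 assumes [measurable]: "w:bm" and C: "!!r. nn_integral lborel (%k. ennreal (S (r, k))) <= ennreal (C*abs r powr-g)" "0<C" and w: "!!r. 0<=w r"
 shows "nn_integral lborel (%v. ennreal (S v * w (fst v))) <= ennreal C*nn_integral lborel (%r. ennreal (w r*abs r powr-g))"
proof -
 let ?A = "%r. \<integral>\<^sup>+k. ennreal (S (r, k)) \<partial>lborel"
 have [measurable]: "(%v::real*'a. w (fst v)):bm" by (rule measurable_compose[OF borel_measurable_continuous_onI[OF continuous_on_fst[OF continuous_on_id]]]) simp
 have "nn_integral lborel (%v. ennreal (S v * w (fst v))) = nn_integral lborel (%r. \<integral>\<^sup>+k. ennreal (S (r, k)*w r) \<partial>lborel)"
 unfolding lborel_prod[symmetric] by (subst lborel.nn_integral_fst[symmetric]) (auto simp: lborel_prod)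
 also have "... = nn_integral lborel (%r. ennreal (w r)*?A r)"
 using S_nonneg w by (intro nn_integral_cong, subst nn_integral_cmult[symmetric]) (auto simp: ennreal_mult[symmetric] mult.commute)
 also have "... <= nn_integral lborel (%r. ennreal C*ennreal (w r*abs r powr-g))"
 proof (rule nn_integral_mono)
 fix r
 have "ennreal (w r)*?A r <= ennreal (w r)*ennreal (C*abs r powr-g)" by (rule mult_left_mono[OF C(1)]) simp
 also have "... = ennreal C*ennreal (w r*abs r powr-g)" using C(2) w by (simp add: ennreal_mult[symmetric])
 finally show "ennreal (w r)*?A r <= ennreal C*ennreal (w r*abs r powr-g)" .
 qed
 finally show ?thesis by (simp add: nn_integral_cmult)
qed

lemma nn_integral_space:
 assumes [measurable]: "w:bm" and C: "!!k. nn_integral lborel (%r. ennreal (S (r, k))) <= ennreal (C*norm k powr-g)" "0<C" and w: "!!k. 0<=w k"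
 shows "nn_integral lborel (%v. ennreal (S v * w (snd v))) <= ennreal C*nn_integral lborel (%k. ennreal (w k*norm k powr-g))"
proof -
 let ?A = "%k. \<integral>\<^sup>+r. ennreal (S (r, k)) \<partial>lborel"
 have [measurable]: "(%v::real*'a. w (snd v)):bm" by (rule measurable_compose[OF borel_measurable_continuous_onI[OF continuous_on_snd[OF continuous_on_id]]]) simp
 have "nn_integral lborel (%v. ennreal (S v * w (snd v))) = nn_integral lborel (%k. \<integral>\<^sup>+r. ennreal (S (r, k)*w k) \<partial>lborel)"
 unfolding lborel_prod[symmetric] by (subst lborel_pair.nn_integral_snd[symmetric]) (auto simp: lborel_prod)
 also have "... = nn_integral lborel (%k. ennreal (w k)*?A k)"
 using S_nonneg w by (intro nn_integral_cong, subst nn_integral_cmult[symmetric]) (auto simp: ennreal_mult[symmetric] mult.commute)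
 also have "... <= nn_integral lborel (%k. ennreal C*ennreal (w k*norm k powr-g))"
 proof (rule nn_integral_mono)
 fix k
 have "ennreal (w k)*?A k <= ennreal (w k)*ennreal (C*norm k powr-g)" by (rule mult_left_mono[OF C(1)]) simp
 also have "... = ennreal C*ennreal (w k*norm k powr-g)" using C(2) w by (simp add: ennreal_mult[symmetric])
 finally show "ennreal (w k)*?A k <= ennreal C*ennreal (w k*norm k powr-g)" .
 qed
 finally show ?thesis by (simp add: nn_integral_cmult)
qed

text \<open>The second bound of each pair needs \<open>H1 < 1\<close> and \<open>H2 < 1\<close>.\<close>

lemma time_bounds:
 obtains C where "0<C" "!!T. 0<T ==> (nn_integral lborel (%w. ennreal (S w*(if T < abs (fst w) then 1 else 0)))) <= ennreal (C*T powr-(2*H1))"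
 "!!T. 0<T ==> (nn_integral lborel (%w. ennreal (S w*(if abs (fst w) <= T then (fst w)^2 else 0)))) <= ennreal (C*T powr (2-2*H1))"
proof -
 let ?D = "%T. \<integral>\<^sup>+w. ennreal (S w*(if T < abs (fst w) then 1 else 0)) \<partial>lborel"
 let ?C = "%T. \<integral>\<^sup>+w. ennreal (S w*(if abs (fst w) <= T then (fst w)^2 else 0)) \<partial>lborel"
 let ?B = "%T. \<integral>\<^sup>+r. ennreal ((if T < abs r then 1 else 0)*abs r powr-(1+2*H1)) \<partial>lborel"
 let ?A = "%T. \<integral>\<^sup>+r. ennreal ((if abs r <= T then r^2 else 0)*abs r powr-(1+2*H1)) \<partial>lborel"
 obtain C0 where C0: "0<C0" "!!r. nn_integral lborel (%k. ennreal (S (r, k))) <= ennreal (C0*abs r powr-(1+2*H1))" by (rule space_marginal) blast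
 have g: "real DIM(real) < 1+2*H1" "2*H1-1 < real DIM(real)" using H1 by auto
 obtain A where A: "0<A" "!!X. 0<X ==> (\<integral>\<^sup>+(x::real). ennreal (if X < norm x then norm x powr-(1+2*H1) else 0) \<partial>lborel) <= ennreal (A*X powr (real DIM(real)-(1+2*H1)))"
 using nn_integral_powr_outer[OF g(1)] by auto
 obtain B where B: "0<B" "!!X. 0<X ==> (\<integral>\<^sup>+(x::real). ennreal (if norm x <= X then norm x powr-(2*H1-1) else 0) \<partial>lborel) <= ennreal (B*X powr (real DIM(real)-(2*H1-1)))"
 using nn_integral_powr_inner[OF g(2)] by auto
 have "?D T <= ennreal (C0*(A+B)*T powr-(2*H1))" if T: "0<T" for T
 proof -
 have "?D T <= ennreal C0*?B T" by (rule nn_integral_time[OF _ C0(2,1)]) auto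
 also have "?B T = (\<integral>\<^sup>+(x::real). ennreal (if T < norm x then norm x powr-(1+2*H1) else 0) \<partial>lborel)" by (intro nn_integral_cong) simp
 also have "... <= ennreal (A*T powr-(2*H1))" using A(2)[OF T] by simp
 also have "ennreal C0*ennreal (A*T powr-(2*H1)) <= ennreal (C0*(A+B)*T powr-(2*H1))"
 using C0(1) A(1) B(1) by (auto simp: ennreal_mult[symmetric] intro!: mult_right_mono)
 finally show ?thesis by (simp add: mult_left_mono)
 qed
 moreover have "?C T <= ennreal (C0*(A+B)*T powr (2-2*H1))" if T: "0<T" for T
 proof -
 have e: "abs r powr-(2*H1-1) = r^2*abs r powr-(1+2*H1)" for r :: real
 proof (cases "r = 0")
 case False
 hence "r^2*abs r powr-(1+2*H1) = abs r powr 2*abs r powr-(1+2*H1)" by simp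
 also have "... = abs r powr-(2*H1-1)" unfolding powr_add[symmetric] by simp
 finally show ?thesis ..
 qed simp
 have "?C T <= ennreal C0*?A T" by (rule nn_integral_time[OF _ C0(2,1)]) auto
 also have "?A T = (\<integral>\<^sup>+(x::real). ennreal (if norm x <= T then norm x powr-(2*H1-1) else 0) \<partial>lborel)"
 by (intro nn_integral_cong, simp only: real_norm_def e) auto
 also have "... <= ennreal (B*T powr (2-2*H1))" using B(2)[OF T] by simp
 also have "ennreal C0*ennreal (B*T powr (2-2*H1)) <= ennreal (C0*(A+B)*T powr (2-2*H1))"
 using C0(1) A(1) B(1) by (auto simp: ennreal_mult[symmetric] intro!: mult_right_mono)
 finally show ?thesis by (simp add: mult_left_mono)
 qed
 ultimately show ?thesis using that[of "C0*(A+B)"] C0(1) A(1) B(1) by simp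
qed

lemma space_bounds:
 obtains C where "0<C" "!!X. 0<X ==> (nn_integral lborel (%w. ennreal (S w*(if X < norm (snd w) then 1 else 0)))) <= ennreal (C*X powr-(2*H2))"
 "!!X. 0<X ==> (nn_integral lborel (%w. ennreal (S w*(if norm (snd w) <= X then (norm (snd w))^2 else 0)))) <= ennreal (C*X powr (2-2*H2))"
proof -
 let ?D = "%X. \<integral>\<^sup>+w. ennreal (S w*(if X < norm (snd w) then 1 else 0)) \<partial>lborel"
 let ?C = "%X. \<integral>\<^sup>+w. ennreal (S w*(if norm (snd w) <= X then (norm (snd w))^2 else 0)) \<partial>lborel"
 let ?B = "\<beta>+2*\<alpha>*H-2"
 let ?A = "\<beta>+2*\<alpha>*H"
 obtain C0 where C0: "0<C0" "!!k. nn_integral lborel (%r. ennreal (S (r, k))) <= ennreal (C0*norm k powr-?A)" by (rule time_marginal) blast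
 have g: "real DIM('a) < \<beta>+2*\<alpha>*H" "\<beta>+2*\<alpha>*H-2 < real DIM('a)" using H2 H2_eq by auto
 obtain A where A: "0<A" "!!X. 0<X ==> (\<integral>\<^sup>+(x::'a). ennreal (if X < norm x then norm x powr-?A else 0) \<partial>lborel) <= ennreal (A*X powr (real DIM('a)-?A))"
 using nn_integral_powr_outer[OF g(1)] by auto
 obtain B where B: "0<B" "!!X. 0<X ==> (\<integral>\<^sup>+(x::'a). ennreal (if norm x <= X then norm x powr-?B else 0) \<partial>lborel) <= ennreal (B*X powr (real DIM('a)-?B))"
 using nn_integral_powr_inner[OF g(2)] by auto
 have ex: "real DIM('a)-?A = - (2*H2)" "real DIM('a)-?B = 2-2*H2" using H2_eq by auto
 have "?D X <= ennreal (C0*(A+B)*X powr-(2*H2))" if X: "0<X" for X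
 proof -
 have "?D X <= ennreal C0*(\<integral>\<^sup>+(k::'a). ennreal ((if X < norm k then 1 else 0)*norm k powr-?A) \<partial>lborel)"
 by (rule nn_integral_space[OF _ C0(2,1)]) auto
 also have "(\<integral>\<^sup>+(k::'a). ennreal ((if X < norm k then 1 else 0)*norm k powr-?A) \<partial>lborel) = (\<integral>\<^sup>+(x::'a). ennreal (if X < norm x then norm x powr-?A else 0) \<partial>lborel)"
 by (intro nn_integral_cong) simp
 also have "... <= ennreal (A*X powr-(2*H2))" using A(2)[OF X] unfolding ex .
 also have "ennreal C0*ennreal (A*X powr-(2*H2)) <= ennreal (C0*(A+B)*X powr-(2*H2))"
 using C0(1) A(1) B(1) by (auto simp: ennreal_mult[symmetric] intro!: mult_right_mono)
 finally show ?thesis by (simp add: mult_left_mono)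
 qed
 moreover have "?C X <= ennreal (C0*(A+B)*X powr (2-2*H2))" if X: "0<X" for X
 proof -
 have e: "norm k powr-?B = (norm k)^2*norm k powr-?A" for k :: 'a
 proof (cases "k = 0")
 case False
 hence "(norm k)^2*norm k powr-?A = norm k powr 2*norm k powr-?A" by simp
 also have "... = norm k powr-?B" unfolding powr_add[symmetric] by (rule arg_cong[where f="%x. norm k powr x"]) simp
 finally show ?thesis ..
 qed simp
 have "?C X <= ennreal C0*(\<integral>\<^sup>+(k::'a). ennreal ((if norm k <= X then (norm k)^2 else 0)*norm k powr-?A) \<partial>lborel)"
 by (rule nn_integral_space[OF _ C0(2,1)]) auto
 also have "(\<integral>\<^sup>+(k::'a). ennreal ((if norm k <= X then (norm k)^2 else 0)*norm k powr-?A) \<partial>lborel) = (\<integral>\<^sup>+(x::'a). ennreal (if norm x <= X then norm x powr-?B else 0) \<partial>lborel)"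
 by (intro nn_integral_cong, simp only: e) auto
 also have "... <= ennreal (B*X powr (2-2*H2))" using B(2)[OF X] unfolding ex .
 also have "ennreal C0*ennreal (B*X powr (2-2*H2)) <= ennreal (C0*(A+B)*X powr (2-2*H2))"
 using C0(1) A(1) B(1) by (auto simp: ennreal_mult[symmetric] intro!: mult_right_mono)
 finally show ?thesis by (simp add: mult_left_mono)
 qed
 ultimately show ?thesis using that[of "C0*(A+B)"] C0(1) A(1) B(1) by simp
qed

section \<open>Variance of increments by frequency range\<close>

definition phase :: "real*'a => real*'a => complex" where
 "phase p w = cis (- (fst w*fst p+snd w \<bullet> snd p))"

text \<open>The feature of a field with stationary increments that vanishes at the origin.\<close>

definition vf :: "real*'a => real*'a => complex" where "vf p w = phase p w-1"

lemma phase_measurable[measurable]: "phase p:bm" "vf p:bm"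
proof -
 have [measurable]: "(%w::real*'a. - (fst w*fst p+snd w \<bullet> snd p)):bm" by (intro borel_measurable_continuous_onI continuous_intros)
 show "phase p:bm" unfolding phase_def by measurable
 thus "vf p:bm" unfolding vf_def by simp
qed

text \<open>Variance of the increment over \<open>p\<close> due to frequencies in \<open>A\<close>,
  kept in \<open>ennreal\<close> so that finiteness is a result.\<close>

definition nvar :: "(real*'a) set => real*'a => ennreal" where
 "nvar A p = nn_integral lborel (%w. ennreal (S w*(cmod (vf p w))^2)*indicator A w)"

lemma vf_bound: "(cmod (vf p w))^2 <= 2*(cmod (cis (- (fst w*fst p))-1))^2+2*(cmod (cis (- (snd w \<bullet> snd p))-1))^2"
proof -
 let ?A = "- (snd w \<bullet> snd p)"
 define a b where "a = cis (- (fst w*fst p))-1" and "b = cis ?A-1"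
 have "vf p w = a * cis ?A+b" by (simp add: vf_def phase_def a_def b_def algebra_simps cis_mult)
 hence "(cmod (vf p w))^2 <= (cmod a + cmod b)^2" using norm_triangle_ineq[of "a * cis ?A" b] by (simp add: norm_mult)
 also have "... <= 2*(cmod a)^2+2*(cmod b)^2" using sum_squares_bound[of "cmod a" "cmod b"] by (simp add: power2_sum)
 finally show ?thesis by (simp add: a_def b_def)
qed

lemma vf_square_le: "(cmod (vf p w))^2<=4" unfolding vf_def phase_def by (rule norm_cis_diff)

text \<open>The frequencies that resolve no \<open>\<rho>\<close>-distance much below
  2^(-L).\<close>

definition "low L = {w::real*'a. abs (fst w)<=2 powr (L/H1) & norm (snd w)<=2 powr (L/H2)}"

lemma low_measurable[measurable]: "low L:sets borel"
proof -
 have "closed (low L)" unfolding low_def by (intro closed_Collect_conj closed_Collect_le continuous_intros)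
 thus ?thesis by simp
qed

lemma nn_integral_le_add:
 assumes "!!w. f w <= a*(S w*g w)+b*(S w*h w)" and ab: "0<=a" "0<=b" and gm: "(%w. S w*g w):bm" "(%w. S w*h w):bm" and gh: "!!w. 0<=g w" "!!w. 0<=h w"
 and A: "nn_integral lborel (%w. ennreal (S w*g w)) <= ennreal A" "nn_integral lborel (%w. ennreal (S w*h w)) <= ennreal B" and AB: "0<=A" "0<=B"
 shows "nn_integral lborel (%w. ennreal (f w)) <= ennreal (a*A+b*B)"
proof -
 have "nn_integral lborel (%w. ennreal (f w)) <= nn_integral lborel (%w. ennreal a*ennreal (S w*g w)+ennreal b*ennreal (S w*h w))"
 by (rule nn_integral_mono) (use assms(1) ab gh S_nonneg in "simp add: ennreal_mult[symmetric] ennreal_plus[symmetric] ennreal_leI del: ennreal_plus")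
 also have "... = ennreal a*nn_integral lborel (%w. ennreal (S w*g w))+ennreal b*nn_integral lborel (%w. ennreal (S w*h w))"
 using gm by (subst nn_integral_add) (auto simp: nn_integral_cmult)
 also have "... <= ennreal a*ennreal A+ennreal b*ennreal B" by (intro add_mono mult_left_mono A) auto
 finally show ?thesis using ab AB by (simp add: ennreal_mult[symmetric] ennreal_plus[symmetric] del: ennreal_plus)
qed

lemma time_space_measurable[measurable]:
 "Measurable.pred borel (%w::real*'a. T < abs (fst w))" "Measurable.pred borel (%w::real*'a. T < norm (snd w))"
 "Measurable.pred borel (%w::real*'a. abs (fst w) <= T)" "Measurable.pred borel (%w::real*'a. norm (snd w) <= T)"
 "(%w::real*'a. (fst w)^2):bm" "(%w::real*'a. (norm (snd w))^2):bm"
proof -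
 have [measurable]: "(%w::real*'a. abs (fst w)):bm" "(%w::real*'a. norm (snd w)):bm" by (intro borel_measurable_continuous_onI continuous_intros)+
 show "Measurable.pred borel (%w::real*'a. T < abs (fst w))" "Measurable.pred borel (%w::real*'a. T < norm (snd w))"
 "Measurable.pred borel (%w::real*'a. abs (fst w) <= T)" "Measurable.pred borel (%w::real*'a. norm (snd w) <= T)" by auto
qed (intro borel_measurable_continuous_onI continuous_intros)+

lemma weighted_measurable:
 "(%w. S w*(if T < abs (fst w) then 1 else 0)):bm" "(%w. S w*(if T < norm (snd w) then 1 else 0)):bm"
 "(%w. S w*(if abs (fst w) <= T then (fst w)^2 else 0)):bm" "(%w. S w*(if norm (snd w) <= T then (norm (snd w))^2 else 0)):bm" by auto

text \<open>A frequency outside the box is large in time or in space, so the tails of the two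
  marginals apply with the trivial bound on the feature. The estimate is uniform in the
  increment.\<close>

lemma nvar_high:
 obtains C where "0<C" "!!L p. nvar (- low L) p <= ennreal (C*2 powr (- 2*L))"
proof -
 obtain A where A: "0<A" "!!T. 0<T ==> (nn_integral lborel (%w. ennreal (S w*(if T < abs (fst w) then 1 else 0)))) <= ennreal (A*T powr-(2*H1))"
 by (rule time_bounds) blast
 obtain B where B: "0<B" "!!X. 0<X ==> (nn_integral lborel (%w. ennreal (S w*(if X < norm (snd w) then 1 else 0)))) <= ennreal (B*X powr-(2*H2))"
 by (rule space_bounds) blast
 have "nvar (- low L) p <= ennreal ((4*A+4*B)*2 powr (- 2*L))" for L p
 proof -
 have "nvar (- low L) p = nn_integral lborel (%w. ennreal (S w*(cmod (vf p w))^2*indicator (- low L) w))"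
 unfolding nvar_def by (intro nn_integral_cong) (auto simp: indicator_def)
 also have "... <= ennreal (4*(A*(2 powr (L/H1)) powr-(2*H1))+4*(B*(2 powr (L/H2)) powr-(2*H2)))"
 proof (rule nn_integral_le_add[OF _ _ _ weighted_measurable(1,2) _ _ A(2) B(2)])
 fix w :: "real*'a"
 have "S w*(cmod (vf p w))^2 <= S w*4" by (intro mult_left_mono vf_square_le S_nonneg)
 thus "S w*(cmod (vf p w))^2*indicator (- low L) w <= 4*(S w*(if 2 powr (L/H1) < abs (fst w) then 1 else 0))+4*(S w*(if 2 powr (L/H2) < norm (snd w) then 1 else 0))"
 using S_nonneg[of w] by (auto simp: low_def)
 qed (use A(1) B(1) in simp_all)
 also have "4*(A*(2 powr (L/H1)) powr-(2*H1))+4*(B*(2 powr (L/H2)) powr-(2*H2)) = (4*A+4*B)*2 powr (- 2*L)"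
 using H1 H2 by (simp add: powr_powr distrib_right mult.commute[of L])
 finally show ?thesis .
 qed
 thus ?thesis using that[of "4*A+4*B"] A(1) B(1) by simp
qed

lemma nvar_low_bound:
 obtains C where "0<C" "!!L s y. nvar (low L) (s, y) <= ennreal (C*(s^2*(2 powr (L/H1)) powr (2-2*H1)+(norm y)^2*(2 powr (L/H2)) powr (2-2*H2)))"
proof -
 obtain A where A: "0<A" "!!T. 0<T ==> (nn_integral lborel (%w. ennreal (S w*(if abs (fst w) <= T then (fst w)^2 else 0)))) <= ennreal (A*T powr (2-2*H1))"
 by (rule time_bounds) blast
 obtain B where B: "0<B" "!!X. 0<X ==> (nn_integral lborel (%w. ennreal (S w*(if norm (snd w) <= X then (norm (snd w))^2 else 0)))) <= ennreal (B*X powr (2-2*H2))"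
 by (rule space_bounds) blast
 have "nvar (low L) (s, y) <= ennreal ((2*A+2*B)*(s^2*(2 powr (L/H1)) powr (2-2*H1)+(norm y)^2*(2 powr (L/H2)) powr (2-2*H2)))" for L s y
 proof -
 define a b where "a = (2 powr (L/H1)) powr (2-2*H1)" and "b = (2 powr (L/H2)) powr (2-2*H2)"
 have "nvar (low L) (s, y) = nn_integral lborel (%w. ennreal (S w*(cmod (vf (s, y) w))^2*indicator (low L) w))"
 unfolding nvar_def by (intro nn_integral_cong) (auto simp: indicator_def)
 also have "... <= ennreal ((2 * s^2)*(A*a)+(2*(norm y)^2)*(B*b))" unfolding a_def b_def
 proof (rule nn_integral_le_add[OF _ _ _ weighted_measurable(3,4) _ _ A(2) B(2)])
 fix w :: "real*'a"
 have 1: "(cmod (cis (- (fst w * s))-1))^2 <= s^2*(fst w)^2" using norm_cis_diff(1)[of "- (fst w * s)"] by (simp add: power_mult_distrib mult.commute)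
 have "(cmod (cis (- (snd w \<bullet> y))-1))^2 <= (snd w \<bullet> y)^2" using norm_cis_diff(1)[of "- (snd w \<bullet> y)"] by simp
 also have "... <= (norm (snd w)*norm y)^2" by (metis Cauchy_Schwarz_ineq2 abs_le_square_iff abs_mult abs_norm_cancel)
 finally have 2: "(cmod (cis (- (snd w \<bullet> y))-1))^2 <= (norm y)^2*(norm (snd w))^2" by (simp add: power_mult_distrib mult.commute)
 have "(cmod (vf (s, y) w))^2 <= 2*(s^2*(fst w)^2)+2*((norm y)^2*(norm (snd w))^2)" using vf_bound[of "(s, y)" w] 1 2 by simp
 from mult_left_mono[OF this S_nonneg[of w]]
 show "S w*(cmod (vf (s, y) w))^2*indicator (low L) w<=2 * s^2*(S w*(if abs (fst w)<=2 powr (L/H1) then (fst w)^2 else 0))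
 + 2*(norm y)^2*(S w*(if norm (snd w)<=2 powr (L/H2) then (norm (snd w))^2 else 0))"
 using S_nonneg[of w] by (auto simp: low_def algebra_simps)
 qed (use A(1) B(1) in simp_all)
 also have "... <= ennreal ((2*A+2*B)*(s^2*a+(norm y)^2*b))" using A(1) B(1) by (intro ennreal_leI) (simp add: algebra_simps a_def b_def)
 finally show ?thesis by (simp add: a_def b_def)
 qed
 thus ?thesis using that[of "2*A+2*B"] A(1) B(1) by simp
qed

lemma nvar_split: "nvar UNIV p = nvar (low L) p+nvar (- low L) p"
 unfolding nvar_def by (subst nn_integral_add[symmetric]) (auto intro!: nn_integral_cong simp: indicator_def)

definition "gap = min (1/H1-1) (1/H2-1)"

lemma gap_pos: "0<gap" using H1 H2 by (simp add: gap_def)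

text \<open>For low frequencies the feature is at most linear in the increment. A coordinate of size
  2^(-K/h) against frequencies up to 2^(L/h) yields 2^(-2 K) times 2^(-2 (1/h - 1) (K - L));
  \<open>gap\<close> is the smaller of the two gains 1/h - 1, positive since \<open>H1\<close> and
  \<open>H2\<close> are below 1.\<close>

lemma nvar_low:
 obtains C where "0<C" "!!L K p. dist_rho H1 H2 p<=2 powr (- K) ==> L <= K ==> nvar (low L) p <= ennreal (C*2 powr (- 2*K-2*gap*(K-L)))"
proof -
 let ?A = "%K L. - 2*K-2*gap*(K-L)"
 obtain C where C: "0<C" "!!L s y. nvar (low L) (s, y) <= ennreal (C*(s^2*(2 powr (L/H1)) powr (2-2*H1)+(norm y)^2*(2 powr (L/H2)) powr (2-2*H2)))"
 by (rule nvar_low_bound) blast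
 have b: "r^2*(2 powr (L/h)) powr (2-2*h)<=2 powr (?A K L)" if h: "0<h" "gap <= 1/h-1" and r: "0<=r" "r powr h<=2 powr (- K)" and KL: "L <= K" for r h L K
 proof -
 have "(r powr h) powr (2/h) <= (2 powr (- K)) powr (2/h)" using h r by (intro powr_mono2) auto
 hence "r^2*(2 powr (L/h)) powr (2-2*h)<=2 powr (- 2*K/h)*2 powr (L/h*(2-2*h))" using h r by (simp add: powr_powr mult.commute)
 also have "... = 2 powr (- 2*K-2*(1/h-1)*(K-L))" unfolding powr_add[symmetric] using h by (intro arg_cong[where f="%x. 2 powr x"]) (simp add: field_simps)
 also have "... <= 2 powr (?A K L)" using h KL by (simp add: mult_right_mono)
 finally show ?thesis .
 qed
 have "nvar (low L) p <= ennreal (2*C*2 powr (?A K L))" if p: "dist_rho H1 H2 p<=2 powr (- K)" and KL: "L <= K" for L K p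
 proof -
 have "abs (fst p) powr H1<=2 powr (- K)" "norm (snd p) powr H2<=2 powr (- K)"
 using p powr_ge_zero[of "norm (snd p)" H2] powr_ge_zero[of "abs (fst p)" H1] unfolding dist_rho_def rho_def by linarith+
 hence "abs (fst p)^2*(2 powr (L/H1)) powr (2-2*H1)+(norm (snd p))^2*(2 powr (L/H2)) powr (2-2*H2) <= 2*2 powr (?A K L)"
 using b[of H1 "abs (fst p)" K L] b[of H2 "norm (snd p)" K L] H1 H2 KL by (simp add: gap_def)
 from mult_left_mono[OF this, of C] C(1) have "C*(abs (fst p)^2*(2 powr (L/H1)) powr (2-2*H1)+(norm (snd p))^2*(2 powr (L/H2)) powr (2-2*H2))
 <= 2*C*2 powr (?A K L)" by simp
 from order.trans[OF C(2)[of L "fst p" "snd p"] ennreal_leI[OF this[unfolded power2_abs]]] show ?thesis by simp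
 qed
 thus ?thesis using that[of "2*C"] C(1) by simp
qed

lemma nvar_lipschitz:
 obtains C where "0<C" "!!p. nvar (low L) p <= ennreal ((C*norm p)^2)"
proof -
 obtain C where C: "0<C" "!!L s y. nvar (low L) (s, y) <= ennreal (C*(s^2*(2 powr (L/H1)) powr (2-2*H1)+(norm y)^2*(2 powr (L/H2)) powr (2-2*H2)))"
 by (rule nvar_low_bound) blast
 define a b where "a = (2 powr (L/H1)) powr (2-2*H1)" and "b = (2 powr (L/H2)) powr (2-2*H2)"
 have ab: "0<a" "0<b" by (simp_all add: a_def b_def)
 have "nvar (low L) p <= ennreal ((sqrt (C*(a+b))*norm p)^2)" for p
 proof -
 have "(norm p)^2 = (fst p)^2+(norm (snd p))^2" by (cases p) (simp add: norm_Pair)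
 hence "C*((fst p)^2*a+(norm (snd p))^2*b) <= C*((a+b)*(norm p)^2)" using C(1) ab by (simp add: algebra_simps)
 also have "... = (sqrt (C*(a+b))*norm p)^2" using C(1) ab by (simp add: power_mult_distrib)
 finally have "C*((fst p)^2*a+(norm (snd p))^2*b) <= (sqrt (C*(a+b))*norm p)^2" .
 from order.trans[OF C(2)[of L "fst p" "snd p"] ennreal_leI[OF this[unfolded a_def b_def]]] show ?thesis by (simp add: a_def b_def)
 qed
 thus ?thesis using that[of "sqrt (C*(a+b))"] C(1) ab by simp
qed

text \<open>Cutting the frequencies exactly at the scale of \<open>p\<close> balances the low and
  the high part. Distance 0 means the origin, where \<open>vf\<close> vanishes.\<close>

lemma nvar_upper:
 obtains A where "0<A" "!!p. nvar UNIV p <= ennreal ((A*dist_rho H1 H2 p)^2)"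
proof -
 obtain B where B: "0<B" "!!L p. nvar (- low L) p <= ennreal (B*2 powr (- 2*L))" by (rule nvar_high) blast
 obtain C where C: "0<C" "!!L K p. dist_rho H1 H2 p<=2 powr (- K) ==> L <= K ==> nvar (low L) p <= ennreal (C*2 powr (- 2*K-2*gap*(K-L)))" by (rule nvar_low) blast
 have "nvar UNIV p <= ennreal ((sqrt (B+C)*dist_rho H1 H2 p)^2)" for p
 proof (cases "dist_rho H1 H2 p = 0")
 case True
 have "abs (fst p) powr H1 = 0 & norm (snd p) powr H2 = 0" using True powr_ge_zero[of "norm (snd p)" H2] powr_ge_zero[of "abs (fst p)" H1]
 unfolding dist_rho_def rho_def by linarith
 hence "vf p w = 0" for w by (simp add: vf_def phase_def)
 thus ?thesis by (simp add: nvar_def)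
 next
 case False
 hence r: "0<dist_rho H1 H2 p" using powr_ge_zero[of "norm (snd p)" H2] powr_ge_zero[of "abs (fst p)" H1] unfolding dist_rho_def rho_def by linarith
 define K where "K = - log 2 (dist_rho H1 H2 p)"
 have K: "2 powr (- K) = dist_rho H1 H2 p" using r by (simp add: K_def)
 have K2: "2 powr (- 2*K) = (dist_rho H1 H2 p)^2" unfolding K[symmetric] by (simp add: powr_power)
 have "nvar UNIV p <= ennreal (C*2 powr (- 2*K))+ennreal (B*2 powr (- 2*K))" unfolding nvar_split[of p K] using C(2)[of p K K] B(2)[of K p] K by (intro add_mono) auto
 also have "... = ennreal ((sqrt (B+C)*dist_rho H1 H2 p)^2)" unfolding K2 using B(1) C(1) by (simp add: ennreal_plus[symmetric] algebra_simps del: ennreal_plus)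
 finally show ?thesis .
 qed
 thus ?thesis using that[of "sqrt (B+C)"] B(1) C(1) by simp
qed

end

section \<open>Kernels of square integrable features\<close>

definition l2_kernel :: "'x measure => ('i => 'x => complex) => 'i => 'i => real" where
 "l2_kernel N f p q = (LINT w|N. Re (f p w * cnj (f q w)))"

definition l2_features :: "'x measure => 'i set => ('i => 'x => complex) => bool" where
 "l2_features N I f \<longleftrightarrow> (ALL p:I. f p:borel_measurable N & integrable N (%w. (cmod (f p w))^2))"

lemma l2_featuresD:
 assumes "l2_features N I f" "p:I" shows "f p:borel_measurable N" "integrable N (%w. (cmod (f p w))^2)" using assms by (auto simp: l2_features_def)

lemma l2_integrable:
 assumes f: "l2_features N I f" "p:I" "q:I" shows "integrable N (%w. Re (f p w * cnj (f q w)))"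
proof (rule lint_bound)
 let ?A = "%w. f p w * cnj (f q w)"
 note [measurable] = l2_featuresD(1)[OF f(1,2)] l2_featuresD(1)[OF f(1,3)]
 show "integrable N (%w. (cmod (f p w))^2+(cmod (f q w))^2)" using l2_featuresD(2)[OF f(1)] f(2,3) by simp
 show "(%w. Re (?A w)):borel_measurable N" by simp
 show "AE w in N. norm (Re (?A w)) <= norm ((cmod (f p w))^2+(cmod (f q w))^2)"
 proof (rule AE_I2)
 fix w
 have "abs (Re (?A w)) <= cmod (?A w)" by (rule abs_Re_le_cmod)
 also have "... = cmod (f p w) * cmod (f q w)" by (simp add: norm_mult)
 also have "... <= (cmod (f p w))^2+(cmod (f q w))^2"
 proof -
 have "0<=cmod (f p w) * cmod (f q w)" by simp
 thus ?thesis using sum_squares_bound[of "cmod (f p w)" "cmod (f q w)"] by linarith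
 qed
 finally show "norm (Re (?A w)) <= norm ((cmod (f p w))^2+(cmod (f q w))^2)" by simp
 qed
qed

lemma l2_kernel_sym: "l2_kernel N f p q = l2_kernel N f q p" unfolding l2_kernel_def by (intro lint_cong refl) simp

lemma l2_kernel_quad:
 assumes f: "l2_features N I f" and J: "finite J" "F ` J \<subseteq> I"
 shows "(SUM i:J. SUM j:J. a i*a j*l2_kernel N f (F i) (F j)) = (LINT w|N. (cmod (SUM i:J. complex_of_real (a i)*f (F i) w))^2)"
proof -
 let ?B = "%w. cmod (SUM i:J. of_real (a i)*f (F i) w)"
 let ?A = "%w. SUM i:J. SUM j:J. a i*a j * Re (f (F i) w * cnj (f (F j) w))"
 have "(SUM i:J. SUM j:J. a i*a j*l2_kernel N f (F i) (F j)) = (LINT w|N. (?A w))"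
 proof -
 define R where "R i j w = Re (f (F i) w * cnj (f (F j) w))" for i j w
 have i: "integrable N (%w. a i*a j * R i j w)" if "i:J" "j:J" for i j unfolding R_def by (intro integrable_mult_right l2_integrable[OF f]) (use that J in auto)
 have "(LINT w|N. (SUM i:J. SUM j:J. a i*a j * R i j w)) = (SUM i:J. LINT w|N. (SUM j:J. a i*a j * R i j w))" by (rule lint_sum) (intro integrable_lint_sum i)
 also have "... = (SUM i:J. SUM j:J. LINT w|N. a i*a j * R i j w)" by (intro sum.cong refl lint_sum i)
 finally show ?thesis by (simp add: l2_kernel_def R_def)
 qed
 also have "... = (LINT w|N. (?B w)^2)"
 proof (intro lint_cong refl)
 fix w
 define z where "z i = of_real (a i)*f (F i) w" for i
 have "(cmod (SUM i:J. z i))^2 = Re ((SUM i:J. z i) * cnj (SUM i:J. z i))" by (metis complex_norm_square Re_complex_of_real)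
 also have "... = ?A w" by (simp add: sum_product z_def algebra_simps)
 finally show "?A w = (?B w)^2" by (simp add: z_def)
 qed
 finally show ?thesis .
qed

lemma l2_kernel_incr_var:
 assumes f: "l2_features N I f" "p:I" "q:I"
 shows "incr_var (l2_kernel N f) p q = (LINT w|N. (cmod (f p w-f q w))^2)"
proof -
 have "incr_var (l2_kernel N f) p q = (SUM i:{True,False}. SUM j:{True,False}. (if i then 1 else -1)*(if j then 1 else -1)*l2_kernel N f (if i then p else q) (if j then p else q))"
 by (simp add: incr_var_def)
 also have "... = (LINT w|N. (cmod (SUM i:{True,False}. of_real (if i then 1 else -1)*f (if i then p else q) w))^2)" by (rule l2_kernel_quad[OF f(1)]) (use f in auto)
 finally show ?thesis by simp
qed

lemma l2_gaussian_exists: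
 fixes f :: "'i => 'x => complex"
 assumes f: "l2_features N I f" and I: "countable I" "I ~= {}"
 obtains X where "gaussian_family (PiM UNIV (%_::nat. N01)) I X (l2_kernel N f)"
proof (rule gaussian_family_exists[OF I l2_kernel_sym])
 fix n a and g :: "nat => 'i" assume "range g \<subseteq> I"
 hence "(SUM i<n. SUM j<n. a i*a j*l2_kernel N f (g i) (g j)) = (LINT w|N. (cmod (SUM i<n. of_real (a i)*f (g i) w))^2)" by (intro l2_kernel_quad[OF f]) auto
 thus "0<=(SUM i<n. SUM j<n. a i*a j*l2_kernel N f (g i) (g j))" by simp
qed (rule that)

section \<open>The lower limit as a functional of the values on a countable set\<close>

definition scale :: "real => real => real" where
 "scale Q e = e*ln (ln (1/e)) powr (- (1/Q))"

lemma ln_ln_pos: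
 assumes "0<e" "e < exp (- exp 1)"
 shows "1<ln (ln (1/e))" "0<scale Q e" "0<ln (1/e)"
proof -
 have "exp (exp 1) < 1/e" using assms by (simp add: exp_minus field_simps)
 hence "ln (exp (exp 1)) < ln (1/e)" using assms(1) by (subst ln_less_cancel_iff) auto
 hence 2: "exp 1<ln (1/e)" by simp
 show 3: "0<ln (1/e)" using 2 exp_gt_zero[of "1::real"] by linarith
 have "ln (exp 1) < ln (ln (1/e))" using 2 3 by (subst ln_less_cancel_iff) auto
 thus 1: "1<ln (ln (1/e))" by simp
 thus "0<scale Q e" using assms by (simp add: scale_def)
qed

lemma Liminf_le_add:
 fixes f g :: "'b => ereal"
 assumes "eventually (%x. f x <= g x+ereal e) F"
 shows "Liminf F f <= Liminf F g+ereal e"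
proof -
 have "Liminf F f-ereal e <= Liminf F g" unfolding le_Liminf_iff
 proof safe
 fix y assume "y < Liminf F f-ereal e"
 hence "eventually (%x. y+ereal e < f x) F" by (simp add: ereal_less_minus less_LiminfD)
 with assms show "eventually (%x. y < g x) F"
 proof eventually_elim
 case (elim x)
 hence "y+ereal e < g x+ereal e" by simp
 thus ?case by (cases y; cases "g x") auto
 qed
 qed
 thus ?thesis by (simp add: ereal_minus_le_iff)
qed

context grid
begin

definition "lratio v e = (SUP p\<in>{p:D. \<rho> p <= e}. ereal (abs (v p) / scale Q e))"

definition "lfun v = Liminf (at_right 0) (lratio v)"

lemma lratio_nonneg: "0<e ==> e < exp (- exp 1) ==> 0<=lratio v e" unfolding lratio_def by (rule SUP_upper2[of 0]) (use D_0 ln_ln_pos(2)[of e Q] in auto)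

text \<open>Below exp (- exp 1) the iterated logarithm exceeds 1, so that \<open>scale\<close> is
  positive and continuous; \<open>eN\<close> decreases to 0 from there.\<close>

definition "eN n = exp (- exp 1)/real (Suc n)"

lemma eN: "0<eN n" "eN n <= exp (- exp 1)" by (auto simp: eN_def divide_le_eq)

lemma scale_tendsto:
 assumes "0<e" "e < exp (- exp 1)" "q \<longlonglongrightarrow> e"
 shows "(%k. scale Q (q k)) \<longlonglongrightarrow> scale Q e"
proof -
 show ?thesis using ln_ln_pos(1)[OF assms(1,2)] unfolding scale_def by (auto intro!: tendsto_intros ln_ln_pos(1,3)[OF assms(1,2)] assms)
qed

text \<open>Measurability asks for countably many radii. A radius is approximated from below by
  rationals: the ball shrinks, so the supremum does not grow, and \<open>scale\<close> is
  continuous.\<close>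

lemma lfun_rational: "lfun v = (SUP n. INF q\<in>{q:\<rat>. 0<q & q < eN n}. lratio v q)"
proof (rule antisym)
 let ?A = "%k. 1-1/real (k+2)"
 show "(SUP n. INF q\<in>{q:\<rat>. 0<q & q < eN n}. lratio v q) <= lfun v"
 proof (rule SUP_least)
 fix n
 have "(INF q\<in>{q:\<rat>. 0<q & q < eN n}. lratio v q) <= lratio v d" if e: "0<d" "d < eN n" for d
 proof (cases "lratio v d")
 case (real g)
 have ee: "d < exp (- exp 1)" using e eN(2)[of n] by simp
 have "EX q:\<rat>. d*?A k < q & q < d" for k using Rats_dense_in_real[of "d*?A k" d] e by simp
 then obtain q where q: "!!k. q k:\<rat>" "!!k. d*?A k < q k" "!!k. q k < d" by metis
 have q0: "0<q k" for k
 proof -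
 have "0<=d*?A k" using e by simp
 thus ?thesis using q(2)[of k] by simp
 qed
 have "(%k. d*?A k) \<longlonglongrightarrow> d*(1-0)" by (intro tendsto_intros) real_asymp
 hence l: "(%k. d*?A k) \<longlonglongrightarrow> d" by simp
 have "q \<longlonglongrightarrow> d" by (intro tendsto_sandwich[OF _ _ l tendsto_const])
 (rule always_eventually, rule, rule less_imp_le, rule q)+
 note st = scale_tendsto[OF e(1) ee this]
 have se: "0<scale Q d" by (rule ln_ln_pos(2)[OF e(1) ee])
 have bd: "(INF q\<in>{q:\<rat>. 0<q & q < eN n}. lratio v q) <= ereal (g*(scale Q d / scale Q (q k)))" for k
 proof -
 have qe: "q k < exp (- exp 1)" using q(3)[of k] ee by simp
 have sq: "0<scale Q (q k)" by (rule ln_ln_pos(2)[OF q0 qe])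
 have "(INF q\<in>{q:\<rat>. 0<q & q < eN n}. lratio v q) <= lratio v (q k)" by (rule INF_lower) (use q q0 e less_trans[OF q(3) e(2)] in auto)
 also have "... <= ereal (g*(scale Q d / scale Q (q k)))" unfolding lratio_def
 proof (rule SUP_least)
 fix p assume p: "p:{p:D. \<rho> p <= q k}"
 hence "ereal (abs (v p) / scale Q d) <= lratio v d" unfolding lratio_def by (intro SUP_upper) (use q(3)[of k] in auto)
 thus "ereal (abs (v p) / scale Q (q k)) <= ereal (g*(scale Q d / scale Q (q k)))" using se sq by (simp add: real pos_divide_le_eq divide_right_mono)
 qed
 finally show ?thesis .
 qed
 have lim: "(%k. ereal (g*(scale Q d / scale Q (q k)))) \<longlonglongrightarrow> ereal (g*(scale Q d / scale Q d))" using se by (intro tendsto_intros st) auto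
 have "(INF q\<in>{q:\<rat>. 0<q & q < eN n}. lratio v q) <= ereal (g*(scale Q d / scale Q d))" by (rule LIMSEQ_le_const[OF lim]) (use bd in blast)
 thus ?thesis using se real by simp
 next
 case MInf
 thus ?thesis using lratio_nonneg[of d v] e eN(2)[of n] by auto
 qed simp
 thus "(INF q\<in>{q:\<rat>. 0<q & q < eN n}. lratio v q) <= lfun v" unfolding lfun_def by (intro Liminf_bounded) (auto simp: eventually_at_right_field intro!: eN)
 qed
next
 show "lfun v <= (SUP n. INF q\<in>{q:\<rat>. 0<q & q < eN n}. lratio v q)" unfolding lfun_def Liminf_def
 proof (rule SUP_least)
 fix P assume "P:{P. eventually P (at_right (0::real))}"
 then obtain b where b: "0<b" "!!y. 0<y ==> y < b ==> P y" by (auto simp: eventually_at_right_field)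
 obtain n where n: "exp (- exp 1)/b < real n" using reals_Archimedean2 by auto
 hence "exp (- exp 1) < b*real n" using b(1) by (simp add: pos_divide_less_eq mult.commute)
 also have "... <= b*real (Suc n)" using b(1) by simp
 finally have "eN n <= b" by (simp add: eN_def pos_divide_le_eq)
 hence "(INF x\<in>Collect P. lratio v x) <= (INF q\<in>{q:\<rat>. 0<q & q < eN n}. lratio v q)" by (intro INF_superset_mono) (auto intro!: b)
 thus "(INF x\<in>Collect P. lratio v x) <= (SUP n. INF q\<in>{q:\<rat>. 0<q & q < eN n}. lratio v q)" by (rule SUP_upper2[OF UNIV_I])
 qed
qed

lemma lfun_measurable: "lfun:borel_measurable (PiM D (%_. borel))"
proof -
 have "countable {q:\<rat>. 0<q & q < eN n}" for n by (rule countable_subset[OF _ countable_rat]) auto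
 moreover have "(%v. lratio v q):borel_measurable (PiM D (%_. borel))" for q
 unfolding lratio_def by (rule borel_measurable_SUP) (auto intro!: countable_subset[OF _ ball_pts_countable(1)])
 ultimately show ?thesis unfolding lfun_rational by simp
qed

lemma lfun_cong: "(!!p. p:D ==> v p = w p) ==> lfun v = lfun w" unfolding lfun_def lratio_def by simp

text \<open>To bound a lower limit from above, infinitely many radii suffice. The closed ball of
  radius 1/2^Suc K lies inside the open ball of \<open>ball_pts K\<close>.\<close>

lemma lfun_upper:
 assumes c: "0<c" and ev: "\<exists>\<^sub>F K in sequentially. ALL p:ball_pts K. abs (v p) <= c * scale Q (1/2^Suc K)"
 shows "lfun v <= ereal c"
proof (rule ccontr)
 assume "~ lfun v <= ereal c"
 hence "eventually (%\<epsilon>. ereal c < lratio v \<epsilon>) (at_right 0)" using less_LiminfD[of "ereal c" "at_right 0" "lratio v"] by (simp add: lfun_def)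
 then obtain b where b: "0<b" "!!y. 0<y ==> y < b ==> ereal c < lratio v y" by (auto simp: eventually_at_right_field)
 have "eventually (%K::nat. 1/2^Suc K < min b (exp (- exp 1))) sequentially" by (rule order_tendstoD(2)[of _ 0]) (real_asymp, use b in simp)
 from frequently_ex[OF frequently_eventually_conj[OF ev this]]
 obtain K where K: "ALL p:ball_pts K. abs (v p) <= c * scale Q (1/2^Suc K)" "1/2^Suc K < min b (exp (- exp 1))" by auto
 define \<epsilon> :: real where "\<epsilon> = 1/2^Suc K"
 have e: "0<\<epsilon>" "\<epsilon> < b" "\<epsilon> < exp (- exp 1)" "\<epsilon> < 1/2^K" using K(2) by (auto simp: \<epsilon>_def field_simps)
 have "lratio v \<epsilon> <= ereal c" unfolding lratio_def
 proof (rule SUP_least)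
 fix p assume "p:{p:D. \<rho> p <= \<epsilon>}"
 hence "p:ball_pts K" using e by (auto simp: ball_pts_def)
 thus "ereal (abs (v p) / scale Q \<epsilon>) <= ereal c" using K(1) ln_ln_pos(2)[OF e(1,3), of Q] by (simp add: pos_divide_le_eq \<epsilon>_def)
 qed
 thus False using b(2)[OF e(1,2)] by simp
qed

text \<open>A radius d between 2^(-K) and 2^(1-K) covers the open ball of radius 2^(-K). There
  \<open>scale\<close> is at most the bracketed factor, with K - 1 because 1/d is at least
  2^(K-1).\<close>

lemma lfun_lower:
 assumes c: "0<c" and ev: "\<forall>\<^sub>F K in sequentially. EX p:ball_pts K. c*(2/2^K*ln (real (K-1)*ln 2) powr (- (1/Q))) <= abs (v p)"
 shows "ereal c <= lfun v"
proof -
 let ?A = "%K. 2/2^K*ln (real (K-1)*ln 2) powr (- (1/Q))"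
 obtain N where N: "!!K. N <= K ==> EX p:ball_pts K. c*?A K <= abs (v p)" using ev by (auto simp: eventually_sequentially)
 \<comment> \<open>Ten extra levels make (K - 1) ln 2 exceed 5, so that its logarithm is
   positive.\<close>
 define M where "M = N+10"
 have "ereal c <= lratio v d" if e: "0<d" "d < min (1/2^M) (exp (- exp 1))" for d
 proof -
 have "exp (- exp 1) <= (1::real)" by simp
 hence "d<=1" using e(2) by linarith
 hence "1<=1/d" using e(1) by simp
 then obtain k where k: "2^k <= 1/d" "1/d < 2^Suc k" by (rule dyadic_bracket)
 define K where "K = Suc k"
 have e2: "d <= 2/2^K" "1/2^K <= d" using k e(1) by (simp_all add: K_def field_simps)
 have "(1::real)/2^K < 1/2^M" using e2 e by simp
 hence KM: "M < K" by (simp add: field_simps)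
 then obtain p where p: "p:ball_pts K" "c*?A K <= abs (v p)" using N[of K] by (auto simp: M_def)
 have k10: "10 <= real k" using KM by (simp add: K_def M_def)
 have l2: "1/2 < ln (2::real)" using ln2_ge_two_thirds by simp
 have "10*ln 2<=real k*ln 2" using k10 by simp
 hence "5<real k*ln 2" using l2 by linarith
 have lk: "0<ln (real k*ln 2)" using \<open>5 < k * ln 2\<close> by simp
 have "real k*ln 2<=ln (1/d)" using k(1) e(1) by (metis ln_realpow ln_mono zero_less_numeral zero_less_power)
 hence "ln (real k*ln 2) <= ln (ln (1/d))" using \<open>5 < k * ln 2\<close> by simp
 hence "ln (ln (1/d)) powr (- (1/Q)) <= ln (real k*ln 2) powr (- (1/Q))" using lk Q_pos by (intro powr_mono2') auto
 hence "scale Q d <= 2/2^K*ln (real (K-1)*ln 2) powr (- (1/Q))" unfolding scale_def using e2 by (intro mult_mono) (auto simp: K_def)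
 hence "c * scale Q d <= abs (v p)" using p(2) c by (meson mult_left_mono less_imp_le order.trans)
 thus ?thesis using ln_ln_pos(2)[of d Q] e p(1) e2 unfolding lratio_def by (simp add: pos_le_divide_eq ball_pts_def SUP_upper2[of p])
 qed
 thus ?thesis unfolding lfun_def by (intro Liminf_bounded) (auto simp: eventually_at_right_field intro!: exI[of _ "min (1/2^M) (exp (- exp 1))"])
qed

text \<open>A difference of order e^(1 + c) is small against \<open>scale Q e\<close>, since a power
  of an iterated logarithm cannot offset a power of e. Passing from dyadic to arbitrary radii costs
  a factor 4.\<close>

lemma lfun_negligible:
 assumes c: "0<c" and ev: "\<forall>\<^sub>F K in sequentially. ALL p:ball_pts K. abs (v p-w p)<=2 powr (- (1 + c)*real K)"
 shows "lfun v <= lfun w"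
proof (rule ereal_le_epsilon2)
 fix h :: real assume h: "0<h"
 obtain N where N: "!!K p. N <= K ==> p:ball_pts K ==> abs (v p-w p)<=2 powr (- (1 + c)*real K)" using ev by (auto simp: eventually_sequentially)
 have "((%q::real. (4*q) powr (1 + c)/(q*ln (ln (1/q)) powr (- (1/Q)))) \<longlongrightarrow> 0) (at_right 0)" using c by real_asymp
 from order_tendstoD(2)[OF this h] obtain b where b: "0<b" "!!q. 0<q ==> q < b ==> (4*q) powr (1 + c) / scale Q q < h" by (auto simp: eventually_at_right_field scale_def)
 have "lratio v q <= lratio w q+ereal h" if e: "0<q" "q < min b (min (1/2^(N+1)) (exp (- exp 1)))" for q
 proof -
 have se: "0<scale Q q" by (rule ln_ln_pos(2)) (use e in auto)
 have "(1::real)/2^(N+1) <= 1/2" by simp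
 hence "q < 1/2" using e by linarith
 hence "1<=1/(2*q)" using e(1) by simp
 then obtain K where K: "2^K <= 1/(2*q)" "1/(2*q) < 2^Suc K" by (rule dyadic_bracket)
 have K1: "q < 1/2^K" "1/2^K < 4*q" using K e(1) by (auto simp: field_simps)
 have "N <= K"
 proof (rule ccontr)
 assume "~ N <= K"
 hence "(2::real)^Suc K <= 2^N" by (intro power_increasing) auto
 hence "1/(2*q) < 2^N" using K(2) by simp
 thus False using e by (simp add: field_simps)
 qed
 have d: "abs (v p-w p) <= h * scale Q q" if "p:D" "\<rho> p <= q" for p
 proof -
 have "p:ball_pts K" using that K1 by (auto simp: ball_pts_def)
 hence "abs (v p-w p)<=2 powr (- (1 + c)*real K)" by (rule N[OF \<open>N <= K\<close>])
 also have "... = (1/2^K) powr (1 + c)"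
 proof -
 have e: "(1/2^K :: real) = 2 powr (- real K)" by (simp add: powr_minus powr_realpow divide_inverse)
 show ?thesis unfolding e powr_powr by (simp add: algebra_simps)
 qed
 also have "... <= (4*q) powr (1 + c)" using K1 c by (intro powr_mono2) auto
 finally show ?thesis using b(2)[of q] e se by (simp add: pos_divide_less_eq)
 qed
 show ?thesis unfolding lratio_def[of v]
 proof (rule SUP_least)
 fix p assume p: "p:{p:D. \<rho> p <= q}"
 have "ereal (abs (v p) / scale Q q) <= ereal (abs (w p) / scale Q q)+ereal h" using d[of p] p se by (simp add: field_simps)
 also have "... <= lratio w q+ereal h" unfolding lratio_def by (intro add_right_mono SUP_upper p)
 finally show "ereal (abs (v p) / scale Q q) <= lratio w q+ereal h" .
 qed
 qed
 thus "lfun v <= lfun w+ereal h" unfolding lfun_def using b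
 by (intro Liminf_le_add) (auto simp: eventually_at_right_field intro!: exI[of _ "min b (min (1/2^(N+1)) (exp (- exp 1)))"])
qed

lemma lfun_negligible_eq:
 assumes c: "0<c" and ev: "\<forall>\<^sub>F K in sequentially. ALL p:ball_pts K. abs (v p-w p)<=2 powr (- (1 + c)*real K)"
 shows "lfun v = lfun w" using lfun_negligible[OF c ev] lfun_negligible[OF c, of w v] ev by (intro antisym) (auto simp: abs_minus_commute)

lemma trunc_tendsto: "(%n. T n p) \<longlonglongrightarrow> p"
proof -
 have m: "(%n. 1/2^nat (floor (real n/h))) \<longlonglongrightarrow> (0::real)" if h: "0<h" for h :: real using h by real_asymp
 have "(%n. tr (nat (floor (real n/H1))) (fst p)) \<longlonglongrightarrow> fst p" by (rule Lim_null_comparison[THEN LIM_zero_cancel, OF _ m[OF H1(1)]])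
 (use tr_diff[of "fst p"] in \<open>auto intro!: always_eventually simp: abs_minus_commute\<close>)
 moreover have "(%n. trv (nat (floor (real n/H2))) (snd p)) \<longlonglongrightarrow> snd p"
 by (rule Lim_null_comparison[THEN LIM_zero_cancel, OF _ tendsto_mult_right_zero[OF m[OF H2(1)], of "real DIM('a)"]])
 (use trv_diff[of "snd p"] in \<open>auto intro!: always_eventually simp: norm_minus_commute\<close>)
 ultimately have "(%n. (tr (nat (floor (real n/H1))) (fst p), trv (nat (floor (real n/H2))) (snd p))) \<longlonglongrightarrow> (fst p, snd p)" by (rule tendsto_Pair)
 thus ?thesis by (simp add: trunc_def)
qed

text \<open>Truncation does not increase \<open>\<rho>\<close> and converges to the point, so every
  point of a closed ball is a limit of points of \<open>D\<close> in the same ball, and continuity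
  identifies the suprema. Radii below \<open>a powr H1\<close> keep the time increment below
  \<open>a\<close>.\<close>

lemma lfun_continuous:
 assumes a: "0<a" and D: "D = {p:dyadics. abs (fst p) < a}" and v: "continuous_on {p. abs (fst p) < a} v"
 shows "Liminf (at_right 0) (%d. SUP (s, y)\<in>{(s, y). rho H1 H2 s y <= d}. ereal (abs (v (s, y)) / scale Q d)) = lfun v" unfolding lfun_def
proof (rule Liminf_eq)
 let ?A = "%d. SUP (s, y)\<in>{(s, y). rho H1 H2 s y <= d}. ereal (abs (v (s, y)) / scale Q d)"
 have "?A d = lratio v d" if e: "0<d" "d < min (a powr H1) (exp (- exp 1))" for d
 proof (rule antisym)
 have se: "0<scale Q d" by (rule ln_ln_pos(2)) (use e in auto)
 show "?A d <= lratio v d"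
 proof (rule SUP_least, safe)
 fix s and y :: 'a assume r: "rho H1 H2 s y <= d"
 define p where "p = (s, y)"
 have rp: "\<rho> p <= d" using r by (simp add: p_def dist_rho_def)
 hence pa: "abs (fst p) < a" using \<rho>_components(1)[of p "a powr H1"] e a H1 by (simp add: powr_powr)
 have Ta: "abs (fst (T n p)) < a" for n by (simp add: trunc_def le_less_trans[OF tr_le pa])
 have TD: "T n p:D" for n
 proof -
 have "T (max n n) p:dyadics" unfolding dyadics_def trunc_def
 by (auto intro!: exI[of _ "max (nat (floor (real n/H1))) (nat (floor (real n/H2)))"] tr_fixed_mono[of "nat (floor (real n/H1))"] trv_fixed_mono[of "nat (floor (real n/H2))"] tr_tr trv_trv)
 thus ?thesis using Ta[of n] by (simp add: D)
 qed
 have "(%n. v (T n p)) \<longlonglongrightarrow> v p" by (rule continuous_on_tendsto_compose[OF v trunc_tendsto]) (use pa Ta in auto)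
 hence lim: "(%n. ereal (abs (v (T n p)) / scale Q d)) \<longlonglongrightarrow> ereal (abs (v p) / scale Q d)" using se by (intro tendsto_intros) auto
 have bd: "ereal (abs (v (T n p)) / scale Q d) <= lratio v d" for n unfolding lratio_def by (rule SUP_upper) (use TD[of n] order.trans[OF T_\<rho>_le rp, of n] in simp)
 show "ereal (abs (v (s, y)) / scale Q d) <= lratio v d" by (metis LIMSEQ_le_const2[OF lim] bd p_def)
 qed
 show "lratio v d <= ?A d" unfolding lratio_def by (rule SUP_mono) (auto simp: dist_rho_def intro!: exI)
 qed
 thus "\<forall>\<^sub>F d in at_right 0. (?A d) = lratio v d" using a by (auto simp: eventually_at_right_field intro!: exI[of _ "min (a powr H1) (exp (- exp 1))"])
qed

end

definition lincomb :: "'i set => ('i => real) => ('i => 'w => real) => 'w => real" where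
 "lincomb J a Z w = (SUM l:J. a l*Z l w)"

lemma lincomb_measurable:
 assumes "J \<subseteq> I" "!!l. l:I ==> Z l:borel_measurable M" shows "lincomb J a Z:borel_measurable M"
 unfolding lincomb_def using assms by (intro borel_measurable_sum borel_measurable_times) auto

section \<open>The stationary increments field and the zero-one law\<close>

context grid
begin

section \<open>Increment functionals and negligible perturbations\<close>

definition "lf v = lfun (%p. v p-v 0)"

lemma lf_restrict: "lf (restrict v D) = lf v" unfolding lf_def by (rule lfun_cong) (use D_0 in auto)

lemma lf_measurable: "lf:borel_measurable (PiM D (%_. borel))"
proof -
 have "(%v. \<lambda>p\<in>D. v p-v 0):measurable (PiM D (%_. borel)) (PiM D (%_. borel :: real measure))" by rule (use D_0 in measurable)
 from measurable_compose[OF this lfun_measurable] show ?thesis unfolding lf_def by (rule measurable_cong[THEN iffD1, rotated]) (auto intro: lfun_cong)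
qed

lemma lf_family_measurable:
 assumes "gaussian_family P D X K" shows "(%w. lf (%p. X p w)):borel_measurable P"
proof -
 have "(%w. \<lambda>p\<in>D. X p w):measurable P (PiM D (%_. borel))" using gaussian_familyD(2)[OF assms] by simp
 from measurable_compose[OF this lf_measurable] show ?thesis by (simp add: lf_restrict)
qed

lemma lf_law:
 assumes "gaussian_family P D X K" "gaussian_family P' D X' K" and B: "B:sets borel"
 shows "\<P>(w in P. lf (%p. X p w):B) = \<P>(w in P'. lf (%p. X' p w):B)"
proof -
 have A: "lf -` B Int space (PiM D (%_. borel)):sets (PiM D (%_. borel :: real measure))" by (rule measurable_sets[OF lf_measurable B])
 show ?thesis using gaussian_family_law[OF assms(1,2) A] by (simp add: lf_restrict space_PiM)
qed

text \<open>A field whose increments are Lipschitz in mean square is negligible, since \<open>H1\<close> and \<open>H2\<close> are less than 1.\<close>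

definition "gp = min (1/H1-1) (1/H2-1)"

lemma gp_pos: "0<gp" using H1 H2 by (simp add: gp_def)

text \<open>A coordinate of size x is (x^h)^(1/h), and 1/h is at least 1 + gp. Dividing the
  coordinate by 2 brings it below 1, where exponents may be lowered.\<close>

lemma norm_le_\<rho>:
 assumes "p:ball_pts K" "q:ball_pts K" shows "norm (p-q) <= 2*2 powr (1/H1+1/H2)*\<rho> (p-q) powr (1+gp)"
proof -
 let ?A = "1/H1+1/H2"
 have b: "abs (fst r)<=1 & norm (snd r)<=1" if "r:ball_pts K" for r
 proof -
 have "\<rho> r < 1/2^K" using that by (simp add: ball_pts_def)
 also have "... <= 1" by simp
 finally show ?thesis using \<rho>_components[of r 1] by auto
 qed
 have c: "x<=2 powr ?A*\<rho> (p-q) powr (1+gp)" if x: "0<=x" "x<=2" "x powr h <= \<rho> (p-q)" and h: "0<h" "1+gp <= 1/h" "1/h <= 1/H1+1/H2" for x h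
 proof (cases "x = 0")
 case False
 have "h*(1+gp)<=1" using h by (simp add: field_simps)
 have "(x/2) powr 1<=(x/2) powr (h*(1+gp))" using x \<open>h * (1 + gp) <= 1\<close> by (intro powr_mono') auto
 also have "... = ((x/2) powr h) powr (1+gp)" by (simp add: powr_powr)
 also have "... <= \<rho> (p-q) powr (1+gp)"
 proof (rule powr_mono2)
 have "(x/2) powr h <= x powr h" using x h by (intro powr_mono2) auto
 thus "(x/2) powr h <= \<rho> (p-q)" using x by simp
 qed (use gp_pos in auto)
 finally have "x <= 2*\<rho> (p-q) powr (1+gp)" by simp
 also have "2<=2 powr ?A"
 proof -
 have "1<=1/H1" "0<=1/H2" using H1 H2 by auto
 hence "1<=1/H1+1/H2" by linarith
 from powr_mono[OF this, of 2] show ?thesis by simp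
 qed
 hence "2*\<rho> (p-q) powr (1+gp)<=2 powr ?A*\<rho> (p-q) powr (1+gp)" by (rule mult_right_mono) simp
 finally show ?thesis .
 qed simp
 have "norm (p-q) <= abs (fst (p-q))+norm (snd (p-q))" by (metis norm_Pair_le prod.collapse real_norm_def)
 moreover have "abs (fst (p-q))<=2 powr ?A*\<rho> (p-q) powr (1+gp)"
 by (rule c[of _ H1]) (use b[OF assms(1)] b[OF assms(2)] H1 H2 in "auto simp: dist_rho_def rho_def gp_def")
 moreover have "norm (snd (p-q))<=2 powr ?A*\<rho> (p-q) powr (1+gp)"
 by (rule c[of _ H2]) (use b[OF assms(1)] b[OF assms(2)] H1 H2 norm_triangle_ineq4[of "snd p" "snd q"] in \<open>auto simp: dist_rho_def rho_def gp_def\<close>)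
 ultimately show ?thesis by simp
qed

text \<open>\<open>large_deviation\<close> with exponent 1 + gp allows deviations of order 2^(-(1 +
  gp) n) on the n-th ball. The threshold concedes half of \<open>gp\<close>, which leaves failure
  probabilities geometric in n for Borel-Cantelli.\<close>

lemma lipschitz_negligible:
 fixes X :: "real*'a => 'w => real"
 assumes g: "gaussian_family P D X K" and C: "0<C" "!!p q. p:D ==> q:D ==> incr_var K p q <= (C*norm (p-q))^2"
 shows "AE w in P. \<forall>\<^sub>F n in sequentially. incr_le X n (2 powr (- (1+gp/2)*real n)) w"
proof -
 let ?A = "%m. 2 powr (- gp*real m)"
 interpret prob_space P by (rule gaussian_familyD[OF g])
 define \<theta> where "\<theta> = 1+gp"
 have th: "0<\<theta>" using gp_pos by (simp add: \<theta>_def)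
 obtain m :: nat where m: "Q < \<theta>*real m" using reals_Archimedean3[OF th] by (metis mult.commute)
 have m0: "0<m" using m Q_pos by cases auto
 define A where "A = C*(2*2 powr (1/H1+1/H2))"
 have A: "0<A" using C(1) by (simp add: A_def)
 obtain C' where C': "0<C'"
 "!!(P::'w measure) X Kf K A b. gaussian_family P D X Kf ==> 0<A ==> 0<b ==>
 (!!p q. p:ball_pts K ==> q:ball_pts K ==> incr_var Kf p q <= (A*\<rho> (p-q) powr \<theta>)^2) ==>
 1-C'*(A*2 powr (- \<theta>*real K)/b)^(2*m) <= \<P>(w in P. incr_le X K b w)"
 by (rule large_deviation[OF th m]) blast
 define b where "b n = 2 powr (- (1+gp/2)*real n)" for n
 define E where "E n = {w:space P. incr_le X n (b n) w}" for n
 have Em[measurable]: "E n:events" for n unfolding E_def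
 by (intro sets.sets_Collect_countable_All' predE increments_measurable[OF g]) (auto simp: ball_pts_def intro: countable_subset[OF _ ball_pts_countable(1)])
 have le: "measure P (space P-E n) <= C'*A^(2*m)*(?A m)^n" for n
 proof -
 have "1-C'*(A*2 powr (- \<theta>*real n)/b n)^(2*m) <= measure P (E n)" unfolding E_def
 proof (rule C'(2)[OF g A])
 fix p q assume pq: "p:ball_pts n" "q:ball_pts n"
 have "(C*norm (p-q))^2 <= (A*\<rho> (p-q) powr \<theta>)^2" using mult_left_mono[OF norm_le_\<rho>[OF pq], of C] C(1) by (simp add: A_def \<theta>_def)
 thus "incr_var K p q <= (A*\<rho> (p-q) powr \<theta>)^2" using C(2)[of p q] pq by (auto simp: ball_pts_def)
 qed (simp add: b_def)
 moreover have "(A*2 powr (- \<theta>*real n)/b n)^(2*m) = A^(2*m)*(?A m)^n"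
 proof -
 have "2 powr (- \<theta>*real n)/b n = 2 powr (- (gp/2)*real n)"
 unfolding b_def powr_diff[symmetric] by (rule arg_cong[where f="%x. 2 powr x"]) (simp add: \<theta>_def algebra_simps)
 hence "(A*2 powr (- \<theta>*real n)/b n)^(2*m) = A^(2*m)*(2 powr (- (gp/2)*real n))^(2*m)" by (simp only: times_divide_eq_right[symmetric] power_mult_distrib)
 also have "(2 powr (- (gp/2)*real n))^(2*m) = (?A m)^n" by (simp add: powr_realpow[symmetric] powr_powr mult_ac)
 finally show ?thesis .
 qed
 ultimately show ?thesis using prob_compl[OF Em[of n]] by simp
 qed
 have sm: "summable (%n. C'*A^(2*m)*(?A m)^n)" using gp_pos m0 by (intro summable_mult) (simp add: powr_less_one)
 have "summable (%n. measure P (space P-E n))" by (rule summable_comparison_test'[OF sm, of 0]) (use le in simp)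
 hence "AE w in P. \<forall>\<^sub>F n in sequentially. w:space P-(space P-E n)" by (intro borel_cantelli_AE1) (auto simp: less_top[symmetric])
 thus ?thesis by (auto elim!: eventually_mono simp: E_def b_def)
qed

end

locale points = spectral H \<alpha> \<beta> cS S for H \<alpha> \<beta> cS :: real and S :: "real*'a::euclidean_space => real" +
 fixes D :: "(real*'a) set"
 assumes D: "D \<subseteq> dyadics" "0:D" "!!n p. p:D ==> trunc H1 H2 n p:D"

sublocale points \<subseteq> G: grid H1 H2 D by unfold_locales (use H1 H2 D in auto)

context points
begin

section \<open>Covariances by sets of frequencies\<close>

definition "\<nu>S A = density lborel (%w::real*'a. ennreal (S w)*indicator A w)"

definition "KV A = l2_kernel (\<nu>S A) vf"

lemma nvar_mono: "nvar A p <= nvar UNIV p" unfolding nvar_def by (intro nn_integral_mono) (auto simp: indicator_def)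

lemma nn_integral_\<nu>S:
 assumes [measurable]: "A:sets borel" "f:bm"
 shows "nn_integral (\<nu>S A) (%w. ennreal (f w)) = nn_integral lborel (%w. ennreal (S w*f w)*indicator A w)"
 unfolding \<nu>S_def by (subst nn_integral_density) (auto simp: ennreal_mult' S_nonneg mult_ac)

lemma V_features:
 assumes [measurable]: "A:sets borel" shows "l2_features (\<nu>S A) UNIV vf"
proof -
 let ?A = "%p. \<integral>\<^sup>+w. ennreal ((cmod (vf p w))^2) \<partial>\<nu>S A"
 obtain B where B: "0<B" "!!p. nvar UNIV p <= ennreal ((B*dist_rho H1 H2 p)^2)" by (rule nvar_upper) blast
 have "integrable (\<nu>S A) (%w. (cmod (vf p w))^2)" for p
 proof (rule integrableI_nonneg)
 have "?A p < \<infinity>" using order.trans[OF nvar_mono B(2), of A p] unfolding nvar_def by (simp add: le_less_trans nn_integral_\<nu>S)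
 thus "?A p < \<infinity>" .
 qed (auto simp: \<nu>S_def)
 thus ?thesis by (auto simp: l2_features_def \<nu>S_def)
qed

text \<open>Stationarity of the increments: a common phase of modulus one factors out.\<close>

lemma vf_diff: "cmod (vf p w-vf q w) = cmod (vf (p-q) w)"
proof -
 have "vf p w-vf q w = phase q w * vf (p-q) w" by (simp add: vf_def phase_def cis_mult algebra_simps)
 thus ?thesis by (simp add: norm_mult phase_def)
qed

lemma KV_var:
 assumes [measurable]: "A:sets borel" and c: "nvar A (p-q) <= ennreal c" "0<=c"
 shows "incr_var (KV A) p q <= c"
proof -
 have "incr_var (KV A) p q = (LINT w|\<nu>S A. (cmod (vf p w-vf q w))^2)" unfolding KV_def by (rule l2_kernel_incr_var[OF V_features]) auto
 also have "... = enn2real (nn_integral (\<nu>S A) (%w. ennreal ((cmod (vf (p-q) w))^2)))" unfolding vf_diff by (rule integral_eq_nn_integral) (auto simp: \<nu>S_def)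
 finally show ?thesis using c unfolding nvar_def by (simp add: enn2real_leI nn_integral_\<nu>S)
qed

lemma KV_eq:
 assumes [measurable]: "A:sets borel"
 shows "KV A p q = (LINT w|lborel. indicator A w*(S w * Re (vf p w * cnj (vf q w))))"
 "integrable lborel (%w. indicator A w*(S w * Re (vf p w * cnj (vf q w))))"
proof -
 have d: "\<nu>S A = density lborel (%w. ennreal (indicator A w*S w))" unfolding \<nu>S_def by (intro arg_cong[where f="density lborel"]) (auto simp: indicator_def)
 show "KV A p q = (LINT w|lborel. indicator A w*(S w * Re (vf p w * cnj (vf q w))))"
 unfolding KV_def l2_kernel_def d by (subst integral_density) (auto simp: S_nonneg mult.assoc)
 have "integrable (\<nu>S A) (%w. Re (vf p w * cnj (vf q w)))" by (rule l2_integrable[OF V_features]) auto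
 thus "integrable lborel (%w. indicator A w*(S w * Re (vf p w * cnj (vf q w))))" unfolding d by (subst (asm) integrable_density) (auto simp: S_nonneg mult.assoc)
qed

text \<open>Disjoint sets of frequencies contribute additively to the covariance, hence the field
  may be realised as a sum of independent ones.\<close>

lemma KV_sum:
 assumes N: "finite N" and A: "!!n. n:N ==> A n:sets borel" and dis: "disjoint_family_on A N"
 shows "(SUM n:N. KV (A n) p q) = KV (UN n:N. A n) p q"
proof -
 have U: "(UN n:N. A n):sets borel" using A N by auto
 have "(SUM n:N. KV (A n) p q) = (LINT w|lborel. (SUM n:N. indicator (A n) w*(S w * Re (vf p w * cnj (vf q w)))))" using KV_eq[OF A] by simp
 also have "... = KV (UN n:N. A n) p q" unfolding KV_eq(1)[OF U] indicator_UN_disjoint[OF N dis] sum_distrib_right ..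
 finally show ?thesis .
qed

lemma KV_split: assumes A: "A:sets borel" shows "KV UNIV p q = KV A p q+KV (- A) p q"
proof -
 have "(SUM b:{True, False}. KV (if b then A else-A) p q) = KV (UN b:{True, False}. if b then A else-A) p q" by (rule KV_sum) (use A in "auto simp: disjoint_family_on_def")
 thus ?thesis by simp
qed

lemma V_exists:
 assumes "A:sets borel" obtains X where "gaussian_family (PiM UNIV (%_::nat. N01)) D X (KV A)"
proof -
 have "l2_features (\<nu>S A) D vf" using V_features[OF assms] unfolding l2_features_def by auto
 from l2_gaussian_exists[OF this G.ball_pts_countable(1)] D(2) that show ?thesis unfolding KV_def by auto
qed

lemma low_negligible:
 fixes X :: "real*'a => 'w => real"
 assumes g: "gaussian_family P D X (KV (low L))"
 shows "AE w in P. \<forall>\<^sub>F n in sequentially. G.incr_le X n (2 powr (- (1+G.gp/2)*real n)) w"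
proof -
 obtain C where "0<C" "!!p. nvar (low L) p <= ennreal ((C*norm p)^2)" by (rule nvar_lipschitz[of L]) blast
 thus ?thesis by (intro G.lipschitz_negligible[OF g, of C] KV_var) auto
qed

text \<open>As \<open>vf 0\<close> vanishes, the diagonal is the variance of the increment from the
  origin; off the diagonal, a product of features is at most the mean of the squares.\<close>

lemma KV_high_small:
 obtains C where "0<C" "!!L p q. abs (KV (- low L) p q) <= C*2 powr (- 2*L)"
proof -
 obtain C where C: "0<C" "!!L p. nvar (- low L) p <= ennreal (C*2 powr (- 2*L))" by (rule nvar_high) blast
 have d: "KV (- low L) p p <= C*2 powr (- 2*L)" for L p
 proof -
 have [simp]: "vf 0 = (%_. 0)" by (simp add: vf_def phase_def fun_eq_iff)
 have "incr_var (KV (- low L)) p 0<=C*2 powr (- 2*L)" by (rule KV_var) (use C in auto)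
 thus ?thesis by (simp add: incr_var_def KV_def l2_kernel_def)
 qed
 have "abs (KV (- low L) p q) <= C*2 powr (- 2*L)" for L p q
 proof -
 have l: "- low L:sets borel" by simp
 note f = V_features[OF l]
 have "abs (KV (- low L) p q) <= (LINT w|\<nu>S (- low L). abs (Re (vf p w * cnj (vf q w))))" unfolding KV_def l2_kernel_def by simp
 also have "... <= (LINT w|\<nu>S (- low L). ((cmod (vf p w))^2+(cmod (vf q w))^2)/2)"
 proof (rule integral_mono)
 fix w
 have "abs (Re (vf p w * cnj (vf q w))) <= cmod (vf p w) * cmod (vf q w)" by (metis abs_Re_le_cmod complex_mod_cnj norm_mult)
 thus "abs (Re (vf p w * cnj (vf q w))) <= ((cmod (vf p w))^2+(cmod (vf q w))^2)/2" using sum_squares_bound[of "cmod (vf p w)" "cmod (vf q w)"] by simp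
 qed (use l2_featuresD(2)[OF f] l2_integrable[OF f] in auto)
 finally show ?thesis using l2_featuresD(2)[OF f] d[of L p] d[of L q] by (simp add: KV_def l2_kernel_def cmod_power2) (simp add: power2_eq_square)
 qed
 thus ?thesis using that C(1) by simp
qed

text \<open>On a product space the field is split into low and high frequencies. The low part is
  negligible for the lower limit, so the event depends on the high part alone, while the high part
  of any finite linear combination tends to 0 as the cut-off grows. Hence the event is independent
  of every such combination, thus of the whole field and of itself.\<close>

lemma zero_one:
 fixes X :: "real*'a => 'w => real"
 assumes g: "gaussian_family P D X (KV UNIV)" and B: "B:sets (borel :: ereal measure)"
 shows "\<P>(w in P. G.lf (%p. X p w):B):{0, 1}"
proof -
 let ?E = "%Y w. \<lambda>i\<in>D. Y i w"
 let ?D = "%q L. 2-2*exp (- q (KV (- low L))/2)"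
 let ?C = "%q L. - q (KV (low L))/2"
 let ?B = "%w. \<lambda>i\<in>D. X i w"
 let ?A = "PiM D (%_. borel)"
 interpret prob_space P by (rule gaussian_familyD[OF g])
 define E where "E = {w:space P. G.lf (%p. X p w):B}"
 note [measurable] = G.lf_family_measurable[OF g] gaussian_familyD(2)[OF g] B
 have Em[measurable]: "E:events" unfolding E_def by simp
 have fact: "(LINT w|P. indicator E w * cis (SUM l:J. a l*X l w)) = of_real (prob E)*(LINT w|P. cis (SUM l:J. a l*X l w))" if J: "finite J" "J \<subseteq> D" for J a
 proof -
 define q where "q K = (SUM i:J. SUM j:J. a i*a j*K i j)" for K :: "real*'a => real*'a => real"
 obtain C where C: "0<C" "!!L p q. abs (KV (- low L) p q) <= C*2 powr (- 2*L)" by (rule KV_high_small) blast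
 have qh: "(%L. q (KV (- low (real L)))) \<longlonglongrightarrow> 0"
 proof -
 have "(%L. KV (- low (real L)) i j) \<longlonglongrightarrow> 0" for i j
 proof (rule Lim_null_comparison)
 show "(%L. C*2 powr (- 2*real L)) \<longlonglongrightarrow> 0" by real_asymp
 qed (use C(2) in "auto intro!: always_eventually")
 hence "(%L. q (KV (- low (real L)))) \<longlonglongrightarrow> (SUM i:J. SUM j:J. a i*a j*0)" unfolding q_def by (intro tendsto_intros)
 thus ?thesis by simp
 qed
 have qs: "q (KV UNIV) = q (KV (low L))+q (KV (- low L))" for L unfolding q_def by (simp add: KV_split[OF low_measurable[of L]] distrib_left sum.distrib)
 \<comment> \<open>The error of the factorisation at cut-off \<open>L\<close> is at most the L2 norm
   of exp (i Z) - 1, with Z the high part of the combination, and this is computed from the variance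
   of Z.\<close>
 have bound: "norm ((LINT w|P. indicator E w * cis (SUM l:J. a l*X l w)) - of_real (prob E)*exp (?C q L))
 <= sqrt (?D q L)" for L
 proof -
 obtain XL where XL: "gaussian_family (PiM UNIV (%_::nat. N01)) D XL (KV (low L))" by (rule V_exists[OF low_measurable]) blast
 have lm: "- low L:sets borel" by simp
 obtain XH where XH: "gaussian_family (PiM UNIV (%_::nat. N01)) D XH (KV (- low L))" by (rule V_exists[OF lm]) blast
 let ?P = "PiM UNIV (%_::nat. N01)"
 interpret P0: prob_space ?P by (rule gaussian_familyD[OF XL])
 interpret PP: pair_prob_space ?P ?P ..
 define Y where "Y i w = XL i (fst w)+XH i (snd w)" for i w
 have gY: "gaussian_family (?P \<Otimes>\<^sub>M ?P) D Y (KV UNIV)" using gaussian_family_sum[OF XL XH] unfolding Y_def KV_split[OF low_measurable[of L]] .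
 define EH where "EH = {w:space ?P. G.lf (%p. XH p w):B}"
 note [measurable] = G.lf_family_measurable[OF gY] G.lf_family_measurable[OF XH] gaussian_familyD(2)[OF XL] gaussian_familyD(2)[OF XH] gaussian_familyD(2)[OF gY]
 have EHm[measurable]: "EH:sets ?P" unfolding EH_def by simp
 have ae: "AE w in ?P \<Otimes>\<^sub>M ?P. G.lf (%p. Y p w) = G.lf (%p. XH p (snd w))"
 proof -
 have "AE w in distr (?P \<Otimes>\<^sub>M ?P) ?P fst. \<forall>\<^sub>F n in sequentially. G.incr_le XL n (2 powr (- (1+G.gp/2)*real n)) w"
 unfolding P0.distr_pair_fst by (rule low_negligible[OF XL])
 hence "AE w in ?P \<Otimes>\<^sub>M ?P. \<forall>\<^sub>F n in sequentially. ALL p:G.ball_pts n. abs (XL p (fst w)-XL 0 (fst w))<=2 powr (- (1+G.gp/2)*real n)"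
 by (rule AE_distrD[rotated]) simp
 thus ?thesis
 proof eventually_elim
 case (elim w)
 show ?case unfolding G.lf_def by (rule G.lfun_negligible_eq[of "G.gp/2"]) (use elim G.gp_pos in "auto simp: Y_def algebra_simps")
 qed
 qed
 have I1: "(LINT w|P. indicator E w * cis (lincomb J a X w)) = (LINT w|(?P \<Otimes>\<^sub>M ?P). indicator EH (snd w) * cis (lincomb J a Y w))"
 proof -
 have r: "indicator E w = (if G.lf (\<lambda>i\<in>D. X i w):B then 1 else (0::complex))" if "w:space P" for w using that by (simp only: E_def G.lf_restrict) simp
 define \<Phi> where "\<Phi> v = (if G.lf v:B then 1 else 0) * cis (SUM l:J. a l * v l)" for v :: "real*'a => real"
 have \<Phi>[measurable]: "\<Phi>:borel_measurable ?A"
 proof -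
 have [measurable]: "G.lf:borel_measurable ?A" by (rule G.lf_measurable)
 have [measurable]: "(%v. SUM l:J. a l * v l):borel_measurable (PiM D (%_. borel :: real measure))" using J by (intro borel_measurable_sum) auto
 show ?thesis unfolding \<Phi>_def by simp
 qed
 have mX: "?B:measurable P ?A" "(%w. \<lambda>i\<in>D. Y i w):measurable (?P \<Otimes>\<^sub>M ?P) ?A" by auto
 have d: "distr P ?A ?B = distr (?P \<Otimes>\<^sub>M ?P) ?A (%w. \<lambda>i\<in>D. Y i w)"
 by (rule family_law_unique) (use gaussian_familyD[OF g] gaussian_familyD[OF gY] in auto)
 have "(LINT w|P. indicator E w * cis (lincomb J a X w)) = (LINT w|P. \<Phi> (\<lambda>i\<in>D. X i w))"
 by (intro lint_cong) (use J in "auto simp: \<Phi>_def r lincomb_def subset_eq intro!: sum.cong")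
 also have "... = (LINT w|(?P \<Otimes>\<^sub>M ?P). \<Phi> (?E Y w))" using arg_cong[OF d, of "%M. integral\<^sup>L M \<Phi>"] by (simp add: integral_distr)
 also have "... = (LINT w|(?P \<Otimes>\<^sub>M ?P). indicator EH (snd w) * cis (lincomb J a Y w))"
 proof (rule integral_cong_AE)
 show "(%w. \<Phi> (?E Y w)):borel_measurable (?P \<Otimes>\<^sub>M ?P)" by simp
 have [measurable]: "lincomb J a Y:borel_measurable (?P \<Otimes>\<^sub>M ?P)" by (rule lincomb_measurable[OF J(2)]) measurable
 show "(%w. indicator EH (snd w) * cis (lincomb J a Y w)):borel_measurable (?P \<Otimes>\<^sub>M ?P)" by simp
 show "AE w in ?P \<Otimes>\<^sub>M ?P. \<Phi> (?E Y w) = indicator EH (snd w) * cis (lincomb J a Y w)" using ae AE_space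
 proof eventually_elim
 case (elim w)
 have "lincomb J a Y w = (SUM l:J. a l*?E Y w l)" unfolding lincomb_def using J by (intro sum.cong) auto
 thus ?case using elim by (simp add: \<Phi>_def EH_def G.lf_restrict space_pair_measure mem_Times_iff)
 qed
 qed
 finally show ?thesis .
 qed
 have smH[measurable]: "lincomb J a XH:borel_measurable ?P" and smL[measurable]: "lincomb J a XL:borel_measurable ?P" by (rule lincomb_measurable[OF J(2)]; measurable)+
 have "(LINT w|(?P \<Otimes>\<^sub>M ?P). indicator EH (snd w) * cis (lincomb J a Y w)) = (LINT w|(?P \<Otimes>\<^sub>M ?P). cis (lincomb J a XL (fst w))*(indicator EH (snd w) * cis (lincomb J a XH (snd w))))"
 by (intro lint_cong refl) (simp add: lincomb_def Y_def distrib_left sum.distrib cis_mult[symmetric])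
 also have "... = (LINT u|?P. cis (lincomb J a XL u))*(LINT v|?P. indicator EH v * cis (lincomb J a XH v))" by (simp add: norm_mult indicator_def PP.integral_fst'[symmetric] PP.integrable_const_bound[where B=1])
 finally have I2: "(LINT w|P. indicator E w * cis (lincomb J a X w)) = of_real (exp (?C q L))*(LINT v|?P. indicator EH v * cis (lincomb J a XH v))" using I1 unfolding lincomb_def q_def by (simp add: gaussian_familyD(3)[OF XL J])
 have pE: "prob E = measure ?P EH"
 proof -
 have "prob E = measure (?P \<Otimes>\<^sub>M ?P) {w:space (?P \<Otimes>\<^sub>M ?P). G.lf (%p. Y p w):B}" unfolding E_def by (rule G.lf_law[OF g gY B])
 also have "... = measure (?P \<Otimes>\<^sub>M ?P) {w:space (?P \<Otimes>\<^sub>M ?P). snd w:EH}"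
 proof (rule measure_eq_AE)
 show "AE w in ?P \<Otimes>\<^sub>M ?P. (w:{w:space (?P \<Otimes>\<^sub>M ?P). G.lf (%p. Y p w):B}) = (w:{w:space (?P \<Otimes>\<^sub>M ?P). snd w:EH})"
 using ae by eventually_elim (auto simp: EH_def space_pair_measure)
 qed measurable
 also have "{w:space (?P \<Otimes>\<^sub>M ?P). snd w:EH} = space ?P \<times> EH" using sets.sets_into_space[OF EHm] by (auto simp: space_pair_measure)
 finally show ?thesis by (simp add: measure_def P0.emeasure_pair_measure_Times[OF sets.top EHm] P0.emeasure_space_1)
 qed
 have iE: "integrable ?P (%v. indicator EH v * cis (lincomb J a XH v))" "integrable ?P (%v. cis (lincomb J a XH v))" "integrable ?P (%v. indicator EH v :: complex)"
 by (rule P0.integrable_const_bound[where B=1]; auto simp: indicator_def)+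
 have "norm ((LINT v|?P. indicator EH v * cis (lincomb J a XH v)) - of_real (measure ?P EH)) = norm (LINT v|?P. indicator EH v * (cis (lincomb J a XH v)-1))"
 proof -
 have "(LINT v|?P. (indicator EH v :: complex)) = (LINT v|?P. of_real (indicator EH v))" by (intro lint_cong refl) (simp add: indicator_def)
 also have "... = of_real (LINT v|?P. indicat_real EH v)" by simp
 finally show ?thesis using iE by (simp add: right_diff_distrib)
 qed
 also have "... <= (LINT v|?P. norm (indicator EH v * (cis (lincomb J a XH v)-1)))" by simp
 also have "... <= (LINT v|?P. cmod (cis (lincomb J a XH v)-1))"
 proof -
 have "cmod (cis x-1)<=2" for x using norm_triangle_ineq4[of "cis x" 1] by simp
 thus ?thesis by (intro integral_mono) (auto intro!: P0.integrable_const_bound[where B=2] simp: indicator_def)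
 qed
 also have "... <= sqrt (LINT v|?P. (cmod (cis (lincomb J a XH v)-1))^2)"
 proof (rule real_le_rsqrt)
 have c4: "cmod (cis x-1)<=4" for x using norm_triangle_ineq4[of "cis x" 1] by simp
 have i1: "integrable ?P (%v. cmod (cis (lincomb J a XH v)-1))" "integrable ?P (%v. (cmod (cis (lincomb J a XH v)-1))^2)"
 by (auto intro!: P0.integrable_const_bound[where B=4] norm_cis_diff(2) simp: c4)
 have "0<=P0.variance (%v. cmod (cis (lincomb J a XH v)-1))" by simp
 thus "(LINT v|?P. cmod (cis (lincomb J a XH v)-1))^2 <= (LINT v|?P. (cmod (cis (lincomb J a XH v)-1))^2)" using P0.variance_eq[OF i1] by simp
 qed
 also have "(LINT v|?P. (cmod (cis (lincomb J a XH v)-1))^2) = (LINT v|?P. 2-2 * Re (cis (lincomb J a XH v)))" by (simp add: cmod_power2) (simp add: power2_eq_square algebra_simps)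
 finally have I3: "norm ((LINT v|?P. indicator EH v * cis (lincomb J a XH v)) - of_real (prob E)) <= sqrt (?D q L)" using iE(2) integral_Re[OF iE(2)] integrable_Re[OF iE(2)] unfolding lincomb_def q_def by (simp add: P0.prob_space pE gaussian_familyD(3)[OF XH J])
 have "exp (?C q L)<=1" using gaussian_family_psd[OF XL J, of a] by (simp add: q_def)
 have "norm ((LINT w|P. indicator E w * cis (lincomb J a X w)) - of_real (prob E)*exp (?C q L))
 = exp (?C q L)*norm ((LINT v|?P. indicator EH v * cis (lincomb J a XH v)) - of_real (prob E))"
 unfolding I2 by (subst (2) mult.commute) (simp add: right_diff_distrib[symmetric] norm_mult)
 also have "... <= 1 * sqrt (?D q L)" by (intro mult_mono I3) (use \<open>exp (?C q L) <= 1\<close> in auto)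
 finally show ?thesis by (simp add: lincomb_def)
 qed
 have qlow: "q (KV (low L)) = q (KV UNIV)-q (KV (- low L))" for L using qs[of L] by simp
 have "(%L. norm ((LINT w|P. indicator E w * cis (SUM l:J. a l*X l w)) - of_real (prob E)*exp (- q (KV (low (real L)))/2)))
 \<longlonglongrightarrow> norm ((LINT w|P. indicator E w * cis (SUM l:J. a l*X l w)) - of_real (prob E)*exp (- (q (KV UNIV)-0)/2))"
 unfolding qlow by (intro tendsto_intros qh) auto
 moreover have "(%L. sqrt (2-2*exp (- q (KV (- low (real L)))/2))) \<longlonglongrightarrow> sqrt (2-2*exp (- 0/2))" by (intro tendsto_intros qh) auto
 ultimately have "norm ((LINT w|P. indicator E w * cis (SUM l:J. a l*X l w)) - of_real (prob E)*exp (- (q (KV UNIV)-0)/2)) <= sqrt (2-2*exp (- 0/2))"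
 by (rule LIMSEQ_le) (use bound in auto)
 thus ?thesis using gaussian_familyD(3)[OF g J, of a] by (simp add: q_def)
 qed
 let ?M = "density P (%w. ennreal (indicator E w))" and ?M' = "density P (%w. ennreal (prob E))"
 have fin: "finite_measure ?M" "finite_measure ?M'"
 by (rule bounded_density(1)[OF finite_measure_axioms, of "%_. 0" _ UNIV]; use prob_le_1[of E] in \<open>auto simp: indicator_def intro: order.trans[of _ 1]\<close>)+
 \<comment> \<open>The field has the same joint law under \<open>P\<close> restricted to the event
   and under \<open>P\<close> scaled by its probability; on the event itself this reads p =
   p^2.\<close>
 have law: "distr ?M ?A ?B = distr ?M' ?A ?B"
 proof (rule family_law_unique[OF fin])
 fix J and a :: "real*'a => real" assume J: "finite J" "J \<subseteq> D"
 have [measurable]: "(%w. SUM l:J. a l*X l w):borel_measurable P" using J by (intro borel_measurable_sum) auto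
 show "(LINT w|?M. cis (SUM l:J. a l*X l w)) = (LINT w|?M'. cis (SUM l:J. a l*X l w))"
 using fact[OF J, of a] by (subst (1 2) integral_density) (auto simp: scaleR_conv_of_real of_real_indicator)
 qed auto
 define A where "A = G.lf -` B Int space (PiM D (%_. borel :: real measure))"
 have A[measurable]: "A:sets ?A" unfolding A_def by (rule measurable_sets[OF G.lf_measurable B])
 have vA: "?B -` A Int space P = E" by (auto simp: A_def E_def G.lf_restrict space_PiM)
 have "emeasure ?M E = emeasure ?M' E" using arg_cong[OF law, of "%M. emeasure M A"] by (simp add: emeasure_distr vA)
 moreover have "emeasure ?M E = ennreal (prob E)" by (simp add: emeasure_density emeasure_eq_measure[symmetric] cong:)
 (auto simp: indicator_def intro!: nn_integral_cong simp flip: nn_integral_indicator)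
 moreover have "emeasure ?M' E = ennreal (prob E*prob E)" by (simp add: emeasure_density_const emeasure_eq_measure ennreal_mult)
 ultimately show ?thesis unfolding E_def[symmetric] by simp
qed

text \<open>By \<open>zero_one\<close> the distribution function of the functional takes only the
  values 0 and 1. One reference family decides the constant, as the functional has the same law for
  all families with this covariance.\<close>

lemma lf_constant:
 obtains \<kappa> :: ereal where "!!(P::'w measure) X. gaussian_family P D X (KV UNIV) ==> AE w in P. G.lf (%p. X p w) = \<kappa>"
proof -
 obtain X0 where g0: "gaussian_family (PiM UNIV (%_::nat. N01)) D X0 (KV UNIV)" by (rule V_exists[of UNIV]) auto
 let ?P = "PiM UNIV (%_::nat. N01)"
 interpret P0: prob_space ?P by (rule gaussian_familyD[OF g0])
 define L where "L w = G.lf (%p. X0 p w)" for w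
 have Lm[measurable]: "L:borel_measurable ?P" unfolding L_def by (rule G.lf_family_measurable[OF g0])
 have zo: "measure ?P {w:space ?P. L w <= c}:{0, 1}" for c using zero_one[OF g0, of "{..c}"] by (simp add: L_def)
 \<comment> \<open>The jump of the distribution function. It may be infinite at this stage; bounds
   follow separately.\<close>
 define \<kappa> where "\<kappa> = Inf {c. measure ?P {w:space ?P. L w <= c} = 1}"
 have "AE w in ?P. ALL r::rat. (\<kappa> < ereal (real_of_rat r) --> L w <= ereal (real_of_rat r)) & (ereal (real_of_rat r) < \<kappa> --> ~ L w <= ereal (real_of_rat r))"
 unfolding AE_all_countable
 proof
 fix r :: rat
 let ?r = "ereal (real_of_rat r)"
 consider "\<kappa> < ?r" | "?r < \<kappa>" | "\<kappa> = ?r" by (metis linorder_less_linear)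
 thus "AE w in ?P. (\<kappa> < ?r --> L w <= ?r) & (?r < \<kappa> --> ~ L w <= ?r)"
 proof cases
 case 1
 then obtain c where c: "measure ?P {w:space ?P. L w <= c} = 1" "c < ?r" unfolding \<kappa>_def by (auto simp: Inf_less_iff)
 have aec: "AE w in ?P. L w <= c" using c(1) by (subst (asm) P0.prob_Collect_eq_1) auto
 show ?thesis by (rule eventually_mono[OF aec]) (use 1 c(2) in auto)
 next
 case 2
 have "measure ?P {w:space ?P. L w <= ?r} ~= 1"
 proof
 assume "measure ?P {w:space ?P. L w <= ?r} = 1"
 hence "\<kappa> <= ?r" unfolding \<kappa>_def by (intro Inf_lower) simp
 thus False using 2 by simp
 qed
 hence aec: "AE w in ?P. ~ L w <= ?r" using zo[of ?r] P0.prob_Collect_eq_0 by simp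
 show ?thesis by (rule eventually_mono[OF aec]) (use 2 in auto)
 qed simp
 qed
 hence ae: "AE w in ?P. L w = \<kappa>"
 proof eventually_elim
 case (elim w)
 show ?case
 proof (rule antisym)
 show "L w <= \<kappa>" using ereal_dense3[of \<kappa> "L w"] elim by (metis not_le)
 show "\<kappa> <= L w" using ereal_dense3[of "L w" \<kappa>] elim by force
 qed
 qed
 have "AE w in P. G.lf (%p. X p w) = \<kappa>" if g: "gaussian_family P D X (KV UNIV)" for P :: "'w measure" and X
 proof -
 interpret prob_space P by (rule gaussian_familyD[OF g])
 note [measurable] = G.lf_family_measurable[OF g]
 have "\<P>(w in P. G.lf (%p. X p w):{\<kappa>}) = measure ?P {w:space ?P. G.lf (%p. X0 p w):{\<kappa>}}" by (rule G.lf_law[OF g g0]) simp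
 also have "... = 1" using ae Lm unfolding L_def by (subst P0.prob_Collect_eq_1) auto
 finally show ?thesis by (subst (asm) prob_Collect_eq_1) auto
 qed
 thus ?thesis using that by auto
qed

end

section \<open>Finiteness of the constant\<close>

context grid
begin

text \<open>By concavity x^h is at least x (a + b)^h/(a + b) for x up to a + b; the cases x = a and
  x = b are added. This makes \<open>\<rho>\<close> subadditive.\<close>

lemma powr_subadditive: assumes "0<h" "h<1" "0<=a" "0<=b" shows "(a+b) powr h <= a powr h+b powr (h::real)"
proof (cases "a = 0 \<or> b = 0")
 case False
 hence ab: "0<a" "0<b" using assms by auto
 have *: "x*(a+b) powr h/(a+b) <= x powr h" if "0<x" "x <= a+b" for x
 proof -
 have "x powr (1-h) <= (a+b) powr (1-h)" using that assms by (intro powr_mono2) auto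
 from mult_right_mono[OF this, of "x powr h*(a+b) powr h"]
 have "(x powr (1-h)*x powr h)*(a+b) powr h <= x powr h*((a+b) powr (1-h)*(a+b) powr h)" by (simp add: mult_ac)
 thus ?thesis using that ab unfolding powr_add[symmetric] by (simp add: pos_divide_le_eq)
 qed
 have "(a+b) powr h = a*(a+b) powr h/(a+b)+b*(a+b) powr h/(a+b)" by (simp add: add_divide_distrib[symmetric] distrib_right[symmetric])
 thus ?thesis using *[of a] *[of b] ab by simp
qed (use assms in auto)

lemma \<rho>_diff_le: "\<rho> (p-q) <= \<rho> p+\<rho> q"
proof -
 have "abs (fst p-fst q) powr H1 <= (abs (fst p)+abs (fst q)) powr H1" using H1 by (intro powr_mono2) auto
 also have "... <= abs (fst p) powr H1+abs (fst q) powr H1" using H1 by (intro powr_subadditive) auto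
 finally have 1: "abs (fst p-fst q) powr H1 <= abs (fst p) powr H1+abs (fst q) powr H1" .
 have "norm (snd p-snd q) powr H2 <= (norm (snd p)+norm (snd q)) powr H2" using H2 by (intro powr_mono2 norm_triangle_ineq4) auto
 also have "... <= norm (snd p) powr H2+norm (snd q) powr H2" using H2 by (intro powr_subadditive) auto
 finally show ?thesis using 1 by (simp add: dist_rho_def rho_def)
qed

end

context points
begin

section \<open>Annuli of frequencies at quadratically spaced scales\<close>

lemma low_mono: "L <= L' ==> low L \<subseteq> low L'"
proof -
 assume L: "L <= L'"
 have "2 powr (L/H1)<=2 powr (L'/H1)" "2 powr (L/H2)<=2 powr (L'/H2)" using L H1 H2 by (auto intro!: divide_right_mono)
 thus ?thesis by (auto simp: low_def simp del: powr_le_cancel_iff)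
qed

text \<open>The level n^2 belongs to the scale 2^(-n^2), with a margin n on either side. The margins
  make all other frequencies exponentially small in n at that scale, and the upper end n (n + 1) is
  the lower end of the next annulus.\<close>

definition "annulus n = low (real n*(real n+1))-low (real n*(real n-1))"

lemma annulus_measurable[measurable]: "annulus n:sets borel" unfolding annulus_def by simp

lemma annulus_disjoint: assumes "n ~= m" shows "annulus n Int annulus m = {}"
proof -
 have "annulus n Int annulus m = {}" if "n < m" for n m :: nat
 proof -
 have "real n*(real n+1) <= (real m-1)*real m" using that by (simp add: mult_mono)
 hence "low (real n*(real n+1)) \<subseteq> low (real m*(real m-1))" by (intro low_mono) (simp add: mult.commute)
 thus ?thesis unfolding annulus_def by auto
 qed
 thus ?thesis using assms by (metis inf_commute linorder_neqE_nat)
qed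

text \<open>On the ball of radius 2^(-n^2), frequencies below the annulus gain by
  \<open>nvar_low\<close> and those above by \<open>nvar_high\<close>, each a factor exponential in
  n. A uniform bound alone cannot drive chaining; the geometric mean with \<open>nvar_upper\<close>
  keeps half a power of the distance and half of the gain.\<close>

lemma complement_deviation:
 obtains C q N where "0<C" "0<q" "q<1"
 "!!(P::'w measure) X n. N <= n ==> gaussian_family P D X (KV (- annulus n)) ==>
 1-C*q^n <= \<P>(w in P. G.incr_le X (n^2) (2 powr (- real (n^2))*2 powr (- (min gap 1/4)*real n)) w)"
proof -
 let ?F = "%n. low (real n*(real n-1))"
 let ?E = "%n. real n*(real n+1)"
 let ?D = "%n. KV (- annulus n)"
 let ?C = "%K n. - 2*(real K-1)-2*gap*((real K-1)-real n*(real n-1))"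
 let ?B = "%K. - (1/2)*real K"
 let ?A = "%g n. - (g/4)*real n"
 define g where "g = min gap 1"
 have g: "0<g" "g <= gap" "g<=1" using gap_pos by (auto simp: g_def)
 obtain Ch where Ch: "0<Ch" "!!L p. nvar (- low L) p <= ennreal (Ch*2 powr (- 2*L))" by (rule nvar_high) blast
 obtain Cl where Cl: "0<Cl" "!!L K p. dist_rho H1 H2 p<=2 powr (- K) ==> L <= K ==> nvar (low L) p <= ennreal (Cl*2 powr (- 2*K-2*gap*(K-L)))" by (rule nvar_low) blast
 obtain A where A: "0<A" "!!p. nvar UNIV p <= ennreal ((A*dist_rho H1 H2 p)^2)" by (rule nvar_upper) blast
 define E where "E = sqrt (Ch+Cl*2 powr (2+2*gap))"
 have E: "0<E" "E^2 = Ch+Cl*2 powr (2+2*gap)" using Ch(1) Cl(1) by (auto simp: E_def add_pos_pos)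
 \<comment> \<open>The factor 1/2 is the power of the distance that survives the interpolation
   below.\<close>
 obtain m :: nat where m: "G.Q < 1/2*real m"
 proof -
 obtain m :: nat where "2*G.Q < real m" using reals_Archimedean2 by auto
 thus ?thesis by (intro that[of m]) linarith
 qed
 have m0: "0<m" using m G.Q_pos by simp
 obtain C' where C': "0<C'"
 "!!(P::'w measure) X Kf K A b. gaussian_family P D X Kf ==> 0<A ==> 0<b ==>
 (!!p q. p:G.ball_pts K ==> q:G.ball_pts K ==> incr_var Kf p q <= (A*dist_rho H1 H2 (p-q) powr (1/2))^2) ==>
 1-C'*(A*2 powr (?B K)/b)^(2*m) <= \<P>(w in P. G.incr_le X K b w)"
 by (rule G.large_deviation[OF _ m]) auto
 define q where "q = 2 powr (- g*real m/2)"
 have q: "0<q" "q<1" using g m0 by (auto simp: q_def powr_less_one)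
 have "1-C' * sqrt (E*A)^(2*m)*q^n <= \<P>(w in P. G.incr_le X (n^2) (2 powr (- real (n^2))*2 powr (?A g n)) w)"
 if n: "1<=n" and gf: "gaussian_family P D X (?D n)" for P :: "'w measure" and X n
 proof -
 define K where "K = n^2"
 define A' where "A' = sqrt (E*A)*2 powr (- (real K+g*real n)/2)"
 have KA: "- annulus n:sets borel" by simp
 have EA: "0<sqrt (E*A)" using E(1) A(1) by simp
 have var: "incr_var (?D n) p r <= (A'*dist_rho H1 H2 (p-r) powr (1/2))^2" if pr: "p:G.ball_pts K" "r:G.ball_pts K" for p r
 proof -
 define R where "R = dist_rho H1 H2 (p-r)"
 have R0: "0<=R" by (simp add: R_def G.\<rho>_nonneg)
 have R: "R<=2 powr (- (real K-1))" using G.\<rho>_diff_le[of p r] pr by (simp add: R_def G.ball_pts_def powr_diff powr_realpow)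
 have nn: "nvar (- annulus n) (p-r) <= nvar (?F n) (p-r)+nvar (- low (?E n)) (p-r)"
 unfolding nvar_def by (subst nn_integral_add[symmetric]) (auto intro!: nn_integral_mono simp: indicator_def annulus_def)
 have "nvar (?F n) (p-r) <= ennreal (Cl*2 powr (?C K n))" using n by (intro Cl(2) R[unfolded R_def]) (simp add: K_def power2_eq_square algebra_simps)
 also have "... <= ennreal (Cl*2 powr (2+2*gap)*2 powr (- 2*(real K+g*real n)))"
 proof -
 have "2 powr (?C K n)<=2 powr (2+2*gap)*2 powr (- 2*(real K+g*real n))" using mult_right_mono[OF g(2), of "real n"] unfolding powr_add[symmetric] by (simp add: K_def power2_eq_square algebra_simps)
 from mult_left_mono[OF this, of Cl] Cl(1) show ?thesis by simp
 qed
 finally have l: "nvar (?F n) (p-r) <= ennreal (Cl*2 powr (2+2*gap)*2 powr (- 2*(real K+g*real n)))" .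
 have "nvar (- low (?E n)) (p-r) <= ennreal (Ch*2 powr (- 2*?E n))" by (rule Ch)
 also have "... <= ennreal (Ch*2 powr (- 2*(real K+g*real n)))"
 using g(3) Ch(1) mult_right_mono[OF g(3), of "real n"] by (intro ennreal_leI) (auto simp: K_def power2_eq_square algebra_simps)
 finally have h: "nvar (- low (?E n)) (p-r) <= ennreal (Ch*2 powr (- 2*(real K+g*real n)))" .
 have "nvar (- annulus n) (p-r) <= ennreal (Cl*2 powr (2+2*gap)*2 powr (- 2*(real K+g*real n)))+ennreal (Ch*2 powr (- 2*(real K+g*real n)))"
 using order.trans[OF nn add_mono[OF l h]] .
 also have "... = ennreal (E^2*2 powr (- 2*(real K+g*real n)))" using Cl(1) Ch(1) by (subst ennreal_plus[symmetric]) (auto simp: E(2) algebra_simps)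
 finally have 1: "incr_var (?D n) p r <= (E*2 powr (- (real K+g*real n)))^2" by (simp add: power_mult_distrib powr_power KV_var[OF KA])
 have 2: "incr_var (?D n) p r <= (A * R)^2" unfolding R_def by (rule KV_var[OF KA order.trans[OF nvar_mono A(2)]]) simp
 have "(min (E*2 powr (- (real K+g*real n))) (A * R))^2 <= (E*2 powr (- (real K+g*real n)))*(A * R)"
 unfolding power2_eq_square using E(1) A(1) R0 by (intro mult_mono) auto
 hence "incr_var (?D n) p r <= (E*2 powr (- (real K+g*real n)))*(A * R)" using 1 2 by simp
 also have "... = (A' * R powr (1/2))^2"
 proof -
 have "(2 powr (- (real K+g*real n)/2))^2 = 2 powr (- (real K+g*real n))" by (simp add: powr_power diff_divide_distrib)
 moreover have "(R powr (1/2))^2 = R" using R0 by (cases "R = 0") (simp_all add: powr_power)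
 moreover have "(sqrt (E*A))^2 = E*A" using E(1) A(1) by simp
 ultimately show ?thesis unfolding A'_def power_mult_distrib by simp
 qed
 finally show ?thesis by (simp add: R_def)
 qed
 have "1-C'*(A'*2 powr (?B K)/(2 powr (- real K)*2 powr (?A g n)))^(2*m)
 <= \<P>(w in P. G.incr_le X K (2 powr (- real K)*2 powr (?A g n)) w)"
 by (rule C'(2)[OF gf _ _ var]) (use EA in "auto simp: A'_def")
 also have "(A'*2 powr (?B K)/(2 powr (- real K)*2 powr (?A g n)))^(2*m) = sqrt (E*A)^(2*m)*q^n"
 proof -
 have "2 powr (- (real K+g*real n)/2)*2 powr (?B K)/(2 powr (- real K)*2 powr (?A g n)) = 2 powr (?A g n)"
 unfolding powr_add[symmetric] powr_diff[symmetric] by (rule arg_cong[where f="%x. 2 powr x"]) (simp add: field_simps)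
 hence "A'*2 powr (?B K)/(2 powr (- real K)*2 powr (?A g n)) = sqrt (E*A)*2 powr (?A g n)" unfolding A'_def by (simp only: mult.assoc times_divide_eq_right[symmetric])
 moreover have "(2 powr (?A g n))^(2*m) = q^n" by (simp add: q_def powr_power mult_ac)
 ultimately show ?thesis by (simp only: power_mult_distrib)
 qed
 finally show ?thesis by (simp add: K_def)
 qed
 thus ?thesis using that[of "C' * sqrt (E*A)^(2*m)" q 1] q C'(1) E(1) A(1) unfolding g_def by simp
qed

text \<open>The refinement j is taken as large as C 2^(Q j) \<le> ln n permits, which turns the
  bound of \<open>small_ball\<close> into 1/n, the terms of a divergent series. For the radius,
  2^(-j) is of order (ln n)^(-1/Q).\<close>

lemma annulus_small_ball:
 obtains c N where "0<c"
 "!!(P::'w measure) X n. N <= n ==> gaussian_family P D X (KV (annulus n)) ==>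
 1/real n <= \<P>(w in P. G.incr_le X (n^2) (c*(2 powr (- real (n^2))*ln (real n) powr (- (1/G.Q)))) w)"
proof -
 let ?A = "%n. 2 powr (- real (n^2))*ln (real n) powr (- (1/G.Q))"
 obtain A where A: "0<A" "!!p. nvar UNIV p <= ennreal ((A*dist_rho H1 H2 p)^2)" by (rule nvar_upper) blast
 obtain B C where BC: "0<B" "0<C"
 "!!(P::'w measure) X Kf K j. gaussian_family P D X Kf ==> (!!p q. p:D ==> q:D ==> incr_var Kf p q <= (A*dist_rho H1 H2 (p-q))^2) ==>
 exp (- C*2 powr (G.Q*real j)) <= \<P>(w in P. G.incr_le X K (B/2^(K+j)) w)"
 by (rule G.small_ball[OF A(1)]) blast
 obtain N :: nat where N: "exp C < real N" using reals_Archimedean2 by auto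
 define c where "c = 2*B*C powr (1/G.Q)"
 have c: "0<c" using BC by (simp add: c_def)
 have "1/real n <= \<P>(w in P. G.incr_le X (n^2) (c*(?A n)) w)"
 if n: "N <= n" and gf: "gaussian_family P D X (KV (annulus n))" for P :: "'w measure" and X n
 proof -
 interpret prob_space P by (rule gaussian_familyD[OF gf])
 have en: "exp C < real n" using N n by simp
 hence n0: "0<real n" using exp_gt_zero[of C] by linarith
 have lC: "C < ln (real n)" using en n0 by (metis exp_less_cancel_iff exp_ln)
 define u where "u = (ln (real n)/C) powr (1/G.Q)"
 have u1: "1<=u" unfolding u_def using lC BC G.Q_pos by (intro ge_one_powr_ge_zero) auto
 then obtain j where j: "2^j <= u" "u < 2^Suc j" by (rule dyadic_bracket)
 have "2 powr (G.Q*real j) = (2^j) powr G.Q" by (simp add: powr_realpow[symmetric] powr_powr mult.commute)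
 also have "... <= u powr G.Q" using j G.Q_pos by (intro powr_mono2) auto
 finally have "exp (- ln (real n)) <= exp (- C*2 powr (G.Q*real j))" using lC BC G.Q_pos by (simp add: u_def powr_powr pos_le_divide_eq mult.commute)
 hence "1/real n <= exp (- C*2 powr (G.Q*real j))" using n0 by (simp add: exp_minus divide_inverse)
 also have "... <= \<P>(w in P. G.incr_le X (n^2) (B/2^(n^2+j)) w)"
 by (rule BC(3)[OF gf], rule KV_var[OF annulus_measurable order.trans[OF nvar_mono A(2)]]) simp
 also have "... <= \<P>(w in P. G.incr_le X (n^2) (c*(?A n)) w)"
 proof (rule finite_measure_mono)
 have "1/2^j <= 2/u" using j by (simp add: field_simps)
 also have "2/u = 2*(C powr (1/G.Q)*ln (real n) powr (- (1/G.Q)))" by (simp add: u_def powr_divide powr_minus field_simps)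
 finally have le: "B/2^(n^2+j) <= c*?A n" using BC powr_realpow[of 2 "n^2"] by (simp add: c_def powr_minus divide_inverse power_add)
 show "{w:space P. G.incr_le X (n^2) (B/2^(n^2+j)) w} \<subseteq> {w:space P. G.incr_le X (n^2) (c*(?A n)) w}"
 using le by auto
 show "{w:space P. G.incr_le X (n^2) (c*(?A n)) w}:events"
 by (intro sets.sets_Collect_countable_All' predE G.increments_measurable[OF gf] G.ball_pts_countable) (auto simp: G.ball_pts_def)
 qed
 finally show ?thesis .
 qed
 thus ?thesis using that c by blast
qed

text \<open>The field is rebuilt from independent components on the annuli n, ..., 4 n. All these
  components fail to be small with probability at most the product of 1 - 1/k, which telescopes to
  (n - 1)/(4 n); some complement is too large with probability at most 1/4. What remains is at least
  1/2.\<close>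

lemma limsup_event:
 obtains c g N where "0<c" "0<g"
 "!!(P::'w measure) X n. N <= n ==> gaussian_family P D X (KV UNIV) ==>
 1/2 <= \<P>(w in P. EX k:{n..4*n}. G.incr_le X (k^2) (2 powr (- real (k^2))*(c*ln (real k) powr (- (1/G.Q))+2 powr (- g*real k))) w)"
proof -
 let ?B = "PiM D (%_. borel)"
 let ?A = "%k. 2 powr (- real (k^2))*ln (real k) powr (- (1/G.Q))"
 let ?Q0 = "PiM UNIV (%_::nat. N01)"
 obtain c N1 where c: "0<c"
 "!!(P::(nat => real) measure) X n. N1 <= n ==> gaussian_family P D X (KV (annulus n)) ==>
 1/real n <= \<P>(w in P. G.incr_le X (n^2) (c*(2 powr (- real (n^2))*ln (real n) powr (- (1/G.Q)))) w)"
 by (rule annulus_small_ball) blast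
 define g where "g = min gap 1/4"
 obtain C q N2 where C: "0<C" "0<q" "q<1"
 "!!(P::(nat => nat => real) measure) X n. N2 <= n ==> gaussian_family P D X (KV (- annulus n)) ==>
 1-C*q^n <= \<P>(w in P. G.incr_le X (n^2) (2 powr (- real (n^2))*2 powr (- g*real n)) w)"
 unfolding g_def by (rule complement_deviation) blast
 have g: "0<g" using gap_pos by (simp add: g_def)
 have "(%n. C*(q^n/(1-q))) \<longlonglongrightarrow> C*(0/(1-q))" using C by (intro tendsto_intros) auto
 hence "eventually (%n. C*(q^n/(1-q)) < 1/4) sequentially" by (rule order_tendstoD) simp
 then obtain N3 where N3: "!!n. N3 <= n ==> C*(q^n/(1-q)) < 1/4" by (auto simp: eventually_sequentially)
 let ?b = "%k. 2 powr (- real (k^2))*(c*ln (real k) powr (- (1/G.Q))+2 powr (- g*real k))"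
 have "1/2 <= \<P>(w in P. EX k:{n..4*n}. G.incr_le X (k^2) (?b k) w)"
 if n: "max (max 1 N1) (max N2 N3) <= n" and gf: "gaussian_family P D X (KV UNIV)" for P :: "'w measure" and X n
 proof -
 \<comment> \<open>Index 0 is free because \<open>n\<close> is at least 1; it holds all frequencies
   outside the annuli in use.\<close>
 define A where "A k = (if k = 0 then-(UN k:{n..4*n}. annulus k) else annulus k)" for k :: nat
 define M where "M = insert 0 {n..4*n}"
 have M: "finite M" "0 ~: {n..4*n}" using n by (auto simp: M_def)
 have Am: "A k:sets borel" for k unfolding A_def by auto
 have Adis: "disjoint_family_on A M" using annulus_disjoint unfolding disjoint_family_on_def A_def M_def by auto
 have Aun: "(UN k:M. A k) = UNIV" using M by (auto simp: M_def A_def)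
 have "EX X. gaussian_family ?Q0 D X (KV (A k))" for k by (rule V_exists[OF Am, of k]) blast
 then obtain Z where Z: "!!k. gaussian_family ?Q0 D (Z k) (KV (A k))" by metis
 interpret Q0: prob_space ?Q0 by (rule gaussian_familyD[OF Z])
 let ?R = "PiM M (%_. ?Q0)"
 interpret R: product_prob_space "%_. ?Q0" M by standard
 interpret R: finite_product_prob_space "%_. ?Q0" M by standard (rule M)
 define Y where "Y p w = (SUM k:M. Z k p (w k))" for p w
 have Y: "gaussian_family ?R D Y (KV UNIV)" using gaussian_family_PiM[of M "%_. ?Q0" D Z "%k. KV (A k)", OF M(1) Z Q0.prob_space_axioms]
 unfolding Y_def KV_sum[OF M(1) Am Adis] Aun .
 have KV0: "KV {} p q = 0" for p q by (subst KV_eq) auto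
 \<comment> \<open>Setting the \<open>k\<close>-th component to 0 rather than removing it keeps the
   index set \<open>M\<close>; the zero component has the covariance of the empty set of
   frequencies.\<close>
 define W where "W k p w = (SUM l:M. if l = k then 0 else Z l p (w l))" for k p w
 have W: "gaussian_family ?R D (W k) (KV (- annulus k))" if k: "k:{n..4*n}" for k
 proof -
 have 1: "gaussian_family ?Q0 D (%p w. if l = k then 0 else Z l p w) (KV (if l = k then {} else A l))" for l using Z[of l] by (simp add: gaussian_family_def KV0 Q0.prob_space_axioms Q0.prob_space)
 have 2: "(SUM l:M. KV (if l = k then {} else A l) p q) = KV (UN l:M. if l = k then {} else A l) p q" for p q
 by (rule KV_sum[OF M(1)]) (use Am Adis in "auto simp: disjoint_family_on_def")
 have kM: "k:M" "A k = annulus k" using k M by (auto simp: M_def A_def)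
 have 3: "(UN l:M. if l = k then {} else A l) = - annulus k"
 proof
 show "(UN l:M. if l = k then {} else A l) \<subseteq>-annulus k" using Adis kM unfolding disjoint_family_on_def by auto
 show "- annulus k \<subseteq> (UN l:M. if l = k then {} else A l)" using Aun kM by auto
 qed
 show ?thesis using gaussian_family_PiM[of M "%_. ?Q0" D "%l p w. if l = k then 0 else Z l p w", OF M(1) 1 Q0.prob_space_axioms] unfolding W_def 2 3 by simp
 qed
 have YW: "Y p w = Z k p (w k)+W k p w" if k: "k:{n..4*n}" for k p w
 proof -
 have "k:M" using k by (simp add: M_def)
 thus ?thesis unfolding Y_def W_def using M(1) by (simp add: sum.remove[of M k] cong: sum.cong) (rule sum.cong, auto)
 qed
 define GG where "GG k = {w:space ?Q0. ALL p:G.ball_pts (k^2). abs (Z k p w-Z k 0 w) <= c*(?A k)}" for k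
 define WW where "WW k = {w:space ?R. ALL p:G.ball_pts (k^2). abs (W k p w-W k 0 w)<=2 powr (- real (k^2))*2 powr (- g*real k)}" for k
 define EE where "EE = {w:space ?R. EX k:{n..4*n}. G.incr_le Y (k^2) (?b k) w}"
 have GGm[measurable]: "GG k:sets ?Q0" for k unfolding GG_def
 by (intro sets.sets_Collect_countable_All' predE G.increments_measurable[OF Z] G.ball_pts_countable) (auto simp: G.ball_pts_def)
 have WWm[measurable]: "WW k:sets ?R" if "k:{n..4*n}" for k unfolding WW_def
 by (intro sets.sets_Collect_countable_All' predE G.increments_measurable[OF W[OF that]] G.ball_pts_countable) (auto simp: G.ball_pts_def)
 have EEm[measurable]: "EE:sets ?R" unfolding EE_def
 by (intro sets.sets_Collect_finite_Ex sets.sets_Collect_countable_All' predE G.increments_measurable[OF Y] G.ball_pts_countable) (auto simp: G.ball_pts_def)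
 define BB where "BB = (\<Pi>\<^sub>E k\<in>M. if k = 0 then space ?Q0 else space ?Q0-GG k)"
 have BBm[measurable]: "BB:sets ?R" unfolding BB_def by (intro sets_PiM_I_finite M) auto
 have sub: "space ?R-EE \<subseteq> BB \<union> (UN k:{n..4*n}. space ?R-WW k)"
 proof
 fix w assume w: "w:space ?R-EE"
 show "w:BB \<union> (UN k:{n..4*n}. space ?R-WW k)"
 proof (cases "EX k:{n..4*n}. w ~: WW k")
 case False
 have "w k ~: GG k" if k: "k:{n..4*n}" for k
 proof
 assume G: "w k:GG k"
 have "abs (Y p w-Y 0 w) <= ?b k" if p: "p:G.ball_pts (k^2)" for p
 proof -
 have "abs (Z k p (w k)-Z k 0 (w k)) <= c*?A k" using G p unfolding GG_def by simp
 moreover have "abs (W k p w-W k 0 w)<=2 powr (- real (k^2))*2 powr (- g*real k)" using False k p unfolding WW_def by blast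
 moreover have "?b k = c*?A k+2 powr (- real (k^2))*2 powr (- g*real k)" by (simp only: distrib_left mult.left_commute)
 ultimately show ?thesis using YW[OF k, of p w] YW[OF k, of 0 w] by simp
 qed
 thus False using w k unfolding EE_def by blast
 qed
 thus ?thesis using w unfolding BB_def space_PiM M_def by auto
 qed (use w in auto)
 qed
 have "R.prob (space ?R-EE) <= R.prob (BB \<union> (UN k:{n..4*n}. space ?R-WW k))" by (intro R.finite_measure_mono sub) auto
 also have "... <= R.prob BB+R.prob (UN k:{n..4*n}. space ?R-WW k)" by (intro measure_Un_le) auto
 also have "... <= 1/4+1/4"
 proof (rule add_mono)
 have "R.prob BB = (PROD k:M. Q0.prob (if k = 0 then space ?Q0 else space ?Q0-GG k))" unfolding BB_def by (rule R.prob_times) auto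
 also have "... = (PROD k:{n..4*n}. 1-Q0.prob (GG k))" unfolding M_def using M(2) by (simp add: Q0.prob_space) (rule prod.cong, auto simp: Q0.prob_compl)
 also have "... <= (PROD k:{n..4*n}. 1-1/real k)"
 proof (rule prod_mono, rule conjI)
 fix k assume k: "k:{n..4*n}"
 hence "A k = annulus k" "N1 <= k" using n by (auto simp: A_def)
 thus "1-Q0.prob (GG k) <= 1-1/real k" using Z[of k] c(2) unfolding GG_def by simp
 qed simp
 also have "... = (real n-1)/real (4*n)"
 proof -
 have "(PROD k:{n..n+m}. 1-1/real k) = (real n-1)/real (n+m)" for m using n by (induction m) (auto simp: field_simps)
 from this[of "3*n"] show ?thesis by simp
 qed
 also have "... <= 1/4" using n by simp
 finally show "R.prob BB <= 1/4" .
 have "R.prob (UN k:{n..4*n}. space ?R-WW k) <= (SUM k:{n..4*n}. R.prob (space ?R-WW k))" by (intro R.finite_measure_subadditive_finite) auto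
 also have "... <= (SUM k:{n..4*n}. C*q^k)"
 proof (rule sum_mono)
 fix k assume k: "k:{n..4*n}"
 have "1-C*q^k <= R.prob (WW k)" unfolding WW_def by (rule C(4)[OF _ W[OF k]]) (use k n in auto)
 thus "R.prob (space ?R-WW k) <= C*q^k" using R.prob_compl[OF WWm[OF k]] by simp
 qed
 also have "... = C*(q^n*(SUM i<Suc (3*n). q^i))" using sum.shift_bounds_cl_nat_ivl[of "%k. q^k" 0 n "3*n"]
 by (simp add: sum_distrib_left[symmetric] power_add lessThan_Suc_atMost atMost_atLeast0) (simp add: sum_distrib_left mult.commute)
 also have "... <= C*(q^n*(1/(1-q)))" using C by (intro mult_left_mono) (auto simp: sum_gp_strict divide_right_mono simp del: sum.lessThan_Suc)
 also have "... <= 1/4" using N3[of n] n by simp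
 finally show "R.prob (UN k:{n..4*n}. space ?R-WW k) <= 1/4" .
 qed
 finally have EEp: "1/2 <= R.prob EE" using R.prob_compl[OF EEm] by simp
 \<comment> \<open>The event is rewritten as a set of paths on \<open>D\<close>, to which equality
   of laws applies.\<close>
 define V where "V = {v:space (PiM D (%_. borel :: real measure)). EX k:{n..4*n}. ALL p:G.ball_pts (k^2). abs (v p-v 0) <= ?b k}"
 have Vm: "V:sets ?B" unfolding V_def
 proof (intro sets.sets_Collect_finite_Ex sets.sets_Collect_countable_All' predE G.ball_pts_countable)
 fix k p assume "p:G.ball_pts (k^2)"
 hence [measurable]: "(%v. v p):borel_measurable ?B" "(%v. v 0):borel_measurable ?B" using D by (auto simp: G.ball_pts_def)
 show "Measurable.pred ?B (%v. abs (v p-v 0) <= ?b k)" by simp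
 qed auto
 have tr: "(\<lambda>i\<in>D. X i w):V \<longleftrightarrow> (EX k:{n..4*n}. G.incr_le X (k^2) (?b k) w)" for X :: "real*'a => 'z => real" and w
 unfolding V_def using D(2) by (simp add: space_PiM G.ball_pts_def)
 from gaussian_family_law[OF gf Y Vm] EEp show ?thesis unfolding tr EE_def by simp
 qed
 thus ?thesis using that c(1) g by blast
qed

text \<open>Each block of scales has an event of probability at least 1/2, so by continuity from
  above infinitely many scales have it with probability at least 1/2. Positive probability suffices,
  as the functional is almost surely constant.\<close>

lemma lf_le_event:
 obtains c where "0<c" "!!(P::'w measure) X. gaussian_family P D X (KV UNIV) ==> 1/2 <= \<P>(w in P. G.lf (%p. X p w) <= ereal c)"
proof -
 let ?B = "%U. \<Inter>n. UN k:{n..}. U k"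
 let ?A = "%k. real (Suc (k^2))*ln 2"
 obtain c g N where c: "0<c" "0<g"
 "!!(P::'w measure) X n. N <= n ==> gaussian_family P D X (KV UNIV) ==>
 1/2 <= \<P>(w in P. EX k:{n..4*n}. G.incr_le X (k^2) (2 powr (- real (k^2))*(c*ln (real k) powr (- (1/G.Q))+2 powr (- g*real k))) w)"
 by (rule limsup_event) blast
 let ?b = "%k. 2 powr (- real (k^2))*(c*ln (real k) powr (- (1/G.Q))+2 powr (- g*real k))"
 define h where "h = 1/G.Q"
 have h: "0<h" using G.Q_pos by (simp add: h_def)
 \<comment> \<open>The factor 2 pays for the radius 1/2^Suc (k^2) in place of 2^(-k^2),
   \<open>3 powr h\<close> for ln ((k^2 + 1) ln 2) against ln k, and c + 1 absorbs the exponentially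
   small term.\<close>
 define c' where "c' = 2*(c+1)*3 powr h"
 have c': "0<c'" using c by (simp add: c'_def)
 have "eventually (%k. ?b k <= c' * scale G.Q (1/2^Suc (k^2))) sequentially"
 proof -
 have 1: "eventually (%k::nat. 1<ln (real k)) sequentially" by real_asymp
 have 2: "eventually (%k::nat. ln (?A k) <= 3*ln (real k)) sequentially" by real_asymp
 have 3: "eventually (%k::nat. 0<ln (?A k)) sequentially" by real_asymp
 have "eventually (%k::nat. ln (real k)<=2 powr (r*real k)) sequentially" if "0<r" for r :: real using that by real_asymp
 from this[of "g/h"] have 4: "eventually (%k::nat. ln (real k)<=2 powr (g/h*real k)) sequentially" using c h by simp
 show ?thesis using 1 2 3 4
 proof eventually_elim
 case (elim k)
 have "2 powr (- g*real k) = (2 powr (g/h*real k)) powr (- h)" using h by (simp add: powr_powr)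
 also have "... <= ln (real k) powr (- h)" using elim h by (intro powr_mono2') auto
 finally have 5: "2 powr (- g*real k) <= ln (real k) powr (- h)" .
 have "3 powr (- h)*ln (real k) powr (- h) = (3*ln (real k)) powr (- h)" using elim by (simp add: powr_mult)
 also have "... <= ln (?A k) powr (- h)" using elim h by (intro powr_mono2') auto
 finally have 6: "3 powr (- h)*ln (real k) powr (- h) <= ln (?A k) powr (- h)" .
 have "c*ln (real k) powr (- h)+2 powr (- g*real k) <= (c+1)*ln (real k) powr (- h)" using 5 by (simp add: distrib_right)
 also have "... = c'/2*(3 powr (- h)*ln (real k) powr (- h))" by (simp add: c'_def powr_minus)
 also have "... <= c'/2*ln (?A k) powr (- h)" using 6 c' by simp
 finally have "2 powr (- real (k^2))*(c*ln (real k) powr (- h)+2 powr (- g*real k))<=2 powr (- real (k^2))*(c'/2*ln (?A k) powr (- h))" by simp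
 moreover have "c' * scale G.Q (1/2^Suc (k^2)) = 2 powr (- real (k^2))*(c'/2*ln (?A k) powr (- h))"
 proof -
 have "ln (2^Suc (k^2)) = real (Suc (k^2))*ln (2::real)" by (rule ln_realpow)
 moreover have "2 powr (- real (k^2)) = 1/2^(k^2)" using powr_realpow[of 2 "k^2"] by (simp add: powr_minus divide_inverse)
 ultimately show ?thesis unfolding scale_def h_def by simp
 qed
 ultimately show ?case unfolding h_def by linarith
 qed
 qed
 then obtain N2 where N2: "!!k. N2 <= k ==> ?b k <= c' * scale G.Q (1/2^Suc (k^2))" by (auto simp: eventually_sequentially)
 have "1/2 <= \<P>(w in P. G.lf (%p. X p w) <= ereal c')" if gf: "gaussian_family P D X (KV UNIV)" for P :: "'w measure" and X
 proof -
 interpret prob_space P by (rule gaussian_familyD[OF gf])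
 define U where "U k = {w:space P. G.incr_le X (k^2) (?b k) w}" for k
 have Um[measurable]: "U k:events" for k unfolding U_def
 by (intro sets.sets_Collect_countable_All' predE G.increments_measurable[OF gf] G.ball_pts_countable) (auto simp: G.ball_pts_def)
 have lim: "(%n. prob (UN k:{n..}. U k)) \<longlonglongrightarrow> prob (?B U)" by (rule finite_Lim_measure_decseq) (auto simp: decseq_def intro: order.trans)
 have "1/2 <= prob (UN k:{n..}. U k)" if "N <= n" for n
 proof -
 have "1/2 <= prob {w:space P. EX k:{n..4*n}. G.incr_le X (k^2) (?b k) w}" by (rule c(3)[OF that gf])
 also have "... <= prob (UN k:{n..}. U k)" by (rule finite_measure_mono) ((auto simp: U_def)[1], measurable)
 finally show ?thesis .
 qed
 hence "1/2 <= prob (?B U)" by (intro LIMSEQ_le_const[OF lim]) blast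
 also have "... <= \<P>(w in P. G.lf (%p. X p w) <= ereal c')"
 proof (rule finite_measure_mono)
 show "(?B U) \<subseteq> {w:space P. G.lf (%p. X p w) <= ereal c'}"
 proof
 fix w assume w: "w:(?B U)"
 hence sp: "w:space P" by (auto simp: U_def)
 have "\<exists>\<^sub>F K in sequentially. G.incr_le X K (c' * scale G.Q (1/2^Suc K)) w" unfolding frequently_sequentially
 proof
 fix n
 obtain k where k: "max n (max N2 1) <= k" "w:U k" using w by blast
 have "n <= k^2" by (simp add: power2_eq_square) (metis k(1) le_square max.boundedE order_trans)
 moreover have "G.incr_le X (k^2) (c' * scale G.Q (1/2^Suc (k^2))) w" using k N2[of k] unfolding U_def by auto
 ultimately show "EX K>=n. G.incr_le X K (c' * scale G.Q (1/2^Suc K)) w" by auto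
 qed
 thus "w:{w:space P. G.lf (%p. X p w) <= ereal c'}" using sp unfolding G.lf_def by (simp add: G.lfun_upper[OF c'])
 qed
 show "{w:space P. G.lf (%p. X p w) <= ereal c'}:events" using G.lf_family_measurable[OF gf] by simp
 qed
 finally show ?thesis .
 qed
 thus ?thesis using that c' by simp
qed

end

section \<open>Positivity of the constant\<close>

lemma prod_cis: "finite A ==> (PROD b:A. cis (g b)) = cis (SUM b:A. g b)" by (induction rule: finite_induct) (auto simp: cis_mult)

lemma lborel_integral_prod:
 fixes f :: "'a::euclidean_space => real => complex"
 assumes f: "!!b. b:Basis ==> integrable lborel (f b)"
 shows "integrable lborel (%x::'a. PROD b:Basis. f b (x \<bullet> b))"
 "(LINT x|lborel. (PROD b:Basis. f b (x \<bullet> b))) = (PROD b:(Basis::'a set). LINT t|lborel. f b t)"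
proof -
 let ?A = "%x::'a. PROD b:Basis. f b (x \<bullet> b)"
 interpret product_sigma_finite "%_::'a. lborel :: real measure" by standard
 let ?M = "\<Pi>\<^sub>M b\<in>(Basis::'a set). (lborel :: real measure)"
 let ?e = "%x. SUM b:(Basis::'a set). x b *\<^sub>R b"
 have m: "f b:bm" if "b:Basis" for b using borel_measurable_integrable[OF f[OF that]] by simp
 have e: "?e:measurable ?M borel" by simp
 have g[measurable]: "?A:bm" by (intro borel_measurable_prod measurable_compose[OF _ m]) auto
 have eq: "(PROD b:Basis. f b (?e x \<bullet> b)) = (PROD b:Basis. f b (x b))" for x by simp
 show "integrable lborel ?A" unfolding lborel_eq[where 'a='a] by (subst integrable_distr_eq) (simp_all only: e g eq product_integrable_prod[OF finite_Basis f])
 show "(LINT x|lborel. (PROD b:Basis. f b (x \<bullet> b))) = (PROD b:(Basis::'a set). LINT t|lborel. f b t)"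
 unfolding lborel_eq[where 'a='a] by (subst integral_distr) (simp_all only: e g eq product_integral_prod[OF finite_Basis f])
qed

lemma cis_interval:
 assumes h: "0<h"
 shows "integrable lborel (%t. indicator {- pi/h..pi/h} t *\<^sub>R cis (- (t*(of_int k*h))))"
 "(LINT t|lborel. indicator {- pi/h..pi/h} t *\<^sub>R cis (- (t*(of_int k*h)))) = complex_of_real (if k = 0 then 2*pi/h else 0)"
proof -
 let ?A = "{- pi/h..pi/h}"
 have ct: "continuous_on ?A (%t. cis (- (t*(of_int k*h))))" by (intro continuous_intros)
 show "integrable lborel (%t. indicator ?A t *\<^sub>R cis (- (t*(of_int k*h))))" using borel_integrable_compact[OF compact_Icc ct] by simp
 show "(LINT t|lborel. indicator ?A t *\<^sub>R cis (- (t*(of_int k*h)))) = of_real (if k = 0 then 2*pi/h else 0)"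
 proof (cases "k = 0")
 case True
 show ?thesis using True h by (simp add: scaleR_conv_of_real)
 next
 case False
 define c where "c = - (of_int k*h)"
 have c: "c ~= 0" using False h by (simp add: c_def)
 have "(LINT t|lborel. indicator ?A t *\<^sub>R cis (c*t)) = cis (c*(pi/h))/(\<i> * c) - cis (c*(- pi/h))/(\<i> * c)"
 proof (rule integral_FTC_atLeastAtMost)
 show "- pi/h <= pi/h" using h by simp
 show "continuous_on ?A (%t. cis (c*t))" by (intro continuous_intros)
 fix t
 have "((%t. cis (c*t)) has_vector_derivative c *\<^sub>R (\<i> * cis (c*t))) (at t within ?A)"
 unfolding has_vector_derivative_def by (auto intro!: derivative_eq_intros)
 from has_vector_derivative_divide[OF this, of "\<i> * c"]
 show "((%t. cis (c*t)/(\<i> * c)) has_vector_derivative cis (c*t)) (at t within ?A)" using c by (simp add: scaleR_conv_of_real)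
 qed
 moreover have "c*(pi/h) = - (of_int k*pi)" "c*(- pi/h) = of_int k*pi" using h by (simp_all add: c_def)
 moreover have "cis (- (of_int k*pi)) = cis (of_int k*pi)" by (simp add: complex_eq_iff mult.commute)
 ultimately show ?thesis using False by (simp add: c_def mult_ac)
 qed
qed

lemma box_cis:
 fixes h :: "'a::euclidean_space => real" and x :: 'a
 assumes h: "!!b. b:Basis ==> 0<h b" and x: "!!b. b:Basis ==> x \<bullet> b/h b:\<int>"
 defines "Q == {w::'a. ALL b:Basis. abs (w \<bullet> b) <= pi/h b}"
 shows "integrable lborel (%w. indicator Q w * cis (- (w \<bullet> x)))"
 "(LINT w|lborel. indicator Q w * cis (- (w \<bullet> x))) = complex_of_real (if x = 0 then (PROD b:Basis. 2*pi/h b) else 0)"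
proof -
 let ?D = "if x = 0 then (PROD b:Basis. 2*pi/h b) else 0"
 let ?C = "%k. PROD b:Basis. of_real (if k b = 0 then 2*pi/h b else 0)"
 let ?B = "%w. - (w \<bullet> x)"
 let ?A = "LINT w|lborel. indicator Q w * cis (?B w)"
 have "ALL b:Basis. EX k. x \<bullet> b = of_int k*h b"
 proof
 fix b :: 'a assume b: "b:Basis"
 then obtain k where "x \<bullet> b/h b = of_int k" using x by (auto elim: Ints_cases)
 thus "EX k. x \<bullet> b = of_int k*h b" using h[OF b] by (auto simp: field_simps)
 qed
 then obtain k where k: "!!b. b:Basis ==> x \<bullet> b = of_int (k b)*h b" by metis
 let ?f = "%b t. indicator {- pi/h b..pi/h b} t *\<^sub>R cis (- (t*(of_int (k b)*h b)))"
 have eq: "(%w. indicator Q w * cis (?B w)) = (%w. PROD b:Basis. ?f b (w \<bullet> b))"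
 proof
 fix w :: 'a
 have "(PROD b:(Basis::'a set). indicator {- pi/h b..pi/h b} (w \<bullet> b) :: real) = indicator Q w" by (auto simp: Q_def abs_le_iff indicator_def minus_le_iff)
 moreover have "(PROD b:Basis. cis (- (w \<bullet> b*(of_int (k b)*h b)))) = cis (?B w)"
 proof -
 have "w \<bullet> x = (SUM b:Basis. w \<bullet> b*(of_int (k b)*h b))" by (subst euclidean_inner) (simp add: k)
 thus ?thesis by (simp add: prod_cis sum_negf)
 qed
 ultimately show "indicator Q w * cis (?B w) = (PROD b:Basis. ?f b (w \<bullet> b))"
 by (simp add: scaleR_conv_of_real prod.distrib flip: of_real_prod) (simp add: of_real_indicator)
 qed
 show "integrable lborel (%w. indicator Q w * cis (?B w))" unfolding eq by (rule lborel_integral_prod, rule cis_interval) (rule h)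
 have x0: "x = 0 \<longleftrightarrow> (ALL b:Basis. k b = 0)" using h k by (auto simp: euclidean_eq_iff[where 'a='a] less_imp_neq[THEN not_sym])
 have "?A = ?C k"
 proof -
 have "?A = (PROD b:Basis. LINT t|lborel. ?f b t)" unfolding eq by (rule lborel_integral_prod(2)) (rule cis_interval(1)[OF h])
 also have "... = ?C k" by (intro prod.cong refl cis_interval(2) h)
 finally show ?thesis .
 qed
 also have "... = of_real ?D" unfolding x0 by auto
 finally show "?A = of_real ?D" .
qed

text \<open>Differences of lattice points are lattice points, so by \<open>box_cis\<close> the
  characters of distinct points are orthogonal on the box with sides 2 pi/h, and only the diagonal
  survives.\<close>

lemma box_parseval:
 fixes h :: "'a::euclidean_space => real"
 assumes h: "!!b. b:Basis ==> 0<h b" and J: "finite J" "!!x b. x:J ==> b:Basis ==> x \<bullet> b/h b:\<int>"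
 defines "Q == {w::'a. ALL b:Basis. abs (w \<bullet> b) <= pi/h b}"
 shows "integrable lborel (%w. indicator Q w*(cmod (SUM x:J. complex_of_real (a x) * cis (- (w \<bullet> x))))^2)"
 "(LINT w|lborel. indicator Q w*(cmod (SUM x:J. complex_of_real (a x) * cis (- (w \<bullet> x))))^2) = (PROD b:Basis. 2*pi/h b)*(SUM x:J. (a x)^2)"
proof -
 let ?B = "PROD b:Basis. 2*pi/h b"
 let ?A = "%w. cmod (SUM x:J. of_real (a x) * cis (- (w \<bullet> x)))"
 let ?g = "%w. SUM x:J. SUM y:J. of_real (a x*a y)*(indicator Q w * cis (- (w \<bullet> (x-y))))"
 have eq: "of_real (indicator Q w*(?A w)^2) = ?g w" for w
 by (simp add: complex_norm_square sum_distrib_left cis_cnj cis_mult of_real_indicator algebra_simps del: of_real_power)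
 have d: "(x-y) \<bullet> b/h b:\<int>" if "x:J" "y:J" "b:Basis" for x y b using J(2)[of x b] J(2)[of y b] that by (simp add: inner_diff_left diff_divide_distrib)
 note bc = box_cis[OF h d, folded Q_def]
 have ig: "integrable lborel ?g" by (intro integrable_lint_sum integrable_mult_right bc(1))
 have "integrable lborel (%w. Re (?g w))" using ig by rule
 thus "integrable lborel (%w. indicator Q w*(?A w)^2)" unfolding eq[symmetric] by simp
 have "of_real (LINT w|lborel. indicator Q w*(?A w)^2) = (LINT w|lborel. ?g w)" unfolding eq[symmetric] by (rule integral_complex_of_real[symmetric])
 also have "... = (SUM x:J. SUM y:J. of_real (a x*a y) * of_real (if x-y = 0 then ?B else 0))"
 proof -
 have "(LINT w|lborel. ?g w) = (SUM x:J. LINT w|lborel. (SUM y:J. of_real (a x*a y)*(indicator Q w * cis (- (w \<bullet> (x-y))))))"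
 by (rule lint_sum) (intro integrable_lint_sum integrable_mult_right bc(1); assumption)
 also have "... = (SUM x:J. SUM y:J. LINT w|lborel. of_real (a x*a y)*(indicator Q w * cis (- (w \<bullet> (x-y)))))"
 by (intro sum.cong refl lint_sum integrable_mult_right bc(1); assumption)
 finally show ?thesis by (simp add: bc(2))
 qed
 also have "... = of_real (SUM x:J. SUM y:J. if x = y then (a x)^2*?B else 0)" by (auto intro!: sum.cong simp: power2_eq_square)
 also have "(SUM x:J. SUM y:J. if x = y then (a x)^2*?B else 0) = ?B*(SUM x:J. (a x)^2)" using J(1) by (simp add: sum_distrib_right mult.commute)
 finally show "(LINT w|lborel. indicator Q w*(?A w)^2) = ?B*(SUM x:J. (a x)^2)" by (simp only: of_real_eq_iff)
qed

text \<open>The expectation of \<open>exp (- Y\<^sup>2 / (2 b\<^sup>2))\<close> is computed by writing it as a Gaussian average of characters.\<close>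

lemma gaussian_family_small_ball_upper:
 obtains \<delta> where "0<\<delta>"
 "!!(P::'w measure) J Y K s. gaussian_family P J Y K ==> finite J ==> 0<s ==>
 (!!a. s^2*(SUM j:J. (a j)^2) <= (SUM i:J. SUM j:J. a i*a j*K i j)) ==>
 \<P>(w in P. ALL j:J. abs (Y j w) <= \<delta> * s) <= exp (- real (card J))"
proof -
 let ?A = "%n g. - real n*g^2/2"
 interpret N: prob_space N01 by (rule prob_space_N01)
 have "(%n. LINT g|N01. exp (?A n g)) \<longlonglongrightarrow> (LINT g|N01. (0::real))"
 proof (rule integral_dominated_convergence[where w="%_. 1"])
 have "AE g in lborel. g ~= (0::real)" by (rule AE_lborel_singleton)
 hence "AE g in N01. g ~= 0" by (subst AE_density) auto
 thus "AE g in N01. (%n. exp (?A n g)) \<longlonglongrightarrow> 0"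
 proof eventually_elim
 case (elim g)
 hence "0<g^2" by simp
 thus ?case by real_asymp
 qed
 qed auto
 hence "eventually (%n. (LINT g|N01. exp (?A n g)) < exp (- 2)) sequentially" by (rule order_tendstoD) simp
 then obtain n where n: "(LINT g|N01. exp (?A n g)) < exp (- 2)" "1<=n"
 using eventually_conj[OF _ eventually_ge_at_top[of "1::nat"], THEN eventually_happens'[rotated]] by auto
 \<comment> \<open>For this \<open>n\<close> a coordinate contributes less than exp (- 2) to the
   expectation, while on the event each factor is at least exp (- 1); one factor exp (- 1) per point
   is left.\<close>
 define \<delta> where "\<delta> = 1 / sqrt n"
 have \<delta>: "0<\<delta>" using n by (simp add: \<delta>_def)
 have "\<P>(w in P. ALL j:J. abs (Y j w) <= \<delta> * s) <= exp (- real (card J))" if gf: "gaussian_family P J Y K" and J: "finite J" and s: "0<s"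
 and K: "!!a. s^2*(SUM j:J. (a j)^2) <= (SUM i:J. SUM j:J. a i*a j*K i j)" for P :: "'w measure" and J Y K s
 proof -
 interpret prob_space P by (rule gaussian_familyD[OF gf])
 interpret R: product_prob_space "%_. N01" J by standard
 interpret R: finite_product_prob_space "%_. N01" J by standard (rule J)
 interpret PR: pair_prob_space P "PiM J (%_. N01)" by standard
 have Ym[measurable]: "Y j:borel_measurable P" if "j:J" for j using gaussian_familyD(2)[OF gf that] .
 define b where "b = \<delta> * s"
 have b: "0<b" using \<delta> s by (simp add: b_def)
 have E: "(LINT g|PiM J (%_. N01). cis (SUM j:J. g j/b*Y j w)) = of_real (PROD j:J. exp (- (Y j w/b)\<^sup>2/2))" for w
 proof -
 have "(LINT g|PiM J (%_. N01). cis (SUM j:J. g j/b*Y j w)) = (LINT g|PiM J (%_. N01). (PROD j:J. cis (Y j w/b*g j)))" unfolding prod_cis[OF J] by (simp add: mult_ac)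
 also have "... = (PROD j:J. LINT g|N01. cis (Y j w/b*g))" by (intro R.product_integral_prod J N.integrable_const_bound[where B=1]) auto
 finally show ?thesis unfolding cis_N01 by simp
 qed
 have sec: "(LINT w|P. cis (SUM j:J. g j/b*Y j w)) = of_real (exp (- (SUM i:J. SUM j:J. (g i/b)*(g j/b)*K i j)/2))" for g
 using gaussian_familyD(3)[OF gf J, of "%j. g j/b"] by simp
 have i1: "integrable (P \<Otimes>\<^sub>M PiM J (%_. N01)) (%w. cis (SUM j:J. snd w j/b*Y j (fst w)))" by (rule PR.integrable_const_bound[where B=1]) auto
 have nn: "0<=(SUM i:J. SUM j:J. (g i/b)*(g j/b)*K i j)" for g by (rule order.trans[OF _ K[of "%i. g i/b"]]) (simp add: sum_nonneg)
 have "of_real (LINT w|P. (PROD j:J. exp (- (Y j w/b)\<^sup>2/2))) = (LINT g|PiM J (%_. N01). LINT w|P. cis (SUM j:J. g j/b*Y j w))" using PR.Fubini_integral[of "%w g. cis (SUM j:J. g j/b*Y j w)"] i1 unfolding E by (simp add: case_prod_beta' integral_complex_of_real[symmetric])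
 also have "... = of_real (LINT g|PiM J (%_. N01). exp (- (SUM i:J. SUM j:J. (g i/b)*(g j/b)*K i j)/2))" unfolding sec by simp
 finally have "(LINT w|P. (PROD j:J. exp (- (Y j w/b)\<^sup>2/2))) = (LINT g|PiM J (%_. N01). exp (- (SUM i:J. SUM j:J. (g i/b)*(g j/b)*K i j)/2))" by simp
 \<comment> \<open>The form dominates s^2 times the squares of g/b, which by the choice of
   \<open>b\<close> is n times the squares of g; the coordinates decouple.\<close>
 also have "... <= (LINT g|PiM J (%_. N01). (PROD j:J. exp (- real n*(g j)^2/2)))"
 proof (rule integral_mono)
 show "integrable (PiM J (%_. N01)) (%g. exp (- (SUM i:J. SUM j:J. (g i/b)*(g j/b)*K i j)/2))" by (rule R.integrable_const_bound[where B=1]) (use nn in auto)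
 show "integrable (PiM J (%_. N01)) (%g. PROD j:J. exp (- real n*(g j)^2/2))" by (intro R.product_integrable_prod J N.integrable_const_bound[where B=1]) auto
 fix g
 have "real n*(SUM j:J. (g j)^2) = s^2*(SUM j:J. (g j/b)^2)" using s by (simp add: b_def \<delta>_def power_divide power_mult_distrib sum_distrib_left mult.commute)
 also note K
 finally show "exp (- (SUM i:J. SUM j:J. (g i/b)*(g j/b)*K i j)/2) <= (PROD j:J. exp (- real n*(g j)^2/2))" unfolding exp_sum[OF J, symmetric] by (simp add: sum_negf sum_divide_distrib[symmetric] sum_distrib_left[symmetric])
 qed
 also have "... = (PROD j:J. LINT g|N01. exp (?A n g))" by (intro R.product_integral_prod J N.integrable_const_bound[where B=1]) auto
 also have "... <= exp (- 2) ^ card J" using n by (simp add: power_mono)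
 finally have L: "(LINT w|P. (PROD j:J. exp (- (Y j w/b)\<^sup>2/2))) <= exp (- 2) ^ card J" .
 have "exp (- 1) ^ card J*prob {w:space P. ALL j:J. abs (Y j w) <= b} = (LINT w|P. exp (- 1) ^ card J*indicator {w:space P. ALL j:J. abs (Y j w) <= b} w)"
 using J by simp
 also have "... <= (LINT w|P. (PROD j:J. exp (- (Y j w/b)\<^sup>2/2)))"
 proof (rule integral_mono)
 show "integrable P (%w. exp (- 1) ^ card J*indicator {w:space P. ALL j:J. abs (Y j w) <= b} w :: real)"
 using J by (intro integrable_const_bound[where B=1]) (auto simp: indicator_def power_le_one)
 show "integrable P (%w. PROD j:J. exp (- (Y j w/b)\<^sup>2/2))" by (intro integrable_const_bound[where B=1]) (auto simp: abs_prod intro!: prod_le_1)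
 fix w
 show "exp (- 1) ^ card J*indicator {w:space P. ALL j:J. abs (Y j w) <= b} w <= (PROD j:J. exp (- (Y j w/b)\<^sup>2/2))"
 proof (cases "w:{w:space P. ALL j:J. abs (Y j w) <= b}")
 case True
 have "(PROD j:J. exp (- 1)) <= (PROD j:J. exp (- (Y j w/b)\<^sup>2/2))"
 proof (rule prod_mono, rule conjI)
 fix j assume "j:J"
 hence "(Y j w/b)^2<=1" using True b by (simp add: abs_square_le_1)
 thus "exp (- 1) <= exp (- (Y j w/b)\<^sup>2/2)" by simp
 qed simp
 thus ?thesis using True by simp
 qed (simp add: prod_nonneg)
 qed
 also note L
 finally have "prob {w:space P. ALL j:J. abs (Y j w) <= b} <= exp (- 2) ^ card J/exp (- 1) ^ card J" by (simp add: pos_le_divide_eq mult.commute)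
 also have "... = exp (- real (card J))" by (simp add: power_divide exp_diff[symmetric] exp_of_nat_mult[symmetric])
 finally show ?thesis by (simp add: b_def)
 qed
 thus ?thesis using that \<delta> by blast
qed

text \<open>Excludes frequencies with a vanishing coordinate, where a negative power of 0 is 0 by
  convention and lower bounds on the spectral density break down.\<close>

lemma AE_components_nonzero: "AE x in lborel. ALL b:(Basis::'a::euclidean_space set). x \<bullet> b ~= 0"
proof (rule AE_finite_allI)
 fix b :: 'a assume b: "b:Basis"
 have "{x::'a. x \<bullet> b = 0}:null_sets lebesgue" using negligible_standard_hyperplane[OF b, of 0] by (simp add: negligible_iff_null_sets)
 moreover have "{x::'a. x \<bullet> b = 0}:sets lborel" by simp
 ultimately show "AE x in lborel. x \<bullet> b ~= 0" by (simp add: null_sets_completion_iff AE_I')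
qed simp

lemma dyadic_lattice:
 assumes "!!b. b:Basis ==> EX (k::nat) l. p \<bullet> b = real k/2^l"
 shows "p:(dyadics :: (real*'a::euclidean_space) set)"
proof -
 obtain k l :: "real*'a => nat" where kl: "!!b. b:Basis ==> p \<bullet> b = real (k b)/2^l b" using assms by metis
 define m where "m = Max (l ` Basis)"
 have "tr m (p \<bullet> b) = p \<bullet> b" if b: "b:Basis" for b
 proof -
 have "2^m = 2^l b*(2::real)^(m-l b)" using b unfolding m_def by (simp flip: power_add)
 hence e: "p \<bullet> b*2^m = of_int (int (k b)*2^(m-l b))" using kl[OF b] by simp
 have "0<=p \<bullet> b" using kl[OF b] by simp
 thus ?thesis unfolding tr_def abs_of_nonneg[OF \<open>0 <= p \<bullet> b\<close>] e floor_of_int unfolding e[symmetric] by (auto simp: sgn_if)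
 qed
 hence "tr m (p \<bullet> (1, 0)) = p \<bullet> (1, 0)" "!!b. b:Basis ==> tr m (p \<bullet> (0, b)) = p \<bullet> (0, b)" by (simp_all add: Basis_prod_def)
 hence "tr m (fst p) = fst p" "trv m (snd p) = snd p" by (auto simp: inner_Pair_0 intro: euclidean_eqI)
 thus ?thesis unfolding dyadics_def by auto
qed

context points
begin

section \<open>Lattices in small anisotropic balls\<close>

definition "expo b = (if fst b = 0 then H2 else H1)" for b :: "real*'a"

lemma expo: "0<expo b" "expo b<1" "(SUM b:Basis. 1/expo b) = G.Q"
proof -
 have "(SUM b:Basis. 1/expo b) = (SUM b:(%u. (u, 0)) ` (Basis::real set). 1/expo b)+(SUM b:(%v. (0, v)) ` (Basis::'a set). 1/expo b)"
 unfolding Basis_prod_def by (rule sum.union_disjoint) auto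
 thus "(SUM b:Basis. 1/expo b) = G.Q" by (simp add: sum.reindex inj_on_def expo_def G.Q_def expQ_def)
qed (use H1 H2 in "auto simp: expo_def")

text \<open>On the box dual to the lattice the spectral density is bounded below by a constant of
  order s^((1 + 2 H)/H1 + \<beta>/H2), and the characters are orthogonal there. Multiplied by the
  volume, at least of order s^(-Q), the constant is of order s^2.\<close>

lemma KV_lattice_lower:
 obtains c where "0<c" "!!s h J a. 0<s ==> s<=1 ==> (!!b. b:Basis ==> s powr (1/expo b)/2 <= h b & h b <= s powr (1/expo b)) ==>
 finite J ==> 0 ~: J ==> (!!x b. x:J ==> b:Basis ==> x \<bullet> b/h b:\<int>) ==>
 (c * s)^2*(SUM x:J. (a x)^2) <= (SUM x:J. SUM y:J. a x*a y*KV UNIV x y)"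
proof -
 let ?D = "%J a. %v. S v * (cmod (SUM x:J. of_real (a x) * vf x v))^2"
 let ?C = "(1+2*H)/H1+\<beta>/H2"
 let ?B = "%J a. %v. SUM x:J. SUM y:J. a x*a y*(indicator UNIV v * (S v * Re (vf x v * cnj (vf y v))))"
 let ?A = "%k. k powr (2*\<alpha>)+k^2"
 define k where "k = 2*pi*real DIM('a)"
 have k: "0<k" by (simp add: k_def)
 define c where "c = k powr (1-2*H-\<beta>)/?A k / cS"
 have c: "0<c" using k cS by (simp add: add_pos_pos c_def)
 have "(sqrt c * s)^2*(SUM x:J. (a x)^2) <= (SUM x:J. SUM y:J. a x*a y*KV UNIV x y)"
 if s: "0<s" "s<=1" and h: "!!b. b:Basis ==> s powr (1/expo b)/2 <= h b & h b <= s powr (1/expo b)"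
 and J: "finite J" "0 ~: J" "!!x b. x:J ==> b:Basis ==> x \<bullet> b/h b:\<int>" for s h J a
 proof -
 have h0: "0<h b" if "b:Basis" for b using h[OF that] s by (smt (verit) powr_gt_zero half_gt_zero)
 define B where "B = {v::real*'a. ALL b:Basis. abs (v \<bullet> b) <= pi/h b}"
 \<comment> \<open>The constant -1 in every \<open>vf\<close> is collected as a coefficient at the
   origin, a further lattice point because 0 is not in \<open>J\<close>. Its square can only enlarge
   the norm.\<close>
 define a' where "a' x = (if x = 0 then-(SUM x:J. a x) else a x)" for x
 have ph: "phase x v = cis (- (v \<bullet> x))" for x v :: "real*'a" by (simp add: phase_def inner_prod_def)
 have sm: "(SUM x:J. of_real (a x) * vf x v) = (SUM x:insert 0 J. of_real (a' x) * cis (- (v \<bullet> x)))" for v using J by (auto simp: a'_def vf_def ph right_diff_distrib sum_subtractf intro!: sum.cong)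
 define V where "V = (PROD b:(Basis::(real*'a) set). 2*pi/h b)"
 have J0: "finite (insert 0 J)" "!!x b. x:insert 0 J ==> b:Basis ==> x \<bullet> b/h b:\<int>" using J by auto
 note bp = box_parseval[OF h0 J0, of a', folded B_def V_def]
 define m where "m = c * s powr ?C"
 have m0: "0<m" using c s by (simp add: m_def)
 have Sm: "m <= S v" if v: "v:B" "ALL b:Basis. v \<bullet> b ~= 0" for v
 proof -
 obtain q l where w: "v = (q, l)" by (cases v)
 define T X where "T = s powr (- (1/H1))" and "X = s powr (- (1/H2))"
 have TX: "0<T" "0<X" using s by (auto simp: T_def X_def)
 have le: "pi/h b <= 2*pi * s powr (- (1/expo b))" if "b:Basis" for b
 proof -
 have "pi/h b <= pi/(s powr (1/expo b)/2)" using h[OF that] h0[OF that] s by (intro divide_left_mono) simp_all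
 also have "pi/(s powr (1/expo b)/2) = 2*pi * s powr (- (1/expo b))" by (subst powr_minus_divide) simp
 finally show ?thesis .
 qed
 obtain b0 :: 'a where b0: "b0:Basis" using nonempty_Basis by blast
 have t0: "q ~= 0" using bspec[OF v(2), of "(1, 0)"] by (simp add: w Basis_prod_def)
 have x0: "l ~= 0" using bspec[OF v(2), of "(0, b0)"] b0 by (auto simp: w Basis_prod_def)
 have "abs q <= 2*pi*T" using v(1) le[of "(1, 0)"] unfolding w B_def by (simp add: Basis_prod_def expo_def T_def)
 also have "... <= k*T" using TX by (intro mult_right_mono) (auto simp: k_def)
 finally have t: "abs q <= k*T" .
 have "norm l <= (SUM b:Basis. abs (l \<bullet> b))" by (rule norm_le_l1)
 also have "... <= (SUM b:(Basis::'a set). 2*pi*X)"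
 proof (rule sum_mono)
 fix b :: 'a assume b: "b:Basis"
 show "abs (l \<bullet> b) <= 2*pi*X" using v(1) b le[of "(0, b)"] unfolding w B_def by (auto simp: Basis_prod_def expo_def X_def)
 qed
 finally have x: "norm l <= k*X" by (simp add: k_def mult_ac)
 have X2: "X powr (2*\<alpha>) = T^2" using s \<alpha> by (simp add: X_def T_def powr_powr powr_power H2_def)
 have "norm l powr (2*\<alpha>)+q^2 <= (k*X) powr (2*\<alpha>)+(k*T)^2" using x \<alpha> power_mono[OF t, of 2] by (intro add_mono powr_mono2) auto
 also have "... = ?A k*T^2" using X2 by (simp add: powr_mult power_mult_distrib distrib_right)
 finally have den: "norm l powr (2*\<alpha>)+q^2 <= ?A k*T^2" .
 have "cS*m = k powr (1-2*H-\<beta>)/?A k * s powr ?C" using cS by (simp add: m_def c_def)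
 also have "s powr ?C = T powr (1-2*H)*X powr (- \<beta>)/T^2"
 proof -
 show ?thesis using s unfolding T_def X_def powr_powr by (simp add: T_def powr_power powr_add[symmetric] powr_diff[symmetric] diff_divide_distrib add_divide_distrib add.assoc)
 qed
 also have "k powr (1-2*H-\<beta>)/?A k*(T powr (1-2*H)*X powr (- \<beta>)/T^2)
 = (k*T) powr (1-2*H)*(k*X) powr (- \<beta>)/(?A k*T^2)"
 using k TX by (simp add: powr_mult powr_diff powr_minus divide_inverse)
 also have "... <= abs q powr (1-2*H)*norm l powr-\<beta>/(norm l powr (2*\<alpha>)+q^2)"
 using t x t0 x0 H \<beta> den by (intro frac_le mult_mono powr_mono2') (auto intro!: add_nonneg_pos)
 also have "... <= cS*S v" unfolding w by (rule S_lower)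
 finally show ?thesis using cS by simp
 qed
 have V: "m*V >= c * s^2"
 proof -
 have "s powr (- G.Q) = (PROD b:(Basis::(real*'a) set). s powr (- (1/expo b)))" using s by (simp add: powr_sum[symmetric] sum_negf expo(3))
 also have "... <= V" unfolding V_def
 proof (rule prod_mono, rule conjI)
 fix b :: "real*'a" assume b: "b:Basis"
 have "s powr (- (1/expo b)) = 1 / s powr (1/expo b)" by (simp add: powr_minus divide_inverse)
 also have "... <= 2*pi/h b" using h[OF b] h0[OF b] pi_ge_two by (intro frac_le) auto
 finally show "s powr (- (1/expo b)) <= 2*pi/h b" .
 qed simp
 finally have "m*V >= m * s powr (- G.Q)" using m0 by simp
 also have "m * s powr (- G.Q) = c * s powr ((1+2*H)/H1+\<beta>/H2-G.Q)" by (simp add: m_def powr_diff powr_minus divide_inverse)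
 also have "(1+2*H)/H1+\<beta>/H2-G.Q = 2"
 proof -
 have "(1+2*H)/H1+\<beta>/H2-G.Q = (\<alpha>*(2*H)-(real DIM('a)-\<beta>))/H2"
 using H1 unfolding G.Q_def expQ_def by (simp add: H2_def) (use \<alpha> in "simp add: field_simps")
 also have "\<alpha>*(2*H)-(real DIM('a)-\<beta>) = 2*H2" using H2_eq by simp
 finally show ?thesis using H2 by simp
 qed
 finally show ?thesis using s by simp
 qed
 have d: "\<nu>S UNIV = density lborel (%v. ennreal (S v))" by (simp add: \<nu>S_def)
 have "(sqrt c * s)^2*(SUM x:J. (a x)^2) <= m*V*(SUM x:J. (a x)^2)" using V c by (intro mult_right_mono sum_nonneg) (auto simp: power_mult_distrib)
 also have "... <= m*V*(SUM x:insert 0 J. (a' x)^2)"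
 proof -
 have "(SUM x:J. (a' x)^2) = (SUM x:J. (a x)^2)" using J by (intro sum.cong) (auto simp: a'_def)
 moreover have "0<=m*V" using m0 h0 unfolding V_def by (intro mult_nonneg_nonneg prod_nonneg) (auto simp: less_imp_le)
 ultimately show ?thesis using J by (intro mult_left_mono) auto
 qed
 also have "... = (LINT v|lborel. m*(indicator B v * (cmod (SUM x:J. of_real (a x) * vf x v))^2))" unfolding sm by (simp only: bp(2) integral_mult_right_zero mult.assoc)
 also have "... <= (LINT v|lborel. S v * (cmod (SUM x:J. of_real (a x) * vf x v))^2)"
 proof (rule integral_mono_AE)
 show "integrable lborel (%v. m*(indicator B v * (cmod (SUM x:J. of_real (a x) * vf x v))^2))" unfolding sm by (intro integrable_mult_right bp)
 have "integrable lborel (?B J a)" by (intro integrable_lint_sum integrable_mult_right KV_eq(2)) auto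
 also have "?B J a = ?D J a"
 proof
 fix v
 have "(cmod (SUM x:J. of_real (a x) * vf x v))^2 = Re ((SUM x:J. of_real (a x) * vf x v) * cnj (SUM x:J. of_real (a x) * vf x v))"
 by (simp only: complex_norm_square[symmetric] Re_complex_of_real)
 also have "... = (SUM x:J. SUM y:J. Re (of_real (a x*a y)*(vf x v * cnj (vf y v))))" by (simp add: sum_product mult_ac)
 finally show "(SUM x:J. SUM y:J. a x*a y*(indicator UNIV v * (S v * Re (vf x v * cnj (vf y v))))) = S v * (cmod (SUM x:J. of_real (a x) * vf x v))^2"
 by (simp add: sum_distrib_left mult_ac)
 qed
 finally show "integrable lborel (?D J a)" .
 show "AE v in lborel. m*(indicator B v * (cmod (SUM x:J. of_real (a x) * vf x v))^2) <= S v * (cmod (SUM x:J. of_real (a x) * vf x v))^2"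
 by (rule eventually_mono[OF AE_components_nonzero]) (auto simp: indicator_def S_nonneg intro!: mult_right_mono Sm)
 qed
 also have "... = (LINT v|\<nu>S UNIV. (cmod (SUM x:J. of_real (a x) * vf x v))^2)" unfolding d by (subst integral_density) (auto simp: S_nonneg)
 finally show ?thesis using l2_kernel_quad[OF V_features[of UNIV] J(1), of "%x. x" a] by (simp add: KV_def)
 qed
 thus ?thesis using that[of "sqrt c"] c by auto
qed

lemma powr_root_bracket:
 assumes "0<x" "x<=1" obtains l :: nat where "x/2 <= 1/2^l" "1/2^l <= (x::real)"
proof -
 obtain l where l: "2^l <= 1/x" "1/x < 2^Suc l" using dyadic_bracket[of "1/x"] assms by auto
 hence "x/2 <= 1/2^Suc l*1" "1/2^Suc l <= x" using assms by (auto simp: field_simps)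
 thus ?thesis by (intro that[of "Suc l"]) auto
qed

text \<open>A mesh of \<open>\<rho>\<close>-size 2^(-K)/u, rounded to powers of 1/2 so that the
  points are dyadic, leaves room for at least a constant times u^Q points in the ball of radius
  2^(-K). Indices start at 1, which avoids the origin.\<close>

lemma lattice_points:
 assumes D0: "0<a0" "!!p. p:dyadics ==> abs (fst p) < a0 ==> p:D"
 obtains A K0 where "1<=A" "!!K u. K0 <= K ==> A <= u ==> EX h J. (ALL b:Basis. (1/2^K/u) powr (1/expo b)/2 <= h b & h b <= (1/2^K/u) powr (1/expo b)) &
 finite J & 0 ~: J & (ALL x:J. ALL b:Basis. x \<bullet> b/h b:\<int>) & J \<subseteq> G.ball_pts K & u powr G.Q <= (2*A)^(1+DIM('a))*real (card J)"
proof -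
 let ?B = "Basis :: (real*'a) set"
 \<comment> \<open>Shrinking the index ranges by \<open>A\<close> makes the time part and the space
   part of \<open>\<rho>\<close> at most a third of the radius each.\<close>
 define A where "A = real DIM('a)*(3 powr (1/H1)+3 powr (1/H2))"
 have p1: "1<=3 powr (1/H1)" "1<=3 powr (1/H2)" using H1 H2 by (auto intro!: ge_one_powr_ge_zero)
 have A1: "1<=A" using mult_mono[of 1 "real DIM('a)" 1 "3 powr (1/H1)+3 powr (1/H2)"] p1 by (simp add: A_def)
 have A3: "3 powr (1/H1) <= A" "real DIM('a)*3 powr (1/H2) <= A" using mult_mono[of 1 "real DIM('a)" "3 powr (1/H1)" "3 powr (1/H1)+3 powr (1/H2)"] by (auto simp: A_def)
 have "eventually (%K::nat. 2 powr (- real K/H1) < a0) sequentially" using H1 D0(1) by (intro order_tendstoD(2)[of _ 0]; (real_asymp | simp))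
 then obtain K0 where K0: "!!K. K0 <= K ==> 2 powr (- real K/H1) < a0" by (auto simp: eventually_sequentially)
 have "EX h J. (ALL b:?B. (1/2^K/u) powr (1/expo b)/2 <= h b & h b <= (1/2^K/u) powr (1/expo b)) &
 finite J & 0 ~: J & (ALL x:J. ALL b:?B. x \<bullet> b/h b:\<int>) & J \<subseteq> G.ball_pts K & u powr G.Q <= (2*A)^(1+DIM('a))*real (card J)"
 if K: "K0 <= K" and u: "A <= u" for K u
 proof -
 define s where "s = 1/2^K/u"
 have u1: "1<=u" using u A1 by simp
 have s: "0<s" "s<=1" using u1 by (auto simp: s_def field_simps intro: order.trans[OF _ mult_mono[of 1 u 1 "2^K"]])
 have "ALL b:?B. EX l::nat. s powr (1/expo b)/2 <= 1/2^l & 1/2^l <= s powr (1/expo b)"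
 proof
 fix b :: "real*'a"
 have "s powr (1/expo b)<=1" using s expo(1,2)[of b] by (intro powr_le1) auto
 thus "EX l::nat. s powr (1/expo b)/2 <= 1/2^l & 1/2^l <= s powr (1/expo b)" using powr_root_bracket[of "s powr (1/expo b)"] s by (metis powr_gt_zero less_irrefl)
 qed
 then obtain l :: "real*'a => nat" where l: "!!b. b:?B ==> s powr (1/expo b)/2 <= 1/2^l b & 1/2^l b <= s powr (1/expo b)" by metis
 define h where "h b = 1/(2::real)^l b" for b
 define m where "m b = nat (floor (u powr (1/expo b)/A))" for b
 define N where "N = PiE ?B (%b. {1..m b})"
 define e where "e n = (SUM b:?B. (real (n b)*h b) *\<^sub>R b)" for n :: "real*'a => nat"
 have eb: "e n \<bullet> b = real (n b)*h b" if "b:?B" for n b unfolding e_def using that by simp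
 have h0: "0<h b" for b by (simp add: h_def)
 have inj: "inj_on e N"
 proof (rule inj_onI)
 fix n n' assume n: "n:N" "n':N" "e n = e n'"
 show "n = n'"
 proof (rule PiE_ext[OF n(1,2)[unfolded N_def]])
 fix b assume "b:?B"
 thus "n b = n' b" using eb[of b n] eb[of b n'] n(3) h0[of b] by simp
 qed
 qed
 have mb: "real (n b)*h b<=2 powr (- real K/expo b)/A" if n: "n:N" and b: "b:?B" for n b
 proof -
 have "real (n b) <= real (m b)" using n b by (auto simp: N_def)
 also have "... <= u powr (1/expo b)/A" unfolding m_def using A1 by simp
 finally have "real (n b) <= u powr (1/expo b)/A" .
 hence "real (n b)*h b <= (u powr (1/expo b)/A) * s powr (1/expo b)" using l[OF b] by (intro mult_mono) (auto simp: h_def)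
 also have "... = (u * s) powr (1/expo b)/A" by (simp add: powr_mult)
 also have "u * s = 2 powr (- real K)" using u1 by (simp add: s_def powr_minus powr_realpow divide_inverse)
 finally show ?thesis by (simp add: powr_powr)
 qed
 have ball: "e n:G.ball_pts K" if n: "n:N" for n
 proof -
 have "e n:dyadics"
 proof (rule dyadic_lattice)
 fix b assume "b:?B"
 thus "EX k l. e n \<bullet> b = real k/2^l" by (intro exI[of _ "n b"] exI[of _ "l b"]) (simp add: eb h_def)
 qed
 have nn: "0<=real (n b)*h b" for b using h0[of b] by simp
 have b1: "(1, 0):?B" "b:Basis ==> (0, b):?B" for b :: 'a by (auto simp: Basis_prod_def)
 have f: "abs (fst (e n))<=2 powr (- real K/H1)/A" using mb[OF n b1(1)] eb[OF b1(1), of n] nn[of "(1, 0)"] by (simp add: inner_Pair_0 expo_def)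
 also have "... <= 2 powr (- real K/H1)" using A1 by (simp add: pos_divide_le_eq)
 also have "... < a0" by (rule K0[OF K])
 finally have "e n:D" using D0(2)[OF \<open>e n : dyadics\<close>] by simp
 have "norm (snd (e n)) <= (SUM b:Basis. abs (snd (e n) \<bullet> b))" by (rule norm_le_l1)
 also have "... <= (SUM b:(Basis::'a set). 2 powr (- real K/H2)/A)" using mb[OF n b1(2)] eb[OF b1(2), of _ n] nn by (intro sum_mono) (simp add: inner_Pair_0 expo_def)
 finally have g: "norm (snd (e n)) <= real DIM('a)*2 powr (- real K/H2)/A" by simp
 have f13: "abs (fst (e n))<=2 powr (- real K/H1)/3 powr (1/H1)" by (rule order.trans[OF f], rule divide_left_mono) (use A3 A1 in auto)
 have "abs (fst (e n)) powr H1 <= (2 powr (- real K/H1)/3 powr (1/H1)) powr H1" using H1 by (intro powr_mono2 f13) auto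
 also have "... = 1/2^K/3" using H1 by (simp add: powr_divide powr_mult powr_powr powr_minus_divide powr_realpow)
 finally have 1: "abs (fst (e n)) powr H1 <= 1/2^K/3" .
 have "real DIM('a)*2 powr (- real K/H2)/A<=2 powr (- real K/H2)/3 powr (1/H2)" using mult_right_mono[OF A3(2), of "2 powr (- real K/H2)"] A1 by (simp add: field_simps)
 hence "norm (snd (e n)) powr H2 <= (2 powr (- real K/H2)/3 powr (1/H2)) powr H2" using H2 g by (intro powr_mono2) auto
 also have "... = 1/2^K/3" using H2 by (simp add: powr_divide powr_mult powr_powr powr_minus_divide powr_realpow)
 finally have "dist_rho H1 H2 (e n) <= 1/2^K/3+1/2^K/3" using 1 by (simp add: dist_rho_def rho_def)
 also have "... < 1/2^K" by (simp add: field_simps)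
 finally show ?thesis using \<open>e n : D\<close> by (simp add: G.ball_pts_def)
 qed
 have ne: "e n ~= 0" if n: "n:N" for n
 proof -
 have b: "(1, 0):?B" by (simp add: Basis_prod_def)
 have "1<=n (1, 0)" using n b by (auto simp: N_def)
 hence "e n \<bullet> (1, 0) ~= 0" unfolding eb[OF b] using h0[of "(1, 0)"] by simp
 thus ?thesis by auto
 qed
 have fin: "finite N" unfolding N_def by (intro finite_PiE) auto
 have "u powr G.Q = (PROD b:?B. u powr (1/expo b))" using u1 by (subst expo(3)[symmetric]) (simp add: powr_sum)
 also have "... <= (PROD b:?B. 2*A*real (m b))"
 proof (rule prod_mono, rule conjI)
 fix b :: "real*'a"
 have "u powr 1<=u powr (1/expo b)" using u1 expo(1,2)[of b] by (intro powr_mono) auto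
 hence "1<=u powr (1/expo b)/A" using u A1 by simp
 moreover have "x <= 2*real (nat (floor (x)))" if "1<=x" for x :: real
 proof -
 have "real (nat (floor (x))) = of_int (floor (x))" "(1::real) <= of_int (floor (x))" using that by auto
 thus ?thesis by linarith
 qed
 ultimately have "u powr (1/expo b)/A <= 2*real (m b)" unfolding m_def by simp
 thus "u powr (1/expo b) <= 2*A*real (m b)" using A1 by (simp add: pos_divide_le_eq mult_ac)
 qed simp
 also have "... = (2*A)^(1+DIM('a))*real (card N)" by (simp add: N_def card_PiE prod.distrib)
 finally show ?thesis using l fin ball ne unfolding s_def[symmetric] by (auto simp: card_image[OF inj] h_def[symmetric] eb intro!: exI[of _ h] exI[of _ "e ` N"])
 qed
 thus ?thesis using that A1 by blast
qed

text \<open>With u = (B ln K)^(1/Q) the lattice has at least 2 ln K points, so smallness on the ball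
  of radius 2^(-K) has probability at most K^(-2). By Borel-Cantelli it eventually fails at every
  dyadic scale, as a positive lower limit demands.\<close>

lemma lf_lower_bound:
 fixes X :: "real*'a => 'w => real"
 assumes D0: "0<a0" "!!p. p:dyadics ==> abs (fst p) < a0 ==> p:D" and gf: "gaussian_family P D X (KV UNIV)"
 obtains c where "0<c" "AE w in P. ereal c <= G.lf (%p. X p w)"
proof -
 let ?B = "%K u. 1/2^K/u K"
 let ?A = "%K. 2/2^K*ln (real (K-1)*ln 2) powr (- (1/G.Q))"
 interpret prob_space P by (rule gaussian_familyD[OF gf])
 obtain A K0 where A: "1<=A" "!!K u. K0 <= K ==> A <= u ==> EX h J. (ALL b:Basis. (1/2^K/u) powr (1/expo b)/2 <= h b & h b <= (1/2^K/u) powr (1/expo b)) &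
 finite J & 0 ~: J & (ALL x:J. ALL b:Basis. x \<bullet> b/h b:\<int>) & J \<subseteq> G.ball_pts K & u powr G.Q <= (2*A)^(1+DIM('a))*real (card J)"
 by (rule lattice_points[of a0], rule D0(1), rule D0(2), assumption, assumption, rule that; assumption)
 obtain c0 where c0: "0<c0" "!!s h J a. 0<s ==> s<=1 ==> (!!b. b:Basis ==> s powr (1/expo b)/2 <= h b & h b <= s powr (1/expo b)) ==>
 finite J ==> 0 ~: J ==> (!!x b. x:J ==> b:Basis ==> x \<bullet> b/h b:\<int>) ==>
 (c0 * s)^2*(SUM x:J. (a x)^2) <= (SUM x:J. SUM y:J. a x*a y*KV UNIV x y)"
 by (rule KV_lattice_lower) blast
 obtain d where d: "0<d"
 "!!(P::'w measure) J (Y::real*'a => 'w => real) K r. gaussian_family P J Y K ==> finite J ==> 0<r ==>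
 (!!a. r^2*(SUM j:J. (a j)^2) <= (SUM i:J. SUM j:J. a i*a j*K i j)) ==>
 \<P>(w in P. ALL j:J. abs (Y j w) <= d*r) <= exp (- real (card J))"
 by (rule gaussian_family_small_ball_upper) blast
 \<comment> \<open>Cancels the constant of the point count and leaves the factor 2 that makes the
   probabilities summable.\<close>
 define B where "B = 2*(2*A)^(1+DIM('a))"
 have B: "0<B" using A by (simp add: B_def)
 define u where "u K = (B*ln (real K)) powr (1/G.Q)" for K
 have KV0: "KV UNIV p 0 = 0" "KV UNIV 0 p = 0" for p by (simp_all add: KV_eq vf_def phase_def)
 define E where "E K = {w:space P. G.incr_le X K (d*(c0*?B K u)) w}" for K
 have Em[measurable]: "E K:events" for K unfolding E_def
 by (intro sets.sets_Collect_countable_All' predE G.increments_measurable[OF gf] G.ball_pts_countable) (auto simp: G.ball_pts_def)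
 have q: "0<1/G.Q" using G.Q_pos by simp
 have "eventually (%K. A <= u K) sequentially"
 proof -
 have "filterlim (%K::nat. (B*ln (real K)) powr q) at_top sequentially" if "0<q" for q using B that by real_asymp
 from this[OF q] show ?thesis unfolding u_def filterlim_at_top by simp
 qed
 moreover have "eventually (%K::nat. 1<real K) sequentially" by simp
 ultimately have "eventually (%K. norm (prob (E K)) <= 1/real K^2) sequentially" using eventually_ge_at_top[of K0]
 proof eventually_elim
 case (elim K)
 obtain h J where hJ: "ALL b:Basis. (?B K u) powr (1/expo b)/2 <= h b & h b <= (?B K u) powr (1/expo b)"
 "finite J" "0 ~: J" "ALL x:J. ALL b:Basis. x \<bullet> b/h b:\<int>" "J \<subseteq> G.ball_pts K" "u K powr G.Q <= (2*A)^(1+DIM('a))*real (card J)"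
 using A(2)[OF elim(3,1)] by auto
 define s where "s = 1/2^K/u K"
 have s: "0<s" "s<=1" using elim A by (auto simp: s_def field_simps intro!: order.trans[OF _ mult_mono[of 1 "u K" 1 "2^K"]])
 have JD: "J \<subseteq> D" using hJ(5) by (auto simp: G.ball_pts_def)
 have g1: "gaussian_family P J (%p w. X p w-X 0 w) (KV UNIV)"
 using gaussian_family_reindex[OF gaussian_family_diff[OF gf], of "%p. (p, 0)" J] JD D(2) by (auto simp: KV0)
 have "prob (E K) <= prob {w:space P. ALL p:J. abs (X p w-X 0 w) <= d*(c0 * s)}"
 proof (rule finite_measure_mono)
 show "E K \<subseteq> {w:space P. ALL p:J. abs (X p w-X 0 w) <= d*(c0 * s)}" using hJ(5) by (auto simp: E_def s_def)
 show "{w:space P. ALL p:J. abs (X p w-X 0 w) <= d*(c0 * s)}:events" using JD by (intro sets.sets_Collect_finite_All hJ predE G.increments_measurable[OF gf]) auto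
 qed
 also have "... <= exp (- real (card J))" using s c0(1) hJ by (intro d(2)[OF g1] c0(2)[of s h]) (auto simp: s_def)
 also have "... <= exp (- 2*ln (real K))" using elim B G.Q_pos hJ(6) A by (simp add: u_def powr_powr B_def)
 also have "exp (- 2*ln (real K)) = 1/real K^2" using elim exp_double[of "ln (real K)"] exp_minus[of "2*ln (real K)"] by (simp add: divide_inverse)
 finally show ?case by simp
 qed
 hence "summable (%K. prob (E K))" by (rule summable_comparison_test_ev) (use inverse_power_summable[of 2, where 'a=real] in "simp add: divide_inverse power_inverse")
 hence bc: "AE w in P. eventually (%K. w:space P-E K) sequentially" by (intro borel_cantelli_AE1) (auto simp: less_top[symmetric])
 define c where "c = d * c0*(2*B) powr (- (1/G.Q))/2"
 have c: "0<c" using d c0 B by (simp add: c_def)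
 have cmp: "eventually (%K. c*?A K <= d*(c0*?B K u)) sequentially"
 proof -
 have 1: "eventually (%K::nat. 0<ln (real K)) sequentially" by real_asymp
 have 2: "eventually (%K::nat. ln (real K) <= 2*ln (real (K-1)*ln 2)) sequentially" by real_asymp
 show ?thesis using 1 2
 proof eventually_elim
 case (elim K)
 let ?L = "ln (real (K-1)*ln 2)"
 have "(2*B) powr (- (1/G.Q))*?L powr (- (1/G.Q)) <= (2*B) powr (- (1/G.Q))*(ln (real K)/2) powr (- (1/G.Q))" using elim q by (simp add: powr_mono2' mult_left_mono)
 also have "... = (2*B*(ln (real K)/2)) powr (- (1/G.Q))" using elim by (subst powr_mult) auto
 also have "... = 1/u K" by (simp add: u_def powr_minus_divide)
 finally have "d * c0/2^K*((2*B) powr (- (1/G.Q))*?L powr (- (1/G.Q))) <= d * c0/2^K*(1/u K)" using d c0 by (intro mult_left_mono) auto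
 thus ?case by (simp add: c_def)
 qed
 qed
 have "AE w in P. ereal c <= G.lf (%p. X p w)"
 proof (rule eventually_mono[OF bc])
 fix w assume w: "eventually (%K. w:space P-E K) sequentially"
 show "ereal c <= G.lf (%p. X p w)" unfolding G.lf_def
 proof (rule G.lfun_lower[OF c], rule eventually_elim2[OF w cmp])
 fix K assume "w:space P-E K" and le: "c*?A K <= d*(c0*?B K u)"
 then obtain p where "p:G.ball_pts K" "~ abs (X p w-X 0 w) <= d*(c0*?B K u)" unfolding E_def by blast
 thus "EX p:G.ball_pts K. c*?A K <= abs (X p w-X 0 w)" using le by (intro bexI[of _ p]) linarith+
 qed
 qed
 thus ?thesis using that c by simp
qed

end

section \<open>The spectral form of the energy\<close>

text \<open>The kernel \<open>\<bar>r\<bar> powr (2 * H - 2)\<close> is a mixture of the Gaussians \<open>exp (- (s * r\<^sup>2))\<close>, whose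
 quadratic forms are nonnegative by inspection of their characteristic functions.\<close>

locale hurst =
 fixes H :: real assumes H: "1/2 < H" "H<1"
begin

section \<open>The power kernel as a mixture of Gaussians\<close>

lemma half_line_scaling:
 assumes [measurable]: "f:bm" and c: "0<c"
 shows "nn_integral lborel (%s. ennreal (if 0<s then s powr-H*f (c * s) else 0))
 = ennreal (c powr (H-1))*nn_integral lborel (%s. ennreal (if 0<s then s powr-H*f s else 0))"
proof -
 let ?B = "\<integral>\<^sup>+s. ennreal (if 0<s then s powr-H*f s else 0) \<partial>lborel"
 let ?A = "\<integral>\<^sup>+s. ennreal (if 0<0 + c * s then (0 + c * s) powr-H*f (0 + c * s) else 0) \<partial>lborel"
 have "?B = ennreal c*?A" using c by (subst nn_integral_real_affine[where c=c and t=0]) auto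
 also have "?A = nn_integral lborel (%s. ennreal (c powr-H)*ennreal (if 0<s then s powr-H*f (c * s) else 0))"
 using c by (intro nn_integral_cong) (auto simp: zero_less_mult_iff powr_mult ennreal_mult'[symmetric] mult.assoc)
 finally have "ennreal (c powr (H-1))*?B
 = ennreal (c powr (H-1)*(c * c powr-H))*nn_integral lborel (%s. ennreal (if 0<s then s powr-H*f (c * s) else 0))" using c by (simp add: ennreal_mult' mult.assoc nn_integral_cmult)
 also have "c powr (H-1)*(c * c powr-H) = 1" using c by (simp add: powr_diff powr_minus)
 finally show ?thesis by simp
qed

text \<open>The bound with p below 1 gives convergence near 0, the one with q above 1 gives it near
  infinity, and positivity of f excludes the value 0. Only existence of the constant is
  recorded.\<close>

lemma half_line_const:
 assumes [measurable]: "f:bm" and f: "!!s. 0<s ==> 0<f s" and pq: "!!s. 0<s ==> f s<=4 * s powr (H-p)" "!!s. 0<s ==> f s<=4 * s powr (H-q)" "p<1" "1<q"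
 obtains A where "0<A" "nn_integral lborel (%s. ennreal (if 0<s then s powr-H*f s else 0)) = ennreal A"
proof -
 let ?g = "%s. if 0<s then s powr-H*f s else 0"
 have "p < real DIM(real)" "real DIM(real) < q" using pq by auto
 obtain B where B: "0<B" "!!X. 0<X ==> (\<integral>\<^sup>+(x::real). ennreal (if norm x <= X then norm x powr-p else 0) \<partial>lborel) <= ennreal (B*X powr (real DIM(real)-p))"
 by (rule nn_integral_powr_inner[OF \<open>p < real DIM(real)\<close>]) blast
 obtain C where C: "0<C" "!!X. 0<X ==> (\<integral>\<^sup>+(x::real). ennreal (if X < norm x then norm x powr-q else 0) \<partial>lborel) <= ennreal (C*X powr (real DIM(real)-q))"
 by (rule nn_integral_powr_outer[OF \<open>real DIM(real) < q\<close>]) blast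
 have le: "?g s <= 4*norm s powr-r" if "!!s. 0<s ==> f s<=4 * s powr (H-r)" for s r
 proof (cases "0<s")
 case True
 have "s powr-H*f s <= s powr-H*(4 * s powr (H-r))" using that[OF True] by (intro mult_left_mono) auto
 also have "... = 4 * s powr-r" by (simp add: powr_add[symmetric])
 finally show ?thesis by simp
 qed simp
 have fin: "nn_integral lborel (%s. ennreal (?g s)) <= ennreal (4*B+4*C)"
 by (rule nn_integral_split_bound[where X=1]) (use le[OF pq(1)] le[OF pq(2)] B(2)[of 1] C(2)[of 1] B(1) C(1) in auto)
 have "nn_integral lborel (%s. ennreal (?g s)) ~= 0"
 proof
 assume "nn_integral lborel (%s. ennreal (?g s)) = 0"
 hence "AE s in lborel. ennreal (?g s) = 0" by (subst (asm) nn_integral_0_iff_AE) auto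
 hence "AE s in lborel. s ~: {0<..<1::real}"
 proof eventually_elim
 case (elim s)
 have "0<s ==> 0<s powr-H*f s" using f by simp
 thus ?case using elim by auto
 qed
 thus False by (subst (asm) AE_iff_measurable[where N="{0<..<1}"]) auto
 qed
 moreover have "nn_integral lborel (%s. ennreal (?g s)) < \<infinity>" using fin by (rule le_less_trans) simp
 ultimately show ?thesis using that[of "enn2real (nn_integral lborel (%s. ennreal (?g s)))"] by (simp add: enn2real_positive_iff zero_less_iff_neq_zero)
qed

text \<open>The Gamma integral with value Gamma (1 - H), treated as an abstract positive
  constant.\<close>

definition "AH = (SOME A. 0<A & nn_integral lborel (%s. ennreal (if 0<s then s powr-H*exp (- s) else 0)) = ennreal A)"

text \<open>The mixing density, normalised so that the mixture carries the factor H (2 H - 1) of the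
  noise covariance.\<close>

definition "hm s = (if 0<s then H*(2*H-1)/AH * s powr-H else 0)"

definition "Mh = density lborel (%s. ennreal (hm s))"

lemma exp_le_inverse: "0<x ==> exp (- x) <= 1/(x::real)"
proof -
 assume "0<x"
 moreover have "x <= exp x" using exp_ge_add_one_self[of x] by linarith
 ultimately show ?thesis by (simp add: exp_minus field_simps)
qed

lemma AH: "0<AH" "nn_integral lborel (%s. ennreal (if 0<s then s powr-H*exp (- s) else 0)) = ennreal AH"
proof -
 let ?A = "\<integral>\<^sup>+s. ennreal (if 0<s then s powr-H*exp (- s) else 0) \<partial>lborel"
 obtain A where "0<A" "?A = ennreal A"
 proof (rule half_line_const[of "%s. exp (- s)" H "H+1"])
 fix s :: real assume s: "0<s"
 have "exp (- s) <= 4*1" by (rule order.trans[of _ 1]) (use s in auto)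
 thus "exp (- s)<=4 * s powr (H-H)" using s by simp
 show "exp (- s)<=4 * s powr (H-(H+1))" using exp_le_inverse[OF s] s by (simp add: powr_minus divide_inverse) (smt (verit) inverse_positive_iff_positive)
 qed (use H in auto)
 hence "EX A. 0<A & ?A = ennreal A" by auto
 from someI_ex[OF this] show "0<AH" "?A = ennreal AH" unfolding AH_def[symmetric] by auto
qed

lemma hm[measurable]: "hm:bm" and hm_nonneg: "0<=hm s" using H AH(1) unfolding hm_def by auto

sublocale Mh: sigma_finite_measure Mh unfolding Mh_def by (subst sigma_finite_measure.sigma_finite_iff_density_finite[OF sigma_finite_lborel]) auto

lemma sets_Mh[measurable_cong]: "sets Mh = sets borel" by (simp add: Mh_def)

lemma nn_integral_Mh:
 assumes [measurable]: "f:bm" and f: "!!s. 0<s ==> 0<=f s"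
 shows "nn_integral Mh (%s. ennreal (f s)) = ennreal (H*(2*H-1)/AH)*nn_integral lborel (%s. ennreal (if 0<s then s powr-H*f s else 0))"
proof -
 have "nn_integral Mh (%s. ennreal (f s)) = nn_integral lborel (%s. ennreal (hm s)*ennreal (f s))" unfolding Mh_def by (rule nn_integral_density) auto
 also have "... = nn_integral lborel (%s. ennreal (H*(2*H-1)/AH)*ennreal (if 0<s then s powr-H*f s else 0))"
 using H AH(1) by (intro nn_integral_cong) (auto simp: hm_def ennreal_mult'[symmetric] mult.assoc)
 finally show ?thesis by (simp add: nn_integral_cmult)
qed

lemma mixture_time: assumes "r ~= 0" shows "nn_integral Mh (%s. ennreal (exp (- (s * r^2)))) = ennreal (H*(2*H-1)*abs r powr (2*H-2))"
proof -
 let ?A = "\<integral>\<^sup>+s. ennreal (if 0<s then s powr-H*exp (- (r^2 * s)) else 0) \<partial>lborel"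
 have "nn_integral Mh (%s. ennreal (exp (- (s * r^2)))) = ennreal (H*(2*H-1)/AH)*?A"
 proof -
 have e: "s * r^2 = r^2 * s" for s by simp
 show ?thesis unfolding e by (subst nn_integral_Mh) auto
 qed
 also have "?A = ennreal ((r^2) powr (H-1))*ennreal AH" unfolding AH(2)[symmetric] by (rule half_line_scaling) (use assms in auto)
 finally show ?thesis using powr_powr[of "abs r" 2 "H-1"] H AH(1) by (simp add: ennreal_mult'[symmetric])
qed

text \<open>The density at r of the centred normal law with variance 2 s. Its characteristic
  function is the Gaussian with parameter s, so this is the Fourier side of the mixture.\<close>

definition "sdens s r = (2 * s) powr-(1/2) * std_normal_density (r / sqrt (2 * s))"

text \<open>Scaling reduces every r to 1. There the factor exp (- 1/(4 s)) tames the singularity at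
  s = 0, and the extra s^(-1/2) gives decay at infinity.\<close>

lemma mixture_frequency:
 obtains c where "0<c" "!!r. r ~= 0 ==> (nn_integral Mh (%s. ennreal (sdens s r))) = ennreal (c*abs r powr (1-2*H))"
proof -
 let ?C = "%r. \<integral>\<^sup>+s. ennreal (sdens s r) \<partial>Mh"
 let ?B = "%s r. if 0<s then s powr-H * sdens (1/r^2 * s) 1 else 0"
 let ?A = "%r. \<integral>\<^sup>+s. ennreal (if 0<s then s powr-H * sdens s r else 0) \<partial>lborel"
 have e: "sdens s 1 = (2 * s) powr-(1/2) / sqrt (2*pi)*exp (- 1/(4 * s))" if "0<s" for s using that by (simp add: sdens_def std_normal_density_def power_divide)
 have p2: "1<=sqrt (2*pi)" using pi_ge_two by simp
 have le2: "(2 * s) powr-(1/2) <= s powr-(1/2)" if "0<s" for s :: real using that by (intro powr_mono2') auto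
 obtain A where A: "0<A" "nn_integral lborel (%s. ennreal (if 0<s then s powr-H * sdens s 1 else 0)) = ennreal A"
 proof (rule half_line_const[of "%s. sdens s 1" "H-1/2" "H+1/2"])
 show "(%s. sdens s 1):bm" unfolding sdens_def by simp
 fix s :: real assume s: "0<s"
 show "0<sdens s 1" using s by (simp add: e)
 have "(2 * s) powr-(1/2) / sqrt (2*pi) <= (2 * s) powr-(1/2)/1" using p2 by (intro divide_left_mono) auto
 hence d: "(2 * s) powr-(1/2) / sqrt (2*pi) <= s powr-(1/2)" using le2[OF s] by simp
 have "sdens s 1<=s powr-(1/2)*(4 * s)" unfolding e[OF s] using exp_le_inverse[of "1/(4 * s)"] s d by (intro mult_mono) auto
 also have "... = 4 * s powr (H-(H-1/2))" using s powr_add[of s "- (1/2)" 1] by simp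
 finally show "sdens s 1<=4 * s powr (H-(H-1/2))" .
 have "sdens s 1<=s powr-(1/2)*1" unfolding e[OF s] using s d by (intro mult_mono) auto
 thus "sdens s 1<=4 * s powr (H-(H+1/2))" by (smt (verit) powr_ge_zero mult_1_right)
 qed (use H in auto)
 have "?C r = ennreal (H*(2*H-1)/AH*A*abs r powr (1-2*H))" if r: "r ~= 0" for r
 proof -
 have m: "(%s. sdens s r):bm" "(%s. sdens s 1):bm" unfolding sdens_def by auto
 have "?C r = ennreal (H*(2*H-1)/AH)*?A r" by (rule nn_integral_Mh[OF m(1)]) (simp add: sdens_def)
 also have "?A r = nn_integral lborel (%s. ennreal (1/abs r)*ennreal (?B s r))"
 proof (intro nn_integral_cong)
 fix s :: real
 have "sdens s r = 1/abs r * sdens (1/r^2 * s) 1" if s: "0<s"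
 proof -
 have "(2*(1/r^2 * s)) powr-(1/2) = (2 * s) powr-(1/2)*abs r" using s by (simp add: powr_minus powr_half_sqrt real_sqrt_divide field_simps)
 moreover have "(1 / sqrt (2*(1/r^2 * s)))^2 = (r / sqrt (2 * s))^2" using s by (simp add: power_divide)
 ultimately show ?thesis using r unfolding sdens_def std_normal_density_def by simp
 qed
 thus "ennreal (if 0<s then s powr-H * sdens s r else 0) = ennreal (1/abs r)*ennreal (?B s r)" by (auto simp: ennreal_mult'[symmetric])
 qed
 also have "... = ennreal (1/abs r)*(ennreal ((1/r^2) powr (H-1))*ennreal A)"
 unfolding A(2)[symmetric] using m r by (subst nn_integral_cmult) (auto simp: half_line_scaling[of "%s. sdens s 1" "1/r^2"])
 also have "(1/r^2) powr (H-1) = abs r powr (2-2*H)"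
 proof -
 have "1/r^2 = abs r powr-2" by (simp add: powr_minus_divide)
 thus ?thesis by (simp add: powr_powr)
 qed
 finally show ?thesis using A(1) r powr_diff[of "abs r" "2-2*H" 1] H AH(1) by (simp add: ennreal_mult'[symmetric] mult.assoc)
 qed
 thus ?thesis using that[of "H*(2*H-1)/AH*A"] H AH(1) A(1) by simp
qed

definition "cH = (SOME c. 0<c & (ALL r. r ~= 0 --> (nn_integral Mh (%s. ennreal (sdens s r))) = ennreal (c*abs r powr (1-2*H))))"

lemma cH: "0<cH" "r ~= 0 ==> (nn_integral Mh (%s. ennreal (sdens s r))) = ennreal (cH*abs r powr (1-2*H))"
proof -
 let ?A = "%r. \<integral>\<^sup>+s. ennreal (sdens s r) \<partial>Mh"
 have "EX c. 0<c & (ALL r. r ~= 0 --> (?A r) = ennreal (c*abs r powr (1-2*H)))" by (rule mixture_frequency) blast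
 from someI_ex[OF this] show "0<cH" "r ~= 0 ==> (?A r) = ennreal (cH*abs r powr (1-2*H))" unfolding cH_def[symmetric] by auto
qed

abbreviation "L2 == (lborel :: real measure) \<Otimes>\<^sub>M (lborel :: real measure)"

definition FT :: "(real => complex) => real => complex" where
 "FT F r = (LINT u|lborel. cis (- (r*u))*F u)"

lemma integrable_tensor:
 fixes F G :: "'x => complex"
 assumes "sigma_finite_measure M" "sigma_finite_measure N" and F: "integrable M F" and G: "integrable N G"
 shows "integrable (M \<Otimes>\<^sub>M N) (%w. F (fst w)*G (snd w))"
 "(LINT w|(M \<Otimes>\<^sub>M N). F (fst w)*G (snd w)) = (LINT x|M. F x)*(LINT y|N. G y)"
proof -
 interpret M: sigma_finite_measure M by fact
 interpret N: sigma_finite_measure N by fact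
 interpret MN: pair_sigma_finite M N by standard
 show i: "integrable (M \<Otimes>\<^sub>M N) (%w. F (fst w)*G (snd w))" using F G by (intro MN.Fubini_integrable) (auto simp: norm_mult)
 show "(LINT w|(M \<Otimes>\<^sub>M N). F (fst w)*G (snd w)) = (LINT x|M. F x)*(LINT y|N. G y)" using MN.integral_fst'[OF i] by simp
qed

lemma cnj_measurable[measurable (raw)]: "f:borel_measurable M ==> (%x. cnj (f x)):borel_measurable M"
 by (rule measurable_compose[OF _ borel_measurable_continuous_onI]) auto

lemma cis_integrable: "integrable lborel F ==> integrable lborel (%u::real. cis (- (r*u))*F u)" by (rule lint_bound) (auto simp: norm_mult)

lemma FT_measurable[measurable]:
 assumes [measurable]: "F:bm" shows "FT F:bm" unfolding FT_def by simp

text \<open>The Gaussian is an average of characters over a standard normal variable, and by Fubini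
  each character turns the double integral into the squared modulus of a Fourier transform.\<close>

lemma gauss_form:
 assumes F: "integrable lborel F" and s: "0<=s"
 shows "integrable L2 (%w. complex_of_real (exp (- (s * (fst w-snd w)^2)))*(F (fst w) * cnj (F (snd w))))"
 "integrable N01 (%x. (cmod (FT F (sqrt (2 * s)*x)))^2)"
 "(LINT w|L2. complex_of_real (exp (- (s * (fst w-snd w)^2)))*(F (fst w) * cnj (F (snd w)))) = complex_of_real (LINT x|N01. (cmod (FT F (sqrt (2 * s)*x)))^2)"
proof -
 let ?E = "L2 \<Otimes>\<^sub>M N01"
 let ?D = "%x. LINT u|lborel. cnj (cis (- (sqrt (2 * s)*x*u))*F u)"
 let ?C = "%w. LINT x|N01. cis ((- (sqrt (2 * s)*(fst w-snd w)))*x)"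
 let ?B = "%x. FT F (sqrt (2 * s)*x)"
 let ?A = "%w. exp (- (s * (fst w-snd w)^2))"
 interpret N: prob_space N01 by (rule prob_space_N01)
 interpret L2: sigma_finite_measure L2 unfolding lborel_prod by (rule sigma_finite_lborel)
 interpret LN: pair_sigma_finite L2 N01 by standard
 define FF where "FF w = F (fst w) * cnj (F (snd w))" for w
 have iF: "integrable L2 FF" unfolding FF_def using integrable_tensor[OF sigma_finite_lborel sigma_finite_lborel F integrable_cnj[OF F]] by simp
 have mF[measurable]: "FF:borel_measurable L2" using iF by simp
 define h where "h w x = cis (- (sqrt (2 * s)*(fst w-snd w)*x))*FF w" for w x
 have E: "(LINT x|N01. h w x) = of_real (?A w)*FF w" for w
 proof -
 have "(LINT x|N01. h w x) = ?C w*FF w" unfolding h_def by simp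
 also have "?C w = of_real (?A w)" using s unfolding cis_N01 by (simp add: power_mult_distrib)
 finally show ?thesis .
 qed
 have ih: "integrable ?E (case_prod h)"
 proof (rule lint_bound)
 show "integrable ?E (%z. FF (fst z)*1)" using iF by (intro LN.Fubini_integrable) auto
 show "case_prod h:borel_measurable ?E" unfolding h_def by simp
 qed (auto simp: h_def norm_mult)
 have S: "(LINT w|L2. h w x) = of_real ((cmod (?B x))^2)" for x
 proof -
 have ci: "cis (- (y*(a-b)*x)) = cis (- (y*x*a)) * cnj (cis (- (y*x*b)))" for a b y by (simp add: cis_cnj cis_mult algebra_simps)
 have "(LINT w|L2. h w x) = (LINT w|L2. (cis (- (sqrt (2 * s)*x*fst w))*F (fst w))*(cnj (cis (- (sqrt (2 * s)*x * snd w))*F (snd w))))"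
 by (intro lint_cong refl) (unfold h_def FF_def ci, simp)
 also have "... = FT F (sqrt (2 * s)*x)*?D x"
 unfolding FT_def by (rule integrable_tensor[OF sigma_finite_lborel sigma_finite_lborel cis_integrable[OF F] integrable_cnj[OF cis_integrable[OF F]]])
 also have "?D x = cnj (?B x)" unfolding FT_def by (rule Bochner_Integration.integral_cnj)
 finally show ?thesis by (simp only: complex_norm_square)
 qed
 show "integrable L2 (%w. of_real (?A w)*(F (fst w) * cnj (F (snd w))))" using LN.integrable_fst[OF ih] unfolding E FF_def .
 have "integrable N01 (%x. Re (of_real ((cmod (?B x))^2)))" using LN.integrable_snd[OF ih] unfolding S by rule
 thus "integrable N01 (%x. (cmod (?B x))^2)" by simp
 show "(LINT w|L2. of_real (?A w)*(F (fst w) * cnj (F (snd w)))) = of_real (LINT x|N01. (cmod (?B x))^2)"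
 using LN.integral_fst[OF ih] LN.integral_snd[OF ih] unfolding E S FF_def integral_complex_of_real by simp
qed

lemma gauss_form_spectral:
 assumes [measurable]: "F:bm"
 shows "nn_integral Mh (%s. \<integral>\<^sup>+x. ennreal ((cmod (FT F (sqrt (2 * s)*x)))^2) \<partial>N01) = nn_integral lborel (%r. ennreal (cH*abs r powr (1-2*H)*(cmod (FT F r))^2))"
proof -
 let ?C = "%r. cH*abs r powr (1-2*H)*(cmod (FT F r))^2"
 let ?B = "%s x. (cmod (FT F (sqrt (2 * s)*x)))^2"
 let ?A = "%s. \<integral>\<^sup>+r. ennreal (sdens s r)*ennreal ((cmod (FT F r))^2) \<partial>lborel"
 interpret MT: pair_sigma_finite Mh "lborel :: real measure" by standard
 have sd[measurable]: "case_prod sdens:borel_measurable (Mh \<Otimes>\<^sub>M lborel)" unfolding sdens_def by simp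
 have "nn_integral Mh (%s. \<integral>\<^sup>+x. ennreal (?B s x) \<partial>N01) = nn_integral Mh (%s. \<integral>\<^sup>+r. ennreal (sdens s r)*ennreal ((cmod (FT F r))^2) \<partial>lborel)"
 proof (rule nn_integral_cong_AE)
 have "AE s in Mh. 0<s" unfolding Mh_def by (subst AE_density) (auto simp: hm_def)
 thus "AE s in Mh. nn_integral N01 (%x. ennreal (?B s x)) = ?A s"
 proof eventually_elim
 case (elim s)
 have "?A s = ennreal (abs (sqrt (2 * s)))*nn_integral lborel (%x. ennreal (sdens s (0+sqrt (2 * s)*x))*ennreal ((cmod (FT F (0+sqrt (2 * s)*x)))^2))"
 using elim by (intro nn_integral_real_affine) (auto simp: sdens_def)
 also have "... = nn_integral lborel (%x. ennreal (std_normal_density x)*ennreal (?B s x))" using elim by (simp add: sdens_def powr_minus powr_half_sqrt mult.assoc[symmetric] ennreal_mult'[symmetric] nn_integral_cmult[symmetric])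
 finally show ?case by (subst nn_integral_density) auto
 qed
 qed
 also have "... = nn_integral lborel (%r. \<integral>\<^sup>+s. ennreal (sdens s r)*ennreal ((cmod (FT F r))^2) \<partial>Mh)"
 by (rule MT.Fubini'[symmetric]) (use in \<open>auto simp: case_prod_beta'\<close>)
 also have "... = nn_integral lborel (%r. ennreal (?C r))"
 proof (rule nn_integral_cong_AE, rule eventually_mono[OF AE_lborel_singleton[of 0]])
 fix r :: real assume r: "r ~= 0"
 show "nn_integral Mh (%s. ennreal (sdens s r)*ennreal ((cmod (FT F r))^2)) = ennreal (?C r)" using cH(1) by (simp add: nn_integral_multc cH(2)[OF r] ennreal_mult'[symmetric])
 qed
 finally show ?thesis .
qed

abbreviation "kH r == abs r powr (2*H-2)"

lemma AE_L2_neq: "AE w in L2. fst w ~= snd w"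
proof (rule lborel_pair.AE_pair_measure)
 show "AE x in lborel. AE y in lborel. fst (x, y) ~= snd (x, y :: real)" using AE_lborel_singleton by (auto simp: eq_commute)
qed measurable

text \<open>\<open>gauss_form\<close> integrated over the mixture. Fubini is covered by
  integrability against the power kernel, which is the mixture of the positive Gaussians off the
  diagonal, and the diagonal is a null set.\<close>

lemma energy_spectral:
 assumes F: "integrable lborel F" and k: "integrable L2 (%w. complex_of_real (kH (fst w-snd w))*(F (fst w) * cnj (F (snd w))))"
 obtains r where "0<=r" "complex_of_real (H*(2*H-1))*(LINT w|L2. complex_of_real (kH (fst w-snd w))*(F (fst w) * cnj (F (snd w)))) = complex_of_real r"
 "ennreal r = nn_integral lborel (%t. ennreal (cH*abs t powr (1-2*H)*(cmod (FT F t))^2))"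
proof -
 let ?C = "LINT w|L2. of_real (kH (fst w-snd w))*(F (fst w) * cnj (F (snd w)))"
 let ?B = "%w. of_real (H*(2*H-1))*(of_real (kH (fst w-snd w))*(F (fst w) * cnj (F (snd w))))"
 let ?A = "%s x. cmod (FT F (sqrt (2 * s)*x))"
 interpret L2: sigma_finite_measure L2 unfolding lborel_prod by (rule sigma_finite_lborel)
 interpret LM: pair_sigma_finite L2 Mh by standard
 have Fm[measurable]: "F:bm" using borel_measurable_integrable[OF F] by simp
 define FF where "FF w = F (fst w) * cnj (F (snd w))" for w
 have mF[measurable]: "FF:borel_measurable L2" unfolding FF_def by simp
 define h where "h w s = of_real (exp (- (s * (fst w-snd w)^2)))*FF w" for w s
 have mh[measurable]: "case_prod h:borel_measurable (L2 \<Otimes>\<^sub>M Mh)" unfolding h_def by simp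
 have c: "0<H*(2*H-1)" using H by simp
 have ie: "integrable Mh (%s. exp (- (s * r^2)))" "(LINT s|Mh. exp (- (s * r^2))) = H*(2*H-1)*kH r" if "r ~= 0" for r :: real
 using mixture_time[OF that] c by (auto simp: integral_eq_nn_integral intro!: integrableI_bounded)
 have E: "(LINT s|Mh. h w s) = of_real (H*(2*H-1)*kH (fst w-snd w))*FF w" if "fst w ~= snd w" for w unfolding h_def using ie[of "fst w-snd w"] that by simp
 have ih: "integrable (L2 \<Otimes>\<^sub>M Mh) (case_prod h)"
 proof (rule LM.Fubini_integrable)
 have "integrable L2 (%w. norm (?B w))" using k by simp
 thus "integrable L2 (%w. LINT s|Mh. norm (case (w, s) of (x, y) => h x y))"
 proof (rule integrable_cong_AE_imp)
 show "AE w in L2. norm (?B w) = (LINT s|Mh. norm (case (w, s) of (x, y) => h x y))"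
 by (rule eventually_mono[OF AE_L2_neq]) (simp add: h_def FF_def norm_mult ie abs_of_pos[OF c] del: of_real_mult)
 qed measurable
 show "AE w in L2. integrable Mh (%s. case (w, s) of (x, y) => h x y)" by (rule eventually_mono[OF AE_L2_neq]) (auto simp: h_def intro!: integrable_mult_left ie)
 qed measurable
 define r where "r = (LINT s|Mh. LINT x|N01. (?A s x)^2)"
 have s0: "AE s in Mh. 0<=s" unfolding Mh_def by (subst AE_density) (auto simp: hm_def)
 have Sx: "(LINT w|L2. h w s) = of_real (LINT x|N01. (?A s x)^2)" if "0<=s" for s unfolding h_def FF_def by (rule gauss_form(3)[OF F that])
 have ish: "integrable Mh (%s. LINT w|L2. h w s)" by (rule LM.integrable_snd[OF ih])
 have N[measurable]: "(%s. LINT x|N01. (?A s x)^2):borel_measurable Mh"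
 proof -
 interpret N: prob_space N01 by (rule prob_space_N01)
 show ?thesis by simp
 qed
 have ir: "integrable Mh (%s. LINT x|N01. (?A s x)^2)" by (rule integrable_cong_AE_imp[OF integrable_Re[OF ish]]) (auto intro!: eventually_mono[OF s0] simp: Sx)
 have "of_real (H*(2*H-1))*?C = (LINT w|L2. LINT s|Mh. h w s)" unfolding integral_mult_right_zero[symmetric]
 by (intro integral_cong_AE, simp, measurable, rule eventually_mono[OF AE_L2_neq]) (simp add: E FF_def)
 also have "... = (LINT s|Mh. LINT w|L2. h w s)" using LM.Fubini_integral[OF ih] by simp
 also have "... = (LINT s|Mh. of_real (LINT x|N01. (?A s x)^2))" by (intro integral_cong_AE) (auto intro!: eventually_mono[OF s0] simp: Sx)
 also have "... = of_real r" unfolding r_def by simp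
 finally have 1: "of_real (H*(2*H-1))*?C = of_real r" .
 have "ennreal r = nn_integral Mh (%s. ennreal (LINT x|N01. (?A s x)^2))" unfolding r_def by (rule nn_integral_eq_integral[symmetric, OF ir]) simp
 also have "... = nn_integral Mh (%s. \<integral>\<^sup>+x. ennreal ((?A s x)^2) \<partial>N01)"
 by (rule nn_integral_cong_AE, rule eventually_mono[OF s0]) (subst nn_integral_eq_integral, auto intro: gauss_form(2)[OF F])
 also note gauss_form_spectral[OF Fm]
 finally show ?thesis using that[of r] 1 by (simp add: r_def)
qed

text \<open>The form is nonnegative on \<open>f - g\<close>, hence the parallelogram law bounds it on \<open>f + g\<close>.\<close>

lemma energy_add_le:
 fixes f g :: "real => real"
 assumes f: "integrable lborel f" "!!u. 0<=f u" and g: "integrable lborel g" "!!u. 0<=g u"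
 defines "q == %f. \<integral>\<^sup>+w. ennreal (kH (fst w-snd w)*(f (fst w)*f (snd w))) \<partial>L2"
 shows "q (%u. f u+g u) <= 2*q f+2*q g"
proof -
 let ?D = "H*(2*H-1)"
 let ?C = "%A f. \<integral>\<^sup>+s. ennreal (A f s) \<partial>Mh"
 let ?B = "%f w. f (fst w)*f (snd w)"
 let ?A = "%s w. - (s * (fst w-snd w)^2)"
 interpret L2: sigma_finite_measure L2 unfolding lborel_prod by (rule sigma_finite_lborel)
 interpret LM: pair_sigma_finite L2 Mh by standard
 have [measurable]: "f:bm" "g:bm" using borel_measurable_integrable f(1) g(1) by auto
 define A where "A f s = (LINT w|L2. exp (?A s w)*?B f w)" for f and s :: real
 have c: "0<H*(2*H-1)" using H by simp
 have ge: "integrable L2 (%w. exp (?A s w)*?B f w)" "0<=A f s" if "integrable lborel f" "0<=s" for f and s :: real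
 proof -
 have i: "integrable lborel (%u. complex_of_real (f u))" using that by simp
 have eq: "complex_of_real (exp (?A s w))*(complex_of_real (f (fst w)) * cnj (complex_of_real (f (snd w)))) = complex_of_real (exp (?A s w)*?B f w)" for w by simp
 note gf = gauss_form[OF i that(2)]
 show "integrable L2 (%w. exp (?A s w)*?B f w)" using integrable_Re[OF gf(1)] by simp
 have "complex_of_real (A f s) = complex_of_real (LINT x|N01. (cmod (FT (%u. complex_of_real (f u)) (sqrt (2 * s)*x)))^2)"
 using gf(3) unfolding eq integral_complex_of_real A_def .
 thus "0<=A f s" by simp
 qed
 have qA: "ennreal ?D*q f = ?C A f" if f: "integrable lborel f" "!!u. 0<=f u" for f
 proof -
 have [measurable]: "f:bm" using borel_measurable_integrable[OF f(1)] by simp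
 have "ennreal ?D*q f = nn_integral L2 (%w. ennreal ?D*ennreal (kH (fst w-snd w)*?B f w))" unfolding q_def by (rule nn_integral_cmult[symmetric]) measurable
 also have "... = nn_integral L2 (%w. \<integral>\<^sup>+s. ennreal (exp (?A s w))*ennreal (?B f w) \<partial>Mh)"
 proof (rule nn_integral_cong_AE, rule eventually_mono[OF AE_L2_neq])
 fix w :: "real \<times> real" assume w: "fst w ~= snd w"
 have "nn_integral Mh (%s. ennreal (exp (?A s w))*ennreal (?B f w)) = nn_integral Mh (%s. ennreal (exp (?A s w)))*ennreal (?B f w)"
 by (rule nn_integral_multc) measurable
 thus "ennreal ?D*ennreal (kH (fst w-snd w)*?B f w) = nn_integral Mh (%s. ennreal (exp (?A s w))*ennreal (?B f w))"
 unfolding mixture_time[of "fst w-snd w", simplified, OF w] using H f(2) by (simp add: ennreal_mult[symmetric])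
 qed
 also have "... = nn_integral Mh (%s. \<integral>\<^sup>+w. ennreal (exp (?A s w))*ennreal (?B f w) \<partial>L2)" by (rule LM.Fubini'[symmetric]) measurable
 also have "... = ?C A f"
 proof (rule nn_integral_cong_AE)
 have "AE s in Mh. 0<=s" unfolding Mh_def by (subst AE_density) (auto simp: hm_def)
 thus "AE s in Mh. nn_integral L2 (%w. ennreal (exp (?A s w))*ennreal (?B f w)) = ennreal (A f s)"
 proof eventually_elim
 case (elim s)
 show ?case unfolding A_def using ge(1)[OF f(1) elim] f(2) by (subst nn_integral_eq_integral[symmetric]) (auto simp: ennreal_mult')
 qed
 qed
 finally show ?thesis .
 qed
 have Am[measurable]: "A f:borel_measurable Mh" if [measurable]: "f:bm" for f unfolding A_def by simp
 have le: "A (%u. f u+g u) s <= 2*A f s+2*A g s" if s: "0<=s" for s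
 proof -
 note i = ge(1)[OF f(1) s] ge(1)[OF g(1) s] ge(1)[OF Bochner_Integration.integrable_add[OF f(1) g(1)] s] ge(1)[OF Bochner_Integration.integrable_diff[OF f(1) g(1)] s]
 have "A (%u. f u+g u) s+A (%u. f u-g u) s = 2*A f s+2*A g s" unfolding A_def Bochner_Integration.integral_add[OF i(3,4), symmetric] integral_mult_right_zero[symmetric]
 by (subst Bochner_Integration.integral_add[symmetric]; (intro integrable_mult_right i)?) (auto simp: algebra_simps)
 thus ?thesis using ge(2)[OF Bochner_Integration.integrable_diff[OF f(1) g(1)] s] by simp
 qed
 have "ennreal ?D*q (%u. f u+g u) = nn_integral Mh (%s. ennreal (A (%u. f u+g u) s))" by (rule qA) (use f g in auto)
 also have "... <= nn_integral Mh (%s. 2*ennreal (A f s)+2*ennreal (A g s))"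
 proof (rule nn_integral_mono_AE)
 have "AE s in Mh. 0<=s" unfolding Mh_def by (subst AE_density) (auto simp: hm_def)
 thus "AE s in Mh. ennreal (A (%u. f u+g u) s) <= 2*ennreal (A f s)+2*ennreal (A g s)"
 proof eventually_elim
 case (elim s)
 have "2*ennreal (A f s)+2*ennreal (A g s) = ennreal (2*A f s+2*A g s)" using ge(2)[OF f(1) elim] ge(2)[OF g(1) elim] by (simp add: ennreal_mult')
 thus ?case using le[OF elim] by (simp add: ennreal_leI)
 qed
 qed
 also have "... = 2*?C A f+2*nn_integral Mh (%s. ennreal (A g s))" by (subst nn_integral_add) (auto simp: nn_integral_cmult)
 also have "... = ennreal ?D*(2*q f+2*q g)" unfolding qA[OF f, symmetric] qA[OF g, symmetric] by (simp add: distrib_left mult_ac)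
 finally show ?thesis using c by (subst (asm) ennreal_mult_le_mult_iff) (auto simp: ennreal_zero_less_mult_iff)
qed

end

section \<open>Functions of time and spatial frequency\<close>

lemma triple_swap:
 assumes "sigma_finite_measure A" "sigma_finite_measure B" "sigma_finite_measure C"
 shows "A \<Otimes>\<^sub>M (B \<Otimes>\<^sub>M C) = distr (C \<Otimes>\<^sub>M (A \<Otimes>\<^sub>M B)) (A \<Otimes>\<^sub>M (B \<Otimes>\<^sub>M C)) (%w. (fst (snd w), snd (snd w), fst w))" (is "?L = distr ?R ?L ?f")
proof (rule measure_eqI)
 interpret A: sigma_finite_measure A by fact
 interpret B: sigma_finite_measure B by fact
 interpret C: sigma_finite_measure C by fact
 interpret BC: pair_sigma_finite B C by standard
 interpret AB: pair_sigma_finite A B by standard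
 interpret CAB: pair_sigma_finite C "A \<Otimes>\<^sub>M B" by standard
 fix X assume X[measurable]: "X:sets ?L"
 have "emeasure ?L X = nn_integral A (%x. \<integral>\<^sup>+y. \<integral>\<^sup>+z. indicator X (x, y, z) \<partial>C \<partial>B)"
 by (subst BC.emeasure_pair_measure, simp, intro nn_integral_cong, subst C.nn_integral_fst[symmetric]) auto
 also have "... = nn_integral (A \<Otimes>\<^sub>M B) (%p. \<integral>\<^sup>+z. indicator X (fst p, snd p, z) \<partial>C)" by (subst B.nn_integral_fst[symmetric]) auto
 also have "... = nn_integral ?R (%w. indicator X (?f w))" by (simp add: CAB.Fubini' AB.nn_integral_fst[symmetric])
 also have "... = nn_integral (distr ?R ?L ?f) (%w. indicator X w)" by (subst nn_integral_distr) auto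
 finally show "emeasure ?L X = emeasure (distr ?R ?L ?f) X" by simp
qed simp

locale spectral_measure = hurst H for H +
 fixes \<mu> :: "'a::euclidean_space measure" and g :: "'a => real"
 assumes g[measurable]: "g:bm" and g0: "!!k. 0<=g k" and \<mu>: "\<mu> = density lborel (%k. ennreal (g k))"
begin

lemma sets_\<mu>[measurable_cong]: "sets \<mu> = sets borel" by (simp add: \<mu>)

sublocale \<mu>: sigma_finite_measure \<mu> unfolding \<mu> by (subst sigma_finite_measure.sigma_finite_iff_density_finite[OF sigma_finite_lborel]) auto

sublocale L2: sigma_finite_measure L2 unfolding lborel_prod by (rule sigma_finite_lborel)

sublocale \<mu>L: pair_sigma_finite \<mu> L2 by standard

abbreviation "M3 == (lborel :: real measure) \<Otimes>\<^sub>M ((lborel :: real measure) \<Otimes>\<^sub>M \<mu>)"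

lemmas M3_swap = triple_swap[OF sigma_finite_lborel sigma_finite_lborel \<mu>.sigma_finite_measure_axioms]

lemma nn_integral_M3:
 assumes [measurable]: "f:borel_measurable M3"
 shows "nn_integral M3 (%w. f w) = nn_integral \<mu> (%k. \<integral>\<^sup>+w. f (fst w, snd w, k) \<partial>L2)"
 by (subst M3_swap, subst nn_integral_distr) (auto simp: lborel_pair.nn_integral_fst[symmetric])

lemma integral_M3:
 fixes f :: "real \<times> real*'a => complex"
 assumes f: "integrable M3 f"
 shows "AE k in \<mu>. integrable L2 (%w. f (fst w, snd w, k))" "integrable \<mu> (%k. LINT w|L2. f (fst w, snd w, k))"
 "(LINT w|M3. f w) = (LINT k|\<mu>. LINT w|L2. f (fst w, snd w, k))"
proof -
 have [measurable]: "f:borel_measurable M3" using f by simp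
 have i: "integrable (\<mu> \<Otimes>\<^sub>M L2) (%w. f (fst (snd w), snd (snd w), fst w))" using f by (subst (asm) M3_swap, subst (asm) integrable_distr_eq) auto
 show "AE k in \<mu>. integrable L2 (%w. f (fst w, snd w, k))" using \<mu>L.AE_integrable_fst'[OF i] by simp
 show "integrable \<mu> (%k. LINT w|L2. f (fst w, snd w, k))" using \<mu>L.integrable_fst'[OF i] by simp
 show "(LINT w|M3. f w) = (LINT k|\<mu>. LINT w|L2. f (fst w, snd w, k))" using \<mu>L.integral_fst'[OF i] by (subst M3_swap, subst integral_distr) auto
qed

definition "time_bounded F \<longleftrightarrow> (EX R>=0. ALL u k. u<0 \<or> R < u --> F (u, k) = 0)"

definition "nk F w = ennreal (kH (fst w-fst (snd w))*(cmod (F (fst w, snd (snd w))) * cmod (F (fst (snd w), snd (snd w)))))"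

text \<open>The class on which energies are computed: bounded support in time and absolutely
  convergent energy. Its closure under domination and linear combinations carries the passage from
  test functions to general integrands.\<close>

definition good :: "(real*'a => complex) => bool" where
 "good F \<longleftrightarrow> F:bm & time_bounded F & nn_integral M3 (%w. nk F w) < \<infinity>"

lemma goodD: assumes "good F" shows "F:bm" "time_bounded F" "nn_integral M3 (%w. nk F w) < \<infinity>" using assms by (auto simp: good_def)

lemma section_measurable: "F:bm ==> (%u. F (u::real, k::'a)):bm" by simp

lemma space_time_measurable:
 fixes F :: "real*'a => complex"
 assumes F: "F:bm"
 shows "(%w. F (fst w, snd (snd w))):borel_measurable M3" "(%w. F (fst (snd w), snd (snd w))):borel_measurable M3"
 by (rule measurable_compose[OF _ F], simp add: borel_prod[symmetric])+

lemma nk_measurable[measurable]: "F:bm ==> nk F:borel_measurable M3"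
proof -
 assume "F:bm"
 note a = space_time_measurable[OF this]
 have k: "(%w. kH (fst w-fst (snd w))):borel_measurable M3" by simp
 show ?thesis unfolding nk_def
 by (rule measurable_compose[OF borel_measurable_times[OF k borel_measurable_times[OF measurable_compose[OF a(1) borel_measurable_norm] measurable_compose[OF a(2) borel_measurable_norm]]] measurable_ennreal])
qed

definition "eint F F' w = complex_of_real (kH (fst w-fst (snd w)))*(F (fst w, snd (snd w)) * cnj (F' (fst (snd w), snd (snd w))))"

lemma eint_measurable[measurable]: "F:bm ==> F':bm ==> eint F F':borel_measurable M3"
 unfolding eint_def by (intro borel_measurable_times space_time_measurable(1) cnj_measurable space_time_measurable(2)) measurable

lemma good_iff: "good F \<longleftrightarrow> F:bm & time_bounded F & integrable M3 (eint F F)"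
proof -
 have "ennreal (norm (eint F F w)) = nk F w" for w by (simp add: eint_def nk_def norm_mult)
 thus ?thesis unfolding good_def integrable_iff_bounded by auto
qed

text \<open>Times are confined to an interval, so the decreasing kernel is bounded below on the
  support and the energy of a section controls the square of its L1 norm.\<close>

lemma good_section:
 assumes F: "good F"
 shows "AE k in \<mu>. integrable lborel (%u. F (u, k)) & nn_integral L2 (%w. nk F (fst w, snd w, k)) < \<infinity>"
proof -
 note [measurable] = goodD(1)[OF F]
 obtain R where R: "0<=R" "!!u k. u<0 \<or> R < u ==> F (u, k) = 0" using goodD(2)[OF F] unfolding time_bounded_def by auto
 have "nn_integral \<mu> (%k. \<integral>\<^sup>+w. nk F (fst w, snd w, k) \<partial>L2) < \<infinity>" using goodD(3)[OF F] by (simp add: nn_integral_M3[symmetric])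
 hence "AE k in \<mu>. nn_integral L2 (%w. nk F (fst w, snd w, k)) ~= \<infinity>" by (intro nn_integral_PInf_AE) auto
 thus ?thesis
 proof eventually_elim
 case (elim k)
 let ?f = "%u. ennreal (cmod (F (u, k)))"
 have "nn_integral lborel (%u. ?f u)*nn_integral lborel (%u. ?f u) = nn_integral L2 (%w. ?f (fst w)*?f (snd w))" by (simp add: nn_integral_cmult nn_integral_multc lborel.nn_integral_fst[symmetric])
 also have "... <= nn_integral L2 (%w. ennreal ((R+1) powr (2-2*H))*nk F (fst w, snd w, k))"
 proof (rule nn_integral_mono_AE, rule eventually_mono[OF AE_L2_neq])
 fix w :: "real \<times> real" assume w: "fst w ~= snd w"
 show "?f (fst w)*?f (snd w) <= ennreal ((R+1) powr (2-2*H))*nk F (fst w, snd w, k)"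
 proof (cases "F (fst w, k) = 0 \<or> F (snd w, k) = 0")
 case False
 \<comment> \<open>\<open>R + 1\<close> in place of \<open>R\<close> keeps the base of the powers
   positive.\<close>
 hence "abs (fst w-snd w) <= R+1" using R(2)[of "fst w" k] R(2)[of "snd w" k] by force
 hence "(R+1) powr (2-2*H)*(R+1) powr (2*H-2) <= (R+1) powr (2-2*H)*kH (fst w-snd w)" using w H by (simp add: powr_mono2' mult_left_mono)
 hence "1<=(R+1) powr (2-2*H)*kH (fst w-snd w)" using R(1) by (simp add: powr_add[symmetric])
 from mult_right_mono[OF this, of "cmod (F (fst w, k)) * cmod (F (snd w, k))"] show ?thesis by (simp add: nk_def ennreal_mult[symmetric])
 qed (auto simp: nk_def)
 qed
 also have "... < \<infinity>" using elim unfolding nk_def by (simp add: ennreal_mult_less_top less_top nn_integral_cmult)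
 finally have "nn_integral lborel (%u. ?f u) < \<infinity>" by (auto simp: ennreal_mult_less_top)
 thus ?case using elim by (auto intro!: integrableI_bounded simp: less_top)
 qed
qed

definition "TF F w = FT (%u. F (u, snd w)) (fst w)" for F :: "real*'a => complex"

lemma TF_measurable[measurable]: assumes F: "F:bm" shows "TF F:bm"
proof -
 have [measurable]: "F:borel_measurable (borel \<Otimes>\<^sub>M borel)" using F by (simp add: borel_prod)
 have "(%w. LINT u|lborel. cis (- (fst w*u))*F (u, snd w)):borel_measurable (borel \<Otimes>\<^sub>M borel)" by simp
 thus ?thesis unfolding TF_def FT_def by (simp add: borel_prod)
qed

definition "\<nu>0 = density lborel (%w::real*'a. ennreal (cH*abs (fst w) powr (1-2*H)*g (snd w)))"

lemma sets_\<nu>0[measurable_cong]: "sets \<nu>0 = sets borel" by (simp add: \<nu>0_def)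

lemma dens_measurable[measurable]: "(%w::real*'a. cH*abs (fst w) powr (1-2*H)*g (snd w)):bm" unfolding borel_prod[symmetric] by simp

lemma nn_integral_\<nu>0:
 assumes f: "f:bm"
 shows "nn_integral (\<nu>0) (%w. ennreal ((cmod (f w))^2)) = nn_integral \<mu> (%k. \<integral>\<^sup>+r. ennreal (cH*abs r powr (1-2*H)*(cmod (f (r, k)))^2) \<partial>lborel)"
proof -
 let ?B = "%w. cH*abs (fst w) powr (1-2*H)*(cmod (f w))^2"
 let ?A = "\<integral>\<^sup>+w. ennreal ((cmod (f w))^2) \<partial>\<nu>0"
 have [measurable]: "f:borel_measurable (borel \<Otimes>\<^sub>M borel)" "f:bm" using f by (simp_all add: borel_prod)
 have "?A = nn_integral (lborel \<Otimes>\<^sub>M lborel) (%w. ennreal (g (snd w))*ennreal (?B w))"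
 proof -
 have "?A = nn_integral lborel (%w. ennreal (cH*abs (fst w) powr (1-2*H)*g (snd w))*ennreal ((cmod (f w))^2))"
 unfolding \<nu>0_def by (rule nn_integral_density) measurable
 also have "... = nn_integral lborel (%w. ennreal (g (snd w))*ennreal (?B w))" using cH(1) g0 by (intro nn_integral_cong) (simp add: ennreal_mult[symmetric])
 finally show ?thesis by (simp add: lborel_prod)
 qed
 also have "... = nn_integral lborel (%k. ennreal (g k)*nn_integral lborel (%r. ennreal (cH*abs r powr (1-2*H)*(cmod (f (r, k)))^2)))" by (simp add: lborel_pair.nn_integral_snd[symmetric] nn_integral_cmult)
 finally show ?thesis unfolding \<mu> by (simp add: nn_integral_density[symmetric])
qed

text \<open>\<open>energy_spectral\<close> for almost every spatial frequency, integrated over the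
  frequency; \<open>M3_swap\<close> provides this order of integration.\<close>

lemma good_energy:
 assumes F: "good F"
 shows "integrable \<nu>0 (%v. (cmod (TF F v))^2)"
 "complex_of_real (H*(2*H-1))*(LINT w|M3. eint F F w) = complex_of_real (LINT v|\<nu>0. (cmod (TF F v))^2)"
proof -
 let ?B = "%k. LINT w|L2. eint F F (fst w, snd w, k)"
 let ?A = "H*(2*H-1)"
 have Fm[measurable]: "F:bm" using F by (rule goodD)
 have e: "integrable M3 (eint F F)" using F unfolding good_iff by simp
 define r where "r k = Re (of_real ?A*?B k)" for k
 let ?q = "%k. \<integral>\<^sup>+t. ennreal (cH*abs t powr (1-2*H)*(cmod (TF F (t, k)))^2) \<partial>lborel"
 have ae: "AE k in \<mu>. 0<=r k & of_real ?A*?B k = of_real (r k) & ennreal (r k) = ?q k" using good_section[OF F] integral_M3(1)[OF e]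
 proof eventually_elim
 case (elim k)
 obtain r' where "0<=r'" "of_real ?A*(LINT w|L2. of_real (kH (fst w-snd w))*(F (fst w, k) * cnj (F (snd w, k)))) = of_real r'"
 "ennreal r' = nn_integral lborel (%t. ennreal (cH*abs t powr (1-2*H)*(cmod (FT (%u. F (u, k)) t))^2))"
 by (rule energy_spectral[of "%u. F (u, k)"]) (use elim in "auto simp: eint_def")
 thus ?case by (simp add: r_def eint_def TF_def)
 qed
 have ir: "integrable \<mu> r" unfolding r_def by (intro integrable_Re integrable_mult_right integral_M3(2)[OF e])
 have n: "nn_integral (\<nu>0) (%v. ennreal ((cmod (TF F v))^2)) = ennreal (LINT k|\<mu>. r k)"
 unfolding nn_integral_\<nu>0[OF TF_measurable[OF Fm]] using ae by (subst nn_integral_eq_integral[OF ir, symmetric]) (auto intro!: nn_integral_cong_AE)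
 thus i: "integrable \<nu>0 (%v. (cmod (TF F v))^2)" by (intro integrableI_bounded) auto
 have "0<=(LINT k|\<mu>. r k)" by (rule integral_nonneg_AE) (use ae in "auto elim: eventually_mono")
 hence L: "(LINT v|\<nu>0. (cmod (TF F v))^2) = (LINT k|\<mu>. r k)" using n nn_integral_eq_integral[OF i] by simp
 have "of_real ?A*(LINT w|M3. eint F F w) = (LINT k|\<mu>. of_real ?A*?B k)" unfolding integral_M3(3)[OF e] by simp
 also have "... = (LINT k|\<mu>. of_real (r k))" by (rule integral_cong_AE) (use ae ir in "auto elim: eventually_mono")
 also have "... = of_real (LINT k|\<mu>. r k)" by simp
 finally show "of_real ?A*(LINT w|M3. eint F F w) = of_real (LINT v|\<nu>0. (cmod (TF F v))^2)" unfolding L .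
qed

text \<open>The energies of moduli obey the parallelogram bound \<open>energy_add_le\<close>,
  applied frequency by frequency. It rests on the kernel being positive as a quadratic form.\<close>

lemma good_dominated:
 assumes F: "good F" and F': "good F'" and E[measurable]: "E:bm" and tb: "time_bounded E"
 and le: "AE u in lborel. ALL k. cmod (E (u, k)) <= cmod (F (u, k)) + cmod (F' (u, k))"
 shows "good E"
proof -
 let ?C = "%k. \<integral>\<^sup>+w. nk E (fst w, snd w, k) \<partial>L2"
 let ?B = "%k. \<integral>\<^sup>+w. nk F (fst w, snd w, k) \<partial>L2"
 let ?A = "%k. \<integral>\<^sup>+w. nk F' (fst w, snd w, k) \<partial>L2"
 note [measurable] = goodD(1)[OF F] goodD(1)[OF F']
 let ?q = "%f. \<integral>\<^sup>+w. ennreal (kH (fst w-snd w)*(f (fst w)*f (snd w))) \<partial>L2"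
 have l2: "AE w in L2. ALL k. cmod (E (fst w, k)) <= cmod (F (fst w, k)) + cmod (F' (fst w, k)) & cmod (E (snd w, k)) <= cmod (F (snd w, k)) + cmod (F' (snd w, k))"
 proof -
 obtain N where N: "!!u. u:space lborel-N ==> ALL k. cmod (E (u, k)) <= cmod (F (u, k)) + cmod (F' (u, k))" "N:null_sets (lborel :: real measure)"
 by (rule AE_E3[OF le]) blast
 have [measurable]: "N:sets borel" using N(2) by auto
 have "AE w in L2. fst w ~: N & snd w ~: N"
 proof (rule lborel_pair.AE_pair_measure)
 have "AE x in lborel. x ~: N" using N(2) by (rule AE_not_in)
 thus "AE x in lborel. AE y in lborel. fst (x, y) ~: N & snd (x, y) ~: N" by auto
 qed measurable
 thus ?thesis by (rule eventually_mono) (use N(1) in simp)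
 qed
 have "nn_integral M3 (%w. nk E w) = nn_integral \<mu> (%k. \<integral>\<^sup>+w. nk E (fst w, snd w, k) \<partial>L2)" by (rule nn_integral_M3) measurable
 also have "... <= nn_integral \<mu> (%k. 2*?B k+2*?A k)"
 proof (rule nn_integral_mono_AE)
 show "AE k in \<mu>. (?C k) <= 2*?B k+2*?A k" using good_section[OF F] good_section[OF F']
 proof eventually_elim
 case (elim k)
 have "?C k <= ?q (%u. cmod (F (u, k)) + cmod (F' (u, k)))" by (rule nn_integral_mono_AE, rule eventually_mono[OF l2]) (auto simp: nk_def intro!: mult_mono)
 also have "... <= 2*?q (%u. cmod (F (u, k)))+2*?q (%u. cmod (F' (u, k)))" by (rule energy_add_le) (use elim in auto)
 finally show ?case by (simp add: nk_def)
 qed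
 qed
 also have "... < \<infinity>" using goodD(3)[OF F] goodD(3)[OF F'] by (simp add: nn_integral_cmult nn_integral_M3[symmetric] ennreal_mult_less_top nn_integral_add)
 finally show ?thesis using tb by (simp add: good_def)
qed

end

section \<open>The Gaussian family of noise integrals\<close>

lemma slice_derivative:
 fixes F :: "real*'a::euclidean_space => real"
 assumes "smooth F"
 shows "((%x. complex_of_real (iter_deriv ws F (u, x+z))) has_derivative (%v. complex_of_real (frechet_derivative (iter_deriv ws F) (at (u, x+z)) (0, v)))) (at x)"
proof -
 have h: "(iter_deriv ws F has_derivative frechet_derivative (iter_deriv ws F) (at (u, x+z))) (at (u, x+z))"
 using assms unfolding smooth_def by (subst frechet_derivative_works[symmetric]) blast
 have "((%x. (u, x+z)) has_derivative (%v. (0, v))) (at x)" by (intro has_derivative_Pair) (auto intro!: derivative_eq_intros)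
 from has_derivative_of_real[OF has_derivative_compose[OF this h]] show ?thesis .
qed

lemma iter_deriv_slice:
 fixes F :: "real*'a::euclidean_space => real"
 assumes "smooth F"
 shows "iter_deriv vs (%x. complex_of_real (F (u, x+z))) = (%x. complex_of_real (iter_deriv (map (Pair 0) vs) F (u, x+z)))"
proof (induction vs)
 case (Cons v vs)
 show ?case
 proof
 fix x
 let ?h = "iter_deriv (map (Pair 0) vs) F"
 from frechet_derivative_at[OF slice_derivative[OF assms, of "map (Pair 0) vs" u z x]]
 show "iter_deriv (v # vs) (%x. complex_of_real (F (u, x+z))) x = complex_of_real (iter_deriv (map (Pair 0) (v # vs)) F (u, x+z))" by (simp add: Cons.IH fun_eq_iff)
 qed
qed simp

lemma iter_deriv_support:
 assumes K: "closed K" and z: "!!x. x ~: K ==> F x = 0" and x: "x ~: K"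
 shows "iter_deriv vs F x = 0" using x
proof (induction vs arbitrary: x)
 case (Cons v vs)
 have "(iter_deriv vs F has_derivative (%_. 0)) (at x)" by (rule has_derivative_transform_within_open[of _ _ _ _ "- K"]) (use Cons K in auto)
 from frechet_derivative_at[OF this, symmetric] show ?case by simp
qed (use z in simp)

text \<open>Spatial slices of test functions are Schwartz, also after a shift by z, and thus belong
  to the class on which \<open>f\<close> is paired with \<mu>.\<close>

lemma test_fun_basic:
 fixes F :: "real*'a::euclidean_space => real"
 assumes t: "test_fun F"
 shows "continuous_on UNIV F" "F:bm" "schwartz (%x. complex_of_real (F (u, x+z)))"
 "integrable lborel (%y. complex_of_real (F (u, y)))" "EX R>=0. ALL u y. u<0 \<or> R < u --> F (u, y) = 0"
proof -
 let ?A = "%K. %y. indicator (snd ` K) y *\<^sub>R complex_of_real (F (u, y))"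
 obtain K where K: "compact K" "K \<subseteq> {0<..} \<times> UNIV" "!!w. w ~: K ==> F w = 0" and sm: "smooth F" using t unfolding test_fun_def by auto
 have cd: "continuous_on UNIV (iter_deriv ws F)" for ws
 using sm unfolding smooth_def by (intro continuous_at_imp_continuous_on ballI differentiable_imp_continuous_within) blast
 show c: "continuous_on UNIV F" using cd[of "[]"] by simp
 thus "F:bm" by (rule borel_measurable_continuous_onI)
 show "schwartz (%x. complex_of_real (F (u, x+z)))" for u z unfolding schwartz_def smooth_def iter_deriv_slice[OF sm]
 proof (intro conjI allI)
 fix vs :: "'a list" and x :: 'a
 let ?h = "iter_deriv (map (Pair 0) vs) F"
 show "(%x. complex_of_real (?h (u, x+z))) differentiable (at x)" using slice_derivative[OF sm] unfolding differentiable_def by blast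
 next
 fix k :: nat and vs :: "'a list"
 let ?h = "iter_deriv (map (Pair 0) vs) F" and ?q = "%w. norm (snd w-z)^k *\<^sub>R complex_of_real (iter_deriv (map (Pair 0) vs) F w)"
 have "continuous_on UNIV ?q" by (intro continuous_intros cd)
 hence "bounded (?q ` K)" using K(1) by (intro compact_imp_bounded compact_continuous_image) (auto intro: continuous_on_subset)
 moreover have "range (%x. norm x^k *\<^sub>R complex_of_real (?h (u, x+z))) \<subseteq> insert 0 (?q ` K)"
 proof safe
 fix x assume "norm x^k *\<^sub>R complex_of_real (?h (u, x+z)) ~: ?q ` K"
 thus "norm x^k *\<^sub>R complex_of_real (?h (u, x+z)) = 0" by (auto simp: image_iff intro!: iter_deriv_support[OF compact_imp_closed[OF K(1)] K(3)])
 qed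
 ultimately show "bounded (range (%x. norm x^k *\<^sub>R complex_of_real (?h (u, x+z))))" by (meson bounded_insert bounded_subset)
 qed
 have cs: "compact (snd ` K)" using K(1) by (intro compact_continuous_image continuous_intros)
 have "integrable lborel (?A K)" using cs by (intro borel_integrable_compact) (auto intro!: continuous_intros continuous_on_compose2[OF c])
 also have "?A K = (%y. complex_of_real (F (u, y)))"
 proof
 fix y
 show "indicator (snd ` K) y *\<^sub>R complex_of_real (F (u, y)) = complex_of_real (F (u, y))"
 using K(3)[of "(u, y)"] by (cases "(u, y):K") (auto simp: indicator_def image_iff)
 qed
 finally show "integrable lborel (%y. complex_of_real (F (u, y)))" .
 have "bounded (fst ` K)" using K(1) by (intro compact_imp_bounded compact_continuous_image continuous_intros)
 then obtain R where R: "!!p. p:K ==> norm (fst p) <= R" unfolding bounded_iff by auto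
 show "EX R>=0. ALL u y. u<0 \<or> R < u --> F (u, y) = 0"
 proof (intro exI[of _ "max R 0"] conjI allI impI)
 fix u y assume "u<0 \<or> max R 0<u"
 thus "F (u, y) = 0" using R[of "(u, y)"] K(2) by (auto intro!: K(3))
 qed simp
qed

lemma centered_gaussian_cis:
 assumes P: "prob_space P" and Y: "centered_gaussian P Y"
 shows "integrable P (%w. (Y w)^2)" "(LINT w|P. cis (Y w)) = complex_of_real (exp (- (LINT w|P. (Y w)^2)/2))"
proof -
 let ?B = "LINT w|P. (Y w)^2"
 let ?A = "LINT w|P. cis (Y w)"
 interpret prob_space P by fact
 have [measurable]: "Y:borel_measurable P" using Y by (simp add: centered_gaussian_def)
 consider "AE w in P. Y w = 0" | r where "0<r" "distributed P lborel Y (%y. ennreal (normal_density 0 r y))" using Y unfolding centered_gaussian_def by auto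
 hence "integrable P (%w. (Y w)^2) & ?A = of_real (exp (- ?B/2))"
 proof cases
 case 1
 have "integrable P (%w. (Y w)^2)" by (rule integrable_cong_AE_imp[of P "%_. 0"]) (use 1 in "auto elim: eventually_mono")
 moreover have "?B = (LINT w|P. 0)" by (rule integral_cong_AE) (use 1 in "auto elim: eventually_mono")
 moreover have "?A = (LINT w|P. 1)" by (rule integral_cong_AE) (use 1 in "auto elim: eventually_mono")
 ultimately show ?thesis by (simp add: prob_space)
 next
 case (2 r)
 have v: "?B = r^2" using normal_distributed_variance[OF 2] normal_distributed_expectation[OF 2] by simp
 have i: "integrable P (%w. (Y w)^2)" using integrable_normal_moment[OF 2(1), of 0 2] distributed_integrable[OF 2(2), of "%y. y^2"] by simp
 have s: "distributed P lborel (%w. (Y w-0)/r) std_normal_density" using normal_standard_normal_convert[OF 2(1), of Y 0] 2(2) by simp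
 have "?A = (LINT w|P. cis (r*((Y w-0)/r)))" using 2(1) by simp
 also have "... = (LINT x|distr P lborel (%w. (Y w-0)/r). cis (r*x))" by (rule integral_distr[symmetric]) auto
 finally show ?thesis using i v by (metis distributed_distr_eq_density[OF s] cis_N01)
 qed
 thus "integrable P (%w. (Y w)^2)" "?A = of_real (exp (- ?B/2))" by auto
qed

text \<open>Pointwise 2 |a c| \<le> d |a|^2 + |c|^2/d; the free \<open>d\<close> lets convergence in
  L2 pass to the squared norms.\<close>

lemma square_integral_perturb:
 fixes f h :: "'x => complex"
 assumes [measurable]: "f:borel_measurable M" "h:borel_measurable M" and i: "integrable M (%x. (cmod (f x))^2)" "integrable M (%x. (cmod (h x))^2)" and d: "0<d"
 shows "abs ((LINT x|M. (cmod (f x+h x))^2)-(LINT x|M. (cmod (f x))^2)) <= d*(LINT x|M. (cmod (f x))^2)+(1+1/d)*(LINT x|M. (cmod (h x))^2)"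
 "integrable M (%x. (cmod (f x+h x))^2)"
proof -
 let ?B = "LINT x|M. (cmod (f x))^2"
 let ?A = "%x. cmod (f x+h x)"
 have b: "abs ((cmod (a + c))^2-(cmod a)\<^sup>2) <= d*(cmod a)^2+(1+1/d)*(cmod c)^2" for a c
 proof -
 have "(cmod (a + c))^2-(cmod a)\<^sup>2 = 2 * Re (a * cnj c)+(cmod c)^2" unfolding cmod_power2 by (simp add: power2_eq_square algebra_simps)
 moreover have "abs (Re (a * cnj c)) <= cmod a * cmod c" using abs_Re_le_cmod[of "a * cnj c"] by (simp add: norm_mult)
 moreover have "2*(cmod a * cmod c) <= d*(cmod a)^2+1/d*(cmod c)^2"
 proof -
 have "0<=(sqrt d * cmod a - cmod c / sqrt d)^2" by simp
 also have "... = d*(cmod a)^2+1/d*(cmod c)^2-2*(cmod a * cmod c)" using d by (simp add: power2_diff power_mult_distrib power_divide)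
 finally show ?thesis by simp
 qed
 ultimately show ?thesis using zero_le_power2[of "cmod c"] unfolding distrib_right by linarith
 qed
 have c: "(?A x)^2 <= (1+d)*(cmod (f x))^2+(1+1/d)*(cmod (h x))^2" for x using b[of "f x" "h x"] by (simp add: distrib_right)
 show s: "integrable M (%x. (?A x)^2)" by (rule lint_bound[of _ "%x. (1+d)*(cmod (f x))^2+(1+1/d)*(cmod (h x))^2"])
 (use i d c in "auto ")
 have "abs ((LINT x|M. (?A x)^2)-?B) = abs (LINT x|M. (?A x)^2-(cmod (f x))^2)" using s i by simp
 also have "... <= (LINT x|M. abs ((?A x)^2-(cmod (f x))^2))" by simp
 also have "... <= (LINT x|M. d*(cmod (f x))^2+(1+1/d)*(cmod (h x))^2)" using s i b by (intro integral_mono) auto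
 finally show "abs ((LINT x|M. (?A x)^2)-?B) <= d*?B+(1+1/d)*(LINT x|M. (cmod (h x))^2)" using i by simp
qed

context spectral_measure
begin

section \<open>Integrands on the Fourier side\<close>

definition "SF G = (%(u::real, k::'a). fourier (%y. complex_of_real (G (u, y))) k)" for G :: "real*'a => real"

lemma SF_measurable[measurable]: assumes G: "G:bm" shows "SF G:bm"
proof -
 have [measurable]: "G:borel_measurable (borel \<Otimes>\<^sub>M borel)" using G by (simp add: borel_prod)
 have "(%z. LINT y|lborel. cis (- (snd z \<bullet> y)) * of_real (G (fst z, y))):borel_measurable (borel \<Otimes>\<^sub>M borel)" by simp
 thus ?thesis unfolding SF_def fourier_def by (simp add: borel_prod)
qed

lemma energy_good:
 assumes fe: "finite_energy H \<mu> G" and R: "EX R>=0. ALL u y. u<0 \<or> R < u --> G (u, y) = 0"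
 shows "good (SF G)" "energy H \<mu> G = (LINT v|\<nu>0. (cmod (TF (SF G) v))^2)"
proof -
 have e: "energy_integrand H G = eint (SF G) (SF G)" by (simp add: energy_integrand_def eint_def SF_def fun_eq_iff)
 obtain r where r: "r >= 0" "ALL u y. u<0 \<or> r < u --> G (u, y) = 0" using R by auto
 have "time_bounded (SF G)" unfolding time_bounded_def SF_def fourier_def by (intro exI[of _ r]) (use r in simp)
 thus gd: "good (SF G)" using fe unfolding good_iff finite_energy_def e by auto
 have "energy H \<mu> G = Re (of_real (H*(2*H-1))*(LINT w|M3. eint (SF G) (SF G) w))" unfolding energy_def e by simp
 thus "energy H \<mu> G = (LINT v|\<nu>0. (cmod (TF (SF G) v))^2)" unfolding good_energy(2)[OF gd] by simp
qed

lemma SF_diff: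
 assumes "AE u in lborel. integrable lborel (%y. G (u, y))" "AE u in lborel. integrable lborel (%y. G' (u, y))"
 shows "AE u in lborel. ALL k. SF (%z. G z-G' z) (u, k) = SF G (u, k)-SF G' (u, k)" using assms
proof eventually_elim
 case (elim u)
 have c: "integrable lborel (%y. cis (- (k \<bullet> y)) * of_real (h y))" if "integrable lborel h" for h :: "'a => real" and k
 by (rule lint_bound[OF that]) (use that in "auto simp: norm_mult")
 show ?case unfolding SF_def fourier_def using c[OF elim(1)] c[OF elim(2)] by (simp add: right_diff_distrib)
qed

text \<open>Sections in time are integrable only for almost every frequency with respect to \<mu>,
  which says nothing where \<open>g\<close> vanishes; the density of \<open>\<nu>0\<close> vanishes
  there as well.\<close>

lemma TF_lincomb:
 assumes J: "finite J" and F: "!!j. j:J ==> good (F j)" and E: "AE u in lborel. ALL k. E (u, k) = (SUM j:J. complex_of_real (a j)*F j (u, k))" and Em: "E:bm"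
 shows "AE w in \<nu>0. TF E w = (SUM j:J. complex_of_real (a j)*TF (F j) w)"
proof -
 have "AE k in \<mu>. ALL j:J. integrable lborel (%u. F j (u, k))" by (rule AE_finite_allI[OF J]) (use good_section[OF F] in "auto elim: eventually_mono")
 hence "AE k in lborel. 0<g k --> (ALL j:J. integrable lborel (%u. F j (u, k)))" unfolding \<mu> by (subst (asm) AE_density) (auto elim: eventually_mono)
 then obtain N where N: "!!k. k:space lborel-N ==> 0<g k --> (ALL j:J. integrable lborel (%u. F j (u, k)))" "N:null_sets lborel" by (rule AE_E3) blast
 have [measurable]: "N:sets borel" using N(2) by auto
 have "AE w in (lborel :: real measure) \<Otimes>\<^sub>M lborel. snd w ~: N"
 proof (rule lborel_pair.AE_pair_measure)
 show "AE x in (lborel :: real measure). AE y in lborel. snd (x, y) ~: N" using AE_not_in[OF N(2)] by simp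
 qed measurable
 hence "AE w in lborel. snd (w :: real*'a) ~: N" unfolding lborel_prod .
 thus ?thesis unfolding \<nu>0_def
 proof (subst AE_density, simp, rule eventually_mono, safe)
 fix r :: real and k assume "snd (r, k) ~: N" and pos: "0<ennreal (cH*abs (fst (r, k)) powr (1-2*H)*g (snd (r, k)))"
 hence "k:space lborel-N" "0<g k" using g0[of k] by (auto simp: zero_less_mult_iff)
 hence i: "integrable lborel (%u. F j (u, k))" if "j:J" for j using N(1) that by simp
 have [measurable]: "(%u. E (u, k)):bm" by (rule section_measurable[OF Em])
 have [measurable]: "(%u. F j (u, k)):bm" if "j:J" for j by (rule section_measurable[OF goodD(1)[OF F[OF that]]])
 have "TF E (r, k) = (LINT u|lborel. (SUM j:J. of_real (a j)*(cis (- (r*u))*F j (u, k))))"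
 unfolding TF_def FT_def by (rule integral_cong_AE) (use E in "auto simp: sum_distrib_left mult_ac")
 also have "... = (SUM j:J. LINT u|lborel. of_real (a j)*(cis (- (r*u))*F j (u, k)))" by (rule lint_sum) (intro integrable_mult_right cis_integrable i)
 finally show "TF E (r, k) = (SUM j:J. of_real (a j)*TF (F j) (r, k))" by (simp add: TF_def FT_def)
 qed
qed

lemma good_lincomb:
 assumes "finite J" "!!j. j:J ==> good (F j)" shows "good (%w. SUM j:J. complex_of_real (a j)*F j w)" using assms
proof (induction J rule: finite_induct)
 case empty
 show ?case by (auto simp: good_def nk_def time_bounded_def)
next
 case (insert j J)
 note G = insert.IH[OF insert.prems] insert.prems[of j]
 have sc: "good (%w. of_real (a j)*F j w)"
 proof -
 have "eint (%w. of_real (a j)*F j w) (%w. of_real (a j)*F j w) = (%w. of_real ((a j)^2)*eint (F j) (F j) w)" by (simp add: eint_def fun_eq_iff power2_eq_square)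
 thus ?thesis using G(2) unfolding good_iff time_bounded_def by auto
 qed
 have "good (%w. of_real (a j)*F j w+(SUM j:J. of_real (a j)*F j w))"
 proof (rule good_dominated[OF sc G(1)])
 obtain R R' where "R >= 0" "ALL u k. u<0 \<or> R < u --> of_real (a j)*F j (u, k) = 0" "R' >= 0" "ALL u k. u<0 \<or> R' < u --> (SUM j:J. of_real (a j)*F j (u, k)) = 0"
 using goodD(2)[OF sc] goodD(2)[OF G(1)] insert unfolding time_bounded_def by auto
 thus "time_bounded (%w. of_real (a j)*F j w+(SUM j:J. of_real (a j)*F j w))" unfolding time_bounded_def by (intro exI[of _ "max R R'"]) simp
 qed (use goodD(1)[OF sc] goodD(1)[OF G(1)] insert in "auto intro!: norm_triangle_ineq")
 thus ?case using insert by simp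
qed

lemma eint_integrable: assumes F: "good F" "good F'" shows "integrable M3 (eint F F')"
proof -
 note [measurable] = goodD(1)[OF F(1)] goodD(1)[OF F(2)]
 define N where "N w = complex_of_real (cmod (F w) + cmod (F' w))" for w
 obtain R R' where "R >= 0" "ALL u k. u<0 \<or> R < u --> F (u, k) = 0" "R' >= 0" "ALL u k. u<0 \<or> R' < u --> F' (u, k) = 0"
 using goodD(2)[OF F(1)] goodD(2)[OF F(2)] unfolding time_bounded_def by auto
 hence tb: "time_bounded N" unfolding time_bounded_def N_def by (intro exI[of _ "max R R'"]) simp
 have [measurable]: "N:bm" unfolding N_def by simp
 have "good N" by (rule good_dominated[OF F _ tb], measurable) (auto simp: N_def simp del: of_real_add)
 hence "integrable M3 (eint N N)" by (simp add: good_iff)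
 thus ?thesis
 proof (rule lint_bound)
 have "cmod (F w) * cmod (F' w') <= (cmod (F w) + cmod (F' w))*(cmod (F w') + cmod (F' w'))" for w w' by (intro mult_mono) auto
 thus "AE w in M3. norm (eint F F' w) <= norm (eint N N w)" by (auto simp: eint_def N_def norm_mult intro!: mult_left_mono simp del: of_real_add)
 qed measurable
qed

end

locale noise = spectral_measure H \<mu> g for H and \<mu> :: "'a::euclidean_space measure" and g +
 fixes f :: "'a => real" and P :: "'w measure" and B :: "(real*'a => real) => 'w => real"
 assumes f: "is_fourier_transform_of_measure f \<mu>" and B: "fractional_colored_noise P H f B"
begin

lemma fourier_shift: "fourier (%x. h (x+z)) k = cis (k \<bullet> z)*fourier h k" if "h:bm" for h :: "'a => complex" and k z
proof -
 note [measurable] = that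
 have ci: "cis (- (k \<bullet> (z+x))) = cis (- (k \<bullet> z)) * cis (- (k \<bullet> x))" for x by (simp add: cis_mult inner_add_right)
 have "fourier h k = (LINT x|distr lborel borel ((+) z). cis (- (k \<bullet> x))*h x)" unfolding fourier_def lborel_distr_plus ..
 also have "... = (LINT x|lborel. cis (- (k \<bullet> (z+x)))*h (z+x))" by (rule integral_distr) auto
 also have "... = (LINT x|lborel. cis (- (k \<bullet> z))*(cis (- (k \<bullet> x))*h (x+z)))" by (intro lint_cong refl) (unfold ci, simp add: add.commute)
 finally show ?thesis unfolding fourier_def by (simp add: cis_mult)
qed

text \<open>Parseval for the spatial covariance: the pairing of \<open>f\<close> with \<mu> is
  applied to the slice shifted by z', the shift becomes a character in k, and Fubini moves the
  integral over z' inside.\<close>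

lemma spatial_covariance:
 assumes d: "test_fun d" and G: "test_fun G"
 shows "complex_of_real (LINT z'|lborel. LINT z|lborel. d (u, z)*f (z-z')*G (v, z')) = (LINT k|\<mu>. SF d (u, k) * cnj (SF G (v, k)))"
proof -
 let ?D = "%z'. %x. complex_of_real (d (u, x+z'))"
 let ?C = "%z'. LINT x|lborel. complex_of_real (f x) * complex_of_real (d (u, x+z'))"
 let ?B = "%k z'. k \<bullet> z'"
 let ?A = "%z'. LINT z|lborel. complex_of_real (d (u, z)*f (z-z'))"
 interpret LM: pair_sigma_finite "lborel :: 'a measure" \<mu> by standard
 note t = test_fun_basic[OF d] and s = test_fun_basic[OF G]
 have m: "(%y. complex_of_real (d (u, y))):bm" using borel_measurable_integrable[OF t(4)] by simp
 have SFe: "SF d (u, k) = fourier (%y. complex_of_real (d (u, y))) k" "SF G (v, k) = fourier (%y. complex_of_real (G (v, y))) k" for k by (simp_all add: SF_def)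
 have F: "?A z' = (LINT k|\<mu>. cis (?B k z')*SF d (u, k))" "integrable \<mu> (%k. cis (?B k z')*SF d (u, k))" for z'
 proof -
 have fm: "integrable lborel (%x. complex_of_real (f x) * complex_of_real (d (u, x+z')))" "integrable \<mu> (fourier (?D z'))"
 "?C z' = (LINT k|\<mu>. fourier (?D z') k)" using f t(3) unfolding is_fourier_transform_of_measure_def by auto
 have e: "fourier (?D z') = (%k. cis (?B k z')*SF d (u, k))" using fourier_shift[OF m] by (simp add: SFe fun_eq_iff)
 show "integrable \<mu> (%k. cis (?B k z')*SF d (u, k))" using fm(2) unfolding e .
 have "?C z' = ?A z'"
 proof -
 have "(LINT z|distr lborel borel ((+) z'). complex_of_real (f (z-z')) * complex_of_real (d (u, z))) = (LINT x|lborel. complex_of_real (f (z'+x-z')) * complex_of_real (d (u, z'+x)))" using measurable_compose[OF _ borel_measurable_integrable[OF fm(1)], of "%z. z-z'" borel] by (simp add: integral_distr)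
 thus ?thesis unfolding lborel_distr_plus by (simp add: add.commute mult.commute)
 qed
 thus "?A z' = (LINT k|\<mu>. cis (?B k z')*SF d (u, k))" using fm(3) unfolding e by simp
 qed
 have iS: "integrable \<mu> (%k. SF d (u, k))" using F(2)[of 0] by simp
 let ?h = "%z' k. complex_of_real (G (v, z'))*(cis (?B k z')*SF d (u, k))"
 have ih: "integrable (lborel \<Otimes>\<^sub>M \<mu>) (case_prod ?h)"
 proof (rule lint_bound[OF integrable_tensor(1)[OF sigma_finite_lborel \<mu>.sigma_finite_measure_axioms s(4) iS]])
 have [measurable]: "(%y. complex_of_real (G (v, y))):bm" "(%k. SF d (u, k)):bm" using borel_measurable_integrable[OF s(4)] borel_measurable_integrable[OF iS] by auto
 show "case_prod ?h:borel_measurable (lborel \<Otimes>\<^sub>M \<mu>)" by simp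
 qed (auto simp: norm_mult)
 have "complex_of_real (LINT z'|lborel. LINT z|lborel. d (u, z)*f (z-z')*G (v, z')) = (LINT z'|lborel. complex_of_real (G (v, z'))*?A z')"
 unfolding integral_complex_of_real[symmetric] by (simp add: mult_ac)
 also have "... = (LINT k|\<mu>. LINT z'|lborel. ?h z' k)" using LM.Fubini_integral[symmetric, OF ih] unfolding F(1) by simp
 also have "... = (LINT k|\<mu>. SF d (u, k) * cnj (SF G (v, k)))"
 proof (intro lint_cong refl)
 fix k
 have "cnj (SF G (v, k)) = (LINT z'|lborel. cis (?B k z') * complex_of_real (G (v, z')))"
 unfolding SFe fourier_def Bochner_Integration.integral_cnj[symmetric] by (simp add: cis_cnj)
 moreover have "(LINT z'|lborel. ?h z' k) = (LINT z'|lborel. SF d (u, k)*(cis (?B k z') * complex_of_real (G (v, z'))))" by (intro lint_cong refl) simp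
 ultimately show "(LINT z'|lborel. ?h z' k) = SF d (u, k) * cnj (SF G (v, k))" by simp
 qed
 finally show ?thesis .
qed

text \<open>The outer time variable of \<open>noise_covariance\<close> belongs to the second
  function but is the first coordinate of \<open>M3\<close>, so F and G change places under a
  conjugation.\<close>

lemma noise_covariance_eq:
 assumes F: "test_fun F" "good (SF F)" and G: "test_fun G" "good (SF G)"
 shows "complex_of_real (noise_covariance H f F G) = complex_of_real (H*(2*H-1))*(LINT w|M3. cnj (eint (SF G) (SF F) w))"
proof -
 let ?B = "lborel \<Otimes>\<^sub>M \<mu>"
 let ?A = "LINT v|lborel. LINT u|lborel. of_real (kH (u-v))*(LINT k|\<mu>. SF F (u, k) * cnj (SF G (v, k)))"
 interpret LM: pair_sigma_finite "lborel :: real measure" \<mu> by standard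
 interpret LLM: pair_sigma_finite "lborel :: real measure" "(lborel :: real measure) \<Otimes>\<^sub>M \<mu>" by standard
 let ?e = "%w. cnj (eint (SF G) (SF F) w)"
 have i: "integrable M3 ?e" using eint_integrable[OF G(2) F(2)] by simp
 have e: "?e (v, u, k) = of_real (kH (u-v))*(SF F (u, k) * cnj (SF G (v, k)))" for v u k by (simp add: eint_def abs_minus_commute)
 have "of_real (noise_covariance H f F G) = of_real (H*(2*H-1))*?A"
 unfolding noise_covariance_def spatial_covariance[OF F(1) G(1), symmetric] of_real_mult[symmetric] integral_complex_of_real by simp
 also have "?A = (LINT v|lborel. LINT u|lborel. LINT k|\<mu>. ?e (v, u, k))" unfolding e integral_mult_right_zero ..
 also have "... = (LINT v|lborel. LINT w|?B. ?e (v, w))"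
 proof (rule integral_cong_AE)
 note [measurable] = eint_measurable[OF goodD(1)[OF G(2)] goodD(1)[OF F(2)]]
 show "(%v. LINT u|lborel. LINT k|\<mu>. ?e (v, u, k)):borel_measurable lborel" by simp
 show "(%v. LINT w|?B. ?e (v, w)):borel_measurable lborel" by simp
 show "AE v in lborel. (LINT u|lborel. LINT k|\<mu>. ?e (v, u, k)) = (LINT w|?B. ?e (v, w))"
 using LLM.AE_integrable_fst'[OF i] by eventually_elim (rule LM.integral_fst')
 qed
 finally show ?thesis by (metis LLM.integral_fst'[OF i])
qed

lemma noise_variance:
 assumes J: "finite J" and h: "!!j. j:J ==> test_fun (h j)" "!!j. j:J ==> good (SF (h j))"
 shows "(SUM i:J. SUM j:J. a i*a j*noise_covariance H f (h i) (h j)) = (LINT v|\<nu>0. (cmod (SUM j:J. complex_of_real (a j)*TF (SF (h j)) v))^2)"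
proof -
 let ?C = "%E. LINT w|M3. eint E E w"
 let ?B = "%v. cmod (SUM j:J. of_real (a j)*TF (SF (h j)) v)"
 let ?A = "SUM i:J. SUM j:J. (LINT w|M3. of_real (a i*a j) * cnj (eint (SF (h j)) (SF (h i)) w))"
 define E where "E w = (SUM j:J. of_real (a j)*SF (h j) w)" for w
 have gE: "good E" unfolding E_def using J h(2) by (rule good_lincomb)
 have Tm: "TF (SF (h j)):bm" if "j:J" for j using goodD(1)[OF h(2)[OF that]] by simp
 have "of_real (SUM i:J. SUM j:J. a i*a j*noise_covariance H f (h i) (h j))
 = of_real (H*(2*H-1))*?A"
 unfolding of_real_sum sum_distrib_left by (intro sum.cong refl) (simp only: of_real_mult noise_covariance_eq h integral_mult_right_zero mult_ac)
 also have "?A = cnj (?C E)"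
 proof -
 have ii: "integrable M3 (%w. of_real (a i*a j) * cnj (eint (SF (h j)) (SF (h i)) w))" if "i:J" "j:J" for i j
 by (intro integrable_mult_right integrable_cnj eint_integrable h(2) that)
 have "cnj (?C E) = (LINT w|M3. cnj (eint E E w))" by simp
 also have "... = (LINT w|M3. (SUM i:J. SUM j:J. of_real (a i*a j) * cnj (eint (SF (h j)) (SF (h i)) w)))"
 by (intro lint_cong refl, unfold eint_def E_def, subst sum.swap) (simp add: sum_distrib_left mult_ac)
 also have "... = (SUM i:J. LINT w|M3. (SUM j:J. of_real (a i*a j) * cnj (eint (SF (h j)) (SF (h i)) w)))" by (rule lint_sum) (intro integrable_lint_sum ii)
 also have "... = ?A" by (intro sum.cong refl lint_sum ii)
 finally show ?thesis ..
 qed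
 also have "of_real (H*(2*H-1)) * cnj (?C E) = cnj (of_real (H*(2*H-1))*?C E)" by simp
 also have "... = of_real (LINT v|\<nu>0. (cmod (TF E v))^2)" unfolding good_energy(2)[OF gE] by simp
 also have "(LINT v|\<nu>0. (cmod (TF E v))^2) = (LINT v|\<nu>0. (?B v)^2)"
 proof (rule integral_cong_AE)
 show "(%v. (?B v)^2):borel_measurable \<nu>0" using Tm by simp
 show "AE v in \<nu>0. (cmod (TF E v))^2 = (?B v)^2" using TF_lincomb[where F="%j. SF (h j)" and E=E and a=a, OF J h(2)] goodD(1)[OF gE] by (auto simp: E_def)
 qed (use goodD(1)[OF gE] in measurable)
 finally show ?thesis by (simp only: of_real_eq_iff)
qed

text \<open>The approximating test functions yield Gaussian variables with covariance known from
  \<open>noise_variance\<close>. The covariances converge because the energies of the differences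
  tend to 0, the characteristic functions because the variables converge in mean square to
  \<open>Y\<close>; the two limits identify the law.\<close>

lemma noise_family:
 assumes Y: "!!i. i:I ==> is_noise_integral P H \<mu> B (G i) (Y i)" and R: "!!i. i:I ==> EX R>=0. ALL u y. u<0 \<or> R < u --> G i (u, y) = 0"
 shows "l2_features \<nu>0 I (%i. TF (SF (G i)))" "gaussian_family P I Y (l2_kernel \<nu>0 (%i. TF (SF (G i))))"
proof -
 let ?A = "%J a. LINT w|P. cis (SUM j:J. a j*Y j w)"
 interpret prob_space P using B by (simp add: fractional_colored_noise_def)
 have Ym[measurable]: "Y i:borel_measurable P" and fe: "finite_energy H \<mu> (G i)" if "i:I" for i using Y[OF that] by (auto simp: is_noise_integral_def)
 have nB: "centered_gaussian P (%w. SUM \<phi>:S. c \<phi>*B \<phi> w)" if "finite S" "!!\<phi>. \<phi>:S ==> test_fun \<phi>" for S c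
 using B that unfolding fractional_colored_noise_def by simp
 note gG = energy_good[OF fe R]
 have TG: "TF (SF (G i)):bm" if "i:I" for i using goodD(1)[OF gG(1)[OF that that]] by simp
 show feat: "l2_features \<nu>0 I (%i. TF (SF (G i)))" unfolding l2_features_def using TG good_energy(1)[OF gG(1)] by simp
 have "ALL i:I. EX \<phi>::nat => real*'a => real. (ALL n. test_fun (\<phi> n) & finite_energy H \<mu> (%z. \<phi> n z-G i z)) & (%n. energy H \<mu> (%z. \<phi> n z-G i z)) \<longlonglongrightarrow> 0 &
 (%n. \<integral>\<^sup>+ v. ennreal ((B (\<phi> n) v-Y i v)^2) \<partial>P) \<longlonglongrightarrow> 0" using Y unfolding is_noise_integral_def by simp
 from bchoice[OF this] obtain \<phi> :: "'b => nat => real*'a => real" where \<phi>: "!!i n. i:I ==> test_fun (\<phi> i n)" "!!i n. i:I ==> finite_energy H \<mu> (%z. \<phi> i n z-G i z)"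
 "!!i. i:I ==> (%n. energy H \<mu> (%z. \<phi> i n z-G i z)) \<longlonglongrightarrow> 0"
 "!!i. i:I ==> (%n. \<integral>\<^sup>+ v. ennreal ((B (\<phi> i n) v-Y i v)^2) \<partial>P) \<longlonglongrightarrow> 0" by auto
 define E where "E i n z = \<phi> i n z-G i z" for i n z
 have gE: "good (SF (E i n))" "energy H \<mu> (E i n) = (LINT v|\<nu>0. (cmod (TF (SF (E i n)) v))^2)" if i: "i:I" for i n
 proof -
 obtain r r' where "r >= 0" "ALL u y. u<0 \<or> r < u --> G i (u, y) = 0" "r' >= 0" "ALL u y. u<0 \<or> r' < u --> \<phi> i n (u, y) = 0"
 using R[OF i] test_fun_basic(5)[OF \<phi>(1)[OF i]] by blast
 hence "EX R>=0. ALL u y. u<0 \<or> R < u --> E i n (u, y) = 0" unfolding E_def by (intro exI[of _ "max r r'"]) auto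
 moreover have "finite_energy H \<mu> (E i n)" using \<phi>(2)[OF i] unfolding E_def .
 ultimately show "good (SF (E i n))" "energy H \<mu> (E i n) = (LINT v|\<nu>0. (cmod (TF (SF (E i n)) v))^2)" using energy_good by auto
 qed
 have sum: "AE u in lborel. ALL l. SF (\<phi> i n) (u, l) = SF (G i) (u, l)+SF (E i n) (u, l)" if i: "i:I" for i n using integrable_Re[OF test_fun_basic(4)[OF \<phi>(1)[OF i]]] fe[OF i] SF_diff[of "\<phi> i n" "G i"] by (auto simp: finite_energy_def E_def[abs_def])
 have g\<phi>: "good (SF (\<phi> i n))" if i: "i:I" for i n
 proof (rule good_dominated[OF gG(1)[OF i i] gE(1)[OF i]])
 show "SF (\<phi> i n):bm" by (rule SF_measurable[OF test_fun_basic(2)[OF \<phi>(1)[OF i]]])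
 obtain r where "r >= 0" "ALL u y. u<0 \<or> r < u --> \<phi> i n (u, y) = 0" using test_fun_basic(5)[OF \<phi>(1)[OF i]] by blast
 thus "time_bounded (SF (\<phi> i n))" unfolding time_bounded_def SF_def fourier_def by auto
 show "AE u in lborel. ALL l. cmod (SF (\<phi> i n) (u, l)) <= cmod (SF (G i) (u, l)) + cmod (SF (E i n) (u, l))"
 by (rule eventually_mono[OF sum[OF i, of n]]) (auto intro: norm_triangle_ineq)
 qed
 have T\<phi>: "AE v in \<nu>0. TF (SF (\<phi> i n)) v = TF (SF (G i)) v+TF (SF (E i n)) v" if i: "i:I" for i n
 using TF_lincomb[where J="UNIV :: bool set" and F="%b. if b then SF (G i) else SF (E i n)" and a="%_. 1" and E="SF (\<phi> i n)"]
 gG(1)[OF i i] gE(1)[OF i] sum[OF i] goodD(1)[OF g\<phi>[OF i]] by (simp add: UNIV_bool add.commute)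
 show "gaussian_family P I Y (l2_kernel \<nu>0 (%i. TF (SF (G i))))" unfolding gaussian_family_def
 proof (intro conjI allI impI ballI prob_space_axioms Ym)
 fix J and a :: "'b => real" assume "finite J & J \<subseteq> I"
 hence J: "finite J" "J \<subseteq> I" by auto
 define F where "F v = (SUM j:J. of_real (a j)*TF (SF (G j)) v)" for v
 define h where "h n v = (SUM j:J. of_real (a j)*TF (SF (E j n)) v)" for n v
 define V where "V = (LINT v|\<nu>0. (cmod (F v))^2)"
 define W where "W n = (LINT v|\<nu>0. (cmod (F v+h n v))^2)" for n
 define d where "d n = (SUM j:J. (a j)^2*energy H \<mu> (E j n))*real (card J)" for n
 have TE: "TF (SF (E j n)):borel_measurable \<nu>0" "TF (SF (G j)):borel_measurable \<nu>0" if "j:J" for j n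
 using goodD(1)[OF gE(1), of j] TG[of j] that J by (auto simp: measurable_cong_sets[OF sets_\<nu>0 refl])
 have Fm[measurable]: "F:borel_measurable \<nu>0" unfolding F_def by (intro borel_measurable_sum borel_measurable_times TE) auto
 have hm[measurable]: "h n:borel_measurable \<nu>0" for n unfolding h_def by (intro borel_measurable_sum borel_measurable_times TE) auto
 have sq: "(cmod (SUM j:J. of_real (a j)*x j))^2 <= (SUM j:J. (a j)^2*(cmod (x j))^2)*real (card J)" for x
 proof -
 have "(cmod (SUM j:J. of_real (a j)*x j))^2 <= (SUM j:J. abs (a j) * cmod (x j))^2" by (intro power_mono order.trans[OF norm_sum]) (auto simp: norm_mult)
 also have "... <= (SUM j:J. (abs (a j) * cmod (x j))^2)*real (card J)" by (rule sum_squared_le_sum_of_squares)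
 finally show ?thesis by (simp add: power_mult_distrib)
 qed
 have bnd: "integrable \<nu>0 (%v. (cmod (k v))^2)" "(LINT v|\<nu>0. (cmod (k v))^2) <= (SUM j:J. (a j)^2*(LINT v|\<nu>0. (cmod (x j v))^2))*real (card J)"
 if k: "k = (%v. SUM j:J. of_real (a j)*x j v)" "k:borel_measurable \<nu>0" and x: "!!j. j:J ==> integrable \<nu>0 (%v. (cmod (x j v))^2)" for k x
 proof -
 have i: "integrable \<nu>0 (%v. (SUM j:J. (a j)^2*(cmod (x j v))^2)*real (card J))" using x by auto
 show 1: "integrable \<nu>0 (%v. (cmod (k v))^2)"
 proof (rule lint_bound[OF i])
 show "(%v. (cmod (k v))^2):borel_measurable \<nu>0" using k(2) by simp
 have "(cmod (k v))^2 <= (SUM j:J. (a j)^2*(cmod (x j v))^2)*real (card J)" for v unfolding k(1) by (rule sq)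
 hence "norm ((cmod (k v))^2) <= norm ((SUM j:J. (a j)^2*(cmod (x j v))^2)*real (card J))" for v
 unfolding real_norm_def abs_of_nonneg[OF zero_le_power2] using abs_ge_self by (rule order.trans)
 thus "AE v in \<nu>0. norm ((cmod (k v))^2) <= norm ((SUM j:J. (a j)^2*(cmod (x j v))^2)*real (card J))" by simp
 qed
 have "(LINT v|\<nu>0. (cmod (k v))^2) <= (LINT v|\<nu>0. (SUM j:J. (a j)^2*(cmod (x j v))^2)*real (card J))" by (rule integral_mono[OF 1 i]) (simp add: k sq)
 also have "... = (SUM j:J. (a j)^2*(LINT v|\<nu>0. (cmod (x j v))^2))*real (card J)" using x by simp
 finally show "(LINT v|\<nu>0. (cmod (k v))^2) <= (SUM j:J. (a j)^2*(LINT v|\<nu>0. (cmod (x j v))^2))*real (card J)" .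
 qed
 have iF: "integrable \<nu>0 (%v. (cmod (F v))^2)" by (rule bnd(1)[of F "%j. TF (SF (G j))"]) (use J good_energy(1)[OF gG(1)] Fm in "auto simp: F_def[abs_def]")
 have ih: "integrable \<nu>0 (%v. (cmod (h n v))^2)" "(LINT v|\<nu>0. (cmod (h n v))^2) <= d n" for n
 proof -
 have k: "h n = (%v. SUM j:J. of_real (a j)*TF (SF (E j n)) v)" by (simp add: h_def fun_eq_iff)
 have x: "integrable \<nu>0 (%v. (cmod (TF (SF (E j n)) v))^2)" if "j:J" for j using good_energy(1)[OF gE(1)] that J by auto
 have "d n = (SUM j:J. (a j)^2*(LINT v|\<nu>0. (cmod (TF (SF (E j n)) v))^2))*real (card J)"
 unfolding d_def using gE(2) J by (intro arg_cong2[where f="(*)"] sum.cong) auto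
 thus "integrable \<nu>0 (%v. (cmod (h n v))^2)" "(LINT v|\<nu>0. (cmod (h n v))^2) <= d n" using bnd[OF k hm x] by auto
 qed
 have d0: "d \<longlonglongrightarrow> (SUM j:J. (a j)^2*0)*real (card J)" unfolding d_def E_def by (intro tendsto_intros \<phi>(3)) (use J in auto)
 have "W \<longlonglongrightarrow> V"
 proof (rule LIMSEQ_I)
 fix e :: real assume e: "0<e"
 have V0: "0<=V" by (simp add: V_def)
 \<comment> \<open>Half of \<open>e\<close> is reserved for the term with \<open>V\<close>; the
   added 1 avoids division by 0.\<close>
 define \<delta> where "\<delta> = e/2/(V+1)"
 have \<delta>: "0<\<delta>" using e V0 by (simp add: \<delta>_def)
 have "\<delta>*V <= e/2" using \<delta> V0 unfolding \<delta>_def by (simp add: field_simps)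
 hence "\<delta>*V <= e/2" .
 have "(%n. (1+1/\<delta>)*d n) \<longlonglongrightarrow> (1+1/\<delta>)*0" using d0 by (intro tendsto_mult_left) simp
 hence "eventually (%n. (1+1/\<delta>)*d n < e/2) sequentially" using e by (intro order_tendstoD(2)) auto
 then obtain m where m: "!!n. m <= n ==> (1+1/\<delta>)*d n < e/2" by (auto simp: eventually_sequentially)
 show "EX no. ALL n>=no. norm (W n-V) < e"
 proof (intro exI allI impI)
 fix n assume n: "m <= n"
 have "abs (W n-V) <= \<delta>*V+(1+1/\<delta>)*(LINT v|\<nu>0. (cmod (h n v))^2)" unfolding W_def V_def by (rule square_integral_perturb(1)[OF Fm hm iF ih(1) \<delta>])
 also have "... <= \<delta>*V+(1+1/\<delta>)*d n" using ih(2) \<delta> by (intro add_mono mult_left_mono) auto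
 also have "... < e" using m[OF n] \<open>\<delta> * V <= e / 2\<close> by linarith
 finally show "norm (W n-V) < e" by simp
 qed
 qed
 have char: "(%w. SUM j:J. a j*B (\<phi> j n) w):borel_measurable P" "(LINT w|P. cis (SUM j:J. a j*B (\<phi> j n) w)) = of_real (exp (- W n/2))" for n
 proof -
 \<comment> \<open>Distinct indices may have the same test function, whereas the noise is Gaussian
   over finite sets of test functions; equal ones are grouped and their coefficients added.\<close>
 define c where "c p = (SUM j:{j:J. \<phi> j n = p}. a j)" for p
 have tf: "test_fun (\<phi> j n)" if "j:J" for j using \<phi>(1) J that by auto
 have cg1: "centered_gaussian P (B p)" if "test_fun p" for p using nB[of "{p}" "%_. 1"] that by simp
 have cg: "centered_gaussian P (%w. SUM p:(%j. \<phi> j n) ` J. c p*B p w)" by (rule nB) (use J tf in auto)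
 also have "(%w. SUM p:(%j. \<phi> j n) ` J. c p*B p w) = (%w. SUM j:J. a j*B (\<phi> j n) w)"
 proof
 fix w
 show "(SUM p:(%j. \<phi> j n) ` J. c p*B p w) = (SUM j:J. a j*B (\<phi> j n) w)"
 unfolding c_def sum_distrib_right by (subst sum.image_gen[OF J(1), of _ "%j. \<phi> j n"]) (auto intro!: sum.cong)
 qed
 finally have cg: "centered_gaussian P (%w. SUM j:J. a j*B (\<phi> j n) w)" .
 thus "(%w. SUM j:J. a j*B (\<phi> j n) w):borel_measurable P" by (simp add: centered_gaussian_def)
 have Bi: "integrable P (%w. B (\<phi> i n) w*B (\<phi> j n) w)" if "i:J" "j:J" for i j
 proof (rule lint_bound)
 show "integrable P (%w. (B (\<phi> i n) w)^2+(B (\<phi> j n) w)^2)" using centered_gaussian_cis(1)[OF prob_space_axioms cg1[OF tf]] that by auto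
 show "(%w. B (\<phi> i n) w*B (\<phi> j n) w):borel_measurable P" using cg1[OF tf[OF that(1)]] cg1[OF tf[OF that(2)]] unfolding centered_gaussian_def by (intro borel_measurable_times) simp_all
 have "abs (x*y) <= x^2+y^2" for x y :: real
 proof -
 have "2*(abs x*abs y) <= x^2+y^2" using sum_squares_bound[of "abs x" "abs y"] by simp
 moreover have "0<=abs x*abs y" by simp
 ultimately show ?thesis by linarith
 qed
 thus "AE w in P. norm (B (\<phi> i n) w*B (\<phi> j n) w) <= norm ((B (\<phi> i n) w)^2+(B (\<phi> j n) w)^2)" by simp
 qed
 have "(LINT w|P. (SUM j:J. a j*B (\<phi> j n) w)^2) = (SUM i:J. SUM j:J. a i*a j*noise_covariance H f (\<phi> i n) (\<phi> j n))" using Bi B tf unfolding fractional_colored_noise_def by (simp add: power2_eq_square sum_product mult_ac)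
 also have "... = (LINT v|\<nu>0. (cmod (SUM j:J. of_real (a j)*TF (SF (\<phi> j n)) v))^2)" by (rule noise_variance[OF J(1) tf g\<phi>]) (use J in auto)
 also have "... = W n" unfolding W_def
 proof (rule integral_cong_AE)
 have "(%v. SUM j:J. of_real (a j)*TF (SF (\<phi> j n)) v):bm" using goodD(1)[OF g\<phi>] J by (intro borel_measurable_sum borel_measurable_times TF_measurable) auto
 thus "(%v. (cmod (SUM j:J. of_real (a j)*TF (SF (\<phi> j n)) v))^2):borel_measurable \<nu>0" by simp
 have "AE v in \<nu>0. ALL j:J. TF (SF (\<phi> j n)) v = TF (SF (G j)) v+TF (SF (E j n)) v" using J T\<phi> by (intro AE_finite_allI) auto
 thus "AE v in \<nu>0. (cmod (SUM j:J. of_real (a j)*TF (SF (\<phi> j n)) v))^2 = (cmod (F v+h n v))^2"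
 by eventually_elim (simp add: F_def h_def sum.distrib[symmetric] distrib_left)
 qed measurable
 finally show "(LINT w|P. cis (SUM j:J. a j*B (\<phi> j n) w)) = of_real (exp (- W n/2))" using centered_gaussian_cis(2)[OF prob_space_axioms cg] by simp
 qed
 have Sm[measurable]: "(%w. SUM j:J. a j*Y j w):borel_measurable P" using J by (intro borel_measurable_sum) auto
 have "norm (of_real (exp (- V/2))-?A J a) <= 0+\<delta>" if \<delta>: "0<\<delta>" for \<delta>
 proof -
 define c where "c j = (a j)^2*real (card J)/\<delta>" for j
 have Bm: "B (\<phi> j n):borel_measurable P" if "j:J" for j n using nB[of "{\<phi> j n}" "%_. 1"] that \<phi>(1) J by (auto simp: centered_gaussian_def)
 have ic: "integrable P (%w. cis (SUM j:J. a j*Y j w))" "integrable P (%w. cis (SUM j:J. a j*B (\<phi> j n) w))" for n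
 using char(1)[of n] by (auto intro!: integrable_const_bound[where B=1])
 have le: "ennreal (norm (of_real (exp (- W n/2))-?A J a)) <= ennreal \<delta>+(SUM j:J. ennreal (c j)*nn_integral P (%v. ennreal ((B (\<phi> j n) v-Y j v)^2)))" for n
 proof -
 have "ennreal (norm (of_real (exp (- W n/2))-?A J a)) = ennreal (norm (LINT w|P. cis (SUM j:J. a j*B (\<phi> j n) w) - cis (SUM j:J. a j*Y j w)))"
 using ic by (simp add: char(2))
 also have "... <= nn_integral P (%w. ennreal (norm (cis (SUM j:J. a j*B (\<phi> j n) w) - cis (SUM j:J. a j*Y j w))))"
 by (rule integral_norm_bound_ennreal) (use ic in auto)
 also have "... <= nn_integral P (%w. ennreal \<delta>+(SUM j:J. ennreal (c j)*ennreal ((B (\<phi> j n) w-Y j w)^2)))"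
 proof (rule nn_integral_mono)
 fix w
 define x where "x = (SUM j:J. a j*(B (\<phi> j n) w-Y j w))"
 have "cis (SUM j:J. a j*B (\<phi> j n) w) - cis (SUM j:J. a j*Y j w) = cis (SUM j:J. a j*Y j w)*(cis x-1)"
 by (simp add: x_def right_diff_distrib cis_mult sum_subtractf)
 hence "norm (cis (SUM j:J. a j*B (\<phi> j n) w) - cis (SUM j:J. a j*Y j w)) = cmod (cis x-1)" by (simp add: norm_mult)
 also have "... <= abs x" by (rule power2_le_imp_le) (use norm_cis_diff(1)[of x] in auto)
 \<comment> \<open>Passes from the first power to the square, which is what the approximation of
   \<open>Y\<close> controls.\<close>
 also have "abs x <= \<delta>+x^2/\<delta>"
 proof (cases "abs x <= \<delta>")
 case False
 hence "abs x*\<delta> <= abs x*abs x" by (intro mult_left_mono) auto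
 thus ?thesis using \<delta> by (simp add: field_simps power2_eq_square) (smt (verit) mult_pos_pos)
 qed (use \<delta> in "auto intro: order.trans")
 also have "x^2/\<delta> <= ((SUM j:J. (a j*(B (\<phi> j n) w-Y j w))^2)*real (card J))/\<delta>"
 unfolding x_def using \<delta> by (intro divide_right_mono sum_squared_le_sum_of_squares) auto
 finally show "ennreal (norm (cis (SUM j:J. a j*B (\<phi> j n) w) - cis (SUM j:J. a j*Y j w))) <= ennreal \<delta>+(SUM j:J. ennreal (c j)*ennreal ((B (\<phi> j n) w-Y j w)^2))" using \<delta> by (simp add: sum_distrib_left sum_divide_distrib power_mult_distrib mult_ac ennreal_mult[symmetric] c_def sum_nonneg ennreal_plus[symmetric] del: ennreal_plus)
 qed
 finally show ?thesis using J Bm by (simp add: nn_integral_sum nn_integral_cmult emeasure_space_1 subset_eq nn_integral_add)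
 qed
 have l1: "(%n. ennreal (norm (of_real (exp (- W n/2))-?A J a))) \<longlonglongrightarrow> ennreal (norm (of_real (exp (- V/2))-?A J a))"
 by (intro tendsto_intros \<open>W \<longlonglongrightarrow> V\<close>) auto
 have l2: "(%n. ennreal \<delta>+(SUM j:J. ennreal (c j)*nn_integral P (%v. ennreal ((B (\<phi> j n) v-Y j v)^2)))) \<longlonglongrightarrow> ennreal \<delta>+(SUM j:J. ennreal (c j)*0)"
 by (intro tendsto_add tendsto_const tendsto_sum ennreal_tendsto_cmult \<phi>(4)) (use J in auto)
 have "ennreal (norm (of_real (exp (- V/2))-?A J a)) <= ennreal \<delta>+(SUM j:J. ennreal (c j)*0)" by (rule LIMSEQ_le[OF l1 l2]) (use le in blast)
 thus ?thesis using \<delta> by simp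
 qed
 hence "norm (of_real (exp (- V/2))-?A J a)<=0" by (rule field_le_epsilon)
 moreover have "(SUM i:J. SUM j:J. a i*a j*l2_kernel \<nu>0 (%i. TF (SF (G i))) i j) = V"
 using l2_kernel_quad[OF feat J(1), of "%i. i" a] J(2) unfolding V_def F_def by simp
 ultimately show "?A J a = of_real (exp (- (SUM i:J. SUM j:J. a i*a j*l2_kernel \<nu>0 (%i. TF (SF (G i))) i j)/2))" by simp
 qed
qed

end

section \<open>The features of the solution\<close>

lemma powr_le_exp: assumes "0<k" "0<=y" shows "y powr k <= k powr k*exp (y::real)"
proof -
 have "y/k <= exp (y/k)" using exp_ge_add_one_self[of "y/k"] by linarith
 hence "(y/k) powr k <= exp (y/k) powr k" using assms by (intro powr_mono2) auto
 also have "exp (y/k) powr k = exp y" using assms by (simp add: powr_def)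
 finally show ?thesis using assms by (simp add: powr_divide pos_divide_le_eq mult.commute)
qed

lemma gaussian_integral:
 assumes n: "0<n"
 shows "integrable lborel (%s. cis (- (s * z)) * complex_of_real (exp (- (s / n)\<^sup>2/2)))"
 "(LINT s|lborel. cis (- (s * z)) * complex_of_real (exp (- (s / n)\<^sup>2/2))) = complex_of_real (n * sqrt (2*pi)*exp (- (n*z)\<^sup>2/2))"
proof -
 interpret N: prob_space N01 by (rule prob_space_N01)
 let ?f = "%s. cis (- (s * z)) * of_real (exp (- (s / n)\<^sup>2/2))"
 have e: "?f (0+n*x) = of_real (sqrt (2*pi))*(std_normal_density x *\<^sub>R cis ((- n*z)*x))" for x using n by (simp add: std_normal_density_def scaleR_conv_of_real mult_ac)
 have "integrable N01 (%x. cis ((- n*z)*x))" by (rule N.integrable_const_bound[where B=1]) auto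
 hence i: "integrable lborel (%x. std_normal_density x *\<^sub>R cis ((- n*z)*x))" by (subst (asm) integrable_density) auto
 show "integrable lborel ?f" using integrable_mult_right[OF i, of "of_real (sqrt (2*pi))"] lborel_integrable_real_affine_iff[of n ?f 0] n unfolding e by simp
 have "(LINT s|lborel. ?f s) = abs n *\<^sub>R (LINT x|lborel. ?f (0+n*x))" by (rule lborel_integral_real_affine) (use n in simp)
 also have "(LINT x|lborel. ?f (0+n*x)) = of_real (sqrt (2*pi))*(LINT x|N01. cis ((- n*z)*x))" unfolding e integral_mult_right_zero by (subst integral_density) auto
 finally show "(LINT s|lborel. ?f s) = of_real (n * sqrt (2*pi)*exp (- (n*z)\<^sup>2/2))" unfolding cis_N01 using n by (simp add: scaleR_conv_of_real)
qed

text \<open>The exponent determines a positive function by approximating its inverse Fourier transform with Gaussian averages of the process.\<close>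

lemma inverse_fourier_nonneg:
 fixes Y :: "'v => 'a::euclidean_space"
 assumes P: "prob_space N" and Y[measurable]: "Y:borel_measurable N" and F: "!!k. (LINT w|N. cis (k \<bullet> Y w)) = complex_of_real (F k)" and i: "integrable lborel F"
 shows "0<=Re (LINT k|lborel. cis (- (y \<bullet> k)) * complex_of_real (F k))"
proof -
 let ?B = "%k z. - (k \<bullet> z)"
 let ?A = "%k. cis (- (y \<bullet> k)) * of_real (F k)"
 interpret prob_space N by fact
 interpret NL: pair_sigma_finite N "lborel :: 'a measure" by standard
 have c[measurable]: "(%k. cis (- (y \<bullet> k))):bm" for y :: 'a by simp
 \<comment> \<open>Gaussian cut-offs tending to 1. Their Fourier transforms are positive, so each
   regularised integral is an average of positive values over the law of \<open>Y\<close>.\<close>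
 define W where "W n k = (PROD b:Basis. exp (- ((k \<bullet> b)/real (Suc n))\<^sup>2/2))" for n and k :: 'a
 have Wm[measurable]: "W n:bm" for n unfolding W_def by simp
 have W1: "abs (W n k)<=1" for n k unfolding W_def abs_prod by (intro prod_le_1) auto
 have lim: "(%n. W n k) \<longlonglongrightarrow> 1" for k
 proof -
 have "(%n. exp (- (c/real (Suc n))\<^sup>2/2)) \<longlonglongrightarrow> 1" for c :: real
 proof -
 have "(%n. exp (- (c*inverse (real (Suc n)))\<^sup>2/2)) \<longlonglongrightarrow> exp (- (c*0)\<^sup>2/2)" by (intro tendsto_exp tendsto_divide tendsto_minus tendsto_power tendsto_mult tendsto_const LIMSEQ_inverse_real_of_nat) simp
 thus ?thesis unfolding divide_inverse by simp
 qed
 hence "(%n. W n k) \<longlonglongrightarrow> (PROD b:(Basis::'a set). 1)" unfolding W_def by (intro tendsto_prod)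
 thus ?thesis by simp
 qed
 have K: "integrable lborel (%k. cis (?B k z) * of_real (W n k))" "0<=Re (LINT k|lborel. cis (?B k z) * of_real (W n k))" for n z
 proof -
 let ?f = "%b s. cis (- (s * (z \<bullet> b))) * of_real (exp (- (s / real (Suc n))\<^sup>2/2))"
 have e: "cis (?B k z) * of_real (W n k) = (PROD b:Basis. ?f b (k \<bullet> b))" for k
 by (simp only: prod.distrib prod_cis[OF finite_Basis] of_real_prod[symmetric] sum_negf W_def euclidean_inner[of k z])
 have g: "integrable lborel (?f b)" for b by (rule gaussian_integral(1)) simp
 show "integrable lborel (%k. cis (?B k z) * of_real (W n k))" unfolding e by (rule lborel_integral_prod(1)[OF g])
 have "(LINT k|lborel. cis (?B k z) * of_real (W n k)) = (PROD b:Basis. of_real (real (Suc n) * sqrt (2*pi)*exp (- (real (Suc n)*(z \<bullet> b))\<^sup>2/2)))"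
 unfolding e lborel_integral_prod(2)[OF g] by (intro prod.cong refl gaussian_integral(2)) simp
 thus "0<=Re (LINT k|lborel. cis (?B k z) * of_real (W n k))" unfolding of_real_prod[symmetric] by (simp only: Re_complex_of_real) (intro prod_nonneg ; simp)
 qed
 have a: "0<=Re (LINT k|lborel. of_real (W n k)*?A k)" for n
 proof -
 let ?h = "%w k. cis (- (k \<bullet> (y-Y w))) * of_real (W n k)"
 have ih: "integrable (N \<Otimes>\<^sub>M lborel) (case_prod ?h)"
 proof (rule NL.Fubini_integrable)
 show "case_prod ?h:borel_measurable (N \<Otimes>\<^sub>M lborel)" by simp
 show "integrable N (%w. LINT k|lborel. norm (case (w, k) of (w, k) => ?h w k))" by (simp add: norm_mult)
 qed (use K(1) in auto)
 have "(LINT w|N. LINT k|lborel. ?h w k) = (LINT k|lborel. LINT w|N. ?h w k)" using NL.Fubini_integral[OF ih] by simp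
 also have "... = (LINT k|lborel. of_real (W n k)*?A k)"
 proof (intro lint_cong refl)
 fix k
 have e: "?h w k = of_real (W n k)*(cis (- (y \<bullet> k)) * cis (k \<bullet> Y w))" for w by (simp add: cis_mult inner_diff_right inner_commute[of y])
 show "(LINT w|N. ?h w k) = of_real (W n k)*?A k" unfolding e integral_mult_right_zero F ..
 qed
 finally have "Re (LINT k|lborel. of_real (W n k)*?A k) = (LINT w|N. Re (LINT k|lborel. ?h w k))" by (simp add: integral_Re[symmetric] NL.integrable_fst[OF ih])
 also have "0 <= ..." by (intro Bochner_Integration.integral_nonneg K(2))
 finally show ?thesis .
 qed
 have "(%n. LINT k|lborel. of_real (W n k)*?A k) \<longlonglongrightarrow> (LINT k|lborel. of_real 1*?A k)"
 proof (rule integral_dominated_convergence[where w="%k. abs (F k)"])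
 show "AE k in lborel. norm (of_real (W n k)*?A k) <= abs (F k)" for n using mult_right_mono[OF W1] by (auto simp: norm_mult)
 show "AE k in lborel. (%n. of_real (W n k)*?A k) \<longlonglongrightarrow> of_real 1*?A k" by (intro AE_I2 tendsto_intros lim)
 qed (use i in "auto intro!: borel_measurable_times c")
 from LIMSEQ_le_const[OF tendsto_Re[OF this], of 0] a show ?thesis by simp
qed

locale heat = noise H \<mu> g f P B for H and \<mu> :: "'a::euclidean_space measure" and g f and P :: "'w measure" and B +
 fixes N :: "'v measure" and X :: "real => 'v => 'a" and \<Psi> :: "'a => real" and \<alpha> c\<Psi> :: real and u :: "real => 'a => 'w => real"
 assumes levy: "levy_process N X" and ce: "char_exponent N X \<Psi>" and sym: "!!k. \<Psi> (- k) = \<Psi> k"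
 and dens: "!!t. t > 0 ==> distributed N lborel (X t) (%x. ennreal (transition_density \<Psi> t x))"
 and \<alpha>: "0<\<alpha>" and c\<Psi>: "1<=c\<Psi>" "!!k. norm k powr \<alpha> <= c\<Psi>*\<Psi> k" "!!k. \<Psi> k <= c\<Psi>*norm k powr \<alpha>"
 and u: "continuous_mild_solution P H \<mu> B \<Psi> u"
begin

sublocale N: prob_space N using levy by (simp add: levy_process_def)

lemma \<Psi>_nonneg: "0<=\<Psi> k" using order.trans[OF powr_ge_zero c\<Psi>(2)[of k]] c\<Psi>(1) by (simp add: zero_le_mult_iff)

lemma char: "0<=t ==> (LINT w|N. cis (k \<bullet> X t w)) = complex_of_real (exp (- t*\<Psi> k))" and X_measurable: "0<=t ==> X t:borel_measurable N"
 using ce levy by (auto simp: char_exponent_def levy_process_def)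

lemma \<Psi>_measurable[measurable]: "\<Psi>:bm"
proof -
 note [measurable] = X_measurable[of 1, simplified]
 have "(%k. - ln (Re (LINT w|N. cis (k \<bullet> X 1 w)))):bm" by simp
 thus ?thesis by (simp add: char)
qed

lemma exp_\<Psi>_decay:
 assumes "0<t" "0<k"
 obtains C where "0<C" "!!z. 0<norm z ==> exp (- t*\<Psi> z) <= C*norm z powr-k"
proof -
 define j where "j = k/\<alpha>"
 have j: "0<j" using assms \<alpha> by (simp add: j_def)
 define C where "C = j powr j*(t / c\<Psi>) powr-j"
 have "exp (- t*\<Psi> z) <= C*norm z powr-k" if z: "0<norm z" for z
 proof -
 define y where "y = t / c\<Psi>*norm z powr \<alpha>"
 have y: "0<y" using z assms c\<Psi>(1) by (simp add: y_def)
 have "exp (- t*\<Psi> z) <= exp (- y)" using mult_left_mono[OF c\<Psi>(2)[of z], of "t / c\<Psi>"] assms c\<Psi>(1) by (simp add: y_def)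
 also have "... <= j powr j*y powr-j" using powr_le_exp[OF j, of y] y by (simp add: exp_minus powr_minus field_simps)
 also have "y powr-j = (t / c\<Psi>) powr-j*norm z powr-k" unfolding y_def j_def using \<alpha> by (subst powr_mult) (auto simp: powr_powr)
 finally show ?thesis by (simp add: C_def)
 qed
 thus ?thesis using that[of C] j assms c\<Psi>(1) by (simp add: C_def)
qed

lemma exp_\<Psi>_integrable: assumes t: "0<t" shows "integrable lborel (%k. exp (- t*\<Psi> k))"
proof (rule integrableI_bounded)
 let ?A = "\<integral>\<^sup>+k. ennreal (norm (exp (- t*\<Psi> k))) \<partial>lborel"
 obtain C where C: "0<C" "!!k. 0<norm k ==> exp (- t*\<Psi> k) <= C*norm k powr-(real DIM('a)+1)" by (rule exp_\<Psi>_decay[OF t, of "real DIM('a)+1"]) auto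
 have d: "0<real DIM('a)" "real DIM('a) < real DIM('a)+1" by auto
 obtain A where A: "0<A" "!!X. 0<X ==> (\<integral>\<^sup>+(x::'a). ennreal (if norm x <= X then norm x powr-0 else 0) \<partial>lborel) <= ennreal (A*X powr (real DIM('a)-0))"
 by (rule nn_integral_powr_inner[OF d(1)]) blast
 obtain A' where A': "0<A'" "!!X. 0<X ==> (\<integral>\<^sup>+(x::'a). ennreal (if X < norm x then norm x powr-(real DIM('a)+1) else 0) \<partial>lborel) <= ennreal (A'*X powr (real DIM('a)-(real DIM('a)+1)))"
 by (rule nn_integral_powr_outer[OF d(2)]) blast
 have "?A = nn_integral lborel (%k. ennreal (if k = 0 then 0 else exp (- t*\<Psi> k)))"
 by (rule nn_integral_cong_AE, rule eventually_mono[OF AE_lborel_singleton[of 0]]) simp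
 also have "... <= ennreal (1*A+C*A')" by (rule nn_integral_split_bound[where X=1 and p=0 and q="real DIM('a)+1"])
 (use C A(2)[of 1] A'(2)[of 1] A(1) A'(1) t \<Psi>_nonneg in auto)
 also have "... < \<infinity>" by simp
 finally show "?A < \<infinity>" .
qed measurable

text \<open>The law of \<open>X t\<close> is given through \<open>ennreal\<close> of the density,
  which hides negative values; the sign is obtained from the characteristic function.\<close>

lemma transition_density_nonneg: assumes "0<t" shows "0<=transition_density \<Psi> t x"
 using inverse_fourier_nonneg[OF N.prob_space_axioms X_measurable char exp_\<Psi>_integrable[OF assms], of x] assms unfolding transition_density_def by simp

lemma transition_density_even: "transition_density \<Psi> t (- x) = transition_density \<Psi> t x"
proof -
 have "(LINT k|lborel. cis (- (- x \<bullet> k)) * of_real (exp (- t*\<Psi> k))) = (LINT k|lborel. cnj (cis (- (x \<bullet> k)) * of_real (exp (- t*\<Psi> k))))"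
 by (simp add: cis_cnj)
 also have "... = cnj (LINT k|lborel. cis (- (x \<bullet> k)) * of_real (exp (- t*\<Psi> k)))" by (rule Bochner_Integration.integral_cnj)
 finally show ?thesis unfolding transition_density_def by simp
qed

text \<open>Both claims are read off from the law of \<open>X t\<close>, whose density and
  characteristic function are given, in place of a Fourier inversion theorem.\<close>

lemma transition_density_fourier:
 assumes t: "0<t"
 shows "transition_density \<Psi> t:bm" "fourier (%y. complex_of_real (transition_density \<Psi> t y)) k = complex_of_real (exp (- t*\<Psi> k))"
proof -
 let ?p = "transition_density \<Psi> t"
 note nn = transition_density_nonneg[OF t]
 show m[measurable]: "?p:bm" using distributed_real_measurable[OF nn dens[OF t]] by simp
 have "of_real (exp (- t*\<Psi> (- k))) = (LINT w|N. cis (- k \<bullet> X t w))" using char[of t "- k"] t by simp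
 also have "... = (LINT x|distr N lborel (X t). cis (- k \<bullet> x))" using X_measurable[of t] t by (intro integral_distr[symmetric]) auto
 finally show "fourier (%y. of_real (?p y)) k = of_real (exp (- t*\<Psi> k))" using dens[OF t] unfolding fourier_def by (simp add: nn scaleR_conv_of_real mult.commute integral_density sym distributed_distr_eq_density)
qed

lemma SF_heat:
 "SF (heat_integrand \<Psi> t x) (s, k) = (if 0<s & s < t then cis (- (k \<bullet> x)) * complex_of_real (exp (- (t-s)*\<Psi> k)) else 0)"
proof (cases "0<s & s < t")
 case True
 have "transition_density \<Psi> (t-s) (x-y) = transition_density \<Psi> (t-s) (y + - x)" for y using transition_density_even[of "t-s" "x-y"] by simp
 hence "SF (heat_integrand \<Psi> t x) (s, k) = fourier (%y. of_real (transition_density \<Psi> (t-s) (y + - x))) k" using True by (simp add: SF_def heat_integrand_def)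
 also have "... = cis (k \<bullet>-x)*fourier (%y. of_real (transition_density \<Psi> (t-s) y)) k"
 by (rule fourier_shift, rule measurable_compose[OF _ borel_measurable_of_real], rule transition_density_fourier(1)) (use True in simp)
 finally show ?thesis using True by (simp add: transition_density_fourier)
next
 case False
 have "heat_integrand \<Psi> t x (s, y) = 0" for y using False by (auto simp: heat_integrand_def)
 thus ?thesis unfolding if_not_P[OF False] by (simp add: SF_def fourier_def)
qed

text \<open>The numerator of the time Fourier transform of the integrand. The common denominator,
  \<Psi> minus i times the time frequency, goes into the density \<open>Sd\<close>.\<close>

definition "nfeat p w = cis (- (w \<bullet> p)) - cis (- (snd w \<bullet> snd p)) * complex_of_real (exp (- fst p*\<Psi> (snd w)))" for p :: "real*'a"

lemma TF_heat:
 assumes t: "0<=t" and r: "r ~= 0"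
 shows "TF (SF (heat_integrand \<Psi> t x)) (r, k) = nfeat (t, x) (r, k)/(complex_of_real (\<Psi> k)-\<i> * complex_of_real r)"
proof -
 let ?C = "heat_integrand \<Psi> t x"
 let ?B = "exp (- t*\<Psi> k)"
 let ?A = "%s. cis (- (r * s)) * of_real (exp (- (t-s)*\<Psi> k))"
 let ?z = "of_real (\<Psi> k)-\<i> * of_real r"
 have z: "?z ~= 0" using r by simp
 let ?F = "%s. exp (?z * of_real s) * of_real ?B/?z"
 have e: "exp (?z * of_real s) * of_real ?B = cis (- (r * s)) * of_real (exp (- (t-s)*\<Psi> k))" for s
 by (simp add: cis_conv_exp exp_of_real[symmetric] exp_add[symmetric] algebra_simps)
 have "TF (SF ?C) (r, k) = (LINT s|lborel. cis (- (k \<bullet> x))*(indicator {0..t} s *\<^sub>R (?A s)))" unfolding TF_def FT_def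
 proof (rule integral_cong_AE)
 show "(%s. cis (- (fst (r, k) * s))*SF ?C (s, snd (r, k))):borel_measurable lborel" unfolding SF_heat by simp
 show "AE s in lborel. cis (- (fst (r, k) * s))*SF ?C (s, snd (r, k)) = cis (- (k \<bullet> x))*(indicator {0..t} s *\<^sub>R (?A s))"
 using AE_lborel_singleton[of "0::real"] AE_lborel_singleton[of t] by (auto simp: SF_heat indicator_def)
 qed measurable
 also have "... = cis (- (k \<bullet> x))*(LINT s|lborel. indicator {0..t} s *\<^sub>R (?A s))" by (rule integral_mult_right_zero)
 also have "(LINT s|lborel. indicator {0..t} s *\<^sub>R (?A s)) = ?F t-?F 0" unfolding e[symmetric]
 proof (rule integral_FTC_atLeastAtMost[OF t])
 show "continuous_on {0..t} (%s. exp (?z * of_real s) * of_real ?B)" by (intro continuous_intros)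
 fix s
 show "(?F has_vector_derivative exp (?z * of_real s) * of_real ?B) (at s within {0..t})" using z by (auto intro!: derivative_eq_intros has_vector_derivative_real_field)
 qed
 finally show ?thesis unfolding e nfeat_def by (simp add: diff_divide_distrib right_diff_distrib cis_mult minus_diff_commute)
qed

definition "Sd w = cH*abs (fst w) powr (1-2*H)*g (snd w)/((\<Psi> (snd w))^2+(fst w)^2)"

lemma Sd_measurable[measurable]: "Sd:bm"
proof -
 have "(%w. cH*abs (fst w) powr (1-2*H)*g (snd w)/((\<Psi> (snd w))^2+(fst w)^2)):borel_measurable (borel \<Otimes>\<^sub>M borel)" by simp
 thus ?thesis unfolding Sd_def[abs_def] by (simp add: borel_prod)
qed

lemma Sd_nonneg: "0<=Sd w" using cH(1) g0 by (simp add: Sd_def)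

lemma nfeat_measurable[measurable]: "nfeat p:bm"
proof -
 have m: "(%w::real*'a. \<Psi> (snd w)):bm" unfolding borel_prod[symmetric] by simp
 have "(%w::real*'a. cis (- (w \<bullet> p))):bm" "(%w::real*'a. cis (- (snd w \<bullet> snd p))):bm" by (intro borel_measurable_continuous_onI continuous_intros)+
 thus ?thesis unfolding nfeat_def[abs_def] using m by measurable
qed

text \<open>All features share the same denominator, nonzero off time frequency 0, so its squared
  modulus can be moved into the measure without changing any kernel.\<close>

theorem solution_family:
 "gaussian_family P {p. 0<=fst p} (%p. u (fst p) (snd p)) (l2_kernel (density lborel (%v. ennreal (Sd v))) nfeat)"
 "l2_features (density lborel (%v. ennreal (Sd v))) {p. 0<=fst p} nfeat"
proof -
 let ?A = "density lborel (%v. ennreal (Sd v))"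
 let ?I = "{p::real*'a. 0<=fst p}" and ?G = "%p. heat_integrand \<Psi> (fst p) (snd p)"
 have Y: "is_noise_integral P H \<mu> B (?G p) (u (fst p) (snd p))" if "p:?I" for p using u that by (simp add: continuous_mild_solution_def)
 have R: "EX R>=0. ALL u y. u<0 \<or> R < u --> ?G p (u, y) = 0" if "p:?I" for p using that by (intro exI[of _ "fst p"]) (auto simp: heat_integrand_def)
 note nf = noise_family[where I="?I" and G="?G", OF Y R]
 let ?w = "%v::real*'a. cH*abs (fst v) powr (1-2*H)*g (snd v)"
 have w: "0<=?w v" for v using cH(1) g0 by simp
 have ae: "AE v in lborel. fst (v::real*'a) ~= 0" by (rule eventually_mono[OF AE_components_nonzero]) (auto simp: Basis_prod_def)
 have T: "TF (SF (?G p)) v = nfeat p v / (of_real (\<Psi> (snd v))-\<i> * of_real (fst v))" if "p:?I" "fst v ~= 0" for p v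
 using TF_heat[of "fst p" "fst v" "snd p" "snd v"] that by simp
 have z: "?w v * Re (TF (SF (?G p)) v * cnj (TF (SF (?G q)) v)) = Sd v * Re (nfeat p v * cnj (nfeat q v))" if "p:?I" "q:?I" "fst v ~= 0" for p q v
 proof -
 let ?z = "of_real (\<Psi> (snd v))-\<i> * of_real (fst v)"
 have "?z * cnj ?z = of_real ((\<Psi> (snd v))^2+(fst v)^2)" by (simp add: complex_eq_iff power2_eq_square)
 thus ?thesis unfolding T[OF that(1,3)] T[OF that(2,3)] by (simp add: Sd_def)
 qed
 have m: "TF (SF (?G p)):bm" if "p:?I" for p using l2_featuresD(1)[OF nf(1) that] by simp
 have mm: "(%v. Re (f v * cnj (h v))):bm" if "f:bm" "h:bm" for f h :: "real*'a => complex" using that by simp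
 have k: "l2_kernel \<nu>0 (%p. TF (SF (?G p))) p q = l2_kernel ?A nfeat p q"
 "integrable \<nu>0 (%v. Re (TF (SF (?G p)) v * cnj (TF (SF (?G q)) v))) \<longleftrightarrow> integrable ?A (%v. Re (nfeat p v * cnj (nfeat q v)))"
 if pq: "p:?I" "q:?I" for p q
 proof -
 note mt = mm[OF m[OF pq(1)] m[OF pq(2)]] and mn = mm[OF nfeat_measurable nfeat_measurable, of p q]
 have a: "AE v in lborel. ?w v * Re (TF (SF (?G p)) v * cnj (TF (SF (?G q)) v)) = Sd v * Re (nfeat p v * cnj (nfeat q v))"
 by (rule eventually_mono[OF ae]) (rule z[OF pq])
 have ms: "(%v. ?w v * Re (TF (SF (?G p)) v * cnj (TF (SF (?G q)) v))):borel_measurable lborel" "(%v. Sd v * Re (nfeat p v * cnj (nfeat q v))):borel_measurable lborel"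
 using borel_measurable_times[OF dens_measurable mt] by auto
 have "l2_kernel \<nu>0 (%p. TF (SF (?G p))) p q = (LINT v|lborel. ?w v * Re (TF (SF (?G p)) v * cnj (TF (SF (?G q)) v)))"
 unfolding l2_kernel_def \<nu>0_def by (subst integral_density) (use mt w in auto)
 also have "... = (LINT v|lborel. Sd v * Re (nfeat p v * cnj (nfeat q v)))" by (rule integral_cong_AE[OF ms a])
 finally show "l2_kernel \<nu>0 (%p. TF (SF (?G p))) p q = l2_kernel ?A nfeat p q" unfolding l2_kernel_def by (simp add: integral_density Sd_nonneg)
 have "integrable \<nu>0 (%v. Re (TF (SF (?G p)) v * cnj (TF (SF (?G q)) v))) \<longleftrightarrow> integrable lborel (%v. ?w v * Re (TF (SF (?G p)) v * cnj (TF (SF (?G q)) v)))"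
 unfolding \<nu>0_def by (subst integrable_density) (use mt w in auto)
 also have "... \<longleftrightarrow> integrable lborel (%v. Sd v * Re (nfeat p v * cnj (nfeat q v)))" by (rule integrable_cong_AE[OF ms a])
 finally show "integrable \<nu>0 (%v. Re (TF (SF (?G p)) v * cnj (TF (SF (?G q)) v))) \<longleftrightarrow> integrable ?A (%v. Re (nfeat p v * cnj (nfeat q v)))" by (simp add: integrable_density Sd_nonneg)
 qed
 have sqr: "Re (z * cnj z) = (cmod z)^2" for z by (simp only: complex_norm_square[symmetric] Re_complex_of_real)
 show "l2_features ?A ?I nfeat" using k(2) nf(1) unfolding l2_features_def sqr[symmetric] by auto
 show "gaussian_family P ?I (%p. u (fst p) (snd p)) (l2_kernel ?A nfeat)" using nf(2) k(1) by (subst gaussian_family_cong[symmetric]) auto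
qed

end

section \<open>Chung's law for the solution\<close>

lemma l2_kernel_diff:
 assumes f: "l2_features N I f" and I: "a:I" "b:I" "c:I" "d:I"
 shows "l2_kernel N f a c-l2_kernel N f a d-l2_kernel N f b c+l2_kernel N f b d = (LINT w|N. Re ((f a w-f b w) * cnj (f c w-f d w)))"
proof -
 note i = l2_integrable[OF f I(1,3)] l2_integrable[OF f I(1,4)] l2_integrable[OF f I(2,3)] l2_integrable[OF f I(2,4)]
 have "(LINT w|N. Re ((f a w-f b w) * cnj (f c w-f d w))) = (LINT w|N. Re (f a w * cnj (f c w))-Re (f a w * cnj (f d w))-Re (f b w * cnj (f c w))+Re (f b w * cnj (f d w)))"
 by (intro lint_cong refl) (simp add: algebra_simps)
 thus ?thesis using i unfolding l2_kernel_def by simp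
qed

locale solution = heat H \<mu> g f P B N X \<Psi> \<alpha> c\<Psi> u for H \<mu> g f and P :: "'w measure" and B N X and \<Psi> :: "'a::euclidean_space => real" and \<alpha> c\<Psi> u +
 fixes \<beta> cg :: real
 assumes \<beta>: "0<\<beta>" "\<beta> < real DIM('a)" "real DIM('a)-2*\<alpha>*H < \<beta>" and less: "\<alpha>*(H-(real DIM('a)-\<beta>)/(2*\<alpha>))<1"
 and cg: "1<=cg" "!!k. norm k powr-\<beta> <= cg*g k" "!!k. g k <= cg*norm k powr-\<beta>"
begin

text \<open>\<open>c\<Psi>\<close> enters squared because the denominator of the density contains
  the square of \<Psi>; both \<open>cH\<close> and its inverse occur, one for each direction of the
  comparison.\<close>

definition "cS = cg * c\<Psi>^2*(cH+1 / cH)"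

sublocale spectral H \<alpha> \<beta> cS Sd
proof unfold_locales
 show "0<cS" using cg(1) c\<Psi>(1) cH(1) by (auto simp: cS_def intro!: mult_pos_pos add_pos_pos)
 fix r :: real and k :: 'a
 let ?d = "norm k powr (2*\<alpha>)+r^2" and ?e = "(\<Psi> k)^2+r^2" and ?t = "abs r powr (1-2*H)"
 have c1: "1<=c\<Psi>^2" using c\<Psi>(1) by simp
 have n: "(norm k powr \<alpha>)^2 = norm k powr (2*\<alpha>)" by (cases "k = 0") (simp_all add: powr_power)
 have "(norm k powr \<alpha>)^2 <= (c\<Psi>*\<Psi> k)^2" "(\<Psi> k)^2 <= (c\<Psi>*norm k powr \<alpha>)^2" using c\<Psi> \<Psi>_nonneg by (intro power_mono; simp)+
 hence "?d <= c\<Psi>^2*?e" "?e <= c\<Psi>^2*?d" using mult_right_mono[OF c1, of "r^2"] by (simp_all add: power_mult_distrib n distrib_left)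
 note de = this
 have d0: "0<?d" "0<?e" if "r ~= 0" using that by (simp_all add: add_nonneg_pos)
 have inv: "1/?e <= c\<Psi>^2/?d" "1/?d <= c\<Psi>^2/?e" if "r ~= 0" using de d0[OF that] by (simp_all add: field_simps)
 have cc: "cH * cg * c\<Psi>^2 <= cS" "cg * c\<Psi>^2 / cH <= cS" using cH(1) cg(1) c1 by (simp_all add: cS_def distrib_left mult_ac)
 show "Sd (r, k) <= cS*(?t*norm k powr-\<beta>/?d)"
 proof (cases "r = 0")
 case False
 have "cH*?t*g k*(1/?e) <= cH*?t*(cg*norm k powr-\<beta>)*(c\<Psi>^2/?d)" using cH(1) cg g0 inv[OF False] d0[OF False] by (intro mult_mono) auto
 also have "... = cH * cg * c\<Psi>^2*(?t*norm k powr-\<beta>/?d)" by simp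
 also have "... <= cS*(?t*norm k powr-\<beta>/?d)" using cc(1) d0[OF False] by (intro mult_right_mono) auto
 finally show ?thesis by (simp add: Sd_def)
 qed (simp add: Sd_def)
 show "?t*norm k powr-\<beta>/?d <= cS*Sd (r, k)"
 proof (cases "r = 0")
 case False
 have "?t*norm k powr-\<beta>*(1/?d) <= ?t*(cg*g k)*(c\<Psi>^2/?e)" using cg g0 inv[OF False] d0[OF False] by (intro mult_mono) auto
 also have "... = cg * c\<Psi>^2 / cH*Sd (r, k)" using cH(1) by (simp add: Sd_def)
 also have "... <= cS*Sd (r, k)" using cc(2) Sd_nonneg by (intro mult_right_mono)
 finally show ?thesis by simp
 qed (simp add: Sd_def)
qed (use H \<alpha> \<beta> less in auto)

text \<open>The exponential removes high frequencies. Near 0 the weight is at most of order |k|^(2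
  m), with m the minimum of 1 and \<alpha>, and this offsets the singularity of the time marginal
  because \<open>H2\<close> is below both 1 and \<alpha>.\<close>

lemma smooth_weight:
 assumes a: "0<a"
 defines "w == %k. exp (- a*\<Psi> k)*((norm k)^2+(\<Psi> k)^2)"
 shows "integrable (density lborel (%v. ennreal (Sd v))) (%v. w (snd v))"
proof (rule integrableI_nonneg)
 let ?C = "\<integral>\<^sup>+v. ennreal (w (snd v)) \<partial>density lborel (%v. ennreal (Sd v))"
 let ?B = "%m. \<beta>+2*\<alpha>*H-2*m"
 let ?A = "\<beta>+2*\<alpha>*H"
 have wm[measurable]: "w:bm" unfolding w_def by simp
 have w0: "0<=w k" for k by (simp add: w_def)
 show m: "(%v. w (snd v)):borel_measurable (density lborel (%v. ennreal (Sd v)))"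
 using measurable_compose[OF borel_measurable_continuous_onI[OF continuous_on_snd[OF continuous_on_id]] wm] by simp
 obtain C where C: "0<C" "!!k. nn_integral lborel (%r. ennreal (Sd (r, k))) <= ennreal (C*norm k powr-?A)" by (rule time_marginal) blast
 obtain C1 where C1: "0<C1" "!!k. 0<norm k ==> exp (- a*\<Psi> k) <= C1*norm k powr-2" by (rule exp_\<Psi>_decay[OF a, of 2]) auto
 obtain C2 where C2: "0<C2" "!!k. 0<norm k ==> exp (- a*\<Psi> k) <= C2*norm k powr-(2*\<alpha>)" by (rule exp_\<Psi>_decay[OF a, of "2*\<alpha>"]) (use \<alpha> in auto)
 define m where "m = min 1 \<alpha>"
 have dH: "\<beta>+2*\<alpha>*H = real DIM('a)+2*H2" using H2_eq by simp
 have pq: "\<beta>+2*\<alpha>*H-2*m < real DIM('a)" "real DIM('a) < \<beta>+2*\<alpha>*H" using H2 H1 \<alpha> dH by (auto simp: m_def H2_def)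
 obtain A where A: "0<A" "!!X. 0<X ==> (\<integral>\<^sup>+(x::'a). ennreal (if norm x <= X then norm x powr-?B m else 0) \<partial>lborel) <= ennreal (A*X powr (real DIM('a)-?B m))"
 by (rule nn_integral_powr_inner[OF pq(1)]) blast
 obtain A' where A': "0<A'" "!!X. 0<X ==> (\<integral>\<^sup>+(x::'a). ennreal (if X < norm x then norm x powr-?A else 0) \<partial>lborel) <= ennreal (A'*X powr (real DIM('a)-?A))"
 by (rule nn_integral_powr_outer[OF pq(2)]) blast
 have P2: "(\<Psi> k)^2 <= c\<Psi>^2*norm k powr (2*\<alpha>)" for k
 proof -
 have "(\<Psi> k)^2 <= (c\<Psi>*norm k powr \<alpha>)^2" using c\<Psi> \<Psi>_nonneg by simp
 thus ?thesis by (cases "k = 0") (simp_all add: power_mult_distrib powr_power)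
 qed
 have i: "w k*norm k powr-?A <= (1 + c\<Psi>^2)*norm k powr-?B m" if "norm k<=1" for k :: 'a
 proof (cases "k = 0")
 case False
 have "(norm k)^2 = norm k powr 2" by simp
 also have "... <= norm k powr (2*m)" using that by (intro powr_mono') (auto simp: m_def)
 finally have 1: "(norm k)^2 <= norm k powr (2*m)" .
 have 2: "(\<Psi> k)^2 <= c\<Psi>^2*norm k powr (2*m)" using that by (simp add: m_def powr_mono' order.trans[OF P2] mult_left_mono)
 have "w k <= 1*((norm k)^2+(\<Psi> k)^2)" unfolding w_def using a \<Psi>_nonneg[of k] by (intro mult_right_mono) auto
 also have "... <= (1 + c\<Psi>^2)*norm k powr (2*m)" using 1 2 by (simp add: distrib_right)
 finally have "w k*norm k powr-?A <= (1 + c\<Psi>^2)*norm k powr (2*m)*norm k powr-?A" by (rule mult_right_mono) simp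
 also have "... = (1 + c\<Psi>^2)*norm k powr-?B m" unfolding mult.assoc powr_add[symmetric] by (simp add: algebra_simps)
 finally show ?thesis .
 qed simp
 have o: "w k*norm k powr-?A <= (C1+C2 * c\<Psi>^2)*norm k powr-?A" if "1<norm k" for k :: 'a
 proof (rule mult_right_mono)
 have x: "0<norm k" using that by auto
 have "exp (- a*\<Psi> k)*(norm k)^2 <= C1*norm k powr-2*(norm k)^2" by (rule mult_right_mono[OF C1(2)[OF x]]) simp
 also have "... = C1" using x by (simp add: powr_minus)
 finally have 1: "exp (- a*\<Psi> k)*(norm k)^2 <= C1" .
 have "exp (- a*\<Psi> k)*(\<Psi> k)^2 <= C2*norm k powr-(2*\<alpha>)*(c\<Psi>^2*norm k powr (2*\<alpha>))" using C2 x P2 by (intro mult_mono) auto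
 also have "... = C2 * c\<Psi>^2" using x by (simp add: powr_minus)
 finally show "w k <= C1+C2 * c\<Psi>^2" using 1 by (simp add: w_def distrib_left)
 qed simp
 have "?C = nn_integral lborel (%v. ennreal (Sd v * w (snd v)))" using m by (subst nn_integral_density) (auto simp: ennreal_mult[OF Sd_nonneg w0])
 also have "... <= ennreal C*nn_integral lborel (%k. ennreal (w k*norm k powr-?A))" by (rule nn_integral_space[OF wm C(2,1) w0])
 also have "... <= ennreal C*ennreal ((1 + c\<Psi>^2)*A+(C1+C2 * c\<Psi>^2)*A')"
 by (rule mult_left_mono, rule nn_integral_split_bound[where X=1, OF i o]) (use A(1) A(2)[of 1] A'(1) A'(2)[of 1] C1(1) C2(1) in auto)
 also have "... < \<infinity>" by (simp add: ennreal_mult_less_top)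
 finally show "?C < \<infinity>" .
qed (simp add: w_def)

text \<open>The part of an increment of \<open>u\<close> at \<open>(t, x)\<close> that is not an increment of the field with features \<open>vf\<close>.\<close>

definition "rest t x p w = cis (- (snd w \<bullet> x)) * complex_of_real (exp (- t*\<Psi> (snd w)))*(cis (- (snd w \<bullet> snd p)) * complex_of_real (exp (- fst p*\<Psi> (snd w)))-1)"
 for p w :: "real*'a"

lemma rest_measurable[measurable]: "rest t x p:bm"
proof -
 have m: "(%w::real*'a. \<Psi> (snd w)):bm" unfolding borel_prod[symmetric] by simp
 have c: "(%w::real*'a. cis (- (snd w \<bullet> y))):bm" for y by (intro borel_measurable_continuous_onI continuous_intros)
 have e: "(%w::real*'a. complex_of_real (exp (- r*\<Psi> (snd w)))):bm" for r using m by simp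
 show ?thesis unfolding rest_def[abs_def] by (intro borel_measurable_times borel_measurable_diff borel_measurable_const c e)
qed

text \<open>For t at least 2 a and |r| below a the heat factor exp (- (t + r) \<Psi>) is at most exp
  (- a \<Psi>). Increments in space and time cost factors |\<xi>| and \<Psi>, for which this decay
  pays by \<open>smooth_weight\<close>.\<close>

lemma rest_lipschitz:
 assumes a: "0<a" "2*a <= t" and pq: "abs (fst p) < a" "abs (fst q) < a"
 shows "(cmod (rest t x p w-rest t x q w))^2 <= 2*(norm (p-q))^2*(exp (- (2*a)*\<Psi> (snd w))*((norm (snd w))^2+(\<Psi> (snd w))^2))"
proof -
 let ?A = "%e. e (fst p)-e (fst q)"
 define \<xi> where "\<xi> = snd w"
 have pn: "norm (fst p-fst q) <= norm (p-q)" "norm (snd p-snd q) <= norm (p-q)" by (metis norm_fst_le fst_diff prod.collapse) (metis norm_snd_le snd_diff prod.collapse)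
 define e where "e r = exp (- (t+r)*\<Psi> \<xi>)" for r
 have e0: "0<e r" "abs r < a ==> e r <= exp (- a*\<Psi> \<xi>)" for r
 proof -
 assume "abs r < a"
 hence "a*\<Psi> \<xi> <= (t+r)*\<Psi> \<xi>" using a(2) \<Psi>_nonneg[of \<xi>] by (intro mult_right_mono) auto
 thus "e r <= exp (- a*\<Psi> \<xi>)" by (simp add: e_def algebra_simps)
 qed (simp add: e_def)
 have "rest t x p w-rest t x q w = cis (- (\<xi> \<bullet> x))*(of_real (e (fst p))*(cis (- (\<xi> \<bullet> snd p)) - cis (- (\<xi> \<bullet> snd q))) + of_real (?A e) * cis (- (\<xi> \<bullet> snd q)))"
 proof -
 have ee: "e r = exp (- t*\<Psi> \<xi>)*exp (- r*\<Psi> \<xi>)" for r by (simp add: e_def exp_add[symmetric] algebra_simps)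
 show ?thesis unfolding ee by (simp add: rest_def \<xi>_def[symmetric] algebra_simps)
 qed
 hence "cmod (rest t x p w-rest t x q w) <= e (fst p) * cmod (cis (- (\<xi> \<bullet> snd p)) - cis (- (\<xi> \<bullet> snd q)))+abs (?A e)"
 using norm_triangle_ineq[of "of_real (e (fst p))*(cis (- (\<xi> \<bullet> snd p)) - cis (- (\<xi> \<bullet> snd q)))" "of_real (?A e) * cis (- (\<xi> \<bullet> snd q))"] e0(1)[of "fst p"]
 by (simp add: norm_mult del: of_real_diff)
 also have "... <= exp (- a*\<Psi> \<xi>)*(norm \<xi>*norm (p-q))+exp (- a*\<Psi> \<xi>)*(\<Psi> \<xi>*norm (p-q))"
 proof (intro add_mono mult_mono e0(2) pq)
 have "cis (- (\<xi> \<bullet> snd p)) - cis (- (\<xi> \<bullet> snd q)) = cis (- (\<xi> \<bullet> snd q))*(cis (- (\<xi> \<bullet> (snd p-snd q)))-1)"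
 by (simp add: right_diff_distrib cis_mult inner_diff_right)
 hence "cmod (cis (- (\<xi> \<bullet> snd p)) - cis (- (\<xi> \<bullet> snd q))) = cmod (cis (- (\<xi> \<bullet> (snd p-snd q)))-1)" by (simp add: norm_mult)
 also have "... <= abs (\<xi> \<bullet> (snd p-snd q))" by (rule power2_le_imp_le) (use norm_cis_diff(1)[of "- (\<xi> \<bullet> (snd p-snd q))"] in auto)
 also have "... <= norm \<xi>*norm (snd p-snd q)" by (rule Cauchy_Schwarz_ineq2)
 also have "... <= norm \<xi>*norm (p-q)" by (intro mult_left_mono pn) auto
 finally show "cmod (cis (- (\<xi> \<bullet> snd p)) - cis (- (\<xi> \<bullet> snd q))) <= norm \<xi>*norm (p-q)" .
 have ed: "abs (e r-e s) <= exp (- a*\<Psi> \<xi>)*(\<Psi> \<xi>*(s-r))" if "abs r < a" "r <= s" for r s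
 proof -
 have "e s = e r*exp (- ((s-r)*\<Psi> \<xi>))" by (simp add: e_def exp_add[symmetric] algebra_simps)
 moreover have "1-(s-r)*\<Psi> \<xi> <= exp (- ((s-r)*\<Psi> \<xi>))" "exp (- ((s-r)*\<Psi> \<xi>))<=1"
 using exp_ge_add_one_self[of "- ((s-r)*\<Psi> \<xi>)"] that(2) \<Psi>_nonneg[of \<xi>] by auto
 ultimately have "abs (e r-e s) <= e r*((s-r)*\<Psi> \<xi>)" using e0(1)[of r] mult_left_mono[of "1-(s-r)*\<Psi> \<xi>" "exp (- ((s-r)*\<Psi> \<xi>))" "e r"]
 mult_left_mono[of "exp (- ((s-r)*\<Psi> \<xi>))" 1 "e r"] by (simp add: right_diff_distrib)
 also have "... <= exp (- a*\<Psi> \<xi>)*((s-r)*\<Psi> \<xi>)" using that \<Psi>_nonneg[of \<xi>] by (intro mult_right_mono e0(2)) auto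
 finally show ?thesis by (simp add: mult.commute)
 qed
 have "abs (?A e) <= exp (- a*\<Psi> \<xi>)*(\<Psi> \<xi>*abs (fst p-fst q))" using ed[OF pq(1), of "fst q"] ed[OF pq(2), of "fst p"] by (cases "fst p <= fst q") auto
 also have "... <= exp (- a*\<Psi> \<xi>)*(\<Psi> \<xi>*norm (p-q))" using pn(1) \<Psi>_nonneg[of \<xi>] by (intro mult_left_mono) auto
 finally show "abs (?A e) <= exp (- a*\<Psi> \<xi>)*(\<Psi> \<xi>*norm (p-q))" .
 qed auto
 finally have "(cmod (rest t x p w-rest t x q w))^2 <= (exp (- a*\<Psi> \<xi>)*norm (p-q)*(norm \<xi>+\<Psi> \<xi>))^2" by (simp add: algebra_simps power_mono)
 also have "... = exp (- (2*a)*\<Psi> \<xi>)*(norm (p-q))^2*(norm \<xi>+\<Psi> \<xi>)^2" by (simp add: power_mult_distrib exp_double[symmetric])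
 also have "... <= exp (- (2*a)*\<Psi> \<xi>)*(norm (p-q))^2*(2*((norm \<xi>)^2+(\<Psi> \<xi>)^2))"
 using sum_squares_bound[of "norm \<xi>" "\<Psi> \<xi>"] by (intro mult_left_mono) (auto simp: power2_sum)
 finally show ?thesis by (simp only: \<xi>_def mult_ac)
qed

text \<open>Stationary part and remainder are realised jointly as one Gaussian family over
  \<open>D\<close> with a flag, and their difference has the law of the increments of
  \<open>u\<close> at (t, x). The remainder is negligible and the stationary part has covariance
  \<open>KV UNIV\<close> at every base point, so one constant serves all of them; equality of laws
  brings the result back to \<open>u\<close>.\<close>

theorem chung_law:
 assumes a: "0<a"
 obtains j where "0<j" "!!t x. 2*a <= t ==> AE d in P.
 Liminf (at_right 0) (%e. SUP (s, y)\<in>{(s, y). rho H1 H2 s y <= e}. ereal (abs (u (t+s) (x+y) d-u t x d) / scale (expQ TYPE('a) H1 H2) e)) = ereal j"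
proof -
 let ?E = "%d. - (2*a)*\<Psi> (snd d)"
 let ?D = "%p0. %p w. u (fst (p0+p)) (snd (p0+p)) w-u (fst p0) (snd p0) w"
 let ?C = "%X w. %p. X (p, True) w-X (p, False) w"
 let ?B = "%d. (norm (snd d))^2+(\<Psi> (snd d))^2"
 let ?A = "%d. exp (?E d)*?B d"
 \<comment> \<open>Time increments below \<open>a\<close> keep t + s positive for t at least 2 a,
   where \<open>u\<close> is defined.\<close>
 define D where "D = {p:(dyadics :: (real*'a) set). abs (fst p) < a}"
 have D0: "0:D" using a by (auto simp: D_def dyadics_def)
 interpret points H \<alpha> \<beta> cS Sd D
 proof
 show "trunc H1 H2 n p:D" if p: "p:D" for n p
 proof -
 let ?k = "nat (floor (real n/H1))" and ?l = "nat (floor (real n/H2))"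
 have "tr (max ?k ?l) (tr ?k (fst p)) = tr ?k (fst p)" by (rule tr_fixed_mono[of ?k]) (simp_all add: tr_tr)
 moreover have "trv (max ?k ?l) (trv ?l (snd p)) = trv ?l (snd p)" by (rule trv_fixed_mono[of ?l]) (simp_all add: trv_trv)
 ultimately have "trunc H1 H2 n p:dyadics" unfolding dyadics_def trunc_def by auto
 thus ?thesis using p tr_le[of ?k "fst p"] by (auto simp: D_def trunc_def)
 qed
 qed (use D0 in "auto simp: D_def")
 let ?P = "PiM UNIV (%_::nat. N01)"
 obtain V where V: "gaussian_family ?P D V (KV UNIV)" by (rule V_exists[of UNIV]) auto
 interpret V: prob_space ?P by (rule gaussian_familyD[OF V])
 obtain j :: ereal where j: "!!(P::(nat => real) measure) X. gaussian_family P D X (KV UNIV) ==> AE w in P. G.lf (%p. X p w) = j" by (rule lf_constant) blast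
 obtain c where c: "0<c" "AE w in ?P. ereal c <= G.lf (%p. V p w)" by (rule lf_lower_bound[OF a _ V]) (auto simp: D_def)
 have "AE w in ?P. ereal c <= j" using c(2) j[OF V] by eventually_elim simp
 hence k1: "ereal c <= j" by simp
 obtain C where C: "0<C" "!!(P::(nat => real) measure) X. gaussian_family P D X (KV UNIV) ==> 1/2 <= \<P>(w in P. G.lf (%p. X p w) <= ereal C)" by (rule lf_le_event) blast
 have k2: "j <= ereal C"
 proof (rule ccontr)
 assume n: "~ j <= ereal C"
 have "AE w in ?P. w ~: {w:space ?P. G.lf (%p. V p w) <= ereal C}" using j[OF V] by eventually_elim (use n in auto)
 hence "measure ?P {w:space ?P. G.lf (%p. V p w) <= ereal C} = 0"
 proof (subst V.prob_eq_0)
 show "{w:space ?P. G.lf (%p. V p w) <= ereal C}:V.events" using G.lf_family_measurable[OF V] by simp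
 qed
 thus False using C(2)[OF V] by simp
 qed
 obtain k where k: "j = ereal k" using k1 k2 by (cases j) auto
 have k0: "0<k" using k1 c(1) k by simp
 have "AE d in P. Liminf (at_right 0) (%e. SUP (s, y)\<in>{(s, y). rho H1 H2 s y <= e}. ereal (abs (u (t+s) (x+y) d-u t x d) / scale (expQ TYPE('a) H1 H2) e)) = ereal k"
 if t: "2*a <= t" for t x
 proof -
 let ?\<nu> = "density lborel (%d. ennreal (Sd d))"
 define p0 where "p0 = (t, x)"
 have nS: "\<nu>S UNIV = ?\<nu>" by (simp add: \<nu>S_def)
 have pos: "p0+p:{p. 0<=fst p}" if "p:D" for p using that t by (auto simp: D_def p0_def)
 \<comment> \<open>True selects the stationary part. Its factor \<open>phase p0\<close> has modulus
   one and cancels in the kernel, but it turns the difference with \<open>rest\<close> into the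
   exact increment of \<open>nfeat\<close>.\<close>
 define F where "F z = (if snd z then (%d. phase p0 d * vf (fst z) d) else rest t x (fst z))" for z :: "(real*'a) \<times> bool"
 have dF: "F (p, True) d-F (p, False) d = nfeat (p0+p) d-nfeat p0 d" for p d
 proof -
 have "phase q d = cis (- (d \<bullet> q))" for q by (simp add: phase_def inner_prod_def)
 moreover have "cis (- (d \<bullet> (p0+p))) = cis (- (d \<bullet> p0)) * cis (- (d \<bullet> p))" by (simp add: cis_mult inner_add_right)
 moreover have "cis (- (snd d \<bullet> (x+snd p))) = cis (- (snd d \<bullet> x)) * cis (- (snd d \<bullet> snd p))" by (simp add: cis_mult inner_add_right)
 moreover have "exp (- (t+fst p)*\<Psi> (snd d)) = exp (- t*\<Psi> (snd d))*exp (- fst p*\<Psi> (snd d))" by (simp add: exp_add[symmetric] algebra_simps)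
 ultimately show ?thesis by (simp add: F_def rest_def nfeat_def vf_def p0_def algebra_simps)
 qed
 have w: "integrable ?\<nu> (%d. exp (?E d)*?B d)" using smooth_weight[of "2*a"] a by simp
 have fF: "l2_features ?\<nu> (D \<times> UNIV) F" unfolding l2_features_def
 proof safe
 fix s y and b :: bool assume p: "(s, y):D"
 show "F ((s, y), b):borel_measurable ?\<nu>" by cases (auto simp: F_def)
 show "integrable ?\<nu> (%d. (cmod (F ((s, y), b) d))^2)"
 proof (cases b)
 case True
 show ?thesis using l2_featuresD(2)[OF V_features[of UNIV]] True unfolding nS by (simp add: F_def norm_mult phase_def)
 next
 case False
 have r0: "rest t x 0 = (%_. 0)" by (simp add: rest_def fun_eq_iff)
 show ?thesis
 proof (rule lint_bound[OF integrable_mult_right[OF w, of "2*(norm (s, y))^2"]])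
 show "AE d in ?\<nu>. norm ((cmod (F ((s, y), b) d))^2) <= norm (2*(norm (s, y))^2*?A d)"
 proof (rule AE_I2)
 fix d
 show "norm ((cmod (F ((s, y), b) d))^2) <= norm (2*(norm (s, y))^2*?A d)" using rest_lipschitz[OF a t, of "(s, y)" 0 x d] p a False unfolding F_def by (simp add: r0 D_def)
 qed
 qed (use False in "simp add: F_def")
 qed
 qed
 have cI: "countable (D \<times> (UNIV :: bool set))" "D \<times> (UNIV :: bool set) ~= {}" using G.ball_pts_countable(1) D0 by auto
 obtain X where X: "gaussian_family ?P (D \<times> UNIV) X (l2_kernel ?\<nu> F)" by (rule l2_gaussian_exists[OF fF cI]) blast
 have XV: "gaussian_family ?P D (%p. X (p, True)) (KV UNIV)"
 proof -
 have ph: "phase p0 d * vf p d * cnj (phase p0 d * vf q d) = vf p d * cnj (vf q d)" for p q d using complex_norm_square[of "phase p0 d"] by (simp add: phase_def)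
 have "l2_kernel ?\<nu> F (p, True) (q, True) = KV UNIV p q" for p q by (simp only: KV_def nS l2_kernel_def F_def fst_conv snd_conv if_True ph)
 thus ?thesis using gaussian_family_reindex[OF X, of "%p. (p, True)" D] by auto
 qed
 have XZ: "gaussian_family ?P D (%p. X (p, False)) (%p q. l2_kernel ?\<nu> F (p, False) (q, False))" using gaussian_family_reindex[OF X, of "%p. (p, False)" D] by auto
 define M where "M = (LINT d|?\<nu>. exp (?E d)*?B d)"
 have M0: "0<=M" by (simp add: M_def)
 have neg: "AE w in ?P. \<forall>\<^sub>F n in sequentially. ALL p:G.ball_pts n. abs (X (p, False) w-X (0, False) w)<=2 powr (- (1+G.gp/2)*real n)"
 proof (rule G.lipschitz_negligible[OF XZ, of "sqrt (2*M)+1"])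
 show "0<sqrt (2*M)+1" using M0 by (simp add: add_nonneg_pos)
 fix p q assume pq: "p:D" "q:D"
 have "incr_var (%p q. l2_kernel ?\<nu> F (p, False) (q, False)) p q = incr_var (l2_kernel ?\<nu> F) (p, False) (q, False)" by (simp add: incr_var_def)
 also have "... = (LINT d|?\<nu>. (cmod (rest t x p d-rest t x q d))^2)" using pq by (subst l2_kernel_incr_var[OF fF]) (auto simp: F_def)
 also have "... <= (LINT d|?\<nu>. 2*(norm (p-q))^2*?A d)"
 proof (rule Bochner_Integration.integral_mono')
 show "(cmod (rest t x p d-rest t x q d))^2 <= 2*(norm (p-q))^2*?A d" for d by (rule rest_lipschitz[OF a t]) (use pq in "auto simp: D_def")
 qed (use w in auto)
 also have "... = (sqrt (2*M)*norm (p-q))^2" using M0 by (simp only: integral_mult_right_zero M_def[symmetric]) (simp add: power_mult_distrib)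
 also have "... <= ((sqrt (2*M)+1)*norm (p-q))^2" using M0 by (intro power_mono mult_right_mono) auto
 finally show "incr_var (%p q. l2_kernel ?\<nu> F (p, False) (q, False)) p q <= ((sqrt (2*M)+1)*norm (p-q))^2" .
 qed
 let ?K = "%p q. LINT d|?\<nu>. Re ((nfeat (p0+p) d-nfeat p0 d) * cnj (nfeat (p0+q) d-nfeat p0 d))"
 have XD: "gaussian_family ?P D (%p w. X (p, True) w-X (p, False) w) ?K"
 proof (rule gaussian_family_cong[THEN iffD1])
 show "gaussian_family ?P D (%p w. X (p, True) w-X (p, False) w) (%p q. l2_kernel ?\<nu> F (p, True) (q, True)-l2_kernel ?\<nu> F (p, True) (q, False)-l2_kernel ?\<nu> F (p, False) (q, True)+l2_kernel ?\<nu> F (p, False) (q, False))"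
 using gaussian_family_reindex[OF gaussian_family_diff[OF X], of "%p. ((p, True), (p, False))" D] by auto
 fix p q assume "p:D" "q:D"
 hence "l2_kernel ?\<nu> F (p, True) (q, True)-l2_kernel ?\<nu> F (p, True) (q, False)-l2_kernel ?\<nu> F (p, False) (q, True)+l2_kernel ?\<nu> F (p, False) (q, False)
 = (LINT d|?\<nu>. Re ((F (p, True) d-F (p, False) d) * cnj (F (q, True) d-F (q, False) d)))"
 by (intro l2_kernel_diff[OF fF]) auto
 thus "l2_kernel ?\<nu> F (p, True) (q, True)-l2_kernel ?\<nu> F (p, True) (q, False)-l2_kernel ?\<nu> F (p, False) (q, True)+l2_kernel ?\<nu> F (p, False) (q, False) = ?K p q" unfolding dF .
 qed
 have UD: "gaussian_family P D (%p w. u (fst (p0+p)) (snd (p0+p)) w-u t x w) ?K"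
 proof -
 have p0: "p0:{p. 0<=fst p}" using t a by (simp add: p0_def)
 have i: "(%p. (p0+p, p0)) ` D \<subseteq> {p. 0<=fst p} \<times> {p. 0<=fst p}" using pos p0 by auto
 note gd = gaussian_family_reindex[OF gaussian_family_diff[OF solution_family(1)] i]
 have "gaussian_family P D (?D p0) ?K"
 proof (rule gaussian_family_cong[THEN iffD1])
 show "gaussian_family P D (?D p0)
 (%p q. l2_kernel ?\<nu> nfeat (p0+p) (p0+q)-l2_kernel ?\<nu> nfeat (p0+p) p0-l2_kernel ?\<nu> nfeat p0 (p0+q)+l2_kernel ?\<nu> nfeat p0 p0)" using gd by simp
 fix p q assume pq: "p:D" "q:D"
 show "l2_kernel ?\<nu> nfeat (p0+p) (p0+q)-l2_kernel ?\<nu> nfeat (p0+p) p0-l2_kernel ?\<nu> nfeat p0 (p0+q)+l2_kernel ?\<nu> nfeat p0 p0 = ?K p q"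
 by (rule l2_kernel_diff[OF solution_family(2) pos[OF pq(1)] p0 pos[OF pq(2)] p0])
 qed
 thus ?thesis by (simp add: p0_def)
 qed
 have lfX: "AE w in ?P. G.lf (?C X w) = j" using j[OF XV] neg
 proof eventually_elim
 case (elim w)
 have "G.lf (?C X w) = G.lf (%p. X (p, True) w)" unfolding G.lf_def
 proof (rule G.lfun_negligible_eq)
 show "0<G.gp/2" using G.gp_pos by simp
 show "\<forall>\<^sub>F K in sequentially. ALL p:G.ball_pts K. abs (X (p, True) w-X (p, False) w-(X (0, True) w-X (0, False) w)-(X (p, True) w-X (0, True) w))<=2 powr (- (1+G.gp/2)*real K)"
 using elim(2) by eventually_elim auto
 qed
 thus ?case using elim(1) by simp
 qed
 have lfU: "AE w in P. G.lf (%p. u (fst (p0+p)) (snd (p0+p)) w-u t x w) = j"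
 proof -
 interpret P: prob_space P by (rule gaussian_familyD[OF UD])
 have "\<P>(w in P. G.lf (%p. u (fst (p0+p)) (snd (p0+p)) w-u t x w):{j}) = measure ?P {w:space ?P. G.lf (?C X w):{j}}" by (rule G.lf_law[OF UD XD]) simp
 also have "... = 1" using lfX G.lf_family_measurable[OF XD] by (subst V.prob_Collect_eq_1) auto
 finally show ?thesis using G.lf_family_measurable[OF UD] by (subst (asm) P.prob_Collect_eq_1) auto
 qed
 have "AE w in P. continuous_on ({0..} \<times> UNIV) (%(t, x). u t x w)" using u by (simp add: continuous_mild_solution_def)
 thus ?thesis using lfU
 proof eventually_elim
 case (elim w)
 define v where "v p = u (t+fst p) (x+snd p) w-u t x w" for p
 have "continuous_on {p. abs (fst p) < a} (%p. (%(t, x). u t x w) (t+fst p, x+snd p))"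
 by (rule continuous_on_compose2[OF elim(1)]) (use t in "auto intro!: continuous_intros")
 hence cv: "continuous_on {p. abs (fst p) < a} v" unfolding v_def by (intro continuous_intros) simp
 have "Liminf (at_right 0) (%e. SUP (s, y)\<in>{(s, y). rho H1 H2 s y <= e}. ereal (abs (v (s, y)) / scale G.Q e)) = G.lfun v" by (rule G.lfun_continuous[OF a D_def cv])
 also have "G.lfun v = G.lf v" by (simp add: G.lf_def v_def[abs_def])
 also have "G.lf v = j" using elim(2) by (simp add: v_def[abs_def] p0_def)
 finally show ?case by (simp add: v_def G.Q_def k)
 qed
 qed
 thus ?thesis using that k0 by blast
qed

end

theorem proposition3p9:
  fixes H \<alpha> \<beta> H\<^sub>1 H\<^sub>2 Q a b R :: real
    and \<Psi> f :: "real ^ 'd \<Rightarrow> real"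
    and \<mu> :: "(real ^ 'd) measure"
    and N :: "'v measure" and X :: "real \<Rightarrow> 'v \<Rightarrow> real ^ 'd"
    and P :: "'w measure" and B :: "(real \<times> (real ^ 'd) \<Rightarrow> real) \<Rightarrow> 'w \<Rightarrow> real"
    and u :: "real \<Rightarrow> real ^ 'd \<Rightarrow> 'w \<Rightarrow> real"
  assumes "1 / 2 < H" "H < 1" and "0 < \<alpha>" "\<alpha> \<le> 2" and "0 < \<beta>" "\<beta> < real CARD('d)"
    and "real CARD('d) - 2 * \<alpha> * H < \<beta>"
    and "levy_process N X" and "char_exponent N X \<Psi>" and "\<And>\<xi>. \<Psi> (- \<xi>) = \<Psi> \<xi>"
    and "\<And>t. t > 0 \<Longrightarrow> distributed N lborel (X t) (\<lambda>x. ennreal (transition_density \<Psi> t x))"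
    and "comparable \<Psi> (\<lambda>\<xi>. norm \<xi> powr \<alpha>)"
    and "tempered_measure \<mu>" and "has_density_comparable \<mu> (\<lambda>\<xi>. norm \<xi> powr (- \<beta>))"
    and "is_fourier_transform_of_measure f \<mu>"
    and "fractional_colored_noise P H f B"
    and "continuous_mild_solution P H \<mu> B \<Psi> u"
    and "H\<^sub>1 = H - (real CARD('d) - \<beta>) / (2 * \<alpha>)" and "H\<^sub>2 = \<alpha> * H\<^sub>1"
    and "Q = 1 / H\<^sub>1 + real CARD('d) / H\<^sub>2"
    and "H\<^sub>2 < 1"
    and "0 < a" "a < b" and "0 < R"
  shows "\<exists>\<kappa>>0. \<forall>t x. t \<in> {a..b} \<and> (\<forall>i. x $ i \<in> {- R..R}) \<longrightarrow>
     (AE \<omega> in P.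
        Liminf (at_right 0) (\<lambda>\<epsilon>. SUP (s, y) \<in> {(s, y). rho H\<^sub>1 H\<^sub>2 s y \<le> \<epsilon>}.
            ereal (\<bar>u (t + s) (x + y) \<omega> - u t x \<omega>\<bar> / (\<epsilon> * ln (ln (1 / \<epsilon>)) powr (- (1 / Q)))))
        = ereal \<kappa>)"
proof -
 obtain c where c: "1 <= c" "!!\<xi>. inverse c * norm \<xi> powr \<alpha> <= \<Psi> \<xi>" "!!\<xi>. \<Psi> \<xi> <= c * norm \<xi> powr \<alpha>"
  using assms(12) unfolding comparable_def by blast
 obtain g c' where g: "g : borel_measurable borel" "\<mu> = density lborel (%\<xi>. ennreal (g \<xi>))" "1 <= c'"
  "!!\<xi>. inverse c' * norm \<xi> powr - \<beta> <= g \<xi>" "!!\<xi>. g \<xi> <= c' * norm \<xi> powr - \<beta>"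
  using assms(14) unfolding has_density_comparable_def comparable_def by blast
 have inv: "y <= k * z" if "1 <= k" "inverse k * y <= z" for k y z :: real using that by (simp add: field_simps)
 interpret solution H \<mu> g f P B N X \<Psi> \<alpha> c u \<beta> c'
 proof
  show "0 <= g \<xi>" for \<xi> by (rule order.trans[OF _ g(4)]) (use g(3) in simp)
 qed (use assms g c inv[OF c(1,2)] inv[OF g(3,4)] in auto)
 have HH: "spectral.H1 TYPE(real ^ 'd) H \<alpha> \<beta> = H\<^sub>1" "spectral.H2 TYPE(real ^ 'd) H \<alpha> \<beta> = H\<^sub>2" "expQ TYPE(real ^ 'd) H\<^sub>1 H\<^sub>2 = Q"
  using assms(18-20) by (simp_all add: H1_def H2_def expQ_def)
 \<comment> \<open>\<open>chung_law\<close> speaks of times from twice its parameter on; half of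
   \<open>a\<close> reaches the whole time interval.\<close>
 have a2: "0 < a / 2" using assms by simp
 obtain \<kappa> where "0 < \<kappa>" "!!t x. 2 * (a / 2) <= t ==> AE \<omega> in P.
  Liminf (at_right 0) (%\<epsilon>. SUP (s, y)\<in>{(s, y). rho H\<^sub>1 H\<^sub>2 s y <= \<epsilon>}. ereal (abs (u (t + s) (x + y) \<omega> - u t x \<omega>) / scale Q \<epsilon>)) = ereal \<kappa>"
  using chung_law[OF a2] unfolding HH by blast
 thus ?thesis unfolding scale_def by (intro exI[of _ \<kappa>]) auto
qed

end
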